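(* Let $d\in\mathbb N$, $m\in\mathbb N^d$, let $D\subset\mathbb R^d$ be a bounded domain of $m$-type, $\alpha\in(0,\infty)^d$, $1\le p<\infty$, $1\le\theta\le\infty$, $1<q<\infty$, $\lambda\in\mathbb Z_+^d$ with $\lambda_j\le m_j$ for all $j$, and assume $\alpha_j-1/p>0$ and $\alpha_j-\lambda_j-(1/p-1/q)_+>0$ for all $j$. Let $K$ be the closed unit ball of $(S^\alpha_{p,\theta}B)'(D)$, $\mu=\min_j(\alpha_j-\lambda_j)$, $\gamma=\#\{j:\alpha_j-\lambda_j=\mu\}$, $Q=\max(2,q)$. Then there is $c>0$ such that for all integers $n\ge2$: if $q\le p$ or $2\le p<q$, $$\sigma_n(\partial^\lambda,K,L_q(D))\ge c\,n^{-(\mu-(1/p-1/q)_+)}(\log n)^{(\gamma-1)(\mu-(1/p-1/q)-(1/\theta-1/p)_+-(1/q-1/Q)_+)};$$ if $p<\min(2,q)$, $$\sigma_n(\partial^\lambda,K,L_q(D))\ge c\,n^{-(\mu-(1/p-1/q)_+)}(\log n)^{(\gamma-1)(1/Q-1/\theta)_+}.$$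
   Context: Notation: $e=(1,\dots,1)$; products of vectors componentwise; $t_+=\max(t,0)$; $\mathbb Z_+^d(l)=\{k\in\mathbb Z^d:0\le k_j\le l_j\}$; $I^d=(0,1)^d$, $B^d=[-1,1]^d$; $x^J=(x_j)_{j\in J}$, $\chi_J$ the indicator vector of $J\subset\{1,\dots,d\}$. For an open $G$, $h\in\mathbb R^d$, $l\in\mathbb Z_+^d$: $G^l_h=\{x\in G:x+(t_jl_jh_j)_j\in G\ \forall t\in[0,1]^d\}$, $(\Delta^l_hf)(x)=\sum_{k\in\mathbb Z_+^d(l)}(-1)^{\sum(l_j-k_j)}\prod_j\binom{l_j}{k_j}f(x+kh)$. For $f\in L_p(G)$, nonempty $J$, $t\in(0,\infty)^d$: $\Omega'^{l\chi_J}(f,t^J)_{L_p(G)}=\bigl(\prod_{j\in J}(2t_j)^{-1}\int_{\prod_{j\in J}[-t_j,t_j]}\int_{G^{l\chi_J}_\xi}|\Delta^{l\chi_J}_\xi f|^pdx\,d\xi^J\bigr)^{1/p}$ ($\xi_j=0$ for $j\notin J$). $l=l(\alpha)$ with $l_j=\min\{k\in\mathbb N:\alpha_j<k\}$. For nonempty $J$ let $|f|_J=\bigl(\int_{(0,\infty)^J}\prod_{j\in J}t_j^{-1-\theta\alpha_j}(\Omega'^{l\chi_J}(f,t^J)_{L_p(D)})^\theta dt^J\bigr)^{1/\theta}$ ($\theta<\infty$), resp. $\sup_{t^J}\prod_{j\in J}t_j^{-\alpha_j}\Omega'^{l\chi_J}(f,t^J)_{L_p(D)}$ ($\theta=\infty$).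 $(S^\alpha_{p,\theta}B)'(D)$ is the space of $f\in L_p(D)$ with all $|f|_J<\infty$, normed by $\|f\|=\max(\|f\|_{L_p(D)},\max_J|f|_J)$. Its elements have continuous representatives (used for point evaluation); $\partial^\lambda f$ is the distributional derivative. Domains of $m$-type: $Q_{\kappa,\nu}=2^{-\kappa}\nu+2^{-\kappa}I^d$; $N_\kappa=\{\nu\in\mathbb Z^d:(2^{-\kappa}\nu+2^{-\kappa}(m+e)[0,1]^d)\cap D\ne\emptyset\}$; $\Upsilon^d=\{0,1\}^d$, $s(\epsilon)=\{j:\epsilon_j\neq0\}$; $M_\epsilon(\nu)$ = families $(\mu_j)_{j\in s(\epsilon)}$ of integers, $0\le\mu_j\le m_j+1$, $\nu_j-\mu_j$ even; $\mathfrak n_\epsilon(\nu,\mu)_j=(\nu_j-\mu_j)/2$ for $j\in s(\epsilon)$, $=\nu_j$ otherwise. $D$ is of $m$-type if there exist $K^0\in\mathbb Z_+^d$, $\Gamma^0\in(0,\infty)^d$ and maps $\nu_{K^0+\kappa},n_{K^0+\kappa}:N_{K^0+\kappa}\to\mathbb Z^d$ such that for all $\kappa\in\mathbb Z_+^d,\nu\in N_{K^0+\kappa}$: (1) $Q_{K^0+\kappa,\nu_{K^0+\kappa}(\nu)}\cup Q_{K^0+\kappa,n_{K^0+\kappa}(\nu)}\subset D\cap(2^{-K^0-\kappa}\nu+\Gamma^02^{-K^0-\kappa}B^d)$; (2) for $\epsilon\in\Upsilon^d$ with $s(\epsilon)\subset s(\kappa)$ and $\mu\in M_\epsilon(\nu)$,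 the smallest open axis-parallel box containing $Q_{K^0+\kappa,n_{K^0+\kappa}(\nu)}$ and $Q_{K^0+\kappa-\epsilon,\nu_{K^0+\kappa-\epsilon}(\mathfrak n_\epsilon(\nu,\mu))}$ lies in $D$; (3) for such $\epsilon,\mu$ and $j\notin s(\epsilon)$, $(\nu_{K^0+\kappa-\epsilon}(\mathfrak n_\epsilon(\nu,\mu)))_j=(\nu_{K^0+\kappa}(\nu))_j$. Recovery width: $\sigma_n(\partial^\lambda,K,L_q(D))=\inf\sup_{f\in K}\|\partial^\lambda f-A(f(y^1),\dots,f(y^n))\|_{L_q(D)}$, infimum over all points $y^1,\dots,y^n\in D$ and all (arbitrary) maps $A:\mathbb R^n\to L_q(D)$. *)

theory Defs
  imports "HOL-Analysis.Analysis"
begin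

definition epow :: "ennreal \<Rightarrow> real \<Rightarrow> ennreal" where
  "epow a r = (if a = \<infinity> then \<infinity> else ennreal (enn2real a powr r))"

definition pos_part :: "real \<Rightarrow> real" where
  "pos_part t = max t 0"

definition in_Lp :: "real \<Rightarrow> (real^'n) set \<Rightarrow> (real^'n \<Rightarrow> real) \<Rightarrow> bool" where
  "in_Lp p G f \<longleftrightarrow> set_borel_measurable lborel G f \<and>
     set_integrable lborel G (\<lambda>x. \<bar>f x\<bar> powr p)"

definition Lp_norm :: "real \<Rightarrow> (real^'n) set \<Rightarrow> (real^'n \<Rightarrow> real) \<Rightarrow> ennreal" where
  "Lp_norm p G f = epow (\<integral>\<^sup>+ x. ennreal (\<bar>f x\<bar> powr p) * indicator G x \<partial>lborel) (1 / p)"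

definition shift_pt :: "real^'n \<Rightarrow> ('n \<Rightarrow> real) \<Rightarrow> real^'n \<Rightarrow> real^'n" where
  "shift_pt x k h = (\<chi> j. x $ j + k j * h $ j)"

definition Gset :: "(real^'n) set \<Rightarrow> ('n \<Rightarrow> nat) \<Rightarrow> real^'n \<Rightarrow> (real^'n) set" where
  "Gset G l h = {x \<in> G. \<forall>t::'n \<Rightarrow> real. (\<forall>j. 0 \<le> t j \<and> t j \<le> 1) \<longrightarrow>
        shift_pt x (\<lambda>j. t j * real (l j)) h \<in> G}"

definition mdiff :: "('n::finite \<Rightarrow> nat) \<Rightarrow> real^'n \<Rightarrow> (real^'n \<Rightarrow> real) \<Rightarrow> real^'n \<Rightarrow> real" where
  "mdiff l h f x = (\<Sum>k\<in>{k::'n \<Rightarrow> nat. \<forall>j. k j \<le> l j}.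
      (-1::real) ^ (\<Sum>j\<in>UNIV. l j - k j) * (\<Prod>j\<in>UNIV. real (l j choose k j)) *
      f (shift_pt x (\<lambda>j. real (k j)) h))"

definition chiJ :: "'n set \<Rightarrow> ('n \<Rightarrow> nat) \<Rightarrow> ('n \<Rightarrow> nat)" where
  "chiJ J l = (\<lambda>j. if j \<in> J then l j else 0)"

definition vecJ :: "'n set \<Rightarrow> ('n \<Rightarrow> real) \<Rightarrow> real^'n" where
  "vecJ J \<xi> = (\<chi> j. if j \<in> J then \<xi> j else 0)"

definition Omega' :: "real \<Rightarrow> ('n::finite \<Rightarrow> nat) \<Rightarrow> 'n set \<Rightarrow> (real^'n \<Rightarrow> real) \<Rightarrow>
    (real^'n) set \<Rightarrow> ('n \<Rightarrow> real) \<Rightarrow> ennreal" where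
  "Omega' p l J f G t = epow
     (ennreal (\<Prod>j\<in>J. 1 / (2 * t j)) *
      (\<integral>\<^sup>+ \<xi>. indicator (PiE J (\<lambda>j. {- t j .. t j})) \<xi> *
          (\<integral>\<^sup>+ x. ennreal (\<bar>mdiff (chiJ J l) (vecJ J \<xi>) f x\<bar> powr p) *
                 indicator (Gset G (chiJ J l) (vecJ J \<xi>)) x \<partial>lborel)
        \<partial>(PiM J (\<lambda>_. lborel))))
     (1 / p)"

definition l_of :: "('n \<Rightarrow> real) \<Rightarrow> ('n \<Rightarrow> nat)" where
  "l_of \<alpha> = (\<lambda>j. LEAST k::nat. 1 \<le> k \<and> \<alpha> j < real k)"

definition semiJ :: "('n::finite \<Rightarrow> real) \<Rightarrow> real \<Rightarrow> ereal \<Rightarrow> (real^'n) set \<Rightarrow> 'n set \<Rightarrow>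
    (real^'n \<Rightarrow> real) \<Rightarrow> ennreal" where
  "semiJ \<alpha> p \<theta> D J f =
     (if \<theta> = \<infinity> then
        (SUP t\<in>PiE J (\<lambda>_. {0<..}). ennreal (\<Prod>j\<in>J. t j powr (- \<alpha> j)) *
             Omega' p (l_of \<alpha>) J f D t)
      else
        epow (\<integral>\<^sup>+ t. indicator (PiE J (\<lambda>_. {0<..})) t *
                 ennreal (\<Prod>j\<in>J. t j powr (-1 - real_of_ereal \<theta> * \<alpha> j)) *
                 epow (Omega' p (l_of \<alpha>) J f D t) (real_of_ereal \<theta>)
               \<partial>(PiM J (\<lambda>_. lborel)))
          (1 / real_of_ereal \<theta>))"

(* closed unit ball of (S^\<alpha>_{p,\<theta>} B)'(D), elements taken as their continuous representatives *)
definition unit_ball_SB :: "('n::finite \<Rightarrow> real) \<Rightarrow> real \<Rightarrow> ereal \<Rightarrow> (real^'n) set \<Rightarrow>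
    (real^'n \<Rightarrow> real) set" where
  "unit_ball_SB \<alpha> p \<theta> D = {f. continuous_on D f \<and> in_Lp p D f \<and> Lp_norm p D f \<le> 1 \<and>
       (\<forall>J. J \<noteq> {} \<longrightarrow> semiJ \<alpha> p \<theta> D J f \<le> 1)}"

definition pd :: "'n \<Rightarrow> (real^'n \<Rightarrow> real) \<Rightarrow> real^'n \<Rightarrow> real" where
  "pd j \<phi> x = deriv (\<lambda>s. \<phi> (x + s *\<^sub>R axis j 1)) 0"

fun pd_list :: "'n list \<Rightarrow> (real^'n \<Rightarrow> real) \<Rightarrow> real^'n \<Rightarrow> real" where
  "pd_list [] \<phi> = \<phi>"
| "pd_list (j # js) \<phi> = pd j (pd_list js \<phi>)"

definition smooth_fun :: "(real^'n \<Rightarrow> real) \<Rightarrow> bool" where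
  "smooth_fun \<phi> \<longleftrightarrow> (\<forall>js. continuous_on UNIV (pd_list js \<phi>) \<and>
     (\<forall>j x. (\<lambda>s. pd_list js \<phi> (x + s *\<^sub>R axis j 1)) differentiable (at 0)))"

definition test_fun :: "(real^'n) set \<Rightarrow> (real^'n \<Rightarrow> real) \<Rightarrow> bool" where
  "test_fun D \<phi> \<longleftrightarrow> smooth_fun \<phi> \<and> compact (closure {x. \<phi> x \<noteq> 0}) \<and>
     closure {x. \<phi> x \<noteq> 0} \<subseteq> D"

definition weak_deriv :: "(real^'n) set \<Rightarrow> ('n::finite \<Rightarrow> nat) \<Rightarrow> (real^'n \<Rightarrow> real) \<Rightarrow>
    (real^'n \<Rightarrow> real) \<Rightarrow> bool" where
  "weak_deriv D lam f g \<longleftrightarrow> set_borel_measurable lborel D g \<and>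
     (\<forall>C. compact C \<and> C \<subseteq> D \<longrightarrow> set_integrable lborel C g) \<and>
     (\<forall>\<phi>. test_fun D \<phi> \<longrightarrow> (\<forall>js. (\<forall>j. count_list js j = lam j) \<longrightarrow>
        (\<integral>x. indicator D x * (f x * pd_list js \<phi> x) \<partial>lborel) =
        (-1::real) ^ (\<Sum>j\<in>UNIV. lam j) * (\<integral>x. indicator D x * (g x * \<phi> x) \<partial>lborel)))"

definition recovery_width :: "nat \<Rightarrow> ('n::finite \<Rightarrow> nat) \<Rightarrow> (real^'n \<Rightarrow> real) set \<Rightarrow> real \<Rightarrow>
    (real^'n) set \<Rightarrow> ennreal" where
  "recovery_width n lam K q D =
     (INF yA \<in> {(ys, A). length ys = n \<and> set ys \<subseteq> D \<and> (\<forall>v. in_Lp q D (A v))}.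
        (SUP f\<in>K. SUP g\<in>{g. weak_deriv D lam f g}.
           Lp_norm q D (\<lambda>x. g x - snd yA (map f (fst yA)) x)))"

definition dcube_pt :: "('n \<Rightarrow> nat) \<Rightarrow> ('n \<Rightarrow> real) \<Rightarrow> real^'n" where
  "dcube_pt \<kappa> v = (\<chi> j. (1/2::real) ^ \<kappa> j * v j)"

definition Qcube :: "('n \<Rightarrow> nat) \<Rightarrow> ('n \<Rightarrow> int) \<Rightarrow> (real^'n) set" where
  "Qcube \<kappa> \<nu> = box (dcube_pt \<kappa> (\<lambda>j. of_int (\<nu> j))) (dcube_pt \<kappa> (\<lambda>j. of_int (\<nu> j) + 1))"

definition Nset :: "('n \<Rightarrow> nat) \<Rightarrow> (real^'n) set \<Rightarrow> ('n \<Rightarrow> nat) \<Rightarrow> ('n \<Rightarrow> int) set" where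
  "Nset m D \<kappa> = {\<nu>. cbox (dcube_pt \<kappa> (\<lambda>j. of_int (\<nu> j)))
                          (dcube_pt \<kappa> (\<lambda>j. of_int (\<nu> j) + real (m j) + 1)) \<inter> D \<noteq> {}}"

definition supp_set :: "('n \<Rightarrow> nat) \<Rightarrow> 'n set" where
  "supp_set \<epsilon> = {j. \<epsilon> j \<noteq> 0}"

definition Upsilon :: "('n \<Rightarrow> nat) set" where
  "Upsilon = {\<epsilon>. \<forall>j. \<epsilon> j \<le> 1}"

(* M_\<epsilon>(\<nu>): only the coordinates in s(\<epsilon>) of \<mu> are relevant *)
definition Mset :: "('n \<Rightarrow> nat) \<Rightarrow> ('n \<Rightarrow> nat) \<Rightarrow> ('n \<Rightarrow> int) \<Rightarrow> ('n \<Rightarrow> int) set" where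
  "Mset m \<epsilon> \<nu> = {\<mu>. \<forall>j\<in>supp_set \<epsilon>. 0 \<le> \<mu> j \<and> \<mu> j \<le> int (m j) + 1 \<and> even (\<nu> j - \<mu> j)}"

definition nfrak :: "('n \<Rightarrow> nat) \<Rightarrow> ('n \<Rightarrow> int) \<Rightarrow> ('n \<Rightarrow> int) \<Rightarrow> ('n \<Rightarrow> int)" where
  "nfrak \<epsilon> \<nu> \<mu> = (\<lambda>j. if j \<in> supp_set \<epsilon> then (\<nu> j - \<mu> j) div 2 else \<nu> j)"

(* smallest open axis-parallel box containing box a b and box a' b' (both nonempty) *)
definition hull_box :: "real^'n \<Rightarrow> real^'n \<Rightarrow> real^'n \<Rightarrow> real^'n \<Rightarrow> (real^'n) set" where
  "hull_box a b a' b' = box (\<chi> j. min (a $ j) (a' $ j)) (\<chi> j. max (b $ j) (b' $ j))"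

definition m_type :: "('n::finite \<Rightarrow> nat) \<Rightarrow> (real^'n) set \<Rightarrow> bool" where
  "m_type m D \<longleftrightarrow> (\<exists>(K0::'n \<Rightarrow> nat) (\<Gamma>0::'n \<Rightarrow> real)
       (\<nu>m::('n \<Rightarrow> nat) \<Rightarrow> ('n \<Rightarrow> int) \<Rightarrow> ('n \<Rightarrow> int))
       (nm::('n \<Rightarrow> nat) \<Rightarrow> ('n \<Rightarrow> int) \<Rightarrow> ('n \<Rightarrow> int)).
     (\<forall>j. 0 < \<Gamma>0 j) \<and>
     (\<forall>\<kappa>::'n \<Rightarrow> nat. \<forall>\<nu>\<in>Nset m D (\<lambda>j. K0 j + \<kappa> j).
        let k = (\<lambda>j. K0 j + \<kappa> j) in
        Qcube k (\<nu>m k \<nu>) \<union> Qcube k (nm k \<nu>) \<subseteq>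
          D \<inter> cbox (dcube_pt k (\<lambda>j. of_int (\<nu> j) - \<Gamma>0 j)) (dcube_pt k (\<lambda>j. of_int (\<nu> j) + \<Gamma>0 j)) \<and>
        (\<forall>\<epsilon>\<in>Upsilon. supp_set \<epsilon> \<subseteq> supp_set \<kappa> \<longrightarrow> (\<forall>\<mu>\<in>Mset m \<epsilon> \<nu>.
           let k' = (\<lambda>j. K0 j + \<kappa> j - \<epsilon> j); \<nu>' = \<nu>m k' (nfrak \<epsilon> \<nu> \<mu>) in
           hull_box (dcube_pt k (\<lambda>j. of_int (nm k \<nu> j))) (dcube_pt k (\<lambda>j. of_int (nm k \<nu> j) + 1))
                    (dcube_pt k' (\<lambda>j. of_int (\<nu>' j))) (dcube_pt k' (\<lambda>j. of_int (\<nu>' j) + 1)) \<subseteq> D \<and>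
           (\<forall>j. j \<notin> supp_set \<epsilon> \<longrightarrow> \<nu>' j = \<nu>m k \<nu> j)))))"

end

theory Submission
  imports Defs
begin

text \<open>Points \<open>y\<close> cannot distinguish \<open>f\<close> from \<open>- f\<close> if \<open>f\<close> vanishes at all of them, so it
  suffices to find, for any \<open>n\<close> points, such an \<open>f\<close> in the unit ball whose derivative has large
  \<open>L\<^sub>q\<close> norm. It is sought among the sums of dyadic rescaled bumps in a cube inside \<open>D\<close>, over all
  scales \<open>\<kappa>\<close> with \<open>\<Sum>\<kappa> = k\<close> that are supported on the \<open>\<gamma>\<close> critical coordinates; there are about
  \<open>k ^ (\<gamma> - 1)\<close> such scales, each with \<open>2 ^ k\<close> bumps. A Schur test over scales and steps bounds the
  Besov norm by the coefficients; the derivative is bounded below by pairing it with a signed Haar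
  sum, whose norm in the dual space is controlled by a multiparameter square function inequality
  (Burkholder's inequality applied in each coordinate). The coefficients annihilating the \<open>n\<close>
  linear functionals \<open>f \<mapsto> f y\<close> are, depending on \<open>p\<close> and \<open>q\<close>, a vertex of the cube intersected
  with their kernel, a vector of the Euclidean ball of the kernel with a large entry, or the
  indicator of one cell per scale that contains none of the points.\<close>

section \<open>Common kernels of linear functionals\<close>

text \<open>The three choices of coefficients answer different ratios of \<open>p\<close> and
  \<open>q\<close>. For \<open>q \<le> p\<close> spreading is best, hence a vector with many entries
  of modulus one. For \<open>p < q\<close> a single cell of a scale with total \<open>k\<close>
  gains the factor \<open>2 powr (k * (1/p - 1/q))\<close>. If \<open>2 \<le> p\<close>, a Euclidean
  bound also bounds the norm of order \<open>p\<close>, so it is enough that the kernel has at least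
  half the dimension of the whole layer. If \<open>p < 2\<close> this fails and explicit free cells
  are used; then each scale by itself must have more than \<open>n\<close> cells, which changes the
  logarithms. The obstacle in the lower bound is that the bumps are not orthogonal to each other.
  Because all scales of a layer have the same total, each differentiated bump is orthogonal to all
  Haar functions of the layer except its own, so the interaction of the scales never has to be
  estimated; only the norm of the dual Haar sum does, and it is responsible for the exponent
  \<open>1 / max 2 q\<close>.\<close>

lemma common_kernel_nontrivial:
  fixes w :: "nat \<Rightarrow> 't \<Rightarrow> real"
  assumes "finite T" "n < card T"
  shows "\<exists>d. (\<exists>t\<in>T. d t \<noteq> 0) \<and> (\<forall>i<n. (\<Sum>t\<in>T. w i t * d t) = 0)"
  using assms
proof (induction n arbitrary: T w)
  case 0
  then obtain t where "t \<in> T" by fastforce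
  then show ?case by (intro exI[of _ "\<lambda>_. 1"]) auto
next
  case (Suc n)
  show ?case
  proof (cases "\<forall>t\<in>T. w n t = 0")
    case True
    from Suc.IH[of T w] Suc.prems obtain d where "\<exists>t\<in>T. d t \<noteq> 0"
      "\<forall>i<n. (\<Sum>t\<in>T. w i t * d t) = 0" by auto
    with True show ?thesis by (intro exI[of _ d]) (auto simp: less_Suc_eq)
  next
    case False
    then obtain s where s: "s \<in> T" "w n s \<noteq> 0" by auto
    define T' where "T' = T - {s}"
    have T': "finite T'" "n < card T'" using Suc.prems s by (auto simp: T'_def)
    \<comment> \<open>Elimination with the pivot \<open>w n s\<close>: the modified functionals do
      not involve the coordinate \<open>s\<close>, whose value is afterwards fixed by the
      \<open>n\<close>-th equation.\<close>
    obtain d where d: "\<exists>t\<in>T'. d t \<noteq> 0"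
      "\<forall>i<n. (\<Sum>t\<in>T'. (w i t - w i s * w n t / w n s) * d t) = 0"
      using Suc.IH[OF T', of "\<lambda>i t. w i t - w i s * w n t / w n s"] by auto
    define d' where "d' = d(s := - (\<Sum>t\<in>T'. w n t * d t) / w n s)"
    have eq: "(\<Sum>t\<in>T. w i t * d' t) =
        w i s * (- (\<Sum>t\<in>T'. w n t * d t) / w n s) + (\<Sum>t\<in>T'. w i t * d t)" for i
    proof -
      have "(\<Sum>t\<in>T. w i t * d' t) = w i s * d' s + (\<Sum>t\<in>T'. w i t * d' t)"
        unfolding T'_def using Suc.prems s by (simp add: sum.remove)
      moreover have "(\<Sum>t\<in>T'. w i t * d' t) = (\<Sum>t\<in>T'. w i t * d t)"
        by (intro sum.cong) (auto simp: d'_def T'_def)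
      ultimately show ?thesis by (simp add: d'_def)
    qed
    have "(\<Sum>t\<in>T. w i t * d' t) = 0" if "i < Suc n" for i
    proof (cases "i = n")
      case True
      then show ?thesis using s by (simp add: eq)
    next
      case False
      with that d(2) have "(\<Sum>t\<in>T'. (w i t - w i s * w n t / w n s) * d t) = 0" by auto
      moreover have "(\<Sum>t\<in>T'. (w i t - w i s * w n t / w n s) * d t) =
         (\<Sum>t\<in>T'. w i t * d t) - w i s * (\<Sum>t\<in>T'. w n t * d t) / w n s"
        by (simp add: sum_distrib_left sum_divide_distrib sum_subtractf algebra_simps)
      ultimately show ?thesis by (simp add: eq)
    qed
    moreover have "\<exists>t\<in>T. d' t \<noteq> 0" using d(1) by (auto simp: d'_def T'_def)
    ultimately show ?thesis by blast
  qed
qed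

text \<open>An extreme point of the intersection of the cube with the kernel, found by maximising the
  number of coordinates at \<open>\<plusminus>1\<close>.\<close>

lemma kernel_cube_vertex:
  fixes w :: "nat \<Rightarrow> 't \<Rightarrow> real"
  assumes T: "finite T"
  shows "\<exists>a. (\<forall>t\<in>T. \<bar>a t\<bar> \<le> 1) \<and> (\<forall>i<n. (\<Sum>t\<in>T. w i t * a t) = 0) \<and>
    card T \<le> n + card {t\<in>T. \<bar>a t\<bar> = 1}"
proof -
  define P where "P a \<longleftrightarrow> (\<forall>t\<in>T. \<bar>a t\<bar> \<le> 1) \<and> (\<forall>i<n. (\<Sum>t\<in>T. w i t * a t) = 0)" for a
  define m where "m a = card {t\<in>T. \<bar>a t\<bar> = 1}" for a :: "'t \<Rightarrow> real"
  have "P (\<lambda>_. 0)" by (simp add: P_def)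
  moreover have "\<forall>a. P a \<longrightarrow> m a < Suc (card T)"
    unfolding m_def using T by (auto intro: card_mono simp: less_Suc_eq_le)
  ultimately obtain a where a: "P a" "\<And>b. P b \<Longrightarrow> m b \<le> m a"
    using ex_has_greatest_nat[of P "\<lambda>_. 0" m "Suc (card T)"] by blast
  have "card T \<le> n + m a"
  proof (rule ccontr)
    assume neg: "\<not> card T \<le> n + m a"
    \<comment> \<open>If more than \<open>n\<close> coordinates lie in the open interval, the kernel
      has a nonzero direction supported on them; moving along it does not disturb the coordinates of
      modulus one.\<close>
    define U where "U = {t\<in>T. \<bar>a t\<bar> < 1}"
    have Tsplit: "card T = card U + m a"
    proof -
      have "T = U \<union> {t\<in>T. \<bar>a t\<bar> = 1}" using a(1) by (auto simp: U_def P_def)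
      then show ?thesis unfolding m_def using T
        by (subst (1) \<open>T = _\<close>, subst card_Un_disjoint) (auto simp: U_def)
    qed
    have U: "finite U" "n < card U" using T neg Tsplit by (auto simp: U_def)
    obtain d where d: "\<exists>t\<in>U. d t \<noteq> 0" "\<forall>i<n. (\<Sum>t\<in>U. w i t * d t) = 0"
      using common_kernel_nontrivial[OF U] by blast
    define U1 where "U1 = {t\<in>U. d t \<noteq> 0}"
    \<comment> \<open>\<open>r t\<close> solves \<open>sgn (d t) * (a t + r t * d t) = 1\<close>, so
      it is the step at which the coordinate \<open>t\<close> reaches the boundary. The least of
      these steps puts one coordinate there and none outside.\<close>
    define r where "r t = (1 - sgn (d t) * a t) / \<bar>d t\<bar>" for t
    have U1: "finite U1" "U1 \<noteq> {}" using d U by (auto simp: U1_def)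
    define s where "s = Min (r ` U1)"
    obtain t0 where t0: "t0 \<in> U1" "s = r t0"
      using Min_in[of "r ` U1"] U1 unfolding s_def by blast
    have s_le: "s \<le> r t" if "t \<in> U1" for t unfolding s_def using that U1 by auto
    have s_pos: "0 < s"
    proof -
      have "0 < 1 - sgn (d t0) * a t0" "d t0 \<noteq> 0"
        using t0(1) by (auto simp: U1_def U_def sgn_if)
      then show ?thesis by (simp add: t0(2) r_def)
    qed
    define b where "b t = (if t \<in> U then a t + s * d t else a t)" for t
    have b1: "\<bar>b t\<bar> \<le> 1" if "t \<in> T" for t
    proof (cases "t \<in> U1")
      case True
      then have dt: "d t \<noteq> 0" and at: "\<bar>a t\<bar> < 1" by (auto simp: U1_def U_def)
      have "s * \<bar>d t\<bar> \<le> 1 - sgn (d t) * a t"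
        using s_le[OF True] dt by (simp add: r_def field_simps)
      then show ?thesis using at True s_pos dt
        by (auto simp: b_def U1_def sgn_if abs_if mult_less_0_iff zero_less_mult_iff split: if_splits)
          (smt (verit) mult_pos_pos mult_pos_neg)+
    next
      case False
      then show ?thesis using that a(1) by (auto simp: b_def U1_def P_def)
    qed
    have b2: "(\<Sum>t\<in>T. w i t * b t) = 0" if "i < n" for i
    proof -
      have "(\<Sum>t\<in>T. w i t * b t) = (\<Sum>t\<in>T. w i t * a t + (if t \<in> U then s * (w i t * d t) else 0))"
        by (intro sum.cong) (auto simp: b_def algebra_simps)
      also have "\<dots> = (\<Sum>t\<in>T. w i t * a t) + (\<Sum>t\<in>U. s * (w i t * d t))"
        unfolding sum.distrib using T by (subst sum.inter_restrict[symmetric]) (auto simp: U_def intro!: sum.cong)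
      also have "\<dots> = 0" using a(1) d(2) that by (simp add: P_def sum_distrib_left[symmetric])
      finally show ?thesis .
    qed
    have "P b" using b1 b2 by (simp add: P_def)
    moreover have "{t\<in>T. \<bar>a t\<bar> = 1} \<subset> {t\<in>T. \<bar>b t\<bar> = 1}"
    proof
      show "{t\<in>T. \<bar>a t\<bar> = 1} \<subseteq> {t\<in>T. \<bar>b t\<bar> = 1}" by (auto simp: b_def U_def)
      have dt: "d t0 \<noteq> 0" "\<bar>a t0\<bar> < 1" "t0 \<in> U" "t0 \<in> T" using t0 by (auto simp: U1_def U_def)
      have "s * \<bar>d t0\<bar> = 1 - sgn (d t0) * a t0" using dt by (simp add: t0 r_def)
      then have "\<bar>b t0\<bar> = 1" using dt by (auto simp: b_def sgn_if split: if_splits)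
      with dt have "t0 \<in> {t\<in>T. \<bar>b t\<bar> = 1}" "t0 \<notin> {t\<in>T. \<bar>a t\<bar> = 1}" by auto
      then show "{t\<in>T. \<bar>a t\<bar> = 1} \<noteq> {t\<in>T. \<bar>b t\<bar> = 1}" by metis
    qed
    then have "m a < m b" unfolding m_def using T by (intro psubset_card_mono) auto
    ultimately show False using a(2)[of b] by simp
  qed
  with a(1) show ?thesis unfolding P_def m_def by blast
qed

text \<open>The vectors found so far are added to the functionals, so the next kernel vector is
  orthogonal to them from the start and only has to be normalised.\<close>

lemma orthonormal_in_kernel:
  fixes w :: "nat \<Rightarrow> 't \<Rightarrow> real"
  assumes T: "finite T" and "n + m \<le> card T"
  shows "\<exists>v :: nat \<Rightarrow> 't \<Rightarrow> real. (\<forall>k<m. \<forall>i<n. (\<Sum>t\<in>T. w i t * v k t) = 0) \<and>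
    (\<forall>k<m. \<forall>k'<m. (\<Sum>t\<in>T. v k t * v k' t) = (if k = k' then 1 else 0))"
  using assms(2)
proof (induction m)
  case 0
  then show ?case by auto
next
  case (Suc m)
  then have "n + m \<le> card T" by simp
  from Suc.IH[OF this] obtain v :: "nat \<Rightarrow> 't \<Rightarrow> real"
    where v: "\<And>k i. k<m \<Longrightarrow> i<n \<Longrightarrow> (\<Sum>t\<in>T. w i t * v k t) = 0"
    "\<And>k k'. k<m \<Longrightarrow> k'<m \<Longrightarrow> (\<Sum>t\<in>T. v k t * v k' t) = (if k = k' then 1 else 0)" by blast
  define w' where "w' i = (if i < n then w i else v (i - n))" for i
  obtain d where d: "\<exists>t\<in>T. d t \<noteq> 0" "\<And>i. i<n + m \<Longrightarrow> (\<Sum>t\<in>T. w' i t * d t) = 0"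
    using common_kernel_nontrivial[OF T, of "n + m" w'] Suc.prems by auto
  define D where "D = (\<Sum>t\<in>T. d t * d t)"
  have D: "D > 0"
  proof -
    obtain t where t: "t \<in> T" "d t \<noteq> 0" using d by auto
    have "0 < d t * d t" using t by (auto simp: zero_less_mult_iff)
    also have "\<dots> \<le> D" unfolding D_def using T t by (intro member_le_sum) auto
    finally show ?thesis .
  qed
  define v' where "v' = v(m := (\<lambda>t. d t / sqrt D))"
  have 1: "(\<Sum>t\<in>T. w i t * d t) = 0" if "i < n" for i using d(2)[of i] that by (simp add: w'_def)
  have 2: "(\<Sum>t\<in>T. v k t * d t) = 0" if "k < m" for k using d(2)[of "n + k"] that by (simp add: w'_def)
  have 3: "(\<Sum>t\<in>T. d t * v k t) = 0" if "k < m" for k using 2[OF that] by (simp add: mult.commute)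
  have 4: "(\<Sum>t\<in>T. d t / sqrt D * (d t / sqrt D)) = 1"
  proof -
    have "(\<Sum>t\<in>T. d t / sqrt D * (d t / sqrt D)) = D / D"
      unfolding D_def[symmetric] using D
      by (simp add: D_def sum_divide_distrib[symmetric])
    then show ?thesis using D by simp
  qed
  have "(\<Sum>t\<in>T. w i t * v' k t) = 0" if "k < Suc m" "i < n" for k i
  proof (cases "k = m")
    case True
    then have "(\<Sum>t\<in>T. w i t * v' k t) = (\<Sum>t\<in>T. w i t * d t) / sqrt D"
      by (simp add: v'_def sum_divide_distrib)
    then show ?thesis using 1 that by simp
  next
    case False
    then show ?thesis using v(1) that by (simp add: v'_def)
  qed
  moreover have "(\<Sum>t\<in>T. v' k t * v' k' t) = (if k = k' then 1 else 0)"
    if "k < Suc m" "k' < Suc m" for k k'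
  proof -
    have "(\<Sum>t\<in>T. v i t * (d t / sqrt D)) = 0" if "i < m" for i
      using 2[OF that] by (simp add: sum_divide_distrib[symmetric])
    moreover have "(\<Sum>t\<in>T. d t / sqrt D * v i t) = 0" if "i < m" for i
      using 3[OF that] by (simp add: sum_divide_distrib[symmetric])
    ultimately show ?thesis using that v(2) 4 by (auto simp: v'_def less_Suc_eq)
  qed
  ultimately show ?case by blast
qed

text \<open>The vector is the orthogonal projection of a unit vector onto the kernel; the trace of the
  projection yields a unit vector whose projection is large.\<close>

lemma kernel_peaked_vector:
  fixes w :: "nat \<Rightarrow> 't \<Rightarrow> real"
  assumes T: "finite T" "T \<noteq> {}" and n: "2 * n \<le> card T"
  shows "\<exists>a. \<exists>s\<in>T. (\<forall>i<n. (\<Sum>t\<in>T. w i t * a t) = 0) \<and> (\<Sum>t\<in>T. (a t)\<^sup>2) \<le> 1 \<and> 1 / 2 \<le> a s"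
proof -
  define m where "m = card T - n"
  have nm: "n + m \<le> card T" using n by (simp add: m_def)
  obtain v :: "nat \<Rightarrow> 't \<Rightarrow> real" where v: "\<And>k i. k<m \<Longrightarrow> i<n \<Longrightarrow> (\<Sum>t\<in>T. w i t * v k t) = 0"
    "\<And>k k'. k<m \<Longrightarrow> k'<m \<Longrightarrow> (\<Sum>t\<in>T. v k t * v k' t) = (if k = k' then 1 else 0)"
    using orthonormal_in_kernel[OF T(1) nm, of w] by blast
  \<comment> \<open>\<open>P s\<close> is the diagonal entry at \<open>s\<close> of the orthogonal
    projection onto the span of the \<open>v k\<close>. The trace is \<open>m\<close>, at least half
    of \<open>card T\<close>, so some entry is at least 1/2.\<close>
  define P where "P s = (\<Sum>k<m. (v k s)\<^sup>2)" for s
  have "(\<Sum>s\<in>T. P s) = (\<Sum>k<m. \<Sum>s\<in>T. v k s * v k s)"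
    unfolding P_def power2_eq_square by (rule sum.swap)
  then have sumP: "(\<Sum>s\<in>T. P s) = real m" using v(2) by simp
  have "\<exists>s\<in>T. 1 / 2 \<le> P s"
  proof (rule ccontr)
    assume "\<not> ?thesis"
    then have "(\<Sum>s\<in>T. P s) < (\<Sum>s\<in>T. 1 / 2)" using T by (intro sum_strict_mono) auto
    then show False using sumP n by (simp add: m_def of_nat_diff)
  qed
  then obtain s where s: "s \<in> T" "1 / 2 \<le> P s" by auto
  define a where "a t = (\<Sum>k<m. v k s * v k t)" for t
  have as: "a s = P s" by (simp add: a_def P_def power2_eq_square)
  have nrm: "(\<Sum>t\<in>T. (a t)\<^sup>2) = P s"
  proof -
    have "(\<Sum>t\<in>T. (a t)\<^sup>2) = (\<Sum>t\<in>T. \<Sum>k<m. \<Sum>k'<m. v k s * v k' s * (v k t * v k' t))"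
      unfolding a_def power2_eq_square sum_product by (intro sum.cong refl) (simp add: algebra_simps)
    also have "\<dots> = (\<Sum>k<m. \<Sum>k'<m. \<Sum>t\<in>T. v k s * v k' s * (v k t * v k' t))"
      by (subst sum.swap, intro sum.cong refl, subst sum.swap) simp
    also have "\<dots> = (\<Sum>k<m. \<Sum>k'<m. v k s * v k' s * (if k = k' then 1 else 0))"
      by (intro sum.cong refl) (simp add: sum_distrib_left[symmetric] v(2))
    also have "\<dots> = P s" by (simp add: P_def power2_eq_square if_distrib sum.delta cong: if_cong)
    finally show ?thesis .
  qed
  \<comment> \<open>For the projection \<open>a\<close> of the unit vector at \<open>s\<close>, the
    entry \<open>a s\<close> equals the squared norm; comparing one entry with the norm gives
    \<open>P s * P s \<le> P s\<close>.\<close>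
  have "P s \<le> 1"
  proof -
    have "(a s)\<^sup>2 \<le> (\<Sum>t\<in>T. (a t)\<^sup>2)" using T s by (intro member_le_sum) auto
    then have "P s * P s \<le> P s * 1" unfolding nrm as by (simp add: power2_eq_square)
    then show ?thesis using s by (simp add: mult_le_cancel_left)
  qed
  moreover have "(\<Sum>t\<in>T. w i t * a t) = 0" if "i < n" for i
  proof -
    have "(\<Sum>t\<in>T. w i t * a t) = (\<Sum>k<m. \<Sum>t\<in>T. v k s * (w i t * v k t))"
      unfolding a_def sum_distrib_left by (subst sum.swap) (simp add: algebra_simps)
    also have "\<dots> = 0" using v(1) that by (simp add: sum_distrib_left[symmetric])
    finally show ?thesis .
  qed
  ultimately show ?thesis using s nrm as by (intro exI[of _ a] bexI[of _ s]) auto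
qed

section \<open>Bump functions and finite differences\<close>

text \<open>Finitely many continuous derivatives suffice for the bump, because the test functions
  supply the smoothness in the weak formulation. A polynomial cut off at multiple zeros has
  derivatives of the same form, and its order of vanishing at an inner point is known
  exactly.\<close>

definition cut_poly :: "real poly \<Rightarrow> real \<Rightarrow> real" where
  "cut_poly P t = (if 0 < t \<and> t < 1 then poly P t else 0)"

text \<open>Handles the seams 0 and 1, where the cut function is dominated by a polynomial with a
  multiple zero.\<close>

lemma DERIV_zero_dominated:
  fixes f g :: "real \<Rightarrow> real"
  assumes "(g has_real_derivative 0) (at a)" "g a = 0" "\<And>t. \<bar>f t\<bar> \<le> \<bar>g t\<bar>"
  shows "(f has_real_derivative 0) (at a)"
proof -
  have fa: "f a = 0" using assms(3)[of a] assms(2) by simp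
  have "(\<lambda>h. (g (a + h) - g a) / h) \<midarrow>0\<rightarrow> 0" using assms(1) by (simp add: DERIV_def)
  then have "(\<lambda>h. (f (a + h) - f a) / h) \<midarrow>0\<rightarrow> 0"
    by (rule Lim_null_comparison[rotated, OF tendsto_rabs_zero])
      (use assms fa in \<open>auto simp: abs_divide intro!: always_eventually divide_right_mono\<close>)
  then show ?thesis by (simp add: DERIV_def)
qed

lemma cut_poly_has_derivative:
  assumes "poly P 0 = 0" "poly P 1 = 0" "poly (pderiv P) 0 = 0" "poly (pderiv P) 1 = 0"
  shows "(cut_poly P has_real_derivative cut_poly (pderiv P) t) (at t)"
proof -
  consider "t < 0" | "t > 1" | "0 < t \<and> t < 1" | "t = 0" | "t = 1" by linarith
  then show ?thesis
  proof cases
    case 1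
    have "((\<lambda>_. 0) has_real_derivative 0) (at t)" by simp
    then have "(cut_poly P has_real_derivative 0) (at t)"
      by (rule has_field_derivative_transform_within_open[of _ _ _ "{..<0}"])
        (use 1 in \<open>auto simp: cut_poly_def\<close>)
    then show ?thesis using 1 by (simp add: cut_poly_def)
  next
    case 2
    have "((\<lambda>_. 0) has_real_derivative 0) (at t)" by simp
    then have "(cut_poly P has_real_derivative 0) (at t)"
      by (rule has_field_derivative_transform_within_open[of _ _ _ "{1<..}"])
        (use 2 in \<open>auto simp: cut_poly_def\<close>)
    then show ?thesis using 2 by (simp add: cut_poly_def)
  next
    case 3
    have "(poly P has_real_derivative poly (pderiv P) t) (at t)" by (rule poly_DERIV)
    then have "(cut_poly P has_real_derivative poly (pderiv P) t) (at t)"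
      by (rule has_field_derivative_transform_within_open[of _ _ _ "{0<..<1}"])
        (use 3 in \<open>auto simp: cut_poly_def\<close>)
    then show ?thesis using 3 by (simp add: cut_poly_def)
  next
    case 4
    have "(cut_poly P has_real_derivative 0) (at t)"
      by (rule DERIV_zero_dominated[of "poly P"])
        (use assms poly_DERIV[of P 0] 4 in \<open>auto simp: cut_poly_def\<close>)
    then show ?thesis using 4 by (simp add: cut_poly_def)
  next
    case 5
    have "(cut_poly P has_real_derivative 0) (at t)"
      by (rule DERIV_zero_dominated[of "poly P"])
        (use assms poly_DERIV[of P 1] 5 in \<open>auto simp: cut_poly_def\<close>)
    then show ?thesis using 5 by (simp add: cut_poly_def)
  qed
qed

lemma linear_power_dvd_pderiv:
  fixes P :: "real poly"
  assumes "[:- c, 1:] ^ Suc n dvd P"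
  shows "[:- c, 1:] ^ n dvd pderiv P"
proof -
  obtain R where R: "P = [:- c, 1:] ^ Suc n * R" using assms by (auto elim: dvdE)
  have "pderiv P = [:- c, 1:] ^ n * ([:- c, 1:] * pderiv R + R * smult (1 + of_nat n) (pderiv [:- c, 1:]))"
    unfolding R pderiv_mult pderiv_power_Suc by (simp add: algebra_simps)
  then show ?thesis by simp
qed

lemma poly_higher_pderiv_eq_0:
  fixes P :: "real poly"
  assumes "[:- c, 1:] ^ n dvd P" "i < n"
  shows "poly ((pderiv ^^ i) P) c = 0"
proof -
  have "[:- c, 1:] ^ (n - i) dvd (pderiv ^^ i) P"
    using assms(2)
  proof (induction i)
    case 0
    then show ?case using assms by simp
  next
    case (Suc i)
    then have "[:- c, 1:] ^ Suc (n - Suc i) dvd (pderiv ^^ i) P" by (simp add: Suc_diff_Suc)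
    then show ?case by (simp add: linear_power_dvd_pderiv del: power_Suc)
  qed
  moreover have "[:- c, 1:] dvd [:- c, 1:] ^ (n - i)" using assms(2) by (intro dvd_power) auto
  ultimately have "[:- c, 1:] dvd (pderiv ^^ i) P" by (rule dvd_trans[rotated])
  then show ?thesis by (simp add: poly_eq_0_iff_dvd)
qed

text \<open>Each differentiation lowers the order of a root by exactly one, so after
  \<open>order c P\<close> steps the root is gone.\<close>

lemma poly_higher_pderiv_order:
  fixes P :: "real poly"
  assumes "P \<noteq> 0"
  shows "poly ((pderiv ^^ order c P) P) c \<noteq> 0"
  using assms
proof (induction "order c P" arbitrary: P)
  case 0
  then show ?case by (simp add: order_root)
next
  case (Suc n)
  have "pderiv P \<noteq> 0"
  proof
    assume "pderiv P = 0"
    then obtain a where "P = [:a:]" by (metis pderiv_iszero)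
    with Suc.prems Suc.hyps(2) show False by (simp add: order_0I)
  qed
  moreover from this have "n = order c (pderiv P)"
    using Suc.hyps(2) order_pderiv[of P c] order_root[of P c] Suc.prems by simp
  ultimately have "poly ((pderiv ^^ n) (pderiv P)) c \<noteq> 0" using Suc.hyps(1) by metis
  then show ?case unfolding Suc.hyps(2)[symmetric] by (simp add: funpow_swap1)
qed

text \<open>The function \<open>F 0\<close> is itself a derivative, so that \<open>F lam\<close> has mean zero also for
  \<open>lam = 0\<close>.\<close>

lemma bump_chain_exists:
  fixes lam l :: nat
  assumes "lam \<le> l"
  shows "\<exists>F G. (\<forall>i<l. \<forall>t. (F i has_real_derivative F (Suc i) t) (at t)) \<and>
    (\<forall>i\<le>l. continuous_on UNIV (F i)) \<and> (\<forall>i t. t \<le> 0 \<or> 1 \<le> t \<longrightarrow> F i t = 0) \<and>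
    (\<forall>t. (G has_real_derivative F lam t) (at t)) \<and> (\<forall>t. t \<le> 0 \<or> 1 \<le> t \<longrightarrow> G t = 0) \<and>
    G (1/2) \<noteq> (0::real)"
proof -
  \<comment> \<open>The bump is \<open>D 1\<close> and its \<open>l\<close>-th derivative is
    \<open>D (l + 1)\<close>. Continuity of the latter is drawn from its differentiability, which
    needs \<open>l + 2 < L\<close>.\<close>
  define L where "L = l + 3"
  \<comment> \<open>The last factor vanishes at 1/2 to the exact order \<open>lam\<close>. Hence
    \<open>D lam\<close>, the primitive of the \<open>lam\<close>-th derivative of the bump, is
    nonzero at the point where the Haar function jumps.\<close>
  define P :: "real poly" where "P = [:- 0, 1:] ^ L * [:- 1, 1:] ^ L * [:- (1/2), 1:] ^ lam"
  define D where "D i = cut_poly ((pderiv ^^ i) P)" for i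
  have P0: "P \<noteq> 0" by (simp add: P_def)
  have z0: "poly ((pderiv ^^ i) P) 0 = 0" if "i < L" for i
    by (rule poly_higher_pderiv_eq_0[OF _ that]) (simp add: P_def)
  have z1: "poly ((pderiv ^^ i) P) 1 = 0" if "i < L" for i
    by (rule poly_higher_pderiv_eq_0[OF _ that]) (simp add: P_def)
  have D: "(D i has_real_derivative D (Suc i) t) (at t)" if "Suc i < L" for i t
    unfolding D_def using z0[of i] z1[of i] z0[of "Suc i"] z1[of "Suc i"] that
    by (simp add: cut_poly_has_derivative)
  have cont: "continuous_on UNIV (D i)" if "Suc i < L" for i
    using D[OF that] by (meson DERIV_isCont continuous_at_imp_continuous_on)
  have "order (1/2) P = lam"
  proof -
    have "order (1/2) ([:- 0, 1:] ^ L * [:- 1, 1:] ^ L :: real poly) = 0"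
      by (rule order_0I) simp
    then show ?thesis using P0 unfolding P_def by (subst order_mult) (auto simp: order_power_n_n)
  qed
  then have "poly ((pderiv ^^ lam) P) (1/2) \<noteq> 0" using poly_higher_pderiv_order[OF P0, of "1/2"] by simp
  then have "D lam (1/2) \<noteq> 0" by (simp add: D_def cut_poly_def)
  moreover have "D i t = 0" if "t \<le> 0 \<or> 1 \<le> t" for i t using that by (auto simp: D_def cut_poly_def)
  moreover have "Suc (Suc i) < L" if "i \<le> l" for i using that by (simp add: L_def)
  ultimately show ?thesis
    using D cont assms by (intro exI[of _ "\<lambda>i. D (Suc i)"] exI[of _ "D lam"]) (simp add: L_def)
qed

section \<open>Iterated differences in one variable\<close>

primrec fdiff :: "nat \<Rightarrow> real \<Rightarrow> (real \<Rightarrow> real) \<Rightarrow> real \<Rightarrow> real" where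
  "fdiff 0 h f t = f t"
| "fdiff (Suc l) h f t = fdiff l h f (t + h) - fdiff l h f t"

lemma fdiff_eq_sum:
  "fdiff l h f t = (\<Sum>i\<le>l. (-1) ^ (l - i) * real (l choose i) * f (t + real i * h))"
proof -
  \<comment> \<open>During the induction the sign is carried as \<open>(-1) ^ (l + i)\<close>, so
    that Pascal's rule does not meet truncated subtraction.\<close>
  have "fdiff l h f t = (\<Sum>i\<le>l. (-1) ^ (l + i) * real (l choose i) * f (t + real i * h))"
  proof (induction l arbitrary: t)
    case 0
    then show ?case by simp
  next
    case (Suc l)
    have "(\<Sum>i\<le>Suc l. (-1) ^ (Suc l + i) * real (Suc l choose i) * f (t + real i * h)) =
      (-1) ^ Suc l * f t + (\<Sum>i\<le>l. (-1) ^ (l + i) * real (l choose i) * f (t + h + real i * h)) +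
      (\<Sum>i\<le>l. (-1) ^ (l + i) * real (l choose Suc i) * f (t + real (Suc i) * h))"
      by (subst sum.atMost_Suc_shift) (simp add: sum.distrib[symmetric] algebra_simps)
    moreover have "(\<Sum>i\<le>l. (-1) ^ (l + i) * real (l choose i) * f (t + real i * h)) =
       (\<Sum>i\<le>Suc l. (-1) ^ (l + i) * real (l choose i) * f (t + real i * h))" by simp
    moreover have "(\<Sum>i\<le>Suc l. (-1) ^ (l + i) * real (l choose i) * f (t + real i * h)) =
       (-1) ^ l * f t - (\<Sum>i\<le>l. (-1) ^ (l + i) * real (l choose Suc i) * f (t + real (Suc i) * h))"
      by (subst sum.atMost_Suc_shift) (simp add: sum_negf)
    moreover have "(-1) ^ Suc l * f t = - ((-1) ^ l * f t)" by simp
    ultimately show ?case unfolding fdiff.simps Suc.IH by linarith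
  qed
  also have "\<dots> = (\<Sum>i\<le>l. (-1) ^ (l - i) * real (l choose i) * f (t + real i * h))"
    by (intro sum.cong refl) (simp add: minus_one_power_iff)
  finally show ?thesis .
qed

lemma fdiff_has_derivative:
  assumes "\<And>t. (f has_real_derivative f' t) (at t)"
  shows "(fdiff l h f has_real_derivative fdiff l h f' t) (at t)"
proof (induction l arbitrary: t)
  case 0
  have "fdiff 0 h f = f" "fdiff 0 h f' = f'" by auto
  then show ?case using assms by simp
next
  case (Suc l)
  have "((\<lambda>t. fdiff l h f (t + h)) has_real_derivative fdiff l h f' (t + h)) (at t)"
    using Suc.IH[of "t + h"] by (simp add: DERIV_shift)
  from DERIV_diff[OF this Suc.IH[of t]] show ?case by simp
qed

lemma fdiff_le_deriv:
  assumes "\<And>i t. i < l \<Longrightarrow> (F i has_real_derivative F (Suc i) t) (at t)"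
    and "\<And>t. \<bar>F l t\<bar> \<le> M"
  shows "\<bar>fdiff l h (F 0) t\<bar> \<le> M * \<bar>h\<bar> ^ l"
proof -
  \<comment> \<open>Stated for \<open>m\<close> differences of the derivative of order
    \<open>l - m\<close>: each further difference uses up one derivative and gains a factor
    \<open>\<bar>h\<bar>\<close> by the mean value inequality.\<close>
  have "\<bar>fdiff m h (F (l - m)) t\<bar> \<le> M * \<bar>h\<bar> ^ m" if "m \<le> l" for m t
    using that
  proof (induction m arbitrary: t)
    case 0
    then show ?case using assms by simp
  next
    case (Suc m)
    have eq: "Suc (l - Suc m) = l - m" using Suc.prems by simp
    have "(fdiff m h (F (l - Suc m)) has_real_derivative fdiff m h (F (l - m)) s) (at s within UNIV)" for s
      using fdiff_has_derivative[of "F (l - Suc m)" "F (Suc (l - Suc m))"] assms(1)[of "l - Suc m"] Suc.prems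
      unfolding eq by simp
    from field_differentiable_bound[OF convex_UNIV this, of "M * \<bar>h\<bar> ^ m" "t + h" t]
    have "\<bar>fdiff m h (F (l - Suc m)) (t + h) - fdiff m h (F (l - Suc m)) t\<bar> \<le> M * \<bar>h\<bar> ^ m * \<bar>h\<bar>"
      using Suc by simp
    then show ?case by (simp add: mult_ac)
  qed
  from this[of l t] show ?thesis by simp
qed

lemma continuous_vanishing_bounded:
  fixes f :: "real \<Rightarrow> real"
  assumes "continuous_on UNIV f" "\<And>t. t \<le> 0 \<or> 1 \<le> t \<Longrightarrow> f t = 0"
  shows "\<exists>M>0. \<forall>t. \<bar>f t\<bar> \<le> M"
proof -
  have "bounded (f ` {0..1})"
    by (intro compact_imp_bounded compact_continuous_image continuous_on_subset[OF assms(1)]) auto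
  then obtain M where M: "M > 0" "\<forall>x\<in>f ` {0..1}. norm x \<le> M"
    unfolding bounded_pos by blast
  have "\<bar>f t\<bar> \<le> M" for t using M assms(2)[of t] by (cases "t \<in> {0..1}") auto
  with M show ?thesis by blast
qed

text \<open>For steps of length at least \<open>1\<close> the covering intervals are the translates of the support,
  for shorter steps they are consecutive unit intervals.\<close>

lemma fdiff_cover:
  assumes F: "\<And>i t. i < l \<Longrightarrow> (F i has_real_derivative F (Suc i) t) (at t)"
    and cont: "\<And>i. i \<le> l \<Longrightarrow> continuous_on UNIV (F i)"
    and van: "\<And>i t. t \<le> 0 \<or> 1 \<le> t \<Longrightarrow> F i t = (0::real)"
  shows "\<exists>C>0. \<forall>h. \<exists>\<tau>::nat \<Rightarrow> real. \<forall>t.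
    \<bar>fdiff l h (F 0) t\<bar> \<le> C * min 1 \<bar>h\<bar> ^ l * (\<Sum>i\<le>2*l. indicator {0..<1} (t + \<tau> i))"
proof -
  obtain M0 where M0: "M0 > 0" "\<And>t. \<bar>F 0 t\<bar> \<le> M0"
    using continuous_vanishing_bounded[OF cont[of 0]] van by blast
  obtain Ml where Ml: "Ml > 0" "\<And>t. \<bar>F l t\<bar> \<le> Ml"
    using continuous_vanishing_bounded[OF cont[of l]] van by blast
  \<comment> \<open>\<open>Ml\<close> serves the short steps, where the \<open>l\<close>-th
    derivative bounds the difference. \<open>2 ^ l * M0\<close> serves the long steps, where each
    term carries a binomial coefficient of at most \<open>2 ^ l\<close>.\<close>
  define C where "C = Ml + 2 ^ l * M0"
  have C: "C > 0" "Ml \<le> C" "2 ^ l * M0 \<le> C" using M0 Ml by (auto simp: C_def intro!: add_pos_pos)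
  have "\<exists>\<tau>::nat \<Rightarrow> real. \<forall>t.
    \<bar>fdiff l h (F 0) t\<bar> \<le> C * min 1 \<bar>h\<bar> ^ l * (\<Sum>i\<le>2*l. indicator {0..<1} (t + \<tau> i))" for h
  proof (cases "1 \<le> \<bar>h\<bar>")
    case True
    have "\<bar>fdiff l h (F 0) t\<bar> \<le> C * min 1 \<bar>h\<bar> ^ l * (\<Sum>i\<le>2*l. indicator {0..<1} (t + real i * h))" for t
    proof -
      have F0: "\<bar>F 0 s\<bar> \<le> M0 * indicator {0..<1} s" for s
        using M0 van[of s 0] by (auto simp: indicator_def)
      have "\<bar>fdiff l h (F 0) t\<bar> \<le> (\<Sum>i\<le>l. \<bar>(-1) ^ (l - i) * real (l choose i) * F 0 (t + real i * h)\<bar>)"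
        unfolding fdiff_eq_sum by (rule sum_abs)
      also have "\<dots> \<le> (\<Sum>i\<le>l. 2 ^ l * (M0 * indicator {0..<1} (t + real i * h)))"
      proof (intro sum_mono)
        fix i assume "i \<in> {..l}"
        have "real (l choose i) \<le> 2 ^ l"
          using binomial_le_pow2[of l i] by (metis of_nat_le_iff of_nat_numeral of_nat_power)
        then show "\<bar>(-1) ^ (l - i) * real (l choose i) * F 0 (t + real i * h)\<bar> \<le>
            2 ^ l * (M0 * indicator {0..<1} (t + real i * h))"
          using F0[of "t + real i * h"] by (simp add: abs_mult power_abs mult_mono)
      qed
      also have "\<dots> \<le> (\<Sum>i\<le>2*l. 2 ^ l * (M0 * indicator {0..<1} (t + real i * h)))"
        using M0 by (intro sum_mono2) auto
      also have "\<dots> = 2 ^ l * M0 * (\<Sum>i\<le>2*l. indicator {0..<1} (t + real i * h))"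
        by (simp add: sum_distrib_left mult_ac)
      also have "\<dots> \<le> C * (\<Sum>i\<le>2*l. indicator {0..<1} (t + real i * h))"
        using C by (intro mult_right_mono sum_nonneg) auto
      finally show ?thesis using True by (simp add: min_def)
    qed
    then show ?thesis by (intro exI[of _ "\<lambda>i. real i * h"]) blast
  next
    case False
    have "\<bar>fdiff l h (F 0) t\<bar> \<le> C * min 1 \<bar>h\<bar> ^ l *
        (\<Sum>i\<le>2*l. indicator {0..<1} (t + (real l - real i)))" for t
    proof (cases "fdiff l h (F 0) t = 0")
      case True
      then show ?thesis using C by (auto intro!: mult_nonneg_nonneg sum_nonneg)
    next
      case nz: False
      then obtain i where i: "i \<le> l" "F 0 (t + real i * h) \<noteq> 0"
        unfolding fdiff_eq_sum by (metis (no_types, lifting) atMost_iff mult_zero_right sum.neutral)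
      then have "0 < t + real i * h" "t + real i * h < 1" using van by (meson not_le)+
      \<comment> \<open>A short step keeps the support of the difference between \<open>- l\<close>
        and \<open>l + 1\<close>, a range covered by \<open>2 * l + 1\<close> unit
        intervals.\<close>
      moreover have "\<bar>real i * h\<bar> \<le> real l"
        using mult_mono[of "real i" "real l" "\<bar>h\<bar>" 1] i False by (simp add: abs_mult)
      ultimately have t: "- real l < t" "t < 1 + real l" by linarith+
      define i0 where "i0 = nat \<lfloor>t + real l\<rfloor>"
      have "0 \<le> \<lfloor>t + real l\<rfloor>" using t by (simp only: zero_le_floor)
      then have i0: "real i0 = of_int \<lfloor>t + real l\<rfloor>" unfolding i0_def by (rule of_nat_nat)
      have "i0 \<le> 2 * l"
      proof -
        have "real i0 < 2 * real l + 1" unfolding i0 using t by linarith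
        then show ?thesis by linarith
      qed
      moreover have "t + (real l - real i0) \<in> {0..<1}" unfolding i0 by (auto; linarith)
      ultimately have "1 \<le> (\<Sum>i\<le>2*l. indicator {0..<1} (t + (real l - real i)) :: real)"
        using member_le_sum[of i0 "{..2*l}" "\<lambda>i. indicator {0..<1} (t + (real l - real i)) :: real"] by simp
      moreover have "\<bar>fdiff l h (F 0) t\<bar> \<le> C * min 1 \<bar>h\<bar> ^ l"
      proof -
        have "\<bar>fdiff l h (F 0) t\<bar> \<le> Ml * \<bar>h\<bar> ^ l" using F Ml by (intro fdiff_le_deriv) auto
        also have "\<dots> \<le> C * \<bar>h\<bar> ^ l" using C by (intro mult_right_mono) auto
        finally show ?thesis using False by (simp add: min_def)
      qed
      ultimately show ?thesis
        by (meson abs_ge_zero dual_order.trans mult_left_mono mult_le_cancel_left1 not_le order_less_imp_le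
            mult.right_neutral mult_nonneg_nonneg) 
    qed
    then show ?thesis by (intro exI[of _ "\<lambda>i. real l - real i"]) blast
  qed
  with C show ?thesis by blast
qed

section \<open>Dyadic square functions\<close>

text \<open>The last conjunct is a second order estimate: terms linear in \<open>d\<close> cancel
  between \<open>s + d\<close> and \<open>s - d\<close>. The other conjuncts carry the induction, in
  which the sum \<open>a\<close> and the difference \<open>b\<close> of the powers become
  \<open>s * a + d * b\<close> and \<open>s * b + d * a\<close>. Factors \<open>s\<close> on the
  left avoid divisions and lowered exponents.\<close>

lemma symmetric_power_bounds:
  "\<exists>B K. 0 \<le> B \<and> 0 \<le> K \<and> (\<forall>s d::real. \<bar>d\<bar> \<le> s \<longrightarrow>
     2 * s ^ r \<le> (s + d) ^ r + (s - d) ^ r \<and>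
     (s + d) ^ r + (s - d) ^ r \<le> 2 ^ Suc r * s ^ r \<and>
     0 \<le> d * ((s + d) ^ r - (s - d) ^ r) \<and>
     s * \<bar>(s + d) ^ r - (s - d) ^ r\<bar> \<le> B * \<bar>d\<bar> * s ^ r \<and>
     s\<^sup>2 * ((s + d) ^ r + (s - d) ^ r) \<le> 2 * s ^ (r + 2) + K * d\<^sup>2 * s ^ r)"
proof (induction r)
  case 0
  show ?case by (intro exI[of _ 0]) (simp add: power2_eq_square)
next
  case (Suc r)
  then obtain B K where BK: "0 \<le> B" "0 \<le> K" and IH: "\<And>s d::real. \<bar>d\<bar> \<le> s \<Longrightarrow>
     2 * s ^ r \<le> (s + d) ^ r + (s - d) ^ r \<and>
     (s + d) ^ r + (s - d) ^ r \<le> 2 ^ Suc r * s ^ r \<and>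
     0 \<le> d * ((s + d) ^ r - (s - d) ^ r) \<and>
     s * \<bar>(s + d) ^ r - (s - d) ^ r\<bar> \<le> B * \<bar>d\<bar> * s ^ r \<and>
     s\<^sup>2 * ((s + d) ^ r + (s - d) ^ r) \<le> 2 * s ^ (r + 2) + K * d\<^sup>2 * s ^ r" by blast
  have "2 * s ^ Suc r \<le> (s + d) ^ Suc r + (s - d) ^ Suc r \<and>
     (s + d) ^ Suc r + (s - d) ^ Suc r \<le> 2 ^ Suc (Suc r) * s ^ Suc r \<and>
     0 \<le> d * ((s + d) ^ Suc r - (s - d) ^ Suc r) \<and>
     s * \<bar>(s + d) ^ Suc r - (s - d) ^ Suc r\<bar> \<le> (B + 2 ^ Suc r) * \<bar>d\<bar> * s ^ Suc r \<and>
     s\<^sup>2 * ((s + d) ^ Suc r + (s - d) ^ Suc r) \<le> 2 * s ^ (Suc r + 2) + (K + B) * d\<^sup>2 * s ^ Suc r"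
    if ds: "\<bar>d\<bar> \<le> s" for s d :: real
  proof -
    define a where "a = (s + d) ^ r + (s - d) ^ r"
    define b where "b = (s + d) ^ r - (s - d) ^ r"
    have s: "0 \<le> s" using ds by linarith
    have h: "2 * s ^ r \<le> a" "a \<le> 2 ^ Suc r * s ^ r" "0 \<le> d * b" "s * \<bar>b\<bar> \<le> B * \<bar>d\<bar> * s ^ r"
      "s\<^sup>2 * a \<le> 2 * s ^ (r + 2) + K * d\<^sup>2 * s ^ r"
      using IH[OF ds] by (auto simp: a_def b_def)
    have a0: "0 \<le> a" using h(1) s by (meson dual_order.trans mult_nonneg_nonneg zero_le_numeral zero_le_power)
    have a1: "(s + d) ^ Suc r + (s - d) ^ Suc r = s * a + d * b" by (simp add: a_def b_def algebra_simps)
    have b1: "(s + d) ^ Suc r - (s - d) ^ Suc r = s * b + d * a" by (simp add: a_def b_def algebra_simps)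
    have b2: "\<bar>b\<bar> \<le> a" 
    proof -
      have "0 \<le> (s + d) ^ r" "0 \<le> (s - d) ^ r" using ds by auto
      then show ?thesis by (simp add: a_def b_def)
    qed
    have 1: "2 * s ^ Suc r \<le> s * a + d * b"
      using mult_left_mono[OF h(1) s] h(3) by (simp add: mult_ac)
    have "d * b \<le> \<bar>d\<bar> * \<bar>b\<bar>" by (metis abs_ge_self abs_mult)
    also have "\<dots> \<le> s * a" using ds b2 s by (intro mult_mono) auto
    finally have "s * a + d * b \<le> 2 * (s * a)" by linarith
    also have "\<dots> \<le> 2 * (s * (2 ^ Suc r * s ^ r))" using h(2) s by (intro mult_left_mono) auto
    finally have 2: "s * a + d * b \<le> 2 ^ Suc (Suc r) * s ^ Suc r" by (simp add: mult_ac)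
    have "0 \<le> s * (d * b) + d * d * a"
      using mult_nonneg_nonneg[OF s h(3)] mult_nonneg_nonneg[OF zero_le_square[of d] a0] by linarith
    then have 3: "0 \<le> d * (s * b + d * a)" by (simp add: algebra_simps)
    have "s * \<bar>s * b + d * a\<bar> \<le> s * (s * \<bar>b\<bar> + \<bar>d\<bar> * a)"
      using s a0 abs_triangle_ineq[of "s * b" "d * a"] by (intro mult_left_mono) (auto simp: abs_mult)
    also have "\<dots> \<le> s * (B * \<bar>d\<bar> * s ^ r + \<bar>d\<bar> * (2 ^ Suc r * s ^ r))"
      using h s by (intro mult_left_mono add_mono) auto
    finally have 4: "s * \<bar>s * b + d * a\<bar> \<le> (B + 2 ^ Suc r) * \<bar>d\<bar> * s ^ Suc r" by (simp add: algebra_simps)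
    have "s\<^sup>2 * (s * a + d * b) = s * (s\<^sup>2 * a) + s * (s * (d * b))" by (simp add: algebra_simps power2_eq_square)
    also have "s * (s * (d * b)) \<le> s * (\<bar>d\<bar> * (s * \<bar>b\<bar>))"
    proof -
      have "d * b \<le> \<bar>d\<bar> * \<bar>b\<bar>" by (metis abs_ge_self abs_mult)
      then have "s * (d * b) \<le> s * (\<bar>d\<bar> * \<bar>b\<bar>)" using s by (rule mult_left_mono)
      then show ?thesis using s by (intro mult_left_mono) (auto simp: mult_ac)
    qed
    also have "s * (\<bar>d\<bar> * (s * \<bar>b\<bar>)) \<le> s * (\<bar>d\<bar> * (B * \<bar>d\<bar> * s ^ r))"
      using h s by (intro mult_left_mono) auto
    also have "s * (s\<^sup>2 * a) \<le> s * (2 * s ^ (r + 2) + K * d\<^sup>2 * s ^ r)"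
      using h s by (intro mult_left_mono) auto
    finally have "s\<^sup>2 * (s * a + d * b) \<le> s * (2 * s ^ (r + 2) + K * d\<^sup>2 * s ^ r) + s * (\<bar>d\<bar> * (B * \<bar>d\<bar> * s ^ r))"
      by simp
    also have "\<dots> = 2 * s ^ (Suc r + 2) + (K + B) * d\<^sup>2 * s ^ Suc r"
      by (simp add: algebra_simps power2_eq_square flip: abs_mult)
    finally show ?thesis unfolding a1 b1 using 1 2 3 4 by auto
  qed
  then show ?case using BK by (intro exI[of _ "B + 2 ^ Suc r"] exI[of _ "K + B"]) auto
qed

lemma symmetric_power_ge:
  fixes s d :: real
  assumes "\<bar>d\<bar> \<le> s"
  shows "2 * s ^ r \<le> (s + d) ^ r + (s - d) ^ r"
  using symmetric_power_bounds[of r] assms by blast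

lemma power_add_le:
  fixes y w :: real
  assumes "0 \<le> y" "0 \<le> w"
  shows "(y + w) ^ r \<le> y ^ r + real r * w * (y + w) ^ (r - 1)"
proof (induction r)
  case 0
  then show ?case by simp
next
  case (Suc r)
  have "(y + w) ^ Suc r = y * (y + w) ^ r + w * (y + w) ^ r" by (simp add: algebra_simps)
  also have "y * (y + w) ^ r \<le> y * (y ^ r + real r * w * (y + w) ^ (r - 1))"
    using Suc assms by (intro mult_left_mono) auto
  also have "y * (y ^ r + real r * w * (y + w) ^ (r - 1)) =
     y ^ Suc r + real r * w * (y * (y + w) ^ (r - 1))" by (simp add: algebra_simps)
  also have "real r * w * (y * (y + w) ^ (r - 1)) \<le> real r * w * (y + w) ^ r"
  proof (cases r)
    case 0
    then show ?thesis by simp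
  next
    case (Suc r')
    then show ?thesis using assms by (auto intro!: mult_left_mono mult_right_mono)
  qed
  finally show ?case by (simp add: algebra_simps)
qed

text \<open>Read \<open>y\<close> and \<open>w\<close> as the squared norms of a vector and an
  increment and \<open>c\<close> as their inner product: the left side adds the powers of order
  \<open>2 * r\<close> of the norms of vector plus and minus increment. The condition on
  \<open>c\<close> is the Cauchy-Schwarz inequality; it turns the quadratic term in \<open>c\<close>
  into a multiple of \<open>w * (y + w)\<close>.\<close>

lemma two_point_power_bound:
  assumes r: "1 \<le> r"
  shows "\<exists>C>0. \<forall>y w c::real. 0 \<le> y \<longrightarrow> 0 \<le> w \<longrightarrow> c\<^sup>2 \<le> y * w \<longrightarrow>
    (y + w + 2 * c) ^ r + (y + w - 2 * c) ^ r \<le> 2 * y ^ r + C * w * (y + w) ^ (r - 1)"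
proof -
  obtain K where K: "0 \<le> K" and bnd: "\<And>s d::real. \<bar>d\<bar> \<le> s \<Longrightarrow>
     s\<^sup>2 * ((s + d) ^ r + (s - d) ^ r) \<le> 2 * s ^ (r + 2) + K * d\<^sup>2 * s ^ r"
    using symmetric_power_bounds[of r] by blast
  have "(y + w + 2 * c) ^ r + (y + w - 2 * c) ^ r \<le> 2 * y ^ r + (2 * real r + 4 * K + 1) * w * (y + w) ^ (r - 1)"
    if y: "0 \<le> y" and w: "0 \<le> w" and c: "c\<^sup>2 \<le> y * w" for y w c :: real
  proof (cases "y + w = 0")
    case True
    then have "y = 0" "w = 0" using y w by auto
    then show ?thesis using c r by (simp add: power_0_left)
  next
    case False
    define s where "s = y + w"
    have s: "s > 0" using False y w by (simp add: s_def)
    have "y * w \<le> w * s" using w by (simp add: s_def algebra_simps)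
    then have c2: "(2 * c)\<^sup>2 \<le> 4 * w * s" using c by (simp add: power_mult_distrib)
    have "(2 * c)\<^sup>2 \<le> s\<^sup>2"
    proof -
      have "(2 * c)\<^sup>2 \<le> 4 * (y * w)" using c by simp
      also have "\<dots> \<le> s\<^sup>2" using zero_le_power2[of "y - w"] by (simp add: s_def power2_eq_square algebra_simps)
      finally show ?thesis .
    qed
    then have d: "\<bar>2 * c\<bar> \<le> s" using s by (metis abs_le_square_iff abs_of_pos)
    have "s\<^sup>2 * ((s + 2 * c) ^ r + (s - 2 * c) ^ r) \<le> 2 * s ^ (r + 2) + K * (2 * c)\<^sup>2 * s ^ r"
      by (rule bnd[OF d])
    also have "\<dots> \<le> 2 * s ^ (r + 2) + K * (4 * w * s) * s ^ r"
      using c2 K s by (intro add_left_mono mult_right_mono mult_left_mono) auto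
    also have "\<dots> = s\<^sup>2 * (2 * s ^ r + 4 * K * w * s ^ (r - 1))"
      using r by (cases r) (auto simp: power2_eq_square algebra_simps)
    finally have "(s + 2 * c) ^ r + (s - 2 * c) ^ r \<le> 2 * s ^ r + 4 * K * w * s ^ (r - 1)"
      using s by (simp add: mult_le_cancel_left)
    also have "\<dots> \<le> 2 * (y ^ r + real r * w * s ^ (r - 1)) + 4 * K * w * s ^ (r - 1)"
      using power_add_le[OF y w, of r] by (simp add: s_def)
    also have "\<dots> \<le> 2 * y ^ r + (2 * real r + 4 * K + 1) * w * s ^ (r - 1)"
      using s w by (simp add: algebra_simps)
    finally show ?thesis by (simp add: s_def)
  qed
  then show ?thesis using K by (intro exI[of _ "2 * real r + 4 * K + 1"]) auto
qed

section \<open>Burkholder's inequality for dyadic martingales\<close>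

lemma sum_lessThan_double:
  fixes f :: "nat \<Rightarrow> 'a::comm_monoid_add"
  shows "(\<Sum>z<2*n. f z) = (\<Sum>z<n. f (2*z) + f (2*z+1))"
  by (induction n) (auto simp: add.assoc)

definition rad :: "nat \<Rightarrow> real" where "rad z = (if even z then 1 else -1)"

lemma rad_sq [simp]: "(rad z)\<^sup>2 = 1" "rad z * rad z = 1" "\<bar>rad z\<bar> = 1"
  by (auto simp: rad_def)

text \<open>A dyadic martingale on \<open>{..<2^K}\<close> with values in \<open>\<real>\<^sup>T\<close>: the \<open>i\<close>-th difference
  is the sign given by the \<open>i\<close>-th leading bit times a function of the preceding bits.\<close>

definition dyadic_mart :: "(nat \<Rightarrow> nat \<Rightarrow> 't \<Rightarrow> real) \<Rightarrow> nat \<Rightarrow> nat \<Rightarrow> 't \<Rightarrow> real" where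
  "dyadic_mart v K z \<tau> = (\<Sum>i<K. rad (z div 2 ^ (K - Suc i)) * v i (z div 2 ^ (K - i)) \<tau>)"

definition dyadic_sq :: "'t set \<Rightarrow> (nat \<Rightarrow> nat \<Rightarrow> 't \<Rightarrow> real) \<Rightarrow> nat \<Rightarrow> nat \<Rightarrow> real" where
  "dyadic_sq T v K z = (\<Sum>i<K. \<Sum>\<tau>\<in>T. (v i (z div 2 ^ (K - i)) \<tau>)\<^sup>2)"

lemma dyadic_mart_Suc:
  "dyadic_mart v (Suc K) z \<tau> = dyadic_mart v K (z div 2) \<tau> + rad z * v K (z div 2) \<tau>"
proof -
  have "(\<Sum>i<K. rad (z div 2 ^ (Suc K - Suc i)) * v i (z div 2 ^ (Suc K - i)) \<tau>) =
    (\<Sum>i<K. rad (z div 2 div 2 ^ (K - Suc i)) * v i (z div 2 div 2 ^ (K - i)) \<tau>)"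
    by (intro sum.cong refl)
      (auto simp: div_mult2_eq[symmetric] Suc_diff_le Suc_diff_Suc simp flip: power_Suc)
  then show ?thesis by (simp add: dyadic_mart_def)
qed

lemma dyadic_sq_Suc:
  "dyadic_sq T v (Suc K) z = dyadic_sq T v K (z div 2) + (\<Sum>\<tau>\<in>T. (v K (z div 2) \<tau>)\<^sup>2)"
proof -
  have "(\<Sum>i<K. \<Sum>\<tau>\<in>T. (v i (z div 2 ^ (Suc K - i)) \<tau>)\<^sup>2) =
    (\<Sum>i<K. \<Sum>\<tau>\<in>T. (v i (z div 2 div 2 ^ (K - i)) \<tau>)\<^sup>2)"
    by (intro sum.cong refl) (auto simp: div_mult2_eq[symmetric] Suc_diff_le simp flip: power_Suc)
  then show ?thesis by (simp add: dyadic_sq_def)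
qed

lemma dyadic_sq_nonneg: "0 \<le> dyadic_sq T v K z"
  by (auto simp: dyadic_sq_def intro!: sum_nonneg)

text \<open>Burkholder's inequality for an even exponent. The square function only sees preceding bits
  and \<open>Y ^ (r - 1)\<close> is a submartingale, so the increments of \<open>E (Y ^ r)\<close> sum up to at most
  \<open>C * E (W * Y ^ (r - 1))\<close>.\<close>

lemma dyadic_square_function:
  assumes r: "1 \<le> r"
  shows "\<exists>C\<ge>0. \<forall>K T v. finite (T :: 't set) \<longrightarrow>
    (\<Sum>z<2^K. (\<Sum>\<tau>\<in>T. (dyadic_mart v K z \<tau>)\<^sup>2) ^ r) \<le> C * (\<Sum>z<2^K. (dyadic_sq T v K z) ^ r)"
proof -
  obtain C where C: "C > 0" and step: "\<And>y w c::real. 0 \<le> y \<Longrightarrow> 0 \<le> w \<Longrightarrow> c\<^sup>2 \<le> y * w \<Longrightarrow>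
    (y + w + 2 * c) ^ r + (y + w - 2 * c) ^ r \<le> 2 * y ^ r + C * w * (y + w) ^ (r - 1)"
    using two_point_power_bound[OF r] by blast
  \<comment> \<open>The constant of the square function term in the pointwise estimate below,
    doubled because half of the left side is absorbed.\<close>
  define C' where "C' = 2 * C * (2 * C) ^ (r - 1)"
  have main: "(\<Sum>z<2^K. (\<Sum>\<tau>\<in>T. (dyadic_mart v K z \<tau>)\<^sup>2) ^ r) \<le> C' * (\<Sum>z<2^K. (dyadic_sq T v K z) ^ r)"
    if T: "finite T" for K and T :: "'t set" and v
  proof -
    define Y where "Y K z = (\<Sum>\<tau>\<in>T. (dyadic_mart v K z \<tau>)\<^sup>2)" for K z
    define W where "W K z = dyadic_sq T v K z" for K z
    have Y0: "0 \<le> Y K z" for K z by (auto simp: Y_def intro!: sum_nonneg)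
    have W0: "0 \<le> W K z" for K z by (simp add: W_def dyadic_sq_nonneg)
    have "(\<Sum>z<2^K. Y K z ^ r) \<le> C * (\<Sum>z<2^K. W K z * Y K z ^ (r - 1))"
    proof (induction K)
      case 0
      then show ?case using r by (simp add: Y_def dyadic_mart_def W_def dyadic_sq_def power_0_left)
    next
      case (Suc K)
      define w where "w z = (\<Sum>\<tau>\<in>T. (v K z \<tau>)\<^sup>2)" for z
      define c where "c z = (\<Sum>\<tau>\<in>T. dyadic_mart v K z \<tau> * v K z \<tau>)" for z
      have w0: "0 \<le> w z" for z by (auto simp: w_def intro!: sum_nonneg)
      have cw: "(c z)\<^sup>2 \<le> Y K z * w z" for z
        unfolding c_def w_def Y_def by (rule Cauchy_Schwarz_ineq_sum)
      \<comment> \<open>\<open>2 * z\<close> and \<open>2 * z + 1\<close> are the children of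
        \<open>z\<close>; the new sign is plus on the even child and minus on the odd one.\<close>
      have Y1: "Y (Suc K) (2 * z) = Y K z + w z + 2 * c z" for z
        by (simp add: Y_def dyadic_mart_Suc rad_def w_def c_def power2_sum sum.distrib sum_distrib_left mult_ac)
      have Y2: "Y (Suc K) (2 * z + 1) = Y K z + w z - 2 * c z" for z
        by (simp add: Y_def dyadic_mart_Suc rad_def w_def c_def power2_diff sum.distrib sum_subtractf
            sum_distrib_left mult_ac)
      have cs: "\<bar>2 * c z\<bar> \<le> Y K z + w z" for z
      proof -
        have "(2 * c z)\<^sup>2 \<le> 4 * (Y K z * w z)" using cw[of z] by simp
        also have "\<dots> \<le> (Y K z + w z)\<^sup>2"
          using zero_le_power2[of "Y K z - w z"] by (simp add: power2_eq_square algebra_simps)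
        finally show ?thesis using Y0[of K z] w0[of z] 
          by (metis abs_le_square_iff abs_of_nonneg add_nonneg_nonneg)
      qed
      have sub: "2 * (Y K z + w z) ^ (r - 1) \<le> Y (Suc K) (2 * z) ^ (r - 1) + Y (Suc K) (2 * z + 1) ^ (r - 1)" for z
        unfolding Y1 Y2 by (rule symmetric_power_ge[OF cs])
      have sub': "2 * Y K z ^ (r - 1) \<le> Y (Suc K) (2 * z) ^ (r - 1) + Y (Suc K) (2 * z + 1) ^ (r - 1)" for z
      proof -
        have "Y K z ^ (r - 1) \<le> (Y K z + w z) ^ (r - 1)" using Y0 w0 by (intro power_mono) auto
        then show ?thesis using sub[of z] by linarith
      qed
      have "(\<Sum>z<2^Suc K. Y (Suc K) z ^ r) = (\<Sum>z<2^K. Y (Suc K) (2*z) ^ r + Y (Suc K) (2*z+1) ^ r)"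
        by (simp only: power_Suc sum_lessThan_double)
      also have "\<dots> \<le> (\<Sum>z<2^K. 2 * Y K z ^ r + C * w z * (Y K z + w z) ^ (r - 1))"
        unfolding Y1 Y2 using Y0 w0 cw by (intro sum_mono step) auto
      also have "\<dots> = 2 * (\<Sum>z<2^K. Y K z ^ r) + (\<Sum>z<2^K. C * w z * (Y K z + w z) ^ (r - 1))"
        by (simp add: sum.distrib sum_distrib_left)
      also have "\<dots> \<le> 2 * (C * (\<Sum>z<2^K. W K z * Y K z ^ (r - 1))) + (\<Sum>z<2^K. C * w z * (Y K z + w z) ^ (r - 1))"
        using Suc by simp
      also have "\<dots> = C * (\<Sum>z<2^K. W K z * (2 * Y K z ^ (r - 1)) + w z * (Y K z + w z) ^ (r - 1))"
        by (simp add: sum.distrib sum_distrib_left algebra_simps)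
      \<comment> \<open>Both powers at the parent are bounded by the sum over its children, so that
        \<open>W K z + w z\<close>, the square function of the next level, factors out.\<close>
      also have "\<dots> \<le> C * (\<Sum>z<2^K. (W K z + w z) * (Y (Suc K) (2 * z) ^ (r - 1) + Y (Suc K) (2 * z + 1) ^ (r - 1)))"
      proof (intro mult_left_mono sum_mono)
        fix z
        have "0 \<le> (Y K z + w z) ^ (r - 1)" using Y0 w0 by (intro zero_le_power) auto
        then have "(Y K z + w z) ^ (r - 1) \<le> Y (Suc K) (2 * z) ^ (r - 1) + Y (Suc K) (2 * z + 1) ^ (r - 1)"
          using sub[of z] by linarith
        then show "W K z * (2 * Y K z ^ (r - 1)) + w z * (Y K z + w z) ^ (r - 1) \<le>
          (W K z + w z) * (Y (Suc K) (2 * z) ^ (r - 1) + Y (Suc K) (2 * z + 1) ^ (r - 1))"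
          unfolding distrib_right[of "W K z"] using sub' W0 w0 by (intro add_mono mult_left_mono) auto
      qed (use C in auto)
      also have "(\<Sum>z<2^K. (W K z + w z) * (Y (Suc K) (2 * z) ^ (r - 1) + Y (Suc K) (2 * z + 1) ^ (r - 1))) =
         (\<Sum>z<2^Suc K. W (Suc K) z * Y (Suc K) z ^ (r - 1))"
        unfolding power_Suc sum_lessThan_double
        by (intro sum.cong refl) (simp add: W_def dyadic_sq_Suc w_def algebra_simps)
      finally show ?case .
    qed
    \<comment> \<open>Young's inequality by cases: where \<open>Y \<le> 2 * C * W\<close>, the
      remaining power of \<open>Y\<close> is replaced by one of \<open>W\<close>; elsewhere the
      product is at most half of \<open>Y ^ r\<close> and can be absorbed.\<close>
    also have "C * (\<Sum>z<2^K. W K z * Y K z ^ (r - 1)) \<le>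
        (\<Sum>z<2^K. Y K z ^ r / 2 + C * (2 * C) ^ (r - 1) * W K z ^ r)"
      unfolding sum_distrib_left
    proof (rule sum_mono)
      fix z
      have rr: "x * x ^ (r - 1) = x ^ r" for x :: real using r by (cases r) auto
      show "C * (W K z * Y K z ^ (r - 1)) \<le> Y K z ^ r / 2 + C * (2 * C) ^ (r - 1) * W K z ^ r"
      proof (cases "Y K z \<le> 2 * C * W K z")
        case True
        then have "Y K z ^ (r - 1) \<le> (2 * C * W K z) ^ (r - 1)" using Y0 by (intro power_mono) auto
        then have "C * (W K z * Y K z ^ (r - 1)) \<le> C * (W K z * (2 * C * W K z) ^ (r - 1))"
          using C W0 by (intro mult_left_mono) auto
        also have "\<dots> = C * (2 * C) ^ (r - 1) * W K z ^ r"
          by (simp add: power_mult_distrib flip: rr[of "W K z"])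
        finally show ?thesis using Y0[of K z] by (simp add: add_increasing)
      next
        case False
        then have "(2 * C * W K z) * Y K z ^ (r - 1) \<le> Y K z * Y K z ^ (r - 1)"
          using Y0 by (intro mult_right_mono) auto
        then have "C * (W K z * Y K z ^ (r - 1)) \<le> Y K z ^ r / 2" unfolding rr by (simp add: field_simps)
        moreover have "0 \<le> C * (2 * C) ^ (r - 1) * W K z ^ r" using C W0 by auto
        ultimately show ?thesis by simp
      qed
    qed
    also have "\<dots> = (\<Sum>z<2^K. Y K z ^ r) / 2 + C * (2 * C) ^ (r - 1) * (\<Sum>z<2^K. W K z ^ r)"
      by (simp add: sum.distrib sum_divide_distrib sum_distrib_left)
    finally have "(\<Sum>z<2^K. Y K z ^ r) \<le> C' * (\<Sum>z<2^K. W K z ^ r)" by (simp add: C'_def field_simps)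
    then show ?thesis by (simp add: Y_def W_def)
  qed
  moreover have "C' \<ge> 0" using C by (simp add: C'_def)
  ultimately show ?thesis by blast
qed

text \<open>Expanding the squares leaves the pairs that lie in a common fibre. The index set
  \<open>T\<close> thus disappears from the formula.\<close>

lemma sum_squares_over_fibres:
  fixes h :: "'k \<Rightarrow> real"
  assumes "finite T" "finite A" "f ` A \<subseteq> T"
  shows "(\<Sum>\<tau>\<in>T. (\<Sum>\<kappa>\<in>A. if f \<kappa> = \<tau> then h \<kappa> else 0)\<^sup>2) =
    (\<Sum>\<kappa>\<in>A. \<Sum>\<kappa>'\<in>A. if f \<kappa> = f \<kappa>' then h \<kappa> * h \<kappa>' else 0)"
proof -
  have "(\<Sum>\<tau>\<in>T. (\<Sum>\<kappa>\<in>A. if f \<kappa> = \<tau> then h \<kappa> else 0)\<^sup>2) =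
    (\<Sum>\<tau>\<in>T. \<Sum>\<kappa>\<in>A. \<Sum>\<kappa>'\<in>A. if \<tau> = f \<kappa> then (if f \<kappa> = f \<kappa>' then h \<kappa> * h \<kappa>' else 0) else 0)"
    unfolding power2_eq_square sum_product by (intro sum.cong refl) auto
  also have "\<dots> = (\<Sum>\<kappa>\<in>A. \<Sum>\<kappa>'\<in>A. \<Sum>\<tau>\<in>T. if \<tau> = f \<kappa> then (if f \<kappa> = f \<kappa>' then h \<kappa> * h \<kappa>' else 0) else 0)"
    by (subst sum.swap, intro sum.cong refl, subst sum.swap) simp
  also have "\<dots> = (\<Sum>\<kappa>\<in>A. \<Sum>\<kappa>'\<in>A. if f \<kappa> = f \<kappa>' then h \<kappa> * h \<kappa>' else 0)"
    using assms by (intro sum.cong refl) (auto simp: sum.delta)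
  finally show ?thesis .
qed

section \<open>Haar sums in several coordinates on a dyadic grid\<close>

definition dgrid :: "nat \<Rightarrow> ('n::finite \<Rightarrow> nat) set" where
  "dgrid K = {z. \<forall>j. z j < 2 ^ K}"

lemma dgrid_PiE: "dgrid K = PiE UNIV (\<lambda>_. {..<2^K})"
  by (auto simp: dgrid_def PiE_def Pi_def extensional_def)

lemma finite_dgrid[simp]: "finite (dgrid K)"
  unfolding dgrid_PiE by (intro finite_PiE) auto

lemma sum_dgrid_average:
  fixes F :: "('n::finite \<Rightarrow> nat) \<Rightarrow> real"
  shows "(\<Sum>z\<in>dgrid K. \<Sum>y<2^K. F (z(j := y))) = 2 ^ K * (\<Sum>z\<in>dgrid K. F z)"
proof -
  have "(\<Sum>z\<in>dgrid K. \<Sum>y<2^K. F (z(j := y))) = (\<Sum>(z, y)\<in>dgrid K \<times> {..<(2::nat)^K}. F (z(j := y)))"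
    by (rule sum.cartesian_product)
  \<comment> \<open>Exchanging the coordinate \<open>z j\<close> with \<open>y\<close> is an
    involution of the pairs.\<close>
  also have "\<dots> = (\<Sum>(z, y)\<in>dgrid K \<times> {..<(2::nat)^K}. F z)"
    by (rule sum.reindex_bij_witness[of _ "\<lambda>(z, y). (z(j := y), z j)" "\<lambda>(z, y). (z(j := y), z j)"])
      (auto simp: dgrid_def)
  also have "\<dots> = (\<Sum>z\<in>dgrid K. \<Sum>y<(2::nat)^K. F z)" by (rule sum.cartesian_product[symmetric])
  also have "\<dots> = 2 ^ K * (\<Sum>z\<in>dgrid K. F z)" by (simp add: sum_distrib_left)
  finally show ?thesis .
qed

text \<open>The value, on the cell with index \<open>z\<close> of the finest grid, of the part of scale \<open>\<kappa>\<close> of a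
  sum of product Haar functions with coefficients \<open>b \<kappa> \<nu>\<close>.\<close>

definition haar_layer :: "nat \<Rightarrow> (('n::finite \<Rightarrow> nat) \<Rightarrow> ('n \<Rightarrow> nat) \<Rightarrow> real) \<Rightarrow> ('n \<Rightarrow> nat) \<Rightarrow>
    ('n \<Rightarrow> nat) \<Rightarrow> real" where
  "haar_layer K b \<kappa> z = b \<kappa> (\<lambda>j. z j div 2 ^ (K - \<kappa> j)) * (\<Prod>j\<in>UNIV. rad (z j div 2 ^ (K - Suc (\<kappa> j))))"

text \<open>For \<open>S = {}\<close> this is the square of the sum of all layers, for
  \<open>S = UNIV\<close> the sum of their squares. The square function inequality moves the
  coordinates into \<open>S\<close> one at a time.\<close>

definition agree_form :: "nat \<Rightarrow> (('n::finite \<Rightarrow> nat) \<Rightarrow> ('n \<Rightarrow> nat) \<Rightarrow> real) \<Rightarrow> ('n \<Rightarrow> nat) set \<Rightarrow>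
    'n set \<Rightarrow> ('n \<Rightarrow> nat) \<Rightarrow> real" where
  "agree_form K b A S z = (\<Sum>\<kappa>\<in>A. \<Sum>\<kappa>'\<in>A. if \<forall>j\<in>S. \<kappa> j = \<kappa>' j then haar_layer K b \<kappa> z * haar_layer K b \<kappa>' z else 0)"

text \<open>On a line in direction \<open>j\<close> the scales are grouped by their values on
  \<open>S\<close>. Each group sums to a dyadic martingale whose differences are indexed by
  \<open>\<kappa> j\<close>; the squared norm of the vector of these martingales is the form for
  \<open>S\<close>, its square function is the form for \<open>insert j S\<close>. Having the
  one-parameter inequality for vectors is what makes the iteration possible.\<close>

lemma agree_form_insert:
  assumes r: "1 \<le> r"
  shows "\<exists>C\<ge>0. \<forall>K b A S (j::'n::finite). finite A \<longrightarrow> (\<forall>\<kappa>\<in>A. \<forall>j. \<kappa> j < K) \<longrightarrow> j \<notin> S \<longrightarrow>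
    (\<Sum>z\<in>dgrid K. agree_form K b A S z ^ r) \<le> C * (\<Sum>z\<in>dgrid K. agree_form K b A (insert j S) z ^ r)"
proof -
  obtain C where C: "C \<ge> 0" and sq: "\<And>K T v. finite (T :: ('n \<Rightarrow> nat) set) \<Longrightarrow>
    (\<Sum>z<2^K. (\<Sum>\<tau>\<in>T. (dyadic_mart v K z \<tau>)\<^sup>2) ^ r) \<le> C * (\<Sum>z<2^K. (dyadic_sq T v K z) ^ r)"
    using dyadic_square_function[OF r] by blast
  have "(\<Sum>z\<in>dgrid K. agree_form K b A S z ^ r) \<le> C * (\<Sum>z\<in>dgrid K. agree_form K b A (insert j S) z ^ r)"
    if A0: "finite A" "\<forall>\<kappa>\<in>A. \<forall>j. \<kappa> j < K" and jS: "j \<notin> S" for K b A S and j :: 'n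
  proof -
    have A: "finite A" "\<And>\<kappa> j. \<kappa> \<in> A \<Longrightarrow> \<kappa> j < K" using A0 by auto
    have slice: "(\<Sum>y<2^K. agree_form K b A S (z(j := y)) ^ r) \<le>
        C * (\<Sum>y<2^K. agree_form K b A (insert j S) (z(j := y)) ^ r)" for z
    proof -
      define T where "T = (\<lambda>\<kappa>. restrict \<kappa> S) ` A"
      have T: "finite T" using A by (simp add: T_def)
      define h where "h \<kappa> y = haar_layer K b \<kappa> (z(j := y))" for \<kappa> y
      \<comment> \<open>\<open>u\<close> is the layer stripped of its sign in direction
        \<open>j\<close>, as a function of the leading bits \<open>p\<close> of that coordinate. It
        depends only on bits preceding the sign, as a martingale difference must.\<close>
      define u where "u i p \<kappa> = b \<kappa> ((\<lambda>j'. z j' div 2 ^ (K - \<kappa> j'))(j := p)) *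
           (\<Prod>j'\<in>UNIV-{j}. rad (z j' div 2 ^ (K - Suc (\<kappa> j'))))" for i :: nat and p \<kappa>
      define v where "v i p \<tau> = (\<Sum>\<kappa>\<in>A. if restrict \<kappa> S = \<tau> \<and> \<kappa> j = i then u i p \<kappa> else 0)" for i p \<tau>
      have h_eq: "h \<kappa> y = rad (y div 2 ^ (K - Suc (\<kappa> j))) * u (\<kappa> j) (y div 2 ^ (K - \<kappa> j)) \<kappa>" for \<kappa> y
      proof -
        have "(\<lambda>j'. (z(j := y)) j' div 2 ^ (K - \<kappa> j')) = (\<lambda>j'. z j' div 2 ^ (K - \<kappa> j'))(j := y div 2 ^ (K - \<kappa> j))"
          by auto
        moreover have "(\<Prod>j'\<in>UNIV. rad ((z(j := y)) j' div 2 ^ (K - Suc (\<kappa> j')))) =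
           rad (y div 2 ^ (K - Suc (\<kappa> j))) * (\<Prod>j'\<in>UNIV-{j}. rad (z j' div 2 ^ (K - Suc (\<kappa> j'))))"
          by (subst prod.remove[of _ j]) (auto intro!: prod.cong)
        ultimately show ?thesis by (simp add: h_def haar_layer_def u_def)
      qed
      have rv: "rad (y div 2 ^ (K - Suc i)) * v i (y div 2 ^ (K - i)) \<tau> =
          (\<Sum>\<kappa>\<in>A. if (restrict \<kappa> S, \<kappa> j) = (\<tau>, i) then h \<kappa> y else 0)" for y i \<tau>
        unfolding v_def sum_distrib_left by (intro sum.cong refl) (auto simp: h_eq)
      have mart: "dyadic_mart v K y \<tau> = (\<Sum>\<kappa>\<in>A. if restrict \<kappa> S = \<tau> then h \<kappa> y else 0)" for y \<tau>
      proof -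
        have "dyadic_mart v K y \<tau> = (\<Sum>\<kappa>\<in>A. \<Sum>i<K. if i = \<kappa> j then (if restrict \<kappa> S = \<tau> then h \<kappa> y else 0) else 0)"
          unfolding dyadic_mart_def rv by (subst sum.swap) (intro sum.cong refl, auto)
        also have "\<dots> = (\<Sum>\<kappa>\<in>A. if restrict \<kappa> S = \<tau> then h \<kappa> y else 0)"
          using A by (intro sum.cong refl) (auto simp: sum.delta)
        finally show ?thesis .
      qed
      have res: "restrict \<kappa> S = restrict \<kappa>' S \<longleftrightarrow> (\<forall>j\<in>S. \<kappa> j = \<kappa>' j)" for \<kappa> \<kappa>' :: "'n \<Rightarrow> nat"
        by (auto simp: restrict_def fun_eq_iff)
      have 1: "(\<Sum>\<tau>\<in>T. (dyadic_mart v K y \<tau>)\<^sup>2) = agree_form K b A S (z(j := y))" for y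
        unfolding mart
        by (subst sum_squares_over_fibres[OF T A(1)]) (auto simp: T_def agree_form_def res h_def intro!: sum.cong)
      have 2: "dyadic_sq T v K y = agree_form K b A (insert j S) (z(j := y))" for y
      proof -
        have "dyadic_sq T v K y = (\<Sum>i<K. \<Sum>\<tau>\<in>T. (rad (y div 2 ^ (K - Suc i)) * v i (y div 2 ^ (K - i)) \<tau>)\<^sup>2)"
          by (simp add: dyadic_sq_def power_mult_distrib)
        also have "\<dots> = (\<Sum>\<tau>\<in>T. \<Sum>i<K. (\<Sum>\<kappa>\<in>A. if (restrict \<kappa> S, \<kappa> j) = (\<tau>, i) then h \<kappa> y else 0)\<^sup>2)"
          unfolding rv by (rule sum.swap)
        also have "\<dots> = (\<Sum>\<sigma>\<in>T \<times> {..<K}. (\<Sum>\<kappa>\<in>A. if (restrict \<kappa> S, \<kappa> j) = \<sigma> then h \<kappa> y else 0)\<^sup>2)"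
          by (simp add: sum.cartesian_product case_prod_beta prod_eq_iff)
        also have "\<dots> = (\<Sum>\<kappa>\<in>A. \<Sum>\<kappa>'\<in>A. if (restrict \<kappa> S, \<kappa> j) = (restrict \<kappa>' S, \<kappa>' j) then h \<kappa> y * h \<kappa>' y else 0)"
          using T A by (intro sum_squares_over_fibres) (auto simp: T_def)
        also have "\<dots> = agree_form K b A (insert j S) (z(j := y))"
          unfolding agree_form_def h_def prod.inject res by (intro sum.cong refl) auto
        finally show ?thesis .
      qed
      show ?thesis using sq[OF T, of v K] unfolding 1 2 .
    qed
    have "2 ^ K * (\<Sum>z\<in>dgrid K. agree_form K b A S z ^ r) =
        (\<Sum>z\<in>dgrid K. \<Sum>y<2^K. agree_form K b A S (z(j := y)) ^ r)"
      by (rule sum_dgrid_average[symmetric])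
    also have "\<dots> \<le> (\<Sum>z\<in>dgrid K. C * (\<Sum>y<2^K. agree_form K b A (insert j S) (z(j := y)) ^ r))"
      by (intro sum_mono slice)
    also have "\<dots> = 2 ^ K * (C * (\<Sum>z\<in>dgrid K. agree_form K b A (insert j S) z ^ r))"
      by (simp add: sum_dgrid_average[of "\<lambda>z. agree_form K b A (insert j S) z ^ r"] sum_distrib_left[symmetric])
    finally show ?thesis by simp
  qed
  with C show ?thesis by blast
qed

lemma haar_square_function:
  assumes r: "1 \<le> r"
  shows "\<exists>C\<ge>0. \<forall>K b (A :: ('n::finite \<Rightarrow> nat) set). finite A \<longrightarrow> (\<forall>\<kappa>\<in>A. \<forall>j. \<kappa> j < K) \<longrightarrow>
    (\<Sum>z\<in>dgrid K. (\<Sum>\<kappa>\<in>A. haar_layer K b \<kappa> z) ^ (2 * r)) \<le>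
    C * (\<Sum>z\<in>dgrid K. (\<Sum>\<kappa>\<in>A. (haar_layer K b \<kappa> z)\<^sup>2) ^ r)"
proof -
  obtain C where C: "C \<ge> 0" and step: "\<And>K b A S (j::'n). finite A \<Longrightarrow> (\<forall>\<kappa>\<in>A. \<forall>j. \<kappa> j < K) \<Longrightarrow> j \<notin> S \<Longrightarrow>
    (\<Sum>z\<in>dgrid K. agree_form K b A S z ^ r) \<le> C * (\<Sum>z\<in>dgrid K. agree_form K b A (insert j S) z ^ r)"
    using agree_form_insert[OF r, where ?'n = 'n] by blast
  have "(\<Sum>z\<in>dgrid K. (\<Sum>\<kappa>\<in>A. haar_layer K b \<kappa> z) ^ (2 * r)) \<le>
    C ^ CARD('n) * (\<Sum>z\<in>dgrid K. (\<Sum>\<kappa>\<in>A. (haar_layer K b \<kappa> z)\<^sup>2) ^ r)"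
    if A: "finite A" "\<forall>\<kappa>\<in>A. \<forall>j. \<kappa> j < K" for K b and A :: "('n \<Rightarrow> nat) set"
  proof -
    have ind: "(\<Sum>z\<in>dgrid K. agree_form K b A {} z ^ r) \<le> C ^ card S * (\<Sum>z\<in>dgrid K. agree_form K b A S z ^ r)"
      if "finite S" for S :: "'n set"
      using that
    proof (induction S rule: finite_induct)
      case empty
      then show ?case by simp
    next
      case (insert j S)
      note insert.IH
      also have "C ^ card S * (\<Sum>z\<in>dgrid K. agree_form K b A S z ^ r) \<le>
         C ^ card S * (C * (\<Sum>z\<in>dgrid K. agree_form K b A (insert j S) z ^ r))"
        using C step[OF A insert.hyps(2)] by (intro mult_left_mono) auto
      finally show ?case using insert.hyps by (simp add: mult_ac)
    qed
    have "agree_form K b A {} z = (\<Sum>\<kappa>\<in>A. haar_layer K b \<kappa> z)\<^sup>2" for z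
      by (simp add: agree_form_def power2_eq_square sum_product)
    moreover have "agree_form K b A UNIV z = (\<Sum>\<kappa>\<in>A. (haar_layer K b \<kappa> z)\<^sup>2)" for z
    proof -
      have "agree_form K b A UNIV z = (\<Sum>\<kappa>\<in>A. \<Sum>\<kappa>'\<in>A. if \<kappa>' = \<kappa> then haar_layer K b \<kappa> z * haar_layer K b \<kappa>' z else 0)"
        unfolding agree_form_def by (intro sum.cong refl) (auto simp: fun_eq_iff)
      also have "\<dots> = (\<Sum>\<kappa>\<in>A. (haar_layer K b \<kappa> z)\<^sup>2)"
        using A by (intro sum.cong refl) (auto simp: sum.delta power2_eq_square)
      finally show ?thesis .
    qed
    ultimately show ?thesis using ind[of UNIV] by (simp add: power_mult)
  qed
  then show ?thesis using C by (intro exI[of _ "C ^ CARD('n)"]) auto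
qed

section \<open>Haar functions\<close>

definition haar :: "real \<Rightarrow> real" where
  "haar t = (if 0 \<le> t \<and> t < 1/2 then 1 else if 1/2 \<le> t \<and> t < 1 then -1 else 0)"

lemma measurable_haar [measurable]: "haar \<in> borel_measurable borel"
  unfolding haar_def[abs_def] by measurable

text \<open>The integer part of \<open>t\<close> selects the cell, and the next binary digit selects
  the half of it.\<close>

lemma haar_dyadic:
  assumes "0 \<le> t"
  shows "haar (t - real \<nu>) = (if nat \<lfloor>t\<rfloor> = \<nu> then rad (nat \<lfloor>2 * t\<rfloor>) else 0)"
proof -
  define n where "n = nat \<lfloor>t\<rfloor>"
  have n: "real n \<le> t" "t < real n + 1"
    using assms unfolding n_def by (simp_all add: of_nat_nat)
  show ?thesis
  proof (cases "n = \<nu>")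
    case True
    show ?thesis
    proof (cases "t - real n < 1/2")
      case True
      have "\<lfloor>2 * t\<rfloor> = int (2 * n)" by (rule floor_unique) (use n True in auto)
      then show ?thesis using True n \<open>n = \<nu>\<close> by (simp add: haar_def rad_def n_def[symmetric] nat_mult_distrib)
    next
      case False
      have "\<lfloor>2 * t\<rfloor> = int (2 * n + 1)" by (rule floor_unique) (use n False in auto)
      then have "nat \<lfloor>2 * t\<rfloor> = 2 * n + 1" by simp
      then show ?thesis using False n \<open>n = \<nu>\<close> by (simp add: haar_def rad_def n_def[symmetric])
    qed
  next
    case False
    then have "real n + 1 \<le> real \<nu> \<or> real \<nu> + 1 \<le> real n" by linarith
    then have "t - real \<nu> < 0 \<or> 1 \<le> t - real \<nu>" using n by linarith
    then show ?thesis using False by (auto simp: haar_def n_def[symmetric])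
  qed
qed

lemma integral_deriv_vanishing:
  fixes G w :: "real \<Rightarrow> real"
  assumes G: "\<And>t. (G has_real_derivative w t) (at t)" and w: "continuous_on UNIV w" and "a \<le> b"
  shows "(\<integral>t. w t * indicator {a..b} t \<partial>lborel) = G b - G a"
    and "integrable lborel (\<lambda>t. w t * indicator {a..b} t)"
proof -
  show "(\<integral>t. w t * indicator {a..b} t \<partial>lborel) = G b - G a"
    using integral_FTC_Icc_real[of a b G w] assms continuous_on_eq_continuous_at[of UNIV w] by auto
  have "set_integrable lborel {a..b} w"
    by (intro borel_integrable_atLeastAtMost' continuous_on_subset[OF w]) auto
  then show "integrable lborel (\<lambda>t. w t * indicator {a..b} t)"
    by (simp add: set_integrable_def mult.commute)
qed

lemma integral_mult_haar:
  fixes G w :: "real \<Rightarrow> real"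
  assumes G: "\<And>t. (G has_real_derivative w t) (at t)" and w: "continuous_on UNIV w"
    and van: "\<And>t. t \<le> 0 \<or> 1 \<le> t \<Longrightarrow> G t = 0" "\<And>t. t \<le> 0 \<or> 1 \<le> t \<Longrightarrow> w t = 0"
  shows "(\<integral>t. w t * haar t \<partial>lborel) = 2 * G (1/2)" "(\<integral>t. w t \<partial>lborel) = 0"
proof -
  have [measurable]: "w \<in> borel_measurable borel"
    using w by (simp add: borel_measurable_continuous_onI)
  have wnz: "0 < t \<and> t < 1" if "w t \<noteq> 0" for t using van(2)[of t] that by linarith
  have "(\<integral>t. w t * haar t \<partial>lborel) = (\<integral>t. w t * indicator {0..1/2} t - w t * indicator {1/2..1} t \<partial>lborel)"
  proof (rule integral_cong_AE)
    show "AE t in lborel. w t * haar t = w t * indicator {0..1/2} t - w t * indicator {1/2..1} t"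
      using AE_lborel_singleton[of "1/2::real"]
      by eventually_elim (auto simp: haar_def indicator_def dest: wnz)
  qed auto
  also have "\<dots> = G (1/2) - G 0 - (G 1 - G (1/2))"
    by (subst Bochner_Integration.integral_diff) (use integral_deriv_vanishing[OF G w] in auto)
  finally show "(\<integral>t. w t * haar t \<partial>lborel) = 2 * G (1/2)" using van by simp
  have "(\<integral>t. w t \<partial>lborel) = (\<integral>t. w t * indicator {0..1} t \<partial>lborel)"
    by (intro Bochner_Integration.integral_cong refl) (auto simp: indicator_def dest: wnz)
  also have "\<dots> = 0" using integral_deriv_vanishing(1)[OF G w, of 0 1] van by simp
  finally show "(\<integral>t. w t \<partial>lborel) = 0" .
qed

text \<open>A Haar function of strictly coarser scale is constant on the support of \<open>w\<close>.\<close>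

lemma integral_wavelet_haar:
  fixes G w :: "real \<Rightarrow> real"
  assumes G: "\<And>t. (G has_real_derivative w t) (at t)" and w: "continuous_on UNIV w"
    and van: "\<And>t. t \<le> 0 \<or> 1 \<le> t \<Longrightarrow> G t = 0" "\<And>t. t \<le> 0 \<or> 1 \<le> t \<Longrightarrow> w t = 0"
    and \<rho>: "0 < \<rho>" and ii: "i' \<le> i"
  shows "(\<integral>x. w (2 ^ i / \<rho> * (x - e) - real \<nu>) * haar (2 ^ i' / \<rho> * (x - e) - real \<nu>') \<partial>lborel) =
    (if i = i' \<and> \<nu> = \<nu>' then 2 * G (1/2) * (\<rho> / 2 ^ i) else 0)"
proof -
  define d where "d = i - i'"
  have i: "i = i' + d" using ii by (simp add: d_def)
  have "(\<integral>x. w (2 ^ i / \<rho> * (x - e) - real \<nu>) * haar (2 ^ i' / \<rho> * (x - e) - real \<nu>') \<partial>lborel) =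
    \<bar>\<rho> / 2 ^ i\<bar> *\<^sub>R (\<integral>t. w (2 ^ i / \<rho> * (e + real \<nu> * \<rho> / 2 ^ i + \<rho> / 2 ^ i * t - e) - real \<nu>) *
       haar (2 ^ i' / \<rho> * (e + real \<nu> * \<rho> / 2 ^ i + \<rho> / 2 ^ i * t - e) - real \<nu>') \<partial>lborel)"
    using \<rho> by (intro lborel_integral_real_affine) auto
  \<comment> \<open>The substitution moves the support of the bump to the unit interval; the Haar
    factor then varies \<open>2 ^ d\<close> times more slowly.\<close>
  also have "\<dots> = (\<rho> / 2 ^ i) * (\<integral>t. w t * haar ((t + real \<nu>) / 2 ^ d - real \<nu>') \<partial>lborel)"
  proof -
    have "2 ^ i / \<rho> * (e + real \<nu> * \<rho> / 2 ^ i + \<rho> / 2 ^ i * t - e) - real \<nu> = t" for t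
      using \<rho> by (simp add: field_simps)
    moreover have "2 ^ i' / \<rho> * (e + real \<nu> * \<rho> / 2 ^ i + \<rho> / 2 ^ i * t - e) - real \<nu>' =
      (t + real \<nu>) / 2 ^ d - real \<nu>'" for t
      using \<rho> by (simp add: field_simps i power_add)
    ultimately show ?thesis using \<rho> by simp
  qed
  also have "(\<integral>t. w t * haar ((t + real \<nu>) / 2 ^ d - real \<nu>') \<partial>lborel) =
     (if i = i' \<and> \<nu> = \<nu>' then 2 * G (1/2) else 0)"
  proof (cases "d = 0")
    case True
    show ?thesis
    proof (cases "\<nu> = \<nu>'")
      case True
      then show ?thesis using \<open>d = 0\<close> i integral_mult_haar(1)[OF G w van] by simp
    next
      case False
      have "w t * haar (t + real \<nu> - real \<nu>') = 0" for t
      proof (cases "0 < t \<and> t < 1")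
        case True
        from False have "real \<nu> + 1 \<le> real \<nu>' \<or> real \<nu>' + 1 \<le> real \<nu>" by linarith
        then show ?thesis using True by (auto simp: haar_def)
      next
        case False
        then show ?thesis using van by auto
      qed
      then have "(\<lambda>t. w t * haar (t + real \<nu> - real \<nu>')) = (\<lambda>_. 0)" by blast
      then show ?thesis using \<open>d = 0\<close> False by simp
    qed
  next
    case False
    then obtain d' where d': "d = Suc d'" by (cases d) auto
    \<comment> \<open>For \<open>d > 0\<close> the integer parts of
      \<open>(t + \<nu>) / 2 ^ d\<close> and of its double do not depend on \<open>t\<close> in the
      open unit interval, so the Haar factor is constant there and the mean of \<open>w\<close>
      decides.\<close>
    have "w t * haar ((t + real \<nu>) / 2 ^ d - real \<nu>') =
      w t * (if \<nu> div 2 ^ d = \<nu>' then rad (\<nu> div 2 ^ d') else 0)" for t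
    proof (cases "0 < t \<and> t < 1")
      case True
      have fl: "nat \<lfloor>(t + real \<nu>) / 2 ^ k\<rfloor> = \<nu> div 2 ^ k" for k
      proof -
        have "\<lfloor>(t + real \<nu>) / 2 ^ k\<rfloor> = \<lfloor>t + real \<nu>\<rfloor> div 2 ^ k"
          using floor_divide_real_eq_div[of "2 ^ k" "t + real \<nu>"] by simp
        also have "\<lfloor>t + real \<nu>\<rfloor> = int \<nu>" by (rule floor_unique) (use True in auto)
        finally show ?thesis by (metis nat_int of_nat_numeral of_nat_power zdiv_int)
      qed
      have "2 * ((t + real \<nu>) / 2 ^ d) = (t + real \<nu>) / 2 ^ d'" by (simp add: d' field_simps)
      then show ?thesis using haar_dyadic[of "(t + real \<nu>) / 2 ^ d" \<nu>'] True fl[of d] fl[of d'] by simp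
    next
      case False
      then show ?thesis using van by auto
    qed
    then have "(\<lambda>t. w t * haar ((t + real \<nu>) / 2 ^ d - real \<nu>')) =
      (\<lambda>t. w t * (if \<nu> div 2 ^ d = \<nu>' then rad (\<nu> div 2 ^ d') else 0))" by blast
    then show ?thesis using integral_mult_haar(2)[OF G w van] i False by simp
  qed
  finally show ?thesis by simp
qed

section \<open>Integrals of products over the coordinates\<close>

lemma Basis_cart_eq: "(Basis :: (real^'n) set) = range (\<lambda>j. axis j 1)"
  by (auto simp: Basis_vec_def)

lemma inj_axis: "inj (\<lambda>j. axis j 1 :: real^'n::finite)"
  by (auto simp: inj_on_def axis_eq_axis)

lemma prod_Basis_cart:
  fixes f :: "real^'n::finite \<Rightarrow> 'a::comm_monoid_mult"
  shows "(\<Prod>b\<in>Basis. f b) = (\<Prod>j\<in>UNIV. f (axis j 1))"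
  unfolding Basis_cart_eq by (subst prod.reindex[OF inj_axis]) simp

lemma nn_integral_cart_prod:
  fixes f :: "'n::finite \<Rightarrow> real \<Rightarrow> ennreal"
  assumes [measurable]: "\<And>j. f j \<in> borel_measurable borel"
  shows "(\<integral>\<^sup>+x. (\<Prod>j\<in>UNIV. f j (x $ j)) \<partial>(lborel :: (real^'n) measure)) = (\<Prod>j\<in>UNIV. (\<integral>\<^sup>+t. f j t \<partial>lborel))"
proof -
  define g where "g b = f (the_inv (\<lambda>j. axis j 1 :: real^'n) b)" for b
  have g: "g (axis j 1) = f j" for j by (simp add: g_def the_inv_f_f[OF inj_axis])
  have "(\<integral>\<^sup>+x. (\<Prod>b\<in>Basis. g b (x \<bullet> b)) \<partial>(lborel :: (real^'n) measure)) = (\<Prod>b\<in>Basis. (\<integral>\<^sup>+t. g b t \<partial>lborel))"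
    by (rule nn_integral_lborel_prod) (auto simp: g_def)
  then show ?thesis by (simp add: prod_Basis_cart g inner_axis)
qed

lemma integral_cart_prod:
  fixes f :: "'n::finite \<Rightarrow> real \<Rightarrow> real"
  assumes f: "\<And>j. integrable lborel (f j)"
  shows "(\<integral>x. (\<Prod>j\<in>UNIV. f j (x $ j)) \<partial>(lborel :: (real^'n) measure)) = (\<Prod>j\<in>UNIV. (\<integral>t. f j t \<partial>lborel))"
    and "integrable (lborel :: (real^'n) measure) (\<lambda>x. \<Prod>j\<in>UNIV. f j (x $ j))"
proof -
  interpret product_sigma_finite "\<lambda>_::real^'n. lborel :: real measure" ..
  define g where "g b = f (the_inv (\<lambda>j. axis j 1 :: real^'n) b)" for b
  have g: "g (axis j 1) = f j" for j by (simp add: g_def the_inv_f_f[OF inj_axis])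
  have int_g: "integrable lborel (g b)" for b by (simp add: g_def f)
  have [measurable]: "g b \<in> borel_measurable borel" "f j \<in> borel_measurable borel" for b j
    using int_g[of b] f[of j] by auto
  have eq: "(\<Prod>j\<in>UNIV. f j ((\<Sum>b\<in>Basis. y b *\<^sub>R b) $ j)) = (\<Prod>b\<in>Basis. g b (y b))" for y :: "real^'n \<Rightarrow> real"
    by (subst prod_Basis_cart) (simp add: g cart_eq_inner_axis inner_sum_left inner_Basis if_distrib
        sum.delta axis_in_Basis_iff cong: if_cong)
  have m: "(\<lambda>x. \<Prod>j\<in>UNIV. f j (x $ j)) \<in> borel_measurable (borel :: (real^'n) measure)"
    by measurable
  have m2: "(\<lambda>y. \<Sum>b\<in>Basis. y b *\<^sub>R b) \<in> measurable (\<Pi>\<^sub>M b\<in>(Basis::(real^'n) set). lborel) borel"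
    by measurable
  show "(\<integral>x. (\<Prod>j\<in>UNIV. f j (x $ j)) \<partial>(lborel :: (real^'n) measure)) = (\<Prod>j\<in>UNIV. (\<integral>t. f j t \<partial>lborel))"
    by (subst lborel_eq, subst integral_distr[OF m2 m], unfold eq,
        subst product_integral_prod) (auto simp: prod_Basis_cart g int_g)
  show "integrable (lborel :: (real^'n) measure) (\<lambda>x. \<Prod>j\<in>UNIV. f j (x $ j))"
    by (subst lborel_eq, subst integrable_distr_eq[OF m2 m], unfold eq,
        rule product_integrable_prod) (auto simp: int_g)
qed

lemma nn_integral_unit_interval_affine:
  assumes "0 < \<beta>"
  shows "(\<integral>\<^sup>+x. indicator {0..<1} (\<beta> * (x - e) - s :: real) \<partial>lborel) = ennreal (1 / \<beta>)"
proof -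
  have "(\<integral>\<^sup>+x. indicator {0..<1} (\<beta> * (x - e) - s) \<partial>lborel) =
      (\<integral>\<^sup>+x. indicator {e + s / \<beta>..<e + s / \<beta> + 1 / \<beta>} x \<partial>lborel)"
    by (intro nn_integral_cong) (use assms in \<open>auto simp: indicator_def field_simps\<close>)
  also have "\<dots> = ennreal (1 / \<beta>)" using assms by simp
  finally show ?thesis .
qed

lemma nn_integral_cell:
  fixes \<beta> :: "'n::finite \<Rightarrow> real"
  assumes "\<And>j. 0 < \<beta> j"
  shows "(\<integral>\<^sup>+x. ennreal (\<Prod>j\<in>UNIV. indicator {0..<1} (\<beta> j * (x $ j - e j) - s j)) \<partial>(lborel :: (real^'n) measure)) =
    ennreal (\<Prod>j\<in>UNIV. 1 / \<beta> j)"
proof -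
  have "(\<integral>\<^sup>+x. ennreal (\<Prod>j\<in>UNIV. indicator {0..<1} (\<beta> j * (x $ j - e j) - s j)) \<partial>(lborel :: (real^'n) measure)) =
    (\<integral>\<^sup>+x. (\<Prod>j\<in>UNIV. indicator {0..<1} (\<beta> j * (x $ j - e j) - s j)) \<partial>(lborel :: (real^'n) measure))"
    by (intro nn_integral_cong) (simp add: prod_ennreal[symmetric] ennreal_indicator)
  also have "\<dots> = (\<Prod>j\<in>UNIV. ennreal (1 / \<beta> j))"
    by (subst nn_integral_cart_prod) (auto simp: nn_integral_unit_interval_affine assms)
  also have "\<dots> = ennreal (\<Prod>j\<in>UNIV. 1 / \<beta> j)"
    by (rule prod_ennreal) (simp add: assms less_imp_le)
  finally show ?thesis .
qed

section \<open>Integration by parts along one axis\<close>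

lemma integrable_continuous_vanishing:
  fixes f :: "'a::euclidean_space \<Rightarrow> real"
  assumes "continuous_on UNIV f" "\<And>x. x \<notin> cbox a b \<Longrightarrow> f x = 0"
  shows "integrable lborel f"
proof -
  have "integrable lborel (\<lambda>x. indicator (cbox a b) x *\<^sub>R f x)"
    by (intro borel_integrable_compact continuous_on_subset[OF assms(1)]) auto
  moreover have "(\<lambda>x. indicator (cbox a b) x *\<^sub>R f x) = f"
    using assms(2) by (auto simp: fun_eq_iff indicator_def)
  ultimately show ?thesis by simp
qed

lemma integral_lborel_shift:
  fixes f :: "'a::euclidean_space \<Rightarrow> real"
  assumes [measurable]: "f \<in> borel_measurable borel"
  shows "(\<integral>x. f (x + c) \<partial>lborel) = (\<integral>x. f x \<partial>lborel)"
proof -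
  have "(\<integral>x. f x \<partial>lborel) = (\<integral>x. f x \<partial>distr lborel borel ((+) c))" by (simp add: lborel_distr_plus)
  also have "\<dots> = (\<integral>x. f (c + x) \<partial>lborel)" by (rule integral_distr) auto
  finally show ?thesis by (simp add: add.commute)
qed

lemma integrable_lborel_shift:
  fixes f :: "'a::euclidean_space \<Rightarrow> real"
  assumes "integrable lborel f"
  shows "integrable lborel (\<lambda>x. f (x + c))"
proof -
  have "integrable (distr lborel borel ((+) c)) f" using assms by (simp add: lborel_distr_plus)
  then have "integrable lborel (\<lambda>x. f (c + x))" by (subst (asm) integrable_distr_eq) (use assms in auto)
  then show ?thesis by (simp add: add.commute)
qed

text \<open>By translation invariance every difference quotient has integral zero, and the quotients
  converge to \<open>w'\<close> under a common integrable bound. This asks for a derivative along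
  the one axis only.\<close>

lemma integral_axis_derivative_eq_0:
  fixes w w' :: "real^'n::finite \<Rightarrow> real"
  assumes der: "\<And>x. ((\<lambda>s. w (x + s *\<^sub>R axis j 1)) has_real_derivative w' x) (at 0)"
    and cont: "continuous_on UNIV w" "continuous_on UNIV w'"
    and van: "\<And>x. x \<notin> cbox a b \<Longrightarrow> w x = 0" "\<And>x. x \<notin> cbox a b \<Longrightarrow> w' x = 0"
  shows "(\<integral>x. w' x \<partial>lborel) = 0"
proof -
  let ?e = "axis j 1 :: real^'n"
  define h where "h n = inverse (real (Suc n))" for n
  have h: "0 < h n" "h n \<le> 1" for n by (auto simp: h_def field_simps)
  define D where "D n x = (w (x + h n *\<^sub>R ?e) - w x) / h n" for n x
  have int_w: "integrable lborel w" and int_w': "integrable lborel w'"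
    using integrable_continuous_vanishing cont van by blast+
  have "bounded (w' ` cbox a b)"
    by (intro compact_imp_bounded compact_continuous_image continuous_on_subset[OF cont(2)]) auto
  then obtain B where B: "B > 0" "\<forall>y\<in>w' ` cbox a b. norm y \<le> B" unfolding bounded_pos by blast
  have Bw: "\<bar>w' x\<bar> \<le> B" for x using B van(2)[of x] by (cases "x \<in> cbox a b") auto
  have der': "((\<lambda>s. w (x + s *\<^sub>R ?e)) has_real_derivative w' (x + s *\<^sub>R ?e)) (at s within UNIV)" for x s
  proof -
    have "((\<lambda>r. w (x + (r + s) *\<^sub>R ?e)) has_real_derivative w' (x + s *\<^sub>R ?e)) (at 0)"
      using der[of "x + s *\<^sub>R ?e"] by (simp add: algebra_simps)
    then show ?thesis using DERIV_shift[of "\<lambda>s. w (x + s *\<^sub>R ?e)" _ 0 s] by simp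
  qed
  have D_le: "\<bar>D n x\<bar> \<le> B" for n x
  proof -
    have "\<bar>w (x + h n *\<^sub>R ?e) - w (x + 0 *\<^sub>R ?e)\<bar> \<le> B * \<bar>h n - 0\<bar>"
      using field_differentiable_bound[OF convex_UNIV der'[of x], of B "h n" 0] Bw by simp
    then show ?thesis using h[of n] by (simp add: D_def abs_divide field_simps)
  qed
  \<comment> \<open>The steps \<open>h n\<close> are at most 1, so the quotients live in the box
    extended by one unit against the axis.\<close>
  have D0: "D n x = 0" if "x \<notin> cbox (a - ?e) b" for n x
  proof -
    have "\<exists>i. \<not> ((a - ?e) $ i \<le> x $ i \<and> x $ i \<le> b $ i)" using that unfolding mem_box_cart by blast
    then obtain i where i: "x $ i < (a - ?e) $ i \<or> b $ i < x $ i" by (metis not_le)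
    have e: "0 \<le> ?e $ i" "?e $ i \<le> 1" by (auto simp: axis_def)
    have he: "0 \<le> h n * ?e $ i" "h n * ?e $ i \<le> ?e $ i"
      using h[of n] e by (auto intro: mult_nonneg_nonneg mult_left_le_one_le)
    have "x \<notin> cbox a b" "x + h n *\<^sub>R ?e \<notin> cbox a b"
      unfolding mem_box_cart using i he e by (auto intro!: exI[of _ i] simp: not_le)
    then show ?thesis using van(1) by (simp add: D_def)
  qed
  have "(\<lambda>n. \<integral>x. D n x \<partial>lborel) \<longlonglongrightarrow> (\<integral>x. w' x \<partial>lborel)"
  proof (rule integral_dominated_convergence[where w = "\<lambda>x. B * indicator (cbox (a - ?e) b) x"])
    show "w' \<in> borel_measurable lborel" using int_w' by auto
    show "D n \<in> borel_measurable lborel" for n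
      unfolding D_def using borel_measurable_integrable[OF integrable_lborel_shift[OF int_w]] int_w by auto
    show "integrable lborel (\<lambda>x. B * indicator (cbox (a - ?e) b) x)"
      by (rule integrable_mult_right, rule integrable_real_indicator) 
        (simp_all add: emeasure_lborel_cbox_finite[unfolded infinity_ennreal_def])
    show "AE x in lborel. norm (D n x) \<le> B * indicator (cbox (a - ?e) b) x" for n
    proof (rule AE_I2)
      show "norm (D n x) \<le> B * indicator (cbox (a - ?e) b) x" for x
        using D_le[of n x] D0[of x n] by (cases "x \<in> cbox (a - ?e) b") simp_all
    qed
    show "AE x in lborel. (\<lambda>n. D n x) \<longlonglongrightarrow> w' x"
    proof (rule AE_I2)
      fix x
      have "(\<lambda>s. (w (x + (0 + s) *\<^sub>R ?e) - w (x + 0 *\<^sub>R ?e)) / s) \<midarrow>0\<rightarrow> w' x"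
        using der[of x] unfolding DERIV_def .
      moreover have "filterlim h (at 0) sequentially"
        unfolding filterlim_at h_def using LIMSEQ_inverse_real_of_nat by auto
      ultimately have "(\<lambda>n. (w (x + (0 + h n) *\<^sub>R ?e) - w (x + 0 *\<^sub>R ?e)) / h n) \<longlonglongrightarrow> w' x"
        by (rule filterlim_compose[of "\<lambda>s. (w (x + (0 + s) *\<^sub>R ?e) - w (x + 0 *\<^sub>R ?e)) / s"])
      then show "(\<lambda>n. D n x) \<longlonglongrightarrow> w' x" by (simp add: D_def)
    qed
  qed
  moreover have "(\<integral>x. D n x \<partial>lborel) = 0" for n
    unfolding D_def using int_w integrable_lborel_shift[OF int_w]
    by (simp add: integral_lborel_shift)
  ultimately show ?thesis by (simp add: LIMSEQ_const_iff)
qed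

lemma integral_by_parts_axis:
  fixes u u' v v' :: "real^'n::finite \<Rightarrow> real"
  assumes "\<And>x. ((\<lambda>s. u (x + s *\<^sub>R axis j 1)) has_real_derivative u' x) (at 0)"
    and "\<And>x. ((\<lambda>s. v (x + s *\<^sub>R axis j 1)) has_real_derivative v' x) (at 0)"
    and cont: "continuous_on UNIV u" "continuous_on UNIV u'" "continuous_on UNIV v" "continuous_on UNIV v'"
    and van: "\<And>x. x \<notin> cbox a b \<Longrightarrow> u x = 0" "\<And>x. x \<notin> cbox a b \<Longrightarrow> u' x = 0"
  shows "(\<integral>x. u x * v' x \<partial>lborel) = - (\<integral>x. u' x * v x \<partial>lborel)"
proof -
  have 1: "integrable lborel (\<lambda>x. u x * v' x)" "integrable lborel (\<lambda>x. u' x * v x)"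
    using van by (auto intro!: integrable_continuous_vanishing[of _ a b] continuous_intros cont)
  have "(\<integral>x. u x * v' x + u' x * v x \<partial>lborel) = 0"
  proof (rule integral_axis_derivative_eq_0[of "\<lambda>x. u x * v x" j])
    show "((\<lambda>s. u (x + s *\<^sub>R axis j 1) * v (x + s *\<^sub>R axis j 1)) has_real_derivative u x * v' x + u' x * v x) (at 0)" for x
      by (rule DERIV_cong[OF DERIV_mult[OF assms(1,2)]]) simp
  qed (use van in \<open>auto intro!: continuous_intros cont\<close>)
  then show ?thesis using 1 by simp
qed

section \<open>Inequalities for powers and integrals\<close>

lemma nat_floor_div_power2:
  fixes t :: real
  shows "nat \<lfloor>t / 2 ^ m\<rfloor> = nat \<lfloor>t\<rfloor> div 2 ^ m"
proof -
  have "\<lfloor>t / 2 ^ m\<rfloor> = \<lfloor>t\<rfloor> div 2 ^ m"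
    using floor_divide_real_eq_div[of "2 ^ m" t] by simp
  then show ?thesis by (simp add: nat_div_distrib' nat_power_eq)
qed

text \<open>Young's inequality without its constants: either \<open>v \<le> u powr (q - 1)\<close>
  and the product is at most \<open>u powr q\<close>, or \<open>u\<close> is at most
  \<open>v powr (1 / (q - 1))\<close> and it is at most \<open>v powr s\<close>.\<close>

lemma mult_le_powr_add_powr:
  fixes u v q s :: real
  assumes "0 \<le> u" "0 \<le> v" "1 < q" "s = q / (q - 1)"
  shows "u * v \<le> u powr q + v powr s"
proof (cases "u = 0 \<or> v = 0")
  case True
  then show ?thesis by auto
next
  case False
  then have uv: "0 < u" "0 < v" using assms by auto
  show ?thesis
  proof (cases "v \<le> u powr (q - 1)")
    case True
    then have "u * v \<le> u * u powr (q - 1)" using uv by simp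
    also have "\<dots> = u powr q" using uv by (simp add: powr_mult_base)
    finally show ?thesis by (simp add: add_increasing2)
  next
    case False
    then have "(u powr (q - 1)) powr (1 / (q - 1)) \<le> v powr (1 / (q - 1))"
      using assms by (intro powr_mono2) auto
    then have "u \<le> v powr (1 / (q - 1))" using assms uv by (simp add: powr_powr)
    then have "u * v \<le> v * v powr (1 / (q - 1))" using uv by (simp add: mult.commute)
    also have "\<dots> = v powr (1 + 1 / (q - 1))" using uv by (simp add: powr_mult_base)
    also have "1 + 1 / (q - 1) = s" using assms by (simp add: field_simps)
    finally show ?thesis by (simp add: add_increasing)
  qed
qed

lemma powr_le_interpolation:
  fixes y t :: real
  assumes "0 \<le> y" "a \<le> t" "t \<le> b"
  shows "y powr t \<le> y powr a + y powr b"
proof (cases "y \<le> 1")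
  case True
  then have "y powr t \<le> y powr a" using assms by (cases "y = 0") (auto intro: powr_mono')
  then show ?thesis by (simp add: add_increasing2)
next
  case False
  then have "y powr t \<le> y powr b" using assms by (intro powr_mono) auto
  then show ?thesis by (simp add: add_increasing)
qed

text \<open>Duality between \<open>L\<^sub>q\<close> and \<open>L\<^sub>s\<close>, the parameter of Young's inequality being chosen such that
  the term with \<open>h\<close> contributes at most half.\<close>

lemma nn_integral_powr_ge_pairing:
  fixes g h :: "'a::euclidean_space \<Rightarrow> real"
  assumes gh: "integrable lborel (\<lambda>x. g x * h x)" and [measurable]: "g \<in> borel_measurable borel" "h \<in> borel_measurable borel"
    and q: "1 < q" "s = q / (q - 1)"
    and P: "0 < P" "P \<le> \<bar>\<integral>x. g x * h x \<partial>lborel\<bar>"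
    and H: "0 < H" "(\<integral>\<^sup>+x. ennreal (\<bar>h x\<bar> powr s) \<partial>lborel) \<le> ennreal H"
  shows "ennreal ((P / 2) powr q * H powr (1 - q)) \<le> (\<integral>\<^sup>+x. ennreal (\<bar>g x\<bar> powr q) \<partial>lborel)"
proof -
  define \<tau> where "\<tau> = (2 * H / P) powr (1 / s)"
  have s: "0 < s" "q / s = q - 1" unfolding q(2) using q(1) by simp_all
  have \<tau>: "0 < \<tau>" using P H by (simp add: \<tau>_def)
  have "(\<integral>\<^sup>+x. ennreal \<bar>g x * h x\<bar> \<partial>lborel) \<le>
     (\<integral>\<^sup>+x. ennreal (\<tau> powr q) * ennreal (\<bar>g x\<bar> powr q) + ennreal (\<tau> powr (- s)) * ennreal (\<bar>h x\<bar> powr s) \<partial>lborel)"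
  proof (rule nn_integral_mono)
    fix x
    have "\<bar>g x * h x\<bar> = (\<tau> * \<bar>g x\<bar>) * (\<bar>h x\<bar> / \<tau>)" using \<tau> by (simp add: abs_mult)
    also have "\<dots> \<le> (\<tau> * \<bar>g x\<bar>) powr q + (\<bar>h x\<bar> / \<tau>) powr s"
      using \<tau> q by (intro mult_le_powr_add_powr) auto
    also have "\<dots> = \<tau> powr q * \<bar>g x\<bar> powr q + \<tau> powr (- s) * \<bar>h x\<bar> powr s"
      using \<tau> by (simp add: powr_mult powr_divide powr_minus field_simps)
    finally have "ennreal \<bar>g x * h x\<bar> \<le> ennreal (\<tau> powr q * \<bar>g x\<bar> powr q + \<tau> powr (- s) * \<bar>h x\<bar> powr s)"
      by (rule ennreal_leI)
    then show "ennreal \<bar>g x * h x\<bar> \<le> ennreal (\<tau> powr q) * ennreal (\<bar>g x\<bar> powr q) + ennreal (\<tau> powr (- s)) * ennreal (\<bar>h x\<bar> powr s)"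
      by (simp add: ennreal_plus ennreal_mult)
  qed
  also have "\<dots> = ennreal (\<tau> powr q) * (\<integral>\<^sup>+x. ennreal (\<bar>g x\<bar> powr q) \<partial>lborel) +
      ennreal (\<tau> powr (- s)) * (\<integral>\<^sup>+x. ennreal (\<bar>h x\<bar> powr s) \<partial>lborel)"
    by (simp add: nn_integral_add nn_integral_cmult)
  also have "\<dots> \<le> ennreal (\<tau> powr q) * (\<integral>\<^sup>+x. ennreal (\<bar>g x\<bar> powr q) \<partial>lborel) + ennreal (\<tau> powr (- s)) * ennreal H"
    using H by (intro add_left_mono mult_left_mono) auto
  also have "ennreal (\<tau> powr (- s)) * ennreal H = ennreal (P / 2)"
  proof -
    have "\<tau> powr (- s) = P / (2 * H)" using P H s by (simp add: \<tau>_def powr_powr powr_minus)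
    then show ?thesis using P H by (simp add: ennreal_mult[symmetric])
  qed
  finally have 1: "(\<integral>\<^sup>+x. ennreal \<bar>g x * h x\<bar> \<partial>lborel) \<le>
     ennreal (\<tau> powr q) * (\<integral>\<^sup>+x. ennreal (\<bar>g x\<bar> powr q) \<partial>lborel) + ennreal (P / 2)" .
  have "ennreal P \<le> ennreal (\<integral>x. \<bar>g x * h x\<bar> \<partial>lborel)"
    using P integral_abs_bound[of lborel "\<lambda>x. g x * h x"] by (intro ennreal_leI) linarith
  also have "\<dots> = (\<integral>\<^sup>+x. ennreal \<bar>g x * h x\<bar> \<partial>lborel)"
    using gh by (intro nn_integral_eq_integral[symmetric]) auto
  finally have 2: "ennreal P \<le> ennreal (\<tau> powr q) * (\<integral>\<^sup>+x. ennreal (\<bar>g x\<bar> powr q) \<partial>lborel) + ennreal (P / 2)"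
    using 1 by (rule order_trans)
  show ?thesis
  proof (cases "(\<integral>\<^sup>+x. ennreal (\<bar>g x\<bar> powr q) \<partial>lborel)")
    case (real I)
    have "ennreal P \<le> ennreal (\<tau> powr q * I + P / 2)"
      using 2 P real by (simp add: ennreal_mult ennreal_plus)
    then have "P \<le> \<tau> powr q * I + P / 2" using P real by (subst (asm) ennreal_le_iff) auto
    then have "P / 2 \<le> \<tau> powr q * I" by simp
    also have "\<tau> powr q = (2 * H / P) powr (q - 1)" using P H s by (simp add: \<tau>_def powr_powr)
    finally have "P / 2 \<le> (2 * H / P) powr (q - 1) * I" .
    then have "(P / 2) * (P / (2 * H)) powr (q - 1) \<le> (2 * H / P) powr (q - 1) * I * (P / (2 * H)) powr (q - 1)"
      by (rule mult_right_mono) simp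
    also have "\<dots> = I * ((2 * H / P) * (P / (2 * H))) powr (q - 1)"
      using P H by (subst powr_mult) auto
    also have "\<dots> = I" using P H by simp
    also have "(P / 2) * (P / (2 * H)) powr (q - 1) = (P / 2) powr q * H powr (1 - q)"
    proof -
      have "P / (2 * H) = (P / 2) / H" by simp
      then have "(P / (2 * H)) powr (q - 1) = (P / 2) powr (q - 1) / H powr (q - 1)"
        using P H by (simp only: powr_divide)
      moreover have "(P / 2) * (P / 2) powr (q - 1) = (P / 2) powr q"
        using P powr_mult_base[of "P / 2" "q - 1"] by simp
      moreover have "H powr (1 - q) = 1 / H powr (q - 1)" using powr_minus_divide[of H "q - 1"] by simp
      ultimately show ?thesis by simp
    qed
    finally show ?thesis unfolding real by (rule ennreal_leI)
  next
    case top
    then show ?thesis by simp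
  qed
qed

lemma convex_on_powr_nonneg:
  fixes p :: real
  assumes "1 \<le> p"
  shows "convex_on {0..} (\<lambda>x. x powr p)"
proof (rule convex_onI)
  fix t x y :: real assume t: "0 < t" "t < 1" and xy: "x \<in> {0..}" "y \<in> {0..}"
  have small: "u powr p \<le> u" if "0 < u" "u < 1" for u :: real
    using powr_mono'[of 1 p u] that assms by simp
  consider "x = 0" | "y = 0" | "0 < x \<and> 0 < y" using xy by force
  then show "((1 - t) *\<^sub>R x + t *\<^sub>R y) powr p \<le> (1 - t) * x powr p + t * y powr p"
  proof cases
    case 1
    then show ?thesis using small[of t] t xy assms by (simp add: powr_mult mult_right_mono)
  next
    case 2
    then show ?thesis using small[of "1 - t"] t xy assms by (simp add: powr_mult mult_right_mono)
  next
    case 3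
    then show ?thesis using convex_onD[OF powr_convex[OF assms], of t x y] t by simp
  qed
qed simp

text \<open>A sum with few nonzero terms is at most their number times the largest one. This
  exploits bounded overlap of supports: the total number of terms does not enter.\<close>

lemma powr_sum_le:
  fixes z :: "'t \<Rightarrow> real"
  assumes "finite T" "\<And>t. t \<in> T \<Longrightarrow> 0 \<le> z t" "card {t\<in>T. z t \<noteq> 0} \<le> n" "0 < p"
  shows "(\<Sum>t\<in>T. z t) powr p \<le> real n powr p * (\<Sum>t\<in>T. z t powr p)"
proof (cases "{t\<in>T. z t \<noteq> 0} = {}")
  case True
  then have "(\<Sum>t\<in>T. z t) = 0" by (intro sum.neutral) auto
  then show ?thesis using assms by (simp add: sum_nonneg)
next
  case False
  define U where "U = {t\<in>T. z t \<noteq> 0}"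
  have U: "finite U" "U \<noteq> {}" using assms False by (auto simp: U_def)
  define m where "m = Max (z ` U)"
  obtain u where u: "u \<in> U" "m = z u" using Max_in[of "z ` U"] U unfolding m_def by blast
  have "(\<Sum>t\<in>T. z t) = (\<Sum>t\<in>U. z t)"
    using assms(1) by (intro sum.mono_neutral_right) (auto simp: U_def)
  also have "\<dots> \<le> (\<Sum>t\<in>U. m)" using U by (intro sum_mono) (simp add: m_def)
  also have "\<dots> \<le> real n * m"
    using assms u by (auto simp: U_def intro!: mult_right_mono)
  finally have "(\<Sum>t\<in>T. z t) powr p \<le> (real n * m) powr p"
    using assms by (intro powr_mono2) (auto intro: sum_nonneg)
  also have "\<dots> = real n powr p * z u powr p"
    using u assms by (simp add: powr_mult U_def)
  also have "z u powr p \<le> (\<Sum>t\<in>T. z t powr p)"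
    using u assms by (intro member_le_sum) (auto simp: U_def)
  finally show ?thesis by (simp add: mult_left_mono)
qed

text \<open>Minkowski's inequality in terms of given bounds. Convexity of the power is applied with
  the weights \<open>V \<kappa> / W\<close> to the functions
  \<open>W / V \<kappa> * \<bar>f \<kappa> x\<bar>\<close>, which balances the terms. Terms with
  \<open>V \<kappa> = 0\<close> vanish almost everywhere and are removed beforehand to make the
  division legitimate.\<close>

lemma nn_integral_sum_powr_le:
  fixes f :: "'k \<Rightarrow> 'a::euclidean_space \<Rightarrow> real"
  assumes A: "finite A" and [measurable]: "\<And>\<kappa>. \<kappa> \<in> A \<Longrightarrow> f \<kappa> \<in> borel_measurable borel"
    and V: "\<And>\<kappa>. \<kappa> \<in> A \<Longrightarrow> 0 \<le> V \<kappa>"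
    and bnd: "\<And>\<kappa>. \<kappa> \<in> A \<Longrightarrow> (\<integral>\<^sup>+x. ennreal (\<bar>f \<kappa> x\<bar> powr p) \<partial>lborel) \<le> ennreal (V \<kappa> powr p)"
    and p: "1 \<le> p"
  shows "(\<integral>\<^sup>+x. ennreal (\<bar>\<Sum>\<kappa>\<in>A. f \<kappa> x\<bar> powr p) \<partial>lborel) \<le> ennreal ((\<Sum>\<kappa>\<in>A. V \<kappa>) powr p)"
proof -
  define A' where "A' = {\<kappa>\<in>A. 0 < V \<kappa>}"
  have A': "finite A'" "A' \<subseteq> A" using A by (auto simp: A'_def)
  have ae: "AE x in lborel. \<forall>\<kappa>\<in>A - A'. f \<kappa> x = 0"
  proof (rule AE_finite_allI)
    fix \<kappa> assume \<kappa>: "\<kappa> \<in> A - A'"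
    then have [measurable]: "f \<kappa> \<in> borel_measurable borel" by auto
    have "V \<kappa> = 0" using \<kappa> V[of \<kappa>] by (auto simp: A'_def)
    then have "(\<integral>\<^sup>+x. ennreal (\<bar>f \<kappa> x\<bar> powr p) \<partial>lborel) = 0" using bnd[of \<kappa>] \<kappa> by simp
    then have "AE x in lborel. ennreal (\<bar>f \<kappa> x\<bar> powr p) = 0" by (subst (asm) nn_integral_0_iff_AE) auto
    then show "AE x in lborel. f \<kappa> x = 0" by eventually_elim (auto simp: ennreal_eq_0_iff)
  qed (use A in auto)
  have "(\<integral>\<^sup>+x. ennreal (\<bar>\<Sum>\<kappa>\<in>A. f \<kappa> x\<bar> powr p) \<partial>lborel) = (\<integral>\<^sup>+x. ennreal (\<bar>\<Sum>\<kappa>\<in>A'. f \<kappa> x\<bar> powr p) \<partial>lborel)"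
  proof (rule nn_integral_cong_AE)
    show "AE x in lborel. ennreal (\<bar>\<Sum>\<kappa>\<in>A. f \<kappa> x\<bar> powr p) = ennreal (\<bar>\<Sum>\<kappa>\<in>A'. f \<kappa> x\<bar> powr p)"
      using ae
    proof eventually_elim
      case (elim x)
      then have "(\<Sum>\<kappa>\<in>A. f \<kappa> x) = (\<Sum>\<kappa>\<in>A'. f \<kappa> x)" using A A' by (intro sum.mono_neutral_right) auto
      then show ?case by simp
    qed
  qed
  also have "\<dots> \<le> ennreal ((\<Sum>\<kappa>\<in>A. V \<kappa>) powr p)"
  proof (cases "A' = {}")
    case True
    then show ?thesis by simp
  next
    case False
    define W where "W = (\<Sum>\<kappa>\<in>A'. V \<kappa>)"
    have W: "0 < W" unfolding W_def using A' False by (intro sum_pos) (auto simp: A'_def)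
    have V': "0 < V \<kappa>" if "\<kappa> \<in> A'" for \<kappa> using that by (simp add: A'_def)
    have cf0: "0 \<le> V \<kappa> / W * (W / V \<kappa>) powr p" if "\<kappa> \<in> A'" for \<kappa>
      using V'[OF that] W by (intro mult_nonneg_nonneg divide_nonneg_pos powr_ge_zero) auto
    have pt: "\<bar>\<Sum>\<kappa>\<in>A'. f \<kappa> x\<bar> powr p \<le> (\<Sum>\<kappa>\<in>A'. V \<kappa> / W * (W / V \<kappa>) powr p * \<bar>f \<kappa> x\<bar> powr p)" for x
    proof -
      have "\<bar>\<Sum>\<kappa>\<in>A'. f \<kappa> x\<bar> \<le> (\<Sum>\<kappa>\<in>A'. V \<kappa> / W * (W / V \<kappa> * \<bar>f \<kappa> x\<bar>))"
      proof -
        have "(\<Sum>\<kappa>\<in>A'. V \<kappa> / W * (W / V \<kappa> * \<bar>f \<kappa> x\<bar>)) = (\<Sum>\<kappa>\<in>A'. \<bar>f \<kappa> x\<bar>)"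
          using V' W by (intro sum.cong refl) (simp add: less_imp_neq[THEN not_sym])
        then show ?thesis by simp
      qed
      then have "\<bar>\<Sum>\<kappa>\<in>A'. f \<kappa> x\<bar> powr p \<le> (\<Sum>\<kappa>\<in>A'. V \<kappa> / W * (W / V \<kappa> * \<bar>f \<kappa> x\<bar>)) powr p"
        using p by (intro powr_mono2) auto
      also have "\<dots> \<le> (\<Sum>\<kappa>\<in>A'. V \<kappa> / W * (W / V \<kappa> * \<bar>f \<kappa> x\<bar>) powr p)"
      proof -
        have "(\<Sum>\<kappa>\<in>A'. V \<kappa> / W) = 1" using W by (simp add: sum_divide_distrib[symmetric] W_def)
        from convex_on_sum[OF A'(1) False convex_on_powr_nonneg[OF p] this, of "\<lambda>\<kappa>. W / V \<kappa> * \<bar>f \<kappa> x\<bar>"]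
        show ?thesis using V' W by (simp add: less_imp_le)
      qed
      also have "\<dots> = (\<Sum>\<kappa>\<in>A'. V \<kappa> / W * (W / V \<kappa>) powr p * \<bar>f \<kappa> x\<bar> powr p)"
        by (intro sum.cong refl) (simp only: powr_mult mult.assoc)
      finally show ?thesis .
    qed
    have "(\<integral>\<^sup>+x. ennreal (\<bar>\<Sum>\<kappa>\<in>A'. f \<kappa> x\<bar> powr p) \<partial>lborel) \<le>
       (\<integral>\<^sup>+x. (\<Sum>\<kappa>\<in>A'. ennreal (V \<kappa> / W * (W / V \<kappa>) powr p) * ennreal (\<bar>f \<kappa> x\<bar> powr p)) \<partial>lborel)"
    proof (rule nn_integral_mono)
      fix x
      have "ennreal (\<bar>\<Sum>\<kappa>\<in>A'. f \<kappa> x\<bar> powr p) \<le> ennreal (\<Sum>\<kappa>\<in>A'. V \<kappa> / W * (W / V \<kappa>) powr p * \<bar>f \<kappa> x\<bar> powr p)"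
        by (rule ennreal_leI[OF pt])
      also have "\<dots> = (\<Sum>\<kappa>\<in>A'. ennreal (V \<kappa> / W * (W / V \<kappa>) powr p * \<bar>f \<kappa> x\<bar> powr p))"
        by (intro sum_ennreal[symmetric] mult_nonneg_nonneg[OF cf0] powr_ge_zero)
      also have "\<dots> = (\<Sum>\<kappa>\<in>A'. ennreal (V \<kappa> / W * (W / V \<kappa>) powr p) * ennreal (\<bar>f \<kappa> x\<bar> powr p))"
        by (intro sum.cong refl ennreal_mult cf0 powr_ge_zero)
      finally show "ennreal (\<bar>\<Sum>\<kappa>\<in>A'. f \<kappa> x\<bar> powr p) \<le> (\<Sum>\<kappa>\<in>A'. ennreal (V \<kappa> / W * (W / V \<kappa>) powr p) * ennreal (\<bar>f \<kappa> x\<bar> powr p))" .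
    qed
    also have "\<dots> = (\<Sum>\<kappa>\<in>A'. ennreal (V \<kappa> / W * (W / V \<kappa>) powr p) * (\<integral>\<^sup>+x. ennreal (\<bar>f \<kappa> x\<bar> powr p) \<partial>lborel))"
    proof -
      have fm: "(\<lambda>x. ennreal (\<bar>f \<kappa> x\<bar> powr p)) \<in> borel_measurable lborel" if "\<kappa> \<in> A'" for \<kappa>
      proof -
        have [measurable]: "f \<kappa> \<in> borel_measurable borel" using assms(2) A' that by blast
        show ?thesis by measurable
      qed
      have "(\<integral>\<^sup>+x. (\<Sum>\<kappa>\<in>A'. ennreal (V \<kappa> / W * (W / V \<kappa>) powr p) * ennreal (\<bar>f \<kappa> x\<bar> powr p)) \<partial>lborel) =
        (\<Sum>\<kappa>\<in>A'. \<integral>\<^sup>+x. ennreal (V \<kappa> / W * (W / V \<kappa>) powr p) * ennreal (\<bar>f \<kappa> x\<bar> powr p) \<partial>lborel)"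
        by (intro nn_integral_sum borel_measurable_times_ennreal fm borel_measurable_const)
      also have "\<dots> = (\<Sum>\<kappa>\<in>A'. ennreal (V \<kappa> / W * (W / V \<kappa>) powr p) * (\<integral>\<^sup>+x. ennreal (\<bar>f \<kappa> x\<bar> powr p) \<partial>lborel))"
        by (intro sum.cong refl nn_integral_cmult fm)
      finally show ?thesis .
    qed
    also have "\<dots> \<le> (\<Sum>\<kappa>\<in>A'. ennreal (V \<kappa> / W * (W / V \<kappa>) powr p) * ennreal (V \<kappa> powr p))"
      using A' bnd by (intro sum_mono mult_left_mono) auto
    also have "\<dots> = (\<Sum>\<kappa>\<in>A'. ennreal (V \<kappa> / W * W powr p))"
    proof (intro sum.cong refl)
      fix \<kappa> assume "\<kappa> \<in> A'"
      then have "0 < V \<kappa>" by (rule V')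
      then show "ennreal (V \<kappa> / W * (W / V \<kappa>) powr p) * ennreal (V \<kappa> powr p) = ennreal (V \<kappa> / W * W powr p)"
        using W by (subst ennreal_mult[symmetric]) (auto simp: powr_divide)
    qed
    also have "\<dots> = ennreal (\<Sum>\<kappa>\<in>A'. V \<kappa> / W * W powr p)"
      using V' W by (intro sum_ennreal) (auto intro!: mult_nonneg_nonneg divide_nonneg_nonneg less_imp_le)
    also have "(\<Sum>\<kappa>\<in>A'. V \<kappa> / W * W powr p) = W powr p"
      using W by (simp add: sum_distrib_right[symmetric] sum_divide_distrib[symmetric] W_def)
    also have "ennreal (W powr p) \<le> ennreal ((\<Sum>\<kappa>\<in>A. V \<kappa>) powr p)"
      using W p unfolding W_def by (intro ennreal_leI powr_mono2 sum_mono2) (use A A' V in auto)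
    finally show ?thesis .
  qed
  finally show ?thesis .
qed

section \<open>Mixed differences and roots of extended integrals\<close>

lemma fdiff_affine: "fdiff m h (\<lambda>t. f (b * (t - c) - s)) t = fdiff m (b * h) f (b * (t - c) - s)"
  by (induction m arbitrary: t) (simp_all add: algebra_simps)

lemma mdiff_prod:
  fixes u :: "'n::finite \<Rightarrow> real \<Rightarrow> real"
  shows "mdiff m h (\<lambda>x. \<Prod>j\<in>UNIV. u j (x $ j)) x = (\<Prod>j\<in>UNIV. fdiff (m j) (h $ j) (u j) (x $ j))"
proof -
  have set_eq: "{k::'n \<Rightarrow> nat. \<forall>j. k j \<le> m j} = PiE UNIV (\<lambda>j. {..m j})"
    by (auto simp: PiE_def Pi_def extensional_def)
  have "(\<Prod>j\<in>UNIV. fdiff (m j) (h $ j) (u j) (x $ j)) =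
    (\<Prod>j\<in>UNIV. \<Sum>i\<le>m j. (-1) ^ (m j - i) * real (m j choose i) * u j (x $ j + real i * h $ j))"
    by (simp add: fdiff_eq_sum)
  also have "\<dots> = (\<Sum>k\<in>PiE UNIV (\<lambda>j. {..m j}).
     \<Prod>j\<in>UNIV. (-1) ^ (m j - k j) * real (m j choose k j) * u j (x $ j + real (k j) * h $ j))"
    by (rule prod_sum_PiE) auto
  also have "\<dots> = mdiff m h (\<lambda>x. \<Prod>j\<in>UNIV. u j (x $ j)) x"
    unfolding mdiff_def set_eq shift_pt_def
    by (intro sum.cong refl) (simp add: prod.distrib power_sum)
  finally show ?thesis by simp
qed

lemma mdiff_sum:
  "mdiff m h (\<lambda>x. \<Sum>t\<in>T. c t * f t x) x = (\<Sum>t\<in>T. c t * mdiff m h (f t) x)"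
  unfolding mdiff_def sum_distrib_left by (subst sum.swap) (simp add: mult_ac)

lemma epow_mono:
  assumes "a \<le> b" "0 \<le> r"
  shows "epow a r \<le> epow b r"
proof (cases "b = \<infinity>")
  case True
  then show ?thesis by (simp add: epow_def)
next
  case False
  then have "b < top" by (simp add: less_top)
  with assms(1) have "a < top" by (rule le_less_trans)
  moreover have "enn2real a \<le> enn2real b" using assms(1) \<open>b < top\<close> by (rule enn2real_mono)
  ultimately show ?thesis using assms False
    by (auto simp: epow_def intro!: ennreal_leI powr_mono2)
qed

lemma epow_ennreal: "0 \<le> x \<Longrightarrow> epow (ennreal x) r = ennreal (x powr r)"
  by (simp add: epow_def)

lemma epow_le_ennreal:
  assumes "a \<le> ennreal (x powr r)" "0 < r" "0 \<le> x"
  shows "epow a (1 / r) \<le> ennreal x"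
proof -
  have "epow a (1 / r) \<le> epow (ennreal (x powr r)) (1 / r)"
    using assms by (intro epow_mono) auto
  also have "\<dots> = ennreal x" using assms by (simp add: epow_ennreal powr_powr)
  finally show ?thesis .
qed

section \<open>Kernels and bounds of the Schur test\<close>

lemma sum_powr_geometric:
  fixes r :: real
  assumes "finite I" "inj_on d I" "0 \<le> r" "r < 1"
  shows "(\<Sum>i\<in>I. r ^ d i) \<le> 1 / (1 - r)"
proof -
  have "(\<Sum>i\<in>I. r ^ d i) = (\<Sum>m\<in>d ` I. r ^ m)" by (rule sum.reindex_cong[OF assms(2) refl, symmetric]) simp
  also have "\<dots> \<le> (\<Sum>m. r ^ m)" using assms by (intro sum_le_suminf summable_geometric) auto
  also have "\<dots> = 1 / (1 - r)" using assms by (intro suminf_geometric) auto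
  finally show ?thesis .
qed

text \<open>The argument will be a step length times the frequency of a bump.\<close>

definition schur_kernel :: "real \<Rightarrow> nat \<Rightarrow> real \<Rightarrow> real" where
  "schur_kernel a l u = u powr (- a) * min 1 u ^ l"

lemma schur_kernel_nonneg: "0 \<le> u \<Longrightarrow> 0 \<le> schur_kernel a l u"
  by (simp add: schur_kernel_def)

lemma measurable_schur_kernel [measurable]: "schur_kernel a l \<in> borel_measurable borel"
  unfolding schur_kernel_def[abs_def] by measurable

lemma schur_kernel_le_small:
  assumes "0 < u"
  shows "schur_kernel a l u \<le> u powr (real l - a)"
proof -
  have "min 1 u ^ l \<le> u ^ l" using assms by (intro power_mono) auto
  then have "schur_kernel a l u \<le> u powr (- a) * u ^ l"
    unfolding schur_kernel_def by (intro mult_left_mono) auto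
  also have "\<dots> = u powr (real l - a)"
    using assms by (simp add: powr_add[symmetric] powr_realpow[symmetric])
  finally show ?thesis .
qed

lemma schur_kernel_le_large:
  assumes "0 < u"
  shows "schur_kernel a l u \<le> u powr (- a)"
proof -
  have "min 1 u ^ l \<le> 1" using assms by (intro power_le_one) auto
  then show ?thesis unfolding schur_kernel_def
    by (intro mult_left_le) auto
qed

text \<open>Summation over frequencies for a fixed step. The kernel decays geometrically on both
  sides of \<open>u = 1\<close>, and counting exponents from the index nearest to that point makes
  the bound independent of \<open>v\<close>.\<close>

lemma sum_schur_kernel:
  assumes "0 < a" "a < real l"
  shows "\<exists>C>0. \<forall>v>0. \<forall>I. finite I \<longrightarrow> (\<Sum>i\<in>I. schur_kernel a l (2 ^ i * v)) \<le> C"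
proof -
  define r1 where "r1 = 2 powr (- a)"
  define r2 where "r2 = 2 powr (- (real l - a))"
  have r1: "0 \<le> r1" "r1 < 1" and r2: "0 \<le> r2" "r2 < 1"
    using assms powr_less_mono[of "- a" 0 2] powr_less_mono[of "- (real l - a)" 0 2] by (auto simp: r1_def r2_def)
  define C where "C = 1 / (1 - r1) + 1 / (1 - r2)"
  have "(\<Sum>i\<in>I. schur_kernel a l (2 ^ i * v)) \<le> C" if v: "0 < v" and I: "finite I" for v and I :: "nat set"
  proof -
    define I1 where "I1 = {i\<in>I. 1 \<le> 2 ^ i * v}"
    define I2 where "I2 = {i\<in>I. \<not> 1 \<le> 2 ^ i * v}"
    have fin: "finite I1" "finite I2" using I by (auto simp: I1_def I2_def)
    have "(\<Sum>i\<in>I1. schur_kernel a l (2 ^ i * v)) \<le> 1 / (1 - r1)"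
    proof (cases "I1 = {}")
      case True
      then show ?thesis using r1 by simp
    next
      case False
      define i0 where "i0 = Min I1"
      have i0: "i0 \<in> I1" "\<And>i. i \<in> I1 \<Longrightarrow> i0 \<le> i" using False fin by (auto simp: i0_def)
      have "(\<Sum>i\<in>I1. schur_kernel a l (2 ^ i * v)) \<le> (\<Sum>i\<in>I1. r1 ^ (i - i0))"
      proof (rule sum_mono)
        fix i assume i: "i \<in> I1"
        have "2 ^ (i - i0) * 1 \<le> 2 ^ (i - i0) * (2 ^ i0 * v)"
          using i0(1) by (intro mult_left_mono) (auto simp: I1_def)
        also have "\<dots> = 2 ^ i * v" using i0(2)[OF i] by (simp flip: power_add)
        finally have le: "2 ^ (i - i0) \<le> 2 ^ i * v" by simp
        have "schur_kernel a l (2 ^ i * v) \<le> (2 ^ i * v) powr (- a)"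
          using v by (intro schur_kernel_le_large) auto
        also have "\<dots> \<le> (2 ^ (i - i0)) powr (- a)"
          using le assms by (intro powr_mono2') auto
        also have "\<dots> = r1 ^ (i - i0)"
          by (simp add: r1_def powr_powr powr_realpow[symmetric] mult.commute)
        finally show "schur_kernel a l (2 ^ i * v) \<le> r1 ^ (i - i0)" .
      qed
      also have "\<dots> \<le> 1 / (1 - r1)"
        using r1 fin i0(2) by (intro sum_powr_geometric inj_on_diff_nat) auto
      finally show ?thesis .
    qed
    moreover have "(\<Sum>i\<in>I2. schur_kernel a l (2 ^ i * v)) \<le> 1 / (1 - r2)"
    proof (cases "I2 = {}")
      case True
      then show ?thesis using r2 by simp
    next
      case False
      define i1 where "i1 = Max I2"
      have i1: "i1 \<in> I2" "\<And>i. i \<in> I2 \<Longrightarrow> i \<le> i1" using False fin by (auto simp: i1_def)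
      have "(\<Sum>i\<in>I2. schur_kernel a l (2 ^ i * v)) \<le> (\<Sum>i\<in>I2. r2 ^ (i1 - i))"
      proof (rule sum_mono)
        fix i assume i: "i \<in> I2"
        have "2 ^ (i1 - i) * (2 ^ i * v) = 2 ^ i1 * v" using i1(2)[OF i] by (simp flip: power_add)
        also have "\<dots> \<le> 1" using i1(1) by (simp add: I2_def)
        finally have le: "2 ^ i * v \<le> 1 / 2 ^ (i1 - i)" by (simp add: field_simps)
        have "schur_kernel a l (2 ^ i * v) \<le> (2 ^ i * v) powr (real l - a)"
          using v by (intro schur_kernel_le_small) auto
        also have "\<dots> \<le> (1 / 2 ^ (i1 - i)) powr (real l - a)"
          using le assms v by (intro powr_mono2) auto
        also have "\<dots> = r2 ^ (i1 - i)"
        proof -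
          have "1 / 2 ^ (i1 - i) = 2 powr (- real (i1 - i))" by (simp add: powr_minus powr_realpow divide_inverse)
          then show ?thesis by (simp add: r2_def powr_powr powr_realpow[symmetric] algebra_simps)
        qed
        finally show "schur_kernel a l (2 ^ i * v) \<le> r2 ^ (i1 - i)" .
      qed
      also have "\<dots> \<le> 1 / (1 - r2)"
      proof (rule sum_powr_geometric[OF fin(2) _ r2])
        show "inj_on (\<lambda>i. i1 - i) I2" using i1(2) by (intro inj_onI) (metis diff_diff_cancel)
      qed
      finally show ?thesis .
    qed
    moreover have "(\<Sum>i\<in>I. schur_kernel a l (2 ^ i * v)) =
        (\<Sum>i\<in>I1. schur_kernel a l (2 ^ i * v)) + (\<Sum>i\<in>I2. schur_kernel a l (2 ^ i * v))"
    proof -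
      have "I = I1 \<union> I2" by (auto simp: I1_def I2_def)
      then show ?thesis using fin by (simp only:) (rule sum.union_disjoint, auto simp: I1_def I2_def)
    qed
    ultimately show ?thesis by (simp add: C_def)
  qed
  moreover have "C > 0" using r1 r2 by (auto simp: C_def intro!: add_pos_pos)
  ultimately show ?thesis by blast
qed

text \<open>Integration over steps for a fixed frequency. Since \<open>dt / t\<close> is invariant
  under scaling, \<open>b\<close> can be substituted away, and the kernel splits at 1 into two
  convergent power integrals.\<close>

lemma nn_integral_schur_kernel:
  assumes "0 < a" "a < real l"
  shows "\<exists>C>0. \<forall>b>0. (\<integral>\<^sup>+t. indicator {0<..} t * ennreal (t powr (-1) * schur_kernel a l (b * t)) \<partial>lborel) \<le> ennreal C"
proof -
  define C where "C = 1 / (real l - a) + 1 / a"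
  have I1: "(\<integral>\<^sup>+t. ennreal (t powr (real l - a - 1)) * indicator {0..1::real} t \<partial>lborel) = ennreal (1 / (real l - a))"
    using has_integral_powr_from_0[of "real l - a - 1" 1] assms
    by (intro nn_integral_has_integral_lebesgue') auto
  have I2: "(\<integral>\<^sup>+t. ennreal (t powr (- a - 1)) * indicator {1::real..} t \<partial>lborel) = ennreal (1 / a)"
    using has_integral_powr_to_inf[of "- a - 1" 1] assms
    by (intro nn_integral_has_integral_lebesgue') auto
  have base: "(\<integral>\<^sup>+s. indicator {0<..} s * ennreal (s powr (-1) * schur_kernel a l s) \<partial>lborel) \<le> ennreal C"
  proof -
    have "(\<integral>\<^sup>+s. indicator {0<..} s * ennreal (s powr (-1) * schur_kernel a l s) \<partial>lborel) \<le>
      (\<integral>\<^sup>+t. ennreal (t powr (real l - a - 1)) * indicator {0..1::real} t + ennreal (t powr (- a - 1)) * indicator {1::real..} t \<partial>lborel)"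
    proof (rule nn_integral_mono)
      fix s :: real
      show "indicator {0<..} s * ennreal (s powr (-1) * schur_kernel a l s) \<le>
        ennreal (s powr (real l - a - 1)) * indicator {0..1} s + ennreal (s powr (- a - 1)) * indicator {1..} s"
      proof (cases "0 < s")
        case False
        then show ?thesis by simp
      next
        case True
        show ?thesis
        proof (cases "s \<le> 1")
          case le: True
          have "s powr (-1) * schur_kernel a l s \<le> s powr (-1) * s powr (real l - a)"
            using True by (intro mult_left_mono schur_kernel_le_small) auto
          also have "\<dots> = s powr (real l - a - 1)" by (subst powr_add[symmetric]) (simp add: algebra_simps)
          finally have "ennreal (s powr (-1) * schur_kernel a l s) \<le> ennreal (s powr (real l - a - 1))"
            by (rule ennreal_leI)
          then show ?thesis using True le by (simp add: add_increasing2)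
        next
          case gt: False
          have "s powr (-1) * schur_kernel a l s \<le> s powr (-1) * s powr (- a)"
            using True by (intro mult_left_mono schur_kernel_le_large) auto
          also have "\<dots> = s powr (- a - 1)"
          proof -
            have e: "- a - 1 = -1 + - a" by simp
            show ?thesis unfolding e powr_add by (rule refl)
          qed
          finally have "ennreal (s powr (-1) * schur_kernel a l s) \<le> ennreal (s powr (- a - 1))"
            by (rule ennreal_leI)
          then show ?thesis using True gt by simp
        qed
      qed
    qed
    also have "\<dots> = ennreal (1 / (real l - a)) + ennreal (1 / a)"
      by (subst nn_integral_add) (simp_all add: I1 I2)
    also have "\<dots> = ennreal C" using assms by (simp add: C_def ennreal_plus)
    finally show ?thesis .
  qed
  have "(\<integral>\<^sup>+t. indicator {0<..} t * ennreal (t powr (-1) * schur_kernel a l (b * t)) \<partial>lborel) \<le> ennreal C" if b: "0 < b" for b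
  proof -
    have "(\<integral>\<^sup>+t. indicator {0<..} t * ennreal (t powr (-1) * schur_kernel a l (b * t)) \<partial>lborel) =
      ennreal \<bar>1 / b\<bar> * (\<integral>\<^sup>+s. indicator {0<..} (0 + 1 / b * s) * ennreal ((0 + 1 / b * s) powr (-1) * schur_kernel a l (b * (0 + 1 / b * s))) \<partial>lborel)"
      using b by (intro nn_integral_real_affine) auto
    also have "\<dots> = (\<integral>\<^sup>+s. ennreal (1 / b) * (indicator {0<..} (s / b) * ennreal ((s / b) powr (-1) * schur_kernel a l s)) \<partial>lborel)"
      using b by (subst nn_integral_cmult) auto
    also have "\<dots> = (\<integral>\<^sup>+s. indicator {0<..} s * ennreal (s powr (-1) * schur_kernel a l s) \<partial>lborel)"
    proof (rule nn_integral_cong)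
      fix s :: real
      show "ennreal (1 / b) * (indicator {0<..} (s / b) * ennreal ((s / b) powr (-1) * schur_kernel a l s)) =
        indicator {0<..} s * ennreal (s powr (-1) * schur_kernel a l s)"
      proof (cases "0 < s")
        case True
        have "1 / b * ((s / b) powr (-1) * schur_kernel a l s) = s powr (-1) * schur_kernel a l s"
          using True b by (simp add: powr_minus divide_inverse)
        then have "ennreal (1 / b) * ennreal ((s / b) powr (-1) * schur_kernel a l s) = ennreal (s powr (-1) * schur_kernel a l s)"
          using b schur_kernel_nonneg[of s a l] True by (subst ennreal_mult[symmetric]) auto
        then show ?thesis using True b by simp
      next
        case False
        then show ?thesis using b by (simp add: zero_less_divide_iff)
      qed
    qed
    also have "\<dots> \<le> ennreal C" by (rule base)
    finally show ?thesis .
  qed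
  moreover have "C > 0" using assms by (auto simp: C_def intro!: add_pos_pos)
  ultimately show ?thesis by blast
qed

text \<open>Jensen's inequality for the weights \<open>w\<close> divided by their sum. It pulls the
  power into the sum over scales in the Schur test, and with weights 1 it compares sums of different
  exponents.\<close>

lemma schur_powr:
  fixes w b :: "'k \<Rightarrow> real"
  assumes A: "finite A" and w: "\<And>\<kappa>. \<kappa> \<in> A \<Longrightarrow> 0 \<le> w \<kappa>" and b: "\<And>\<kappa>. \<kappa> \<in> A \<Longrightarrow> 0 \<le> b \<kappa>"
    and C: "(\<Sum>\<kappa>\<in>A. w \<kappa>) \<le> C" and th: "1 \<le> th"
  shows "(\<Sum>\<kappa>\<in>A. w \<kappa> * b \<kappa>) powr th \<le> C powr (th - 1) * (\<Sum>\<kappa>\<in>A. w \<kappa> * b \<kappa> powr th)"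
proof (cases "(\<Sum>\<kappa>\<in>A. w \<kappa>) = 0")
  case True
  then have "w \<kappa> = 0" if "\<kappa> \<in> A" for \<kappa> using that A w by (simp add: sum_nonneg_eq_0_iff)
  then have "(\<Sum>\<kappa>\<in>A. w \<kappa> * b \<kappa>) = 0" "(\<Sum>\<kappa>\<in>A. w \<kappa> * b \<kappa> powr th) = 0" by (auto intro!: sum.neutral)
  then show ?thesis by simp
next
  case False
  define W where "W = (\<Sum>\<kappa>\<in>A. w \<kappa>)"
  have W: "0 < W" using False w by (simp add: W_def sum_nonneg order.not_eq_order_implies_strict)
  have A0: "A \<noteq> {}" using False by auto
  have s0: "0 \<le> (\<Sum>\<kappa>\<in>A. w \<kappa> * b \<kappa> powr th)" using w by (intro sum_nonneg mult_nonneg_nonneg) auto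
  have "(\<Sum>\<kappa>\<in>A. w \<kappa> / W) = 1" using W by (simp add: sum_divide_distrib[symmetric] W_def)
  from convex_on_sum[OF A A0 convex_on_powr_nonneg[OF th] this, of b]
  have "(\<Sum>\<kappa>\<in>A. w \<kappa> / W * b \<kappa>) powr th \<le> (\<Sum>\<kappa>\<in>A. w \<kappa> / W * b \<kappa> powr th)" using w b W by simp
  then have "W powr th * (\<Sum>\<kappa>\<in>A. w \<kappa> / W * b \<kappa>) powr th \<le> W powr th * (\<Sum>\<kappa>\<in>A. w \<kappa> / W * b \<kappa> powr th)"
    by (intro mult_left_mono) auto
  moreover have "W powr th * (\<Sum>\<kappa>\<in>A. w \<kappa> / W * b \<kappa>) powr th = (\<Sum>\<kappa>\<in>A. w \<kappa> * b \<kappa>) powr th"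
    unfolding powr_mult[symmetric] using W by (simp add: sum_distrib_left)
  moreover have "W powr th * (\<Sum>\<kappa>\<in>A. w \<kappa> / W * b \<kappa> powr th) = W powr (th - 1) * (\<Sum>\<kappa>\<in>A. w \<kappa> * b \<kappa> powr th)"
  proof -
    have "W powr th = W * W powr (th - 1)" using W powr_mult_base[of W "th - 1"] by simp
    then show ?thesis using W by (simp add: sum_distrib_left mult_ac)
  qed
  ultimately have "(\<Sum>\<kappa>\<in>A. w \<kappa> * b \<kappa>) powr th \<le> W powr (th - 1) * (\<Sum>\<kappa>\<in>A. w \<kappa> * b \<kappa> powr th)" by simp
  also have "\<dots> \<le> C powr (th - 1) * (\<Sum>\<kappa>\<in>A. w \<kappa> * b \<kappa> powr th)"
    using W C th s0 by (intro mult_right_mono powr_mono2) (auto simp: W_def)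
  finally show ?thesis .
qed

text \<open>The assumed bound holds for every step in the box and on the whole space. Averaging over
  the box preserves it and restricting to \<open>Gset\<close> only decreases the integral, so the
  domain \<open>G\<close> may be arbitrary.\<close>

lemma Omega'_le:
  fixes f :: "real^'n::finite \<Rightarrow> real"
  assumes p: "1 \<le> p" and X: "0 \<le> X" and t: "\<And>j. j \<in> J \<Longrightarrow> 0 < t j"
    and bnd: "\<And>\<xi>. (\<And>j. j \<in> J \<Longrightarrow> \<bar>\<xi> j\<bar> \<le> t j) \<Longrightarrow>
      (\<integral>\<^sup>+x. ennreal (\<bar>mdiff (chiJ J l) (vecJ J \<xi>) f x\<bar> powr p) \<partial>lborel) \<le> ennreal (X powr p)"
  shows "Omega' p l J f G t \<le> ennreal X"
proof -
  interpret product_sigma_finite "\<lambda>_::'n. lborel :: real measure" ..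
  define B where "B = PiE J (\<lambda>j. {- t j..t j})"
  have "(\<integral>\<^sup>+ \<xi>. indicator B \<xi> * (\<integral>\<^sup>+ x. ennreal (\<bar>mdiff (chiJ J l) (vecJ J \<xi>) f x\<bar> powr p) *
           indicator (Gset G (chiJ J l) (vecJ J \<xi>)) x \<partial>lborel) \<partial>(PiM J (\<lambda>_. lborel))) \<le>
      (\<integral>\<^sup>+ \<xi>. ennreal (X powr p) * indicator B \<xi> \<partial>(PiM J (\<lambda>_. lborel)))"
  proof (rule nn_integral_mono)
    fix \<xi> :: "'n \<Rightarrow> real"
    show "indicator B \<xi> * (\<integral>\<^sup>+ x. ennreal (\<bar>mdiff (chiJ J l) (vecJ J \<xi>) f x\<bar> powr p) *
           indicator (Gset G (chiJ J l) (vecJ J \<xi>)) x \<partial>lborel) \<le> ennreal (X powr p) * indicator B \<xi>"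
    proof (cases "\<xi> \<in> B")
      case True
      then have "\<bar>\<xi> j\<bar> \<le> t j" if "j \<in> J" for j using that by (force simp: B_def PiE_def Pi_def)
      from bnd[OF this]
      have "(\<integral>\<^sup>+ x. ennreal (\<bar>mdiff (chiJ J l) (vecJ J \<xi>) f x\<bar> powr p) *
           indicator (Gset G (chiJ J l) (vecJ J \<xi>)) x \<partial>lborel) \<le> ennreal (X powr p)"
        by (rule order_trans[rotated]) (auto intro!: nn_integral_mono simp: indicator_def)
      then show ?thesis using True by simp
    next
      case False
      then show ?thesis by simp
    qed
  qed
  also have "\<dots> = ennreal (X powr p) * emeasure (PiM J (\<lambda>_. lborel)) B"
    unfolding B_def by (intro nn_integral_cmult_indicator sets_PiM_I_finite) auto
  also have "emeasure (PiM J (\<lambda>_. lborel)) B = (\<Prod>j\<in>J. ennreal (2 * t j))"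
  proof -
    have "emeasure lborel {- t j..t j} = ennreal (2 * t j)" if "j \<in> J" for j
      using t[OF that] by simp
    then show ?thesis unfolding B_def by (subst emeasure_PiM) (auto intro!: prod.cong)
  qed
  also have "\<dots> = ennreal (\<Prod>j\<in>J. 2 * t j)"
    using t by (intro prod_ennreal) (auto simp: less_imp_le)
  finally have le: "(\<integral>\<^sup>+ \<xi>. indicator B \<xi> * (\<integral>\<^sup>+ x. ennreal (\<bar>mdiff (chiJ J l) (vecJ J \<xi>) f x\<bar> powr p) *
           indicator (Gset G (chiJ J l) (vecJ J \<xi>)) x \<partial>lborel) \<partial>(PiM J (\<lambda>_. lborel))) \<le>
       ennreal (X powr p) * ennreal (\<Prod>j\<in>J. 2 * t j)" .
  have tp: "0 < (\<Prod>j\<in>J. 2 * t j)" using t by (intro prod_pos) auto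
  have "ennreal (\<Prod>j\<in>J. 1 / (2 * t j)) * (\<integral>\<^sup>+ \<xi>. indicator B \<xi> * (\<integral>\<^sup>+ x. ennreal (\<bar>mdiff (chiJ J l) (vecJ J \<xi>) f x\<bar> powr p) *
           indicator (Gset G (chiJ J l) (vecJ J \<xi>)) x \<partial>lborel) \<partial>(PiM J (\<lambda>_. lborel))) \<le>
       ennreal (\<Prod>j\<in>J. 1 / (2 * t j)) * (ennreal (X powr p) * ennreal (\<Prod>j\<in>J. 2 * t j))"
    by (rule mult_left_mono[OF le]) simp
  also have "\<dots> = ennreal ((\<Prod>j\<in>J. 1 / (2 * t j)) * (X powr p * (\<Prod>j\<in>J. 2 * t j)))"
    using t tp by (simp add: ennreal_mult[symmetric] prod_nonneg less_imp_le)
  also have "(\<Prod>j\<in>J. 1 / (2 * t j)) * (X powr p * (\<Prod>j\<in>J. 2 * t j)) = X powr p"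
  proof -
    have "(\<Prod>j\<in>J. 1 / (2 * t j)) * (\<Prod>j\<in>J. 2 * t j) = (\<Prod>j\<in>J. 1)"
      unfolding prod.distrib[symmetric] using t by (intro prod.cong refl) (simp add: less_imp_neq[THEN not_sym])
    then show ?thesis by (simp add: mult.left_commute)
  qed
  finally show ?thesis
    unfolding Omega'_def B_def[symmetric] using p X by (intro epow_le_ennreal) auto
qed

section \<open>Recovery width and the size of layers\<close>

lemma abs_powr_midpoint:
  fixes g h q :: real
  assumes "1 \<le> q"
  shows "2 * \<bar>g\<bar> powr q \<le> \<bar>g - h\<bar> powr q + \<bar>- g - h\<bar> powr q"
proof -
  have "\<bar>g\<bar> \<le> (\<bar>g - h\<bar> + \<bar>- g - h\<bar>) / 2" by (auto simp: abs_if field_simps)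
  then have "\<bar>g\<bar> \<le> (1 - 1 / 2) *\<^sub>R \<bar>g - h\<bar> + (1 / 2) *\<^sub>R \<bar>- g - h\<bar>" by (simp add: field_simps)
  then have "\<bar>g\<bar> powr q \<le> ((1 - 1 / 2) *\<^sub>R \<bar>g - h\<bar> + (1 / 2) *\<^sub>R \<bar>- g - h\<bar>) powr q"
    using assms by (intro powr_mono2) auto
  also have "\<dots> \<le> (1 - 1 / 2) * \<bar>g - h\<bar> powr q + (1 / 2) * \<bar>- g - h\<bar> powr q"
    by (rule convex_onD[OF convex_on_powr_nonneg[OF assms]]) auto
  finally show ?thesis by simp
qed

text \<open>Two functions of the class with the same data whose derivatives are opposite cannot both be
  recovered well.\<close>

lemma recovery_width_ge:
  fixes D :: "(real^'n::finite) set"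
  assumes q: "1 \<le> q" and X: "0 \<le> X" and D: "D \<in> sets borel"
    and fool: "\<And>ys. length ys = n \<Longrightarrow> \<exists>f1\<in>K. \<exists>f2\<in>K. \<exists>g. map f1 ys = map f2 ys \<and>
      weak_deriv D lam f1 g \<and> weak_deriv D lam f2 (\<lambda>x. - g x) \<and> g \<in> borel_measurable borel \<and>
      ennreal (X powr q) \<le> (\<integral>\<^sup>+x. ennreal (\<bar>g x\<bar> powr q) * indicator D x \<partial>lborel)"
  shows "ennreal X \<le> recovery_width n lam K q D"
  unfolding recovery_width_def
proof (rule INF_greatest, clarify)
  fix ys :: "(real^'n) list" and A :: "real list \<Rightarrow> real^'n \<Rightarrow> real"
  assume ys: "n = length ys" "set ys \<subseteq> D" and A: "\<forall>v. in_Lp q D (A v)"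
  obtain f1 f2 g where f: "f1 \<in> K" "f2 \<in> K" "map f1 ys = map f2 ys" "weak_deriv D lam f1 g"
    "weak_deriv D lam f2 (\<lambda>x. - g x)" and g[measurable]: "g \<in> borel_measurable borel"
    and big: "ennreal (X powr q) \<le> (\<integral>\<^sup>+x. ennreal (\<bar>g x\<bar> powr q) * indicator D x \<partial>lborel)"
    using fool[of ys] ys by auto
  define h where "h = A (map f1 ys)"
  note D[measurable]
  \<comment> \<open>A reconstruction is measurable on \<open>D\<close> only, so \<open>h\<close>
    enters the integrals through \<open>indicator D x * h x\<close>.\<close>
  have hm[measurable]: "(\<lambda>x. indicator D x * h x) \<in> borel_measurable borel"
    using A by (simp add: h_def in_Lp_def set_borel_measurable_def)
  have h2: "h = A (map f2 ys)" by (simp only: h_def f(3))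
  define I where "I u = (\<integral>\<^sup>+x. ennreal (\<bar>u x - h x\<bar> powr q) * indicator D x \<partial>lborel)" for u
  have meas: "(\<lambda>x. ennreal (\<bar>u x - h x\<bar> powr q) * indicator D x) \<in> borel_measurable lborel"
    if [measurable]: "u \<in> borel_measurable borel" for u
  proof -
    have "(\<lambda>x. ennreal (\<bar>u x - h x\<bar> powr q) * indicator D x) =
        (\<lambda>x. ennreal (\<bar>u x - indicator D x * h x\<bar> powr q) * indicator D x)"
      by (auto simp: fun_eq_iff indicator_def)
    then show ?thesis by simp
  qed
  have "ennreal (X powr q) + ennreal (X powr q) \<le> (\<integral>\<^sup>+x. ennreal (\<bar>g x\<bar> powr q) * indicator D x \<partial>lborel) +
      (\<integral>\<^sup>+x. ennreal (\<bar>g x\<bar> powr q) * indicator D x \<partial>lborel)"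
    using big by (rule add_mono[OF _ big])
  also have "\<dots> = (\<integral>\<^sup>+x. ennreal (\<bar>g x\<bar> powr q) * indicator D x + ennreal (\<bar>g x\<bar> powr q) * indicator D x \<partial>lborel)"
    by (rule nn_integral_add[symmetric]) auto
  also have "\<dots> \<le> (\<integral>\<^sup>+x. ennreal (\<bar>g x - h x\<bar> powr q) * indicator D x + ennreal (\<bar>- g x - h x\<bar> powr q) * indicator D x \<partial>lborel)"
  proof (rule nn_integral_mono)
    fix x
    have "\<bar>g x\<bar> powr q + \<bar>g x\<bar> powr q \<le> \<bar>g x - h x\<bar> powr q + \<bar>- g x - h x\<bar> powr q"
      using abs_powr_midpoint[OF q, of "g x" "h x"] by simp
    then have "ennreal (\<bar>g x\<bar> powr q + \<bar>g x\<bar> powr q) \<le> ennreal (\<bar>g x - h x\<bar> powr q + \<bar>- g x - h x\<bar> powr q)"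
      by (rule ennreal_leI)
    then have "ennreal (\<bar>g x\<bar> powr q) + ennreal (\<bar>g x\<bar> powr q) \<le> ennreal (\<bar>g x - h x\<bar> powr q) + ennreal (\<bar>- g x - h x\<bar> powr q)"
      by (simp only: ennreal_plus powr_ge_zero)
    then show "ennreal (\<bar>g x\<bar> powr q) * indicator D x + ennreal (\<bar>g x\<bar> powr q) * indicator D x \<le>
        ennreal (\<bar>g x - h x\<bar> powr q) * indicator D x + ennreal (\<bar>- g x - h x\<bar> powr q) * indicator D x"
      by (auto simp: indicator_def)
  qed
  also have "\<dots> = I g + I (\<lambda>x. - g x)"
    unfolding I_def by (intro nn_integral_add meas) auto
  finally have sum: "ennreal (X powr q) + ennreal (X powr q) \<le> I g + I (\<lambda>x. - g x)" .
  have "ennreal (X powr q) \<le> I g \<or> ennreal (X powr q) \<le> I (\<lambda>x. - g x)"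
  proof (rule ccontr)
    assume "\<not> ?thesis"
    then have lt: "I g < ennreal (X powr q)" "I (\<lambda>x. - g x) < ennreal (X powr q)" by auto
    have "I g + I (\<lambda>x. - g x) < ennreal (X powr q) + ennreal (X powr q)"
      by (rule add_strict_mono[OF lt])
    with sum show False by simp
  qed
  moreover have "ennreal X \<le> Lp_norm q D (\<lambda>x. u x - h x)" if "ennreal (X powr q) \<le> I u" for u
  proof -
    have "epow (ennreal (X powr q)) (1 / q) \<le> epow (I u) (1 / q)" using that q by (intro epow_mono) auto
    then show ?thesis using X q by (simp add: epow_ennreal powr_powr Lp_norm_def I_def)
  qed
  ultimately have "ennreal X \<le> Lp_norm q D (\<lambda>x. g x - h x) \<or> ennreal X \<le> Lp_norm q D (\<lambda>x. - g x - h x)" by blast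
  then show "ennreal X \<le> (SUP f\<in>K. SUP g\<in>{g. weak_deriv D lam f g}. Lp_norm q D (\<lambda>x. g x - snd (ys, A) (map f (fst (ys, A))) x))"
  proof
    assume *: "ennreal X \<le> Lp_norm q D (\<lambda>x. g x - h x)"
    show ?thesis
      by (rule SUP_upper2[OF f(1)], rule SUP_upper2[of g]) (use f(4) * in \<open>simp_all add: h_def\<close>)
  next
    assume *: "ennreal X \<le> Lp_norm q D (\<lambda>x. - g x - h x)"
    show ?thesis
      by (rule SUP_upper2[OF f(2)], rule SUP_upper2[of "\<lambda>x. - g x"]) (use f(5) * in \<open>simp_all add: h2[symmetric]\<close>)
  qed
qed

section \<open>Choice of the layer for a given number of points\<close>

lemma two_powr_minus_nat: "2 powr (- real k) = 1 / 2 ^ k"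
  by (simp add: powr_minus_divide powr_realpow)

lemma two_powr_root:
  assumes "0 < p"
  shows "(2 powr (- real k / p)) powr p = 1 / 2 ^ k"
proof -
  have "- real k / p * p = - real k" using assms by simp
  then show ?thesis unfolding powr_powr by (simp only: two_powr_minus_nat)
qed

definition inv_exp :: "ereal \<Rightarrow> real" where
  "inv_exp \<theta> = (if \<theta> = \<infinity> then 0 else 1 / real_of_ereal \<theta>)"

text \<open>\<open>(k + 1) ^ (g - 1) * 2 ^ (g * k)\<close> counts the coefficients of the layer of
  total \<open>g * k\<close>: the first factor counts scales, the second the bumps of each. From
  \<open>k\<close> to \<open>k + 1\<close> it grows by at most \<open>4 ^ g\<close>, so the least
  \<open>k\<close> reaching \<open>2 * n\<close> overshoots by a constant factor only; the
  logarithms follow from \<open>2 ^ k\<close> and \<open>2 ^ (2 * g * k)\<close> as bounds on the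
  count.\<close>

lemma layer_size_log:
  assumes g: "1 \<le> g"
  shows "\<exists>c1>0. \<exists>c2>0. \<forall>n\<ge>2. \<exists>k. 2 * n \<le> (k + 1) ^ (g - 1) * 2 ^ (g * k) \<and>
    (k + 1) ^ (g - 1) * 2 ^ (g * k) \<le> 4 ^ g * (2 * n) \<and>
    c1 * ln (real n) \<le> real (k + 1) \<and> real (k + 1) \<le> c2 * ln (real n)"
proof -
  define M where "M k = (k + 1) ^ (g - 1) * 2 ^ (g * k)" for k :: nat
  have Mge: "2 ^ k \<le> M k" for k
  proof -
    have "(2::nat) ^ k \<le> 2 ^ (g * k)" using g by (intro power_increasing) auto
    also have "\<dots> = 1 * 2 ^ (g * k)" by simp
    also have "\<dots> \<le> M k" unfolding M_def by (intro mult_right_mono) auto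
    finally show ?thesis .
  qed
  have Mle: "M k \<le> 2 ^ (2 * g * k)" for k
  proof -
    have "k + 1 \<le> 2 ^ k" by (induction k) auto
    then have "(k + 1) ^ (g - 1) \<le> (2 ^ k) ^ (g - 1)" by (rule power_mono) simp
    also have "\<dots> \<le> 2 ^ (g * k)" unfolding power_mult[symmetric] using g by (intro power_increasing) auto
    finally have "M k \<le> 2 ^ (g * k) * 2 ^ (g * k)" unfolding M_def by (rule mult_right_mono) simp
    then show ?thesis by (simp add: power_add add_mult_distrib mult_2)
  qed
  have step: "M (Suc k) \<le> 4 ^ g * M k" for k
  proof -
    have "(Suc k + 1) ^ (g - 1) \<le> (2 * (k + 1)) ^ (g - 1)" by (rule power_mono) auto
    also have "\<dots> \<le> 2 ^ g * (k + 1) ^ (g - 1)"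
      unfolding power_mult_distrib by (intro mult_right_mono power_increasing) auto
    finally have "M (Suc k) \<le> 2 ^ g * (k + 1) ^ (g - 1) * 2 ^ (g * Suc k)"
      unfolding M_def by (rule mult_right_mono) simp
    also have "\<dots> = (2 * 2) ^ g * M k"
      by (simp only: M_def mult_Suc_right power_add power_mult_distrib ac_simps)
    finally show ?thesis by simp
  qed
  have "\<exists>k. 2 * n \<le> M k \<and> M k \<le> 4 ^ g * (2 * n) \<and>
      1 / (2 * real g * ln 2) * ln (real n) \<le> real (k + 1) \<and> real (k + 1) \<le> 4 / ln 2 * ln (real n)"
    if n: "2 \<le> n" for n
  proof -
    define k where "k = (LEAST k. 2 * n \<le> M k)"
    have "2 * n \<le> M (2 * n)" using Mge[of "2 * n"] less_exp[of "2 * n"] by linarith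
    then have k: "2 * n \<le> M k" unfolding k_def by (rule LeastI)
    have "M 0 = 1" by (simp add: M_def)
    with k n have "k \<noteq> 0" by (intro notI) simp
    then obtain k' where k': "k = Suc k'" by (auto simp: gr0_conv_Suc)
    then have less: "M k' < 2 * n" using not_less_Least[of k' "\<lambda>k. 2 * n \<le> M k"] by (simp add: k_def)
    have "M k \<le> 4 ^ g * M k'" unfolding k' by (rule step)
    also have "\<dots> \<le> 4 ^ g * (2 * n)" using less by (intro mult_left_mono) auto
    finally have up: "M k \<le> 4 ^ g * (2 * n)" .
    have ln2: "0 < ln (2::real)" by simp
    have lnn: "ln 2 \<le> ln (real n)" using n by simp
    have "n \<le> 2 ^ (2 * g * k)" using k Mle[of k] by linarith
    from of_nat_mono[OF this, where 'a = real] have "real n \<le> 2 ^ (2 * g * k)" by simp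
    then have "ln (real n) \<le> ln (2 ^ (2 * g * k))" using n by (subst ln_le_cancel_iff) auto
    also have "\<dots> = 2 * real g * ln 2 * real k" by (simp add: ln_realpow)
    also have "\<dots> \<le> 2 * real g * ln 2 * real (k + 1)" using ln2 by (intro mult_left_mono) auto
    finally have lo: "1 / (2 * real g * ln 2) * ln (real n) \<le> real (k + 1)"
      using g ln2 by (simp add: field_simps)
    have "2 ^ k' \<le> 2 * n" using Mge[of k'] less by linarith
    from of_nat_mono[OF this, where 'a = real] have "(2::real) ^ k' \<le> 2 * real n" by simp
    then have "ln (2 ^ k') \<le> ln (2 * real n)" using n by (subst ln_le_cancel_iff) auto
    then have "real k' * ln 2 \<le> ln 2 + ln (real n)" using n by (simp add: ln_realpow ln_mult)
    then have "(real k' + 2) * ln 2 \<le> 4 * ln (real n)" using lnn by (simp add: algebra_simps)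
    then have hi: "real (k + 1) \<le> 4 / ln 2 * ln (real n)" using ln2 by (simp add: k' field_simps)
    from k up lo hi show ?thesis by blast
  qed
  moreover have "0 < 1 / (2 * real g * ln 2)" "0 < 4 / ln (2::real)" using g by simp_all
  ultimately show ?thesis unfolding M_def by blast
qed

text \<open>With \<open>N\<close> scales and \<open>M = N * 2 ^ (g * k)\<close> coefficients the
  right side equals \<open>M powr (- \<nu>) * N powr E\<close>. Here \<open>M\<close> is comparable
  to \<open>n\<close> and \<open>N\<close> to a power \<open>g - 1\<close> of the logarithm, so
  counting the whole layer rather than one scale shifts the exponent of \<open>N\<close> by
  \<open>\<nu>\<close>.\<close>

lemma layer_rate:
  assumes g: "1 \<le> g" and \<nu>: "0 \<le> \<nu>"
  shows "\<exists>c>0. \<forall>n\<ge>2. \<exists>k. 2 * n \<le> (k + 1) ^ (g - 1) * 2 ^ (g * k) \<and>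
    c * real n powr (- \<nu>) * ln (real n) powr ((real g - 1) * E) \<le>
    2 powr (- \<nu> * real (g * k)) * real ((k + 1) ^ (g - 1)) powr (E - \<nu>)"
proof -
  obtain c1 c2 where c: "0 < c1" "0 < c2" and ex: "\<And>n. 2 \<le> n \<Longrightarrow> \<exists>k. 2 * n \<le> (k + 1) ^ (g - 1) * 2 ^ (g * k) \<and>
    (k + 1) ^ (g - 1) * 2 ^ (g * k) \<le> 4 ^ g * (2 * n) \<and>
    c1 * ln (real n) \<le> real (k + 1) \<and> real (k + 1) \<le> c2 * ln (real n)"
    using layer_size_log[OF g] by blast
  define x where "x = (real g - 1) * E"
  define C where "C = (4 ^ g * 2) powr (- \<nu>) * min (c1 powr x) (c2 powr x)"
  have "\<exists>k. 2 * n \<le> (k + 1) ^ (g - 1) * 2 ^ (g * k) \<and> C * real n powr (- \<nu>) * ln (real n) powr x \<le>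
    2 powr (- \<nu> * real (g * k)) * real ((k + 1) ^ (g - 1)) powr (E - \<nu>)" if n: "2 \<le> n" for n
  proof -
    obtain k where k: "2 * n \<le> (k + 1) ^ (g - 1) * 2 ^ (g * k)" "(k + 1) ^ (g - 1) * 2 ^ (g * k) \<le> 4 ^ g * (2 * n)"
      "c1 * ln (real n) \<le> real (k + 1)" "real (k + 1) \<le> c2 * ln (real n)"
      using ex[OF n] by (elim exE conjE) (rule that)
    define N where "N = real ((k + 1) ^ (g - 1))"
    define M where "M = N * 2 ^ (g * k)"
    have N: "0 < N" by (simp add: N_def)
    have lnn: "0 < ln (real n)" using n by simp
    have "M = real ((k + 1) ^ (g - 1) * 2 ^ (g * k))" by (simp add: M_def N_def)
    also have "\<dots> \<le> real (4 ^ g * (2 * n))" using k(2) by (rule of_nat_mono)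
    finally have M: "0 < M" "M \<le> 4 ^ g * 2 * real n" using N by (simp_all add: M_def)
    have "(4 ^ g * 2 * real n) powr (- \<nu>) \<le> M powr (- \<nu>)" using M \<nu> by (intro powr_mono2') auto
    then have 1: "(4 ^ g * 2) powr (- \<nu>) * real n powr (- \<nu>) \<le> M powr (- \<nu>)" by (simp only: powr_mult)
    \<comment> \<open>The sign of \<open>x\<close> is unknown: the lower bound on
      \<open>k + 1\<close> is used for \<open>x \<ge> 0\<close>, the upper bound otherwise.\<close>
    have 2: "min (c1 powr x) (c2 powr x) * ln (real n) powr x \<le> real (k + 1) powr x"
    proof (cases "0 \<le> x")
      case True
      have "min (c1 powr x) (c2 powr x) * ln (real n) powr x \<le> c1 powr x * ln (real n) powr x"
        by (intro mult_right_mono) auto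
      also have "\<dots> = (c1 * ln (real n)) powr x" by (simp only: powr_mult)
      also have "\<dots> \<le> real (k + 1) powr x" using True k(3) c lnn by (intro powr_mono2) auto
      finally show ?thesis .
    next
      case False
      have "min (c1 powr x) (c2 powr x) * ln (real n) powr x \<le> c2 powr x * ln (real n) powr x"
        by (intro mult_right_mono) auto
      also have "\<dots> = (c2 * ln (real n)) powr x" by (simp only: powr_mult)
      also have "\<dots> \<le> real (k + 1) powr x" using False k(4) by (intro powr_mono2') auto
      finally show ?thesis .
    qed
    have Nx: "N powr E = real (k + 1) powr x"
    proof -
      have "N = real (k + 1) powr real (g - 1)" unfolding N_def of_nat_power by (subst powr_realpow) auto
      then show ?thesis using g by (simp add: powr_powr x_def of_nat_diff)
    qed
    have "2 powr (- \<nu> * real (g * k)) * N powr (E - \<nu>) = M powr (- \<nu>) * N powr E"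
    proof -
      have "2 powr (- \<nu> * real (g * k)) = (2 ^ (g * k)) powr (- \<nu>)"
        by (simp add: powr_powr mult.commute powr_realpow[symmetric])
      moreover have "M powr (- \<nu>) = N powr (- \<nu>) * (2 ^ (g * k)) powr (- \<nu>)" by (simp only: M_def powr_mult)
      moreover have "N powr (E - \<nu>) = N powr E * N powr (- \<nu>)" by (simp add: powr_add[symmetric])
      ultimately show ?thesis by (simp only: ac_simps)
    qed
    moreover have "(4 ^ g * 2) powr (- \<nu>) * real n powr (- \<nu>) * (min (c1 powr x) (c2 powr x) * ln (real n) powr x) \<le>
        M powr (- \<nu>) * N powr E"
      unfolding Nx using 1 2 by (intro mult_mono) auto
    ultimately have "C * real n powr (- \<nu>) * ln (real n) powr x \<le> 2 powr (- \<nu> * real (g * k)) * N powr (E - \<nu>)"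
      unfolding C_def by (simp only: ac_simps)
    with k(1) show ?thesis unfolding N_def by blast
  qed
  moreover have "0 < C" using c by (simp add: C_def)
  ultimately show ?thesis unfolding x_def by blast
qed

text \<open>Here each single scale must have more cells than there are points, so
  \<open>2 ^ (g * k)\<close> itself is comparable to \<open>n\<close> and the number of scales
  enters only through its power \<open>E\<close>. As \<open>E\<close> is not negative, a lower bound
  on \<open>k\<close> is enough.\<close>

lemma free_layer_rate:
  assumes g: "1 \<le> g" and \<nu>: "0 \<le> \<nu>" and E: "0 \<le> E"
  shows "\<exists>c>0. \<forall>n\<ge>2. \<exists>k. n < 2 ^ (g * k) \<and>
    c * real n powr (- \<nu>) * ln (real n) powr ((real g - 1) * E) \<le>
    2 powr (- \<nu> * real (g * k)) * real ((k + 1) ^ (g - 1)) powr E"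
proof -
  define x where "x = (real g - 1) * E"
  have x: "0 \<le> x" using g E by (simp add: x_def)
  define c1 where "c1 = 1 / (real g * ln 2)"
  have c1: "0 < c1" using g by (simp add: c1_def)
  define C where "C = (2 ^ g) powr (- \<nu>) * c1 powr x"
  have "\<exists>k. n < 2 ^ (g * k) \<and> C * real n powr (- \<nu>) * ln (real n) powr x \<le>
    2 powr (- \<nu> * real (g * k)) * real ((k + 1) ^ (g - 1)) powr E" if n: "2 \<le> n" for n
  proof -
    define k where "k = (LEAST k. n < 2 ^ (g * k))"
    have "n < 2 ^ n" by (rule less_exp)
    also have "(2::nat) ^ n \<le> 2 ^ (g * n)" using g by (intro power_increasing) auto
    finally have k: "n < 2 ^ (g * k)" unfolding k_def by (rule LeastI)
    have "k \<noteq> 0" using k n by (intro notI) simp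
    then obtain k' where k': "k = Suc k'" by (auto simp: gr0_conv_Suc)
    then have "2 ^ (g * k') \<le> n" using not_less_Least[of k' "\<lambda>k. n < 2 ^ (g * k)"] by (simp add: k_def)
    then have "2 ^ (g * k) \<le> 2 ^ g * n" by (simp add: k' power_add)
    from of_nat_mono[OF this, where 'a = real] have M: "(2::real) ^ (g * k) \<le> 2 ^ g * real n" by simp
    have lnn: "0 < ln (real n)" using n by simp
    from of_nat_mono[OF less_imp_le[OF k], where 'a = real] have "real n \<le> 2 ^ (g * k)" by simp
    then have "ln (real n) \<le> ln (2 ^ (g * k))" using n by (subst ln_le_cancel_iff) auto
    also have "\<dots> = real g * ln 2 * real k" by (simp add: ln_realpow)
    also have "\<dots> \<le> real g * ln 2 * real (k + 1)" by (intro mult_left_mono) auto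
    finally have lo: "c1 * ln (real n) \<le> real (k + 1)" using g by (simp add: c1_def field_simps)
    have "(2 ^ g * real n) powr (- \<nu>) \<le> (2 ^ (g * k)) powr (- \<nu>)" using M \<nu> by (intro powr_mono2') auto
    also have "\<dots> = 2 powr (- \<nu> * real (g * k))"
      by (simp add: powr_powr mult.commute powr_realpow[symmetric])
    finally have 1: "(2 ^ g) powr (- \<nu>) * real n powr (- \<nu>) \<le> 2 powr (- \<nu> * real (g * k))" by (simp only: powr_mult)
    have "(c1 * ln (real n)) powr x \<le> real (k + 1) powr x" using x lo c1 lnn by (intro powr_mono2) auto
    also have "\<dots> = real ((k + 1) ^ (g - 1)) powr E"
    proof -
      have "real ((k + 1) ^ (g - 1)) = real (k + 1) powr real (g - 1)"
        unfolding of_nat_power by (subst powr_realpow) auto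
      then show ?thesis using g by (simp add: powr_powr x_def of_nat_diff)
    qed
    finally have 2: "c1 powr x * ln (real n) powr x \<le> real ((k + 1) ^ (g - 1)) powr E" by (simp only: powr_mult)
    have "(2 ^ g) powr (- \<nu>) * real n powr (- \<nu>) * (c1 powr x * ln (real n) powr x) \<le>
        2 powr (- \<nu> * real (g * k)) * real ((k + 1) ^ (g - 1)) powr E"
      using 1 2 by (intro mult_mono) auto
    then have "C * real n powr (- \<nu>) * ln (real n) powr x \<le>
        2 powr (- \<nu> * real (g * k)) * real ((k + 1) ^ (g - 1)) powr E"
      unfolding C_def by (simp only: ac_simps)
    with k show ?thesis by blast
  qed
  moreover have "0 < C" using c1 by (simp add: C_def)
  ultimately show ?thesis unfolding x_def by blast
qed

section \<open>Sums of rescaled bumps\<close>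

text \<open>\<open>F j i\<close> is the derivative of order \<open>i\<close> of the bump in
  coordinate \<open>j\<close>. The primitive \<open>G j\<close> of \<open>F j (lam j)\<close>
  vanishes at both ends, which encodes mean zero, and its value at 1/2 is the pairing with the Haar
  function up to a factor. \<open>e\<close> and \<rho> are corner and side of the cube that carries
  all bumps.\<close>

locale bump_system =
  fixes F :: "'n::finite \<Rightarrow> nat \<Rightarrow> real \<Rightarrow> real" and G :: "'n \<Rightarrow> real \<Rightarrow> real"
    and l lam :: "'n \<Rightarrow> nat" and \<alpha> :: "'n \<Rightarrow> real" and e :: "'n \<Rightarrow> real" and \<rho> :: real
  assumes F_der: "i < l j \<Longrightarrow> (F j i has_real_derivative F j (Suc i) t) (at t)"
    and F_cont: "i \<le> l j \<Longrightarrow> continuous_on UNIV (F j i)"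
    and F_van: "t \<le> 0 \<or> 1 \<le> t \<Longrightarrow> F j i t = 0"
    and G_der: "(G j has_real_derivative F j (lam j) t) (at t)"
    and G_van: "t \<le> 0 \<or> 1 \<le> t \<Longrightarrow> G j t = 0"
    and G_half: "G j (1/2) \<noteq> 0"
    and \<alpha>_pos: "0 < \<alpha> j" and \<alpha>_less: "\<alpha> j < real (l j)" and lam_less: "real (lam j) < \<alpha> j"
    and \<rho>_pos: "0 < \<rho>"
begin

definition \<beta> :: "nat \<Rightarrow> real" where "\<beta> i = 2 ^ i / \<rho>"

definition loc :: "('n \<Rightarrow> nat) \<Rightarrow> ('n \<Rightarrow> nat) \<Rightarrow> real^'n \<Rightarrow> 'n \<Rightarrow> real" where
  "loc \<kappa> \<nu> x j = \<beta> (\<kappa> j) * (x $ j - e j) - real (\<nu> j)"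

definition V :: "('n \<Rightarrow> nat) \<Rightarrow> ('n \<Rightarrow> nat) set" where
  "V \<kappa> = {\<nu>. \<forall>j. \<nu> j < 2 ^ \<kappa> j}"

definition wav :: "('n \<Rightarrow> nat) \<Rightarrow> ('n \<Rightarrow> nat) \<Rightarrow> ('n \<Rightarrow> nat) \<Rightarrow> real^'n \<Rightarrow> real" where
  "wav \<iota> \<kappa> \<nu> x = (\<Prod>j\<in>UNIV. F j (\<iota> j) (loc \<kappa> \<nu> x j))"

text \<open>The \<open>\<iota>\<close>-th derivative of the sum of rescaled bumps; the factor \<open>\<beta> powr (- \<alpha>)\<close> normalises
  the smoothness of order \<open>\<alpha>\<close>.\<close>

definition synth :: "('n \<Rightarrow> nat) \<Rightarrow> ('n \<Rightarrow> nat) set \<Rightarrow> (('n \<Rightarrow> nat) \<Rightarrow> ('n \<Rightarrow> nat) \<Rightarrow> real) \<Rightarrow> real^'n \<Rightarrow> real" where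
  "synth \<iota> A a x = (\<Sum>\<kappa>\<in>A. \<Sum>\<nu>\<in>V \<kappa>.
     (\<Prod>j\<in>UNIV. \<beta> (\<kappa> j) powr (- \<alpha> j) * \<beta> (\<kappa> j) ^ \<iota> j) * a \<kappa> \<nu> * wav \<iota> \<kappa> \<nu> x)"

definition corner :: "real^'n" where "corner = (\<chi> j. e j)"

definition cube :: "(real^'n) set" where "cube = cbox corner (corner + (\<chi> j. \<rho>))"

lemma \<beta>_pos[simp]: "0 < \<beta> i" "0 \<le> \<beta> i" "\<beta> i \<noteq> 0"
  using \<rho>_pos by (simp_all add: \<beta>_def)

lemma lam_less_l: "lam j < l j"
  using lam_less[of j] \<alpha>_less[of j] by linarith

lemma V_PiE: "V \<kappa> = PiE UNIV (\<lambda>j. {..<2 ^ \<kappa> j})"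
  by (auto simp: V_def PiE_def Pi_def extensional_def)

lemma finite_V[simp]: "finite (V \<kappa>)"
  unfolding V_PiE by (intro finite_PiE) auto

lemma card_V: "card (V \<kappa>) = 2 ^ (\<Sum>j\<in>UNIV. \<kappa> j)"
  unfolding V_PiE by (subst card_PiE) (auto simp: power_sum)

lemma loc_outside:
  assumes "\<nu> \<in> V \<kappa>" "x \<notin> cube"
  shows "\<exists>j. loc \<kappa> \<nu> x j < 0 \<or> 1 < loc \<kappa> \<nu> x j"
proof -
  have "\<exists>j. \<not> (e j \<le> x $ j \<and> x $ j \<le> e j + \<rho>)"
    using assms(2) unfolding cube_def corner_def mem_box_cart by auto
  then obtain j where j: "x $ j < e j \<or> e j + \<rho> < x $ j" by (metis not_le)
  have \<nu>: "real (\<nu> j) + 1 \<le> 2 ^ \<kappa> j"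
  proof -
    have "Suc (\<nu> j) \<le> 2 ^ \<kappa> j" using assms(1) by (simp add: V_def Suc_le_eq)
    then show ?thesis by (metis of_nat_Suc of_nat_le_iff of_nat_numeral of_nat_power add.commute)
  qed
  from j show ?thesis
  proof
    assume "x $ j < e j"
    then have "\<beta> (\<kappa> j) * (x $ j - e j) < 0" by (intro mult_pos_neg) auto
    then show ?thesis by (intro exI[of _ j]) (simp add: loc_def)
  next
    assume "e j + \<rho> < x $ j"
    then have "\<beta> (\<kappa> j) * \<rho> < \<beta> (\<kappa> j) * (x $ j - e j)" by (intro mult_strict_left_mono) auto
    then show ?thesis using \<nu> \<rho>_pos by (intro exI[of _ j]) (simp add: loc_def \<beta>_def)
  qed
qed

lemma wav_outside:
  assumes "\<nu> \<in> V \<kappa>" "x \<notin> cube"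
  shows "wav \<iota> \<kappa> \<nu> x = 0"
proof -
  from loc_outside[OF assms] obtain j where "loc \<kappa> \<nu> x j < 0 \<or> 1 < loc \<kappa> \<nu> x j" by blast
  then have "F j (\<iota> j) (loc \<kappa> \<nu> x j) = 0" by (intro F_van) linarith
  then show ?thesis unfolding wav_def by (intro prod_zero) auto
qed

lemma synth_outside: "x \<notin> cube \<Longrightarrow> synth \<iota> A a x = 0"
  unfolding synth_def by (intro sum.neutral ballI) (simp add: wav_outside)

lemma continuous_wav:
  assumes "\<And>j. \<iota> j \<le> l j"
  shows "continuous_on UNIV (wav \<iota> \<kappa> \<nu>)"
proof -
  have "continuous_on UNIV (\<lambda>x. F j (\<iota> j) (loc \<kappa> \<nu> x j))" for j
    by (rule continuous_on_compose2[OF F_cont[OF assms, of j]])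
      (auto simp: loc_def intro!: continuous_intros)
  then show ?thesis unfolding wav_def[abs_def] by (intro continuous_intros) auto
qed

lemma continuous_synth:
  assumes "\<And>j. \<iota> j \<le> l j"
  shows "continuous_on UNIV (synth \<iota> A a)"
  unfolding synth_def[abs_def] by (intro continuous_intros continuous_wav assms)

lemma integrable_synth:
  assumes "\<And>j. \<iota> j \<le> l j"
  shows "integrable lborel (synth \<iota> A a)"
  using continuous_synth[OF assms] synth_outside
  by (intro integrable_continuous_vanishing[of _ corner "corner + (\<chi> j. \<rho>)"]) (auto simp: cube_def)

lemma wav_axis_derivative:
  assumes "\<iota> j < l j"
  shows "((\<lambda>s. wav \<iota> \<kappa> \<nu> (x + s *\<^sub>R axis j 1)) has_real_derivative
    \<beta> (\<kappa> j) * wav (\<iota>(j := Suc (\<iota> j))) \<kappa> \<nu> x) (at 0)"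
proof -
  define R where "R = (\<Prod>i\<in>UNIV-{j}. F i (\<iota> i) (loc \<kappa> \<nu> x i))"
  have 1: "wav \<iota> \<kappa> \<nu> (x + s *\<^sub>R axis j 1) = F j (\<iota> j) (\<beta> (\<kappa> j) * s + loc \<kappa> \<nu> x j) * R" for s
    unfolding wav_def R_def
    by (subst prod.remove[of _ j]) (auto simp: loc_def axis_def algebra_simps intro!: prod.cong)
  have 2: "wav (\<iota>(j := Suc (\<iota> j))) \<kappa> \<nu> x = F j (Suc (\<iota> j)) (loc \<kappa> \<nu> x j) * R"
    unfolding wav_def R_def by (subst prod.remove[of _ j]) (auto intro!: prod.cong)
  have "((\<lambda>s. F j (\<iota> j) (\<beta> (\<kappa> j) * s + loc \<kappa> \<nu> x j)) has_real_derivative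
      F j (Suc (\<iota> j)) (\<beta> (\<kappa> j) * 0 + loc \<kappa> \<nu> x j) * \<beta> (\<kappa> j)) (at 0)"
    by (rule DERIV_chain2[OF F_der[OF assms]]) (auto intro!: derivative_eq_intros)
  then have "((\<lambda>s. F j (\<iota> j) (\<beta> (\<kappa> j) * s + loc \<kappa> \<nu> x j) * R) has_real_derivative
      F j (Suc (\<iota> j)) (\<beta> (\<kappa> j) * 0 + loc \<kappa> \<nu> x j) * \<beta> (\<kappa> j) * R) (at 0)"
    by (rule DERIV_cmult_right)
  then show ?thesis unfolding 1 2 by (simp add: mult_ac)
qed

lemma synth_axis_derivative:
  assumes "\<iota> j < l j"
  shows "((\<lambda>s. synth \<iota> A a (x + s *\<^sub>R axis j 1)) has_real_derivative
    synth (\<iota>(j := Suc (\<iota> j))) A a x) (at 0)"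
proof -
  have c: "(\<Prod>i\<in>UNIV. \<beta> (\<kappa> i) powr (- \<alpha> i) * \<beta> (\<kappa> i) ^ (\<iota>(j := Suc (\<iota> j))) i) =
      (\<Prod>i\<in>UNIV. \<beta> (\<kappa> i) powr (- \<alpha> i) * \<beta> (\<kappa> i) ^ \<iota> i) * \<beta> (\<kappa> j)" for \<kappa>
    unfolding prod.distrib
    by (subst prod.remove[of _ j], simp, simp, subst (4) prod.remove[of _ j]) (auto intro!: prod.cong)
  show ?thesis
    unfolding synth_def c
    by (intro DERIV_sum, rule DERIV_cong[OF DERIV_cmult[OF wav_axis_derivative[of \<iota> j, OF assms]]])
      (simp add: mult_ac)
qed

text \<open>Derivatives move one by one from the test function to the bump sum, and
  \<open>\<iota>\<close> records those already moved. The hypothesis keeps every order within the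
  \<open>l j\<close> derivatives that the bumps have.\<close>

lemma integral_synth_pd_list:
  assumes "smooth_fun \<phi>" "\<And>j. \<iota> j + count_list js j \<le> l j"
  shows "(\<integral>x. synth \<iota> A a x * pd_list js \<phi> x \<partial>lborel) =
    (-1) ^ length js * (\<integral>x. synth (\<lambda>j. \<iota> j + count_list js j) A a x * \<phi> x \<partial>lborel)"
  using assms(2)
proof (induction js arbitrary: \<iota>)
  case Nil
  then show ?case by simp
next
  case (Cons j js)
  have lj: "\<iota> j < l j" using Cons.prems[of j] by simp
  have \<iota>l: "\<iota> i \<le> l i" "(\<iota>(j := Suc (\<iota> j))) i \<le> l i" for i
    using Cons.prems[of i] lj by (auto split: if_splits)
  have le: "(\<iota>(j := Suc (\<iota> j))) i + count_list js i \<le> l i" for i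
    using Cons.prems[of i] by (auto split: if_splits)
  have cont_pd: "continuous_on UNIV (pd_list ks \<phi>)" for ks using assms(1) by (simp add: smooth_fun_def)
  have der_pd: "((\<lambda>s. pd_list js \<phi> (x + s *\<^sub>R axis j 1)) has_real_derivative pd_list (j # js) \<phi> x) (at 0)" for x
  proof -
    have "(\<lambda>s. pd_list js \<phi> (x + s *\<^sub>R axis j 1)) differentiable (at 0)"
      using assms(1) by (simp add: smooth_fun_def)
    then show ?thesis by (simp add: pd_def DERIV_deriv_iff_real_differentiable)
  qed
  have "(\<integral>x. synth \<iota> A a x * pd_list (j # js) \<phi> x \<partial>lborel) =
      - (\<integral>x. synth (\<iota>(j := Suc (\<iota> j))) A a x * pd_list js \<phi> x \<partial>lborel)"
  proof (rule integral_by_parts_axis)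
    show "((\<lambda>s. synth \<iota> A a (x + s *\<^sub>R axis j 1)) has_real_derivative synth (\<iota>(j := Suc (\<iota> j))) A a x) (at 0)" for x
      by (rule synth_axis_derivative[of \<iota> j, OF lj])
    show "((\<lambda>s. pd_list js \<phi> (x + s *\<^sub>R axis j 1)) has_real_derivative pd_list (j # js) \<phi> x) (at 0)" for x
      by (rule der_pd)
    show "synth \<iota> A a x = 0" "synth (\<iota>(j := Suc (\<iota> j))) A a x = 0"
      if "x \<notin> cbox corner (corner + (\<chi> j. \<rho>))" for x
      using that by (simp_all add: synth_outside cube_def)
  qed (use \<iota>l cont_pd continuous_synth in blast)+
  also have "\<dots> = - ((-1) ^ length js *
      (\<integral>x. synth (\<lambda>i. (\<iota>(j := Suc (\<iota> j))) i + count_list js i) A a x * \<phi> x \<partial>lborel))"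
    by (simp only: Cons.IH[OF le])
  also have "(\<lambda>i. (\<iota>(j := Suc (\<iota> j))) i + count_list js i) = (\<lambda>i. \<iota> i + count_list (j # js) i)"
    by (auto simp: fun_eq_iff)
  finally show ?case by simp
qed

lemma weak_deriv_synth:
  assumes "cube \<subseteq> D"
  shows "weak_deriv D lam (synth (\<lambda>_. 0) A a) (synth lam A a)"
  unfolding weak_deriv_def
proof (intro conjI allI impI)
  have lam_l: "lam j \<le> l j" for j using lam_less_l[of j] by simp
  \<comment> \<open>All bumps live in the cube inside \<open>D\<close>, so integrals over
    \<open>D\<close> are integrals over the whole space and integration by parts has no boundary
    terms.\<close>
  have D0: "indicator D x * (synth \<iota> A a x * y) = synth \<iota> A a x * y" for \<iota> x and y :: real
    using assms by (cases "x \<in> cube") (auto simp: synth_outside)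
  show "set_borel_measurable lborel D (synth lam A a)"
  proof -
    have "(\<lambda>x. indicator D x *\<^sub>R synth lam A a x) = synth lam A a"
      using D0[of _ lam 1] by (simp add: fun_eq_iff)
    then show ?thesis using integrable_synth[OF lam_l] by (simp add: set_borel_measurable_def)
  qed
  show "set_integrable lborel C (synth lam A a)" if "compact C \<and> C \<subseteq> D" for C
    unfolding set_integrable_def using that
    by (intro integrable_mult_indicator integrable_synth lam_l) (auto simp: borel_compact)
  fix \<phi> js assume \<phi>: "test_fun D \<phi>" and js: "\<forall>j. count_list js j = lam j"
  have len: "length js = (\<Sum>j\<in>UNIV. lam j)"
    using sum_count_set[of js UNIV] js by simp
  have "(\<integral>x. synth (\<lambda>_. 0) A a x * pd_list js \<phi> x \<partial>lborel) =
    (-1) ^ length js * (\<integral>x. synth (\<lambda>j. 0 + count_list js j) A a x * \<phi> x \<partial>lborel)"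
    by (rule integral_synth_pd_list) (use \<phi> js lam_l in \<open>auto simp: test_fun_def\<close>)
  also have "(\<lambda>j. 0 + count_list js j) = lam" using js by auto
  finally show "(\<integral>x. indicator D x * (synth (\<lambda>_. 0) A a x * pd_list js \<phi> x) \<partial>lborel) =
      (-1) ^ (\<Sum>j\<in>UNIV. lam j) * (\<integral>x. indicator D x * (synth lam A a x * \<phi> x) \<partial>lborel)"
    by (simp only: D0 len)
qed

section \<open>Pairing the derivative with signed Haar sums\<close>

definition hsum :: "(('n \<Rightarrow> nat) \<times> ('n \<Rightarrow> nat)) set \<Rightarrow> (('n \<Rightarrow> nat) \<Rightarrow> ('n \<Rightarrow> nat) \<Rightarrow> real) \<Rightarrow> real^'n \<Rightarrow> real" where
  "hsum S a x = (\<Sum>(\<kappa>, \<nu>)\<in>S. sgn (a \<kappa> \<nu>) * (\<Prod>j\<in>UNIV. haar (loc \<kappa> \<nu> x j)))"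

lemma integrable_bump_haar:
  assumes "i \<le> l j"
  shows "integrable lborel (\<lambda>t. F j i (\<beta> k * (t - e j) - s) * haar (\<beta> k' * (t - e j) - s'))"
proof (rule Bochner_Integration.integrable_bound)
  show "integrable lborel (\<lambda>t. F j i (\<beta> k * (t - e j) - s))"
  proof (rule integrable_continuous_vanishing[of _ "e j + s / \<beta> k" "e j + (s + 1) / \<beta> k"])
    show "continuous_on UNIV (\<lambda>t. F j i (\<beta> k * (t - e j) - s))"
      by (rule continuous_on_compose2[OF F_cont[OF assms]]) (auto intro!: continuous_intros)
    fix t assume "t \<notin> cbox (e j + s / \<beta> k) (e j + (s + 1) / \<beta> k)"
    then have "t < e j + s / \<beta> k \<or> e j + (s + 1) / \<beta> k < t" by auto
    then have "\<beta> k * (t - e j) - s \<le> 0 \<or> 1 \<le> \<beta> k * (t - e j) - s"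
      by (auto simp: field_simps)
    then show "F j i (\<beta> k * (t - e j) - s) = 0" by (rule F_van)
  qed
  then have [measurable]: "(\<lambda>t. F j i (\<beta> k * (t - e j) - s)) \<in> borel_measurable borel" by auto
  show "(\<lambda>t. F j i (\<beta> k * (t - e j) - s) * haar (\<beta> k' * (t - e j) - s')) \<in> borel_measurable lborel"
    by measurable
  show "AE t in lborel. norm (F j i (\<beta> k * (t - e j) - s) * haar (\<beta> k' * (t - e j) - s')) \<le>
      norm (F j i (\<beta> k * (t - e j) - s))"
    by (auto simp: haar_def abs_mult)
qed

text \<open>If two different scales have the same total, neither dominates the other, so in some
  coordinate the bump is strictly finer than the Haar function and that factor of the integral
  vanishes. A coordinate where the bump is coarser would give no control, which is why totals must
  agree.\<close>

lemma integral_wav_haar: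
  assumes "(\<Sum>j\<in>UNIV. \<kappa> j) = (\<Sum>j\<in>UNIV. \<kappa>' j)"
  shows "(\<integral>x. wav lam \<kappa> \<nu> x * (\<Prod>j\<in>UNIV. haar (loc \<kappa>' \<nu>' x j)) \<partial>lborel) =
      (if (\<kappa>, \<nu>) = (\<kappa>', \<nu>') then \<Prod>j\<in>UNIV. 2 * G j (1/2) / \<beta> (\<kappa> j) else 0)" (is ?eq)
    and "integrable lborel (\<lambda>x. wav lam \<kappa> \<nu> x * (\<Prod>j\<in>UNIV. haar (loc \<kappa>' \<nu>' x j)))" (is ?int)
proof -
  define f where "f j t = F j (lam j) (\<beta> (\<kappa> j) * (t - e j) - real (\<nu> j)) * haar (\<beta> (\<kappa>' j) * (t - e j) - real (\<nu>' j))" for j t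
  have f: "integrable lborel (f j)" for j
    unfolding f_def using lam_less_l[of j] by (intro integrable_bump_haar) auto
  have eq: "wav lam \<kappa> \<nu> x * (\<Prod>j\<in>UNIV. haar (loc \<kappa>' \<nu>' x j)) = (\<Prod>j\<in>UNIV. f j (x $ j))" for x
    by (simp add: wav_def loc_def f_def prod.distrib)
  show ?int unfolding eq by (rule integral_cart_prod(2)[OF f])
  have "(\<integral>x. wav lam \<kappa> \<nu> x * (\<Prod>j\<in>UNIV. haar (loc \<kappa>' \<nu>' x j)) \<partial>lborel) = (\<Prod>j\<in>UNIV. \<integral>t. f j t \<partial>lborel)"
    unfolding eq by (rule integral_cart_prod(1)[OF f])
  also have "\<dots> = (if (\<kappa>, \<nu>) = (\<kappa>', \<nu>') then \<Prod>j\<in>UNIV. 2 * G j (1/2) / \<beta> (\<kappa> j) else 0)"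
  proof -
    have cont: "continuous_on UNIV (F j (lam j))" for j using lam_less_l[of j] by (intro F_cont) auto
    have int_f: "(\<integral>t. f j t \<partial>lborel) = (if \<kappa> j = \<kappa>' j \<and> \<nu> j = \<nu>' j then 2 * G j (1/2) / \<beta> (\<kappa> j) else 0)"
      if "\<kappa>' j \<le> \<kappa> j" for j
      unfolding f_def \<beta>_def
      by (subst integral_wavelet_haar[OF G_der cont G_van F_van \<rho>_pos that]) (auto simp: mult_ac)
    show ?thesis
    proof (cases "(\<kappa>, \<nu>) = (\<kappa>', \<nu>')")
      case True
      then show ?thesis using int_f by simp
    next
      case False
      have "\<exists>j. (\<integral>t. f j t \<partial>lborel) = 0"
      proof (cases "\<kappa> = \<kappa>'")
        case True
        with False obtain j where "\<nu> j \<noteq> \<nu>' j" by auto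
        then show ?thesis using int_f[of j] True by auto
      next
        case False
        have "\<exists>j. \<kappa>' j < \<kappa> j"
        proof (rule ccontr)
          assume "\<not> ?thesis"
          then have le: "\<kappa> j \<le> \<kappa>' j" for j by (meson not_le)
          obtain j where "\<kappa> j \<noteq> \<kappa>' j" using False by auto
          with le[of j] have "\<kappa> j < \<kappa>' j" by simp
          then have "(\<Sum>j\<in>UNIV. \<kappa> j) < (\<Sum>j\<in>UNIV. \<kappa>' j)" using le by (intro sum_strict_mono_ex1) auto
          with assms show False by simp
        qed
        then obtain j where "\<kappa>' j < \<kappa> j" by blast
        then show ?thesis using int_f[of j] by auto
      qed
      then have "(\<Prod>j\<in>UNIV. \<integral>t. f j t \<partial>lborel) = 0" by (metis UNIV_I finite_class.finite_UNIV prod_zero)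
      then show ?thesis using False by auto
    qed
  qed
  finally show ?eq .
qed

text \<open>Only the diagonal survives, and the signs in \<open>hsum\<close> turn coefficients into
  their moduli. The bump sum keeps all coefficients, while the dual sum may be restricted to a set
  \<open>S\<close> of useful ones.\<close>

lemma integral_synth_hsum:
  assumes A: "finite A" "\<And>\<kappa>. \<kappa> \<in> A \<Longrightarrow> (\<Sum>j\<in>UNIV. \<kappa> j) = k" and S: "S \<subseteq> Sigma A V"
  shows "(\<integral>x. synth lam A a x * hsum S a x \<partial>lborel) = (\<Sum>(\<kappa>, \<nu>)\<in>S. \<bar>a \<kappa> \<nu>\<bar> *
      (\<Prod>j\<in>UNIV. \<beta> (\<kappa> j) powr (- \<alpha> j) * \<beta> (\<kappa> j) ^ lam j * (2 * G j (1/2) / \<beta> (\<kappa> j))))" (is ?eq)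
    and "integrable lborel (\<lambda>x. synth lam A a x * hsum S a x)" (is ?int)
proof -
  define c where "c \<kappa> = (\<Prod>j\<in>UNIV. \<beta> (\<kappa> j) powr (- \<alpha> j) * \<beta> (\<kappa> j) ^ lam j)" for \<kappa>
  define T where "T = Sigma A V"
  have fin: "finite T" "finite S" using A S by (auto simp: T_def intro: finite_subset[OF S] finite_SigmaI)
  define f where "f \<sigma> \<tau> x = c (fst \<sigma>) * a (fst \<sigma>) (snd \<sigma>) * sgn (a (fst \<tau>) (snd \<tau>)) *
    (wav lam (fst \<sigma>) (snd \<sigma>) x * (\<Prod>j\<in>UNIV. haar (loc (fst \<tau>) (snd \<tau>) x j)))" for \<sigma> \<tau> x
  have eq: "synth lam A a x * hsum S a x = (\<Sum>\<sigma>\<in>T. \<Sum>\<tau>\<in>S. f \<sigma> \<tau> x)" for x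
  proof -
    have "synth lam A a x = (\<Sum>\<sigma>\<in>T. c (fst \<sigma>) * a (fst \<sigma>) (snd \<sigma>) * wav lam (fst \<sigma>) (snd \<sigma>) x)"
      unfolding synth_def c_def T_def using A(1) by (subst sum.Sigma) (auto simp: case_prod_beta)
    moreover have "hsum S a x = (\<Sum>\<tau>\<in>S. sgn (a (fst \<tau>) (snd \<tau>)) * (\<Prod>j\<in>UNIV. haar (loc (fst \<tau>) (snd \<tau>) x j)))"
      by (simp add: hsum_def case_prod_beta)
    ultimately show ?thesis by (simp add: sum_product f_def mult_ac)
  qed
  have sumk: "(\<Sum>j\<in>UNIV. fst \<sigma> j) = (\<Sum>j\<in>UNIV. fst \<tau> j)" if "\<sigma> \<in> T" "\<tau> \<in> S" for \<sigma> \<tau>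
    using that A(2) S by (auto simp: T_def)
  have int: "integrable lborel (f \<sigma> \<tau>)" if "\<sigma> \<in> T" "\<tau> \<in> S" for \<sigma> \<tau>
    unfolding f_def by (intro integrable_mult_right integral_wav_haar(2) sumk that)
  show ?int unfolding eq by (intro Bochner_Integration.integrable_sum int)
  have val: "(\<integral>x. f \<sigma> \<tau> x \<partial>lborel) = (if \<sigma> = \<tau> then \<bar>a (fst \<tau>) (snd \<tau>)\<bar> *
     (\<Prod>j\<in>UNIV. \<beta> (fst \<tau> j) powr (- \<alpha> j) * \<beta> (fst \<tau> j) ^ lam j * (2 * G j (1/2) / \<beta> (fst \<tau> j))) else 0)"
    if "\<sigma> \<in> T" "\<tau> \<in> S" for \<sigma> \<tau>
  proof -
    have "(\<Prod>j\<in>UNIV. \<beta> (\<kappa> j) powr (- \<alpha> j) * \<beta> (\<kappa> j) ^ lam j * (2 * G j (1/2) / \<beta> (\<kappa> j))) =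
        c \<kappa> * (\<Prod>j\<in>UNIV. 2 * G j (1/2) / \<beta> (\<kappa> j))" for \<kappa>
      by (simp only: c_def prod.distrib)
    then show ?thesis
      unfolding f_def using integral_wav_haar(1)[OF sumk[OF that], of "snd \<sigma>" "snd \<tau>"]
      by (auto simp: prod_eq_iff abs_sgn)
  qed
  have "(\<integral>x. synth lam A a x * hsum S a x \<partial>lborel) = (\<Sum>\<sigma>\<in>T. \<Sum>\<tau>\<in>S. \<integral>x. f \<sigma> \<tau> x \<partial>lborel)"
    unfolding eq using int by (simp add: Bochner_Integration.integral_sum Bochner_Integration.integrable_sum)
  also have "\<dots> = (\<Sum>\<tau>\<in>S. \<Sum>\<sigma>\<in>T. \<integral>x. f \<sigma> \<tau> x \<partial>lborel)" by (rule sum.swap)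
  also have "\<dots> = (\<Sum>\<tau>\<in>S. \<bar>a (fst \<tau>) (snd \<tau>)\<bar> *
     (\<Prod>j\<in>UNIV. \<beta> (fst \<tau> j) powr (- \<alpha> j) * \<beta> (fst \<tau> j) ^ lam j * (2 * G j (1/2) / \<beta> (fst \<tau> j))))"
  proof (rule sum.cong[OF refl])
    fix \<tau> assume \<tau>: "\<tau> \<in> S"
    then have "\<tau> \<in> T" using S by (auto simp: T_def)
    then show "(\<Sum>\<sigma>\<in>T. \<integral>x. f \<sigma> \<tau> x \<partial>lborel) = \<bar>a (fst \<tau>) (snd \<tau>)\<bar> *
     (\<Prod>j\<in>UNIV. \<beta> (fst \<tau> j) powr (- \<alpha> j) * \<beta> (fst \<tau> j) ^ lam j * (2 * G j (1/2) / \<beta> (fst \<tau> j)))"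
      using fin \<tau> by (simp add: val sum.delta)
  qed
  finally show ?eq by (simp add: case_prod_beta)
qed

section \<open>Lower bound for the derivative\<close>

definition sign_coeff :: "(('n \<Rightarrow> nat) \<times> ('n \<Rightarrow> nat)) set \<Rightarrow> (('n \<Rightarrow> nat) \<Rightarrow> ('n \<Rightarrow> nat) \<Rightarrow> real) \<Rightarrow>
    ('n \<Rightarrow> nat) \<Rightarrow> ('n \<Rightarrow> nat) \<Rightarrow> real" where
  "sign_coeff S a \<kappa> \<nu> = (if (\<kappa>, \<nu>) \<in> S then sgn (a \<kappa> \<nu>) else 0)"

definition grid_index :: "nat \<Rightarrow> real^'n \<Rightarrow> 'n \<Rightarrow> nat" where
  "grid_index K x j = nat \<lfloor>\<beta> K * (x $ j - e j)\<rfloor>"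

lemma hsum_outside:
  assumes "S \<subseteq> Sigma A V" "\<not> (\<forall>j. 0 \<le> x $ j - e j \<and> x $ j - e j < \<rho>)"
  shows "hsum S a x = 0"
  unfolding hsum_def
proof (intro sum.neutral ballI, clarify)
  fix \<kappa> \<nu> assume "(\<kappa>, \<nu>) \<in> S"
  then have \<nu>V: "\<nu> \<in> V \<kappa>" using assms(1) by auto
  obtain j where j: "x $ j - e j < 0 \<or> \<rho> \<le> x $ j - e j" using assms(2) by (metis not_le)
  have "Suc (\<nu> j) \<le> 2 ^ \<kappa> j" using \<nu>V by (simp add: V_def Suc_le_eq)
  then have \<nu>: "real (\<nu> j) + 1 \<le> 2 ^ \<kappa> j"
    by (metis of_nat_Suc of_nat_le_iff of_nat_numeral of_nat_power add.commute)
  have "loc \<kappa> \<nu> x j < 0 \<or> 1 \<le> loc \<kappa> \<nu> x j"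
    using j
  proof
    assume "x $ j - e j < 0"
    then have "\<beta> (\<kappa> j) * (x $ j - e j) < 0" by (intro mult_pos_neg) auto
    then show ?thesis by (simp add: loc_def)
  next
    assume "\<rho> \<le> x $ j - e j"
    then have "\<beta> (\<kappa> j) * \<rho> \<le> \<beta> (\<kappa> j) * (x $ j - e j)" by (intro mult_left_mono) auto
    then show ?thesis using \<nu> \<rho>_pos by (simp add: loc_def \<beta>_def)
  qed
  then have "haar (loc \<kappa> \<nu> x j) = 0" by (auto simp: haar_def)
  then have "(\<Prod>j\<in>UNIV. haar (loc \<kappa> \<nu> x j)) = 0" by (intro prod_zero) auto
  then show "sgn (a \<kappa> \<nu>) * (\<Prod>j\<in>UNIV. haar (loc \<kappa> \<nu> x j)) = 0" by simp
qed

lemma grid_index_cell: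
  assumes "\<And>j. 0 \<le> x $ j - e j" "\<And>j. x $ j - e j < \<rho>"
  shows "grid_index K x \<in> dgrid K" "\<beta> K * (x $ j - e j) - real (grid_index K x j) \<in> {0..<1}"
proof -
  have 0: "0 \<le> \<beta> K * (x $ j - e j)" for j using assms by simp
  have fl: "real (grid_index K x j) = of_int \<lfloor>\<beta> K * (x $ j - e j)\<rfloor>" for j
    unfolding grid_index_def by (rule of_nat_nat) (use 0[of j] in simp)
  show "\<beta> K * (x $ j - e j) - real (grid_index K x j) \<in> {0..<1}"
    unfolding fl by (simp; linarith)
  have "real (grid_index K x j) < 2 ^ K" for j
  proof -
    have "\<beta> K * (x $ j - e j) < \<beta> K * \<rho>" using assms by (intro mult_strict_left_mono) auto
    also have "\<dots> = 2 ^ K" using \<rho>_pos by (simp add: \<beta>_def)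
    finally show ?thesis unfolding fl by linarith
  qed
  then have "real (grid_index K x j) < real (2 ^ K)" for j by simp
  then show "grid_index K x \<in> dgrid K" unfolding dgrid_def by (simp only: of_nat_less_iff) simp
qed

lemma haar_loc_grid:
  assumes "0 \<le> x $ j - e j" "\<kappa> j < K"
  shows "haar (loc \<kappa> \<nu> x j) = (if grid_index K x j div 2 ^ (K - \<kappa> j) = \<nu> j
     then rad (grid_index K x j div 2 ^ (K - Suc (\<kappa> j))) else 0)"
proof -
  define T where "T = \<beta> K * (x $ j - e j)"
  have "\<beta> (\<kappa> j) = \<beta> K / 2 ^ (K - \<kappa> j)"
    using assms(2) by (simp add: \<beta>_def power_diff)
  then have 1: "\<beta> (\<kappa> j) * (x $ j - e j) = T / 2 ^ (K - \<kappa> j)" by (simp add: T_def)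
  have "(2::real) ^ (K - \<kappa> j) = 2 * 2 ^ (K - Suc (\<kappa> j))"
    using assms(2) by (metis Suc_diff_Suc power_Suc)
  then have 2: "2 * (T / 2 ^ (K - \<kappa> j)) = T / 2 ^ (K - Suc (\<kappa> j))" by simp
  have "0 \<le> T / 2 ^ (K - \<kappa> j)" using assms by (simp add: T_def)
  from haar_dyadic[OF this, of "\<nu> j"] show ?thesis
    unfolding loc_def 1 2 nat_floor_div_power2 grid_index_def T_def[symmetric] .
qed

text \<open>With \<open>K\<close> larger than every \<open>\<kappa> j\<close> even the halves of the
  cells are unions of cells of the grid of level \<open>K\<close>. So the Haar sum is constant on
  these, at most one \<open>\<nu>\<close> per scale contributes, and the discrete square function
  inequality applies to its integrals.\<close>

lemma hsum_eq_layers: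
  assumes A: "finite A" "\<forall>\<kappa>\<in>A. \<forall>j. \<kappa> j < K" and S: "S \<subseteq> Sigma A V"
    and x: "\<And>j. 0 \<le> x $ j - e j" "\<And>j. x $ j - e j < \<rho>"
  shows "hsum S a x = (\<Sum>\<kappa>\<in>A. haar_layer K (sign_coeff S a) \<kappa> (grid_index K x))"
proof -
  define z where "z = grid_index K x"
  define p where "p \<kappa> j = z j div 2 ^ (K - \<kappa> j)" for \<kappa> :: "'n \<Rightarrow> nat" and j
  have z: "z \<in> dgrid K" unfolding z_def by (rule grid_index_cell(1)[OF x])
  have AK: "\<kappa> j < K" if "\<kappa> \<in> A" for \<kappa> j using A(2) that by blast
  have pV: "p \<kappa> \<in> V \<kappa>" if "\<kappa> \<in> A" for \<kappa>
  proof -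
    have "p \<kappa> j < 2 ^ \<kappa> j" for j
    proof -
      have "(2::nat) ^ K = 2 ^ \<kappa> j * 2 ^ (K - \<kappa> j)"
        using AK[OF that, of j] by (simp flip: power_add)
      then show ?thesis unfolding p_def using z by (intro less_mult_imp_div_less) (simp add: dgrid_def)
    qed
    then show ?thesis by (simp add: V_def)
  qed
  have hp: "(\<Prod>j\<in>UNIV. haar (loc \<kappa> \<nu> x j)) =
     (if \<nu> = p \<kappa> then \<Prod>j\<in>UNIV. rad (z j div 2 ^ (K - Suc (\<kappa> j))) else 0)" if "\<kappa> \<in> A" for \<kappa> \<nu>
  proof -
    have 1: "haar (loc \<kappa> \<nu> x j) = (if p \<kappa> j = \<nu> j then rad (z j div 2 ^ (K - Suc (\<kappa> j))) else 0)" for j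
      unfolding z_def p_def by (rule haar_loc_grid[of x j \<kappa> K, OF x(1) AK[OF that]])
    show ?thesis
    proof (cases "\<nu> = p \<kappa>")
      case True
      then have "p \<kappa> j = \<nu> j" for j by simp
      then have "(\<Prod>j\<in>UNIV. haar (loc \<kappa> \<nu> x j)) = (\<Prod>j\<in>UNIV. rad (z j div 2 ^ (K - Suc (\<kappa> j))))"
        by (intro prod.cong refl) (simp only: 1 if_True simp_thms)
      then show ?thesis using True by simp
    next
      case False
      then obtain j where "\<nu> j \<noteq> p \<kappa> j" by (auto simp: fun_eq_iff)
      then have "p \<kappa> j \<noteq> \<nu> j" by (rule not_sym)
      then have "haar (loc \<kappa> \<nu> x j) = 0" by (simp add: 1)
      then have "(\<Prod>j\<in>UNIV. haar (loc \<kappa> \<nu> x j)) = 0" by (intro prod_zero) auto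
      then show ?thesis using False by simp
    qed
  qed
  have "hsum S a x = (\<Sum>\<sigma>\<in>Sigma A V. sign_coeff S a (fst \<sigma>) (snd \<sigma>) * (\<Prod>j\<in>UNIV. haar (loc (fst \<sigma>) (snd \<sigma>) x j)))"
    unfolding hsum_def using A(1) S
    by (intro sum.mono_neutral_cong_left) (auto simp: sign_coeff_def case_prod_beta)
  also have "\<dots> = (\<Sum>\<kappa>\<in>A. \<Sum>\<nu>\<in>V \<kappa>. sign_coeff S a \<kappa> \<nu> * (\<Prod>j\<in>UNIV. haar (loc \<kappa> \<nu> x j)))"
    using A(1) by (subst sum.Sigma) (auto simp: case_prod_beta)
  also have "\<dots> = (\<Sum>\<kappa>\<in>A. haar_layer K (sign_coeff S a) \<kappa> z)"
  proof (intro sum.cong refl)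
    fix \<kappa> assume "\<kappa> \<in> A"
    have "(\<Sum>\<nu>\<in>V \<kappa>. sign_coeff S a \<kappa> \<nu> * (\<Prod>j\<in>UNIV. haar (loc \<kappa> \<nu> x j))) =
      (\<Sum>\<nu>\<in>V \<kappa>. if \<nu> = p \<kappa> then sign_coeff S a \<kappa> \<nu> * (\<Prod>j\<in>UNIV. rad (z j div 2 ^ (K - Suc (\<kappa> j)))) else 0)"
      by (intro sum.cong refl) (simp add: hp[OF \<open>\<kappa> \<in> A\<close>])
    also have "\<dots> = haar_layer K (sign_coeff S a) \<kappa> z"
      using pV[OF \<open>\<kappa> \<in> A\<close>] by (simp add: sum.delta haar_layer_def p_def[abs_def])
    finally show "(\<Sum>\<nu>\<in>V \<kappa>. sign_coeff S a \<kappa> \<nu> * (\<Prod>j\<in>UNIV. haar (loc \<kappa> \<nu> x j))) = haar_layer K (sign_coeff S a) \<kappa> z" .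
  qed
  finally show ?thesis by (simp add: z_def)
qed

lemma nn_integral_hsum_le:
  assumes A: "finite A" "\<forall>\<kappa>\<in>A. \<forall>j. \<kappa> j < K" and S: "S \<subseteq> Sigma A V" and s: "0 < s"
  shows "(\<integral>\<^sup>+x. ennreal (\<bar>hsum S a x\<bar> powr s) \<partial>lborel) \<le>
    ennreal ((\<rho> / 2 ^ K) ^ CARD('n) * (\<Sum>z\<in>dgrid K. \<bar>\<Sum>\<kappa>\<in>A. haar_layer K (sign_coeff S a) \<kappa> z\<bar> powr s))"
proof -
  define M where "M z = \<bar>\<Sum>\<kappa>\<in>A. haar_layer K (sign_coeff S a) \<kappa> z\<bar> powr s" for z
  define I where "I z x = (\<Prod>j\<in>UNIV. indicator {0..<1} (\<beta> K * (x $ j - e j) - real (z j)) :: real)"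
    for z :: "'n \<Rightarrow> nat" and x :: "real^'n"
  have "(\<integral>\<^sup>+x. ennreal (\<bar>hsum S a x\<bar> powr s) \<partial>lborel) \<le> (\<integral>\<^sup>+x. (\<Sum>z\<in>dgrid K. ennreal (M z) * ennreal (I z x)) \<partial>lborel)"
  proof (rule nn_integral_mono)
    fix x :: "real^'n"
    show "ennreal (\<bar>hsum S a x\<bar> powr s) \<le> (\<Sum>z\<in>dgrid K. ennreal (M z) * ennreal (I z x))"
    proof (cases "\<forall>j. 0 \<le> x $ j - e j \<and> x $ j - e j < \<rho>")
      case True
      then have x: "0 \<le> x $ j - e j" "x $ j - e j < \<rho>" for j by auto
      have "I (grid_index K x) x = 1"
        unfolding I_def using grid_index_cell(2)[OF x] by (intro prod.neutral) (auto simp: indicator_def)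
      then have "ennreal (\<bar>hsum S a x\<bar> powr s) = ennreal (M (grid_index K x)) * ennreal (I (grid_index K x) x)"
        by (simp add: hsum_eq_layers[OF A S x] M_def)
      also have "\<dots> \<le> (\<Sum>z\<in>dgrid K. ennreal (M z) * ennreal (I z x))"
        using grid_index_cell(1)[OF x] by (intro member_le_sum) auto
      finally show ?thesis .
    next
      case False
      then show ?thesis using hsum_outside[OF S False] s by simp
    qed
  qed
  also have "\<dots> = (\<Sum>z\<in>dgrid K. ennreal (M z) * (\<integral>\<^sup>+x. ennreal (I z x) \<partial>lborel))"
    by (subst nn_integral_sum) (auto simp: I_def nn_integral_cmult)
  also have "\<dots> = (\<Sum>z\<in>dgrid K. ennreal (M z) * ennreal ((\<rho> / 2 ^ K) ^ CARD('n)))"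
    unfolding I_def by (subst nn_integral_cell) (simp_all add: \<beta>_def \<rho>_pos)
  also have "\<dots> = ennreal ((\<rho> / 2 ^ K) ^ CARD('n) * (\<Sum>z\<in>dgrid K. M z))"
  proof -
    have "(\<Sum>z\<in>dgrid K. ennreal (M z) * ennreal ((\<rho> / 2 ^ K) ^ CARD('n))) =
        (\<Sum>z\<in>dgrid K. ennreal ((\<rho> / 2 ^ K) ^ CARD('n) * M z))"
      using \<rho>_pos by (intro sum.cong refl) (subst ennreal_mult[symmetric], auto simp: M_def mult.commute)
    also have "\<dots> = ennreal (\<Sum>z\<in>dgrid K. (\<rho> / 2 ^ K) ^ CARD('n) * M z)"
      using \<rho>_pos by (intro sum_ennreal) (auto simp: M_def)
    finally show ?thesis by (simp only: sum_distrib_left)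
  qed
  finally show ?thesis by (simp add: M_def)
qed

lemma sum_haar_layer_sq:
  assumes \<kappa>: "\<And>j. \<kappa> j < K"
  shows "(\<Sum>z\<in>dgrid K. (haar_layer K b \<kappa> z)\<^sup>2) = (\<Sum>\<nu>\<in>V \<kappa>. (b \<kappa> \<nu>)\<^sup>2) * 2 ^ (\<Sum>j\<in>UNIV. K - \<kappa> j)"
proof -
  define p where "p z = (\<lambda>j. z j div 2 ^ (K - \<kappa> j))" for z :: "'n \<Rightarrow> nat"
  have K: "(2::nat) ^ K = 2 ^ \<kappa> j * 2 ^ (K - \<kappa> j)" for j
    using \<kappa>[of j] by (simp flip: power_add)
  have pV: "p ` dgrid K \<subseteq> V \<kappa>"
  proof clarify
    fix z :: "'n \<Rightarrow> nat" assume z: "z \<in> dgrid K"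
    have "p z j < 2 ^ \<kappa> j" for j
      unfolding p_def using z K[of j] by (intro less_mult_imp_div_less) (simp add: dgrid_def)
    then show "p z \<in> V \<kappa>" by (simp add: V_def)
  qed
  \<comment> \<open>Above one cell of scale \<open>\<kappa>\<close> lie, in coordinate
    \<open>j\<close>, exactly \<open>2 ^ (K - \<kappa> j)\<close> consecutive indices of the fine
    grid.\<close>
  have fib: "{z \<in> dgrid K. p z = \<nu>} = PiE UNIV (\<lambda>j. {\<nu> j * 2 ^ (K - \<kappa> j)..<(\<nu> j + 1) * 2 ^ (K - \<kappa> j)})"
    if "\<nu> \<in> V \<kappa>" for \<nu>
  proof -
    have d: "n div 2 ^ m = k \<longleftrightarrow> k * 2 ^ m \<le> n \<and> n < (k + 1) * 2 ^ m" for n m k :: nat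
    proof -
      have "n div 2 ^ m = k \<longleftrightarrow> k \<le> n div 2 ^ m \<and> n div 2 ^ m < k + 1" by auto
      then show ?thesis by (simp add: less_eq_div_iff_mult_less_eq div_less_iff_less_mult)
    qed
    have "z \<in> dgrid K" if "\<forall>j. z j < (\<nu> j + 1) * 2 ^ (K - \<kappa> j)" for z
      unfolding dgrid_def
    proof (clarify)
      fix j
      have "(\<nu> j + 1) * 2 ^ (K - \<kappa> j) \<le> 2 ^ \<kappa> j * 2 ^ (K - \<kappa> j)"
        using \<open>\<nu> \<in> V \<kappa>\<close> by (intro mult_right_mono) (auto simp: V_def Suc_le_eq)
      then show "z j < 2 ^ K" using that K[of j] by (metis order_less_le_trans)
    qed
    then show ?thesis by (auto simp: p_def fun_eq_iff d PiE_def Pi_def extensional_def)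
  qed
  have "(\<Sum>z\<in>dgrid K. (haar_layer K b \<kappa> z)\<^sup>2) = (\<Sum>z\<in>dgrid K. (b \<kappa> (p z))\<^sup>2)"
    by (simp add: haar_layer_def p_def power_mult_distrib prod_power_distrib)
  also have "\<dots> = (\<Sum>\<nu>\<in>V \<kappa>. \<Sum>z\<in>{z \<in> dgrid K. p z = \<nu>}. (b \<kappa> (p z))\<^sup>2)"
    by (rule sum.group[symmetric]) (use pV in auto)
  also have "\<dots> = (\<Sum>\<nu>\<in>V \<kappa>. real (card {z \<in> dgrid K. p z = \<nu>}) * (b \<kappa> \<nu>)\<^sup>2)"
    by (intro sum.cong refl) simp
  also have "\<dots> = (\<Sum>\<nu>\<in>V \<kappa>. 2 ^ (\<Sum>j\<in>UNIV. K - \<kappa> j) * (b \<kappa> \<nu>)\<^sup>2)"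
    by (intro sum.cong refl) (simp add: fib card_PiE power_sum)
  finally show ?thesis by (simp add: sum_distrib_right mult.commute)
qed

lemma sum_layers_sq:
  assumes A: "finite A" "\<And>\<kappa>. \<kappa> \<in> A \<Longrightarrow> (\<Sum>j\<in>UNIV. \<kappa> j) = k" and S: "S \<subseteq> Sigma A V"
  shows "(\<rho> / 2 ^ Suc k) ^ CARD('n) * (\<Sum>z\<in>dgrid (Suc k). \<Sum>\<kappa>\<in>A. (haar_layer (Suc k) (sign_coeff S a) \<kappa> z)\<^sup>2) \<le>
    \<rho> ^ CARD('n) * (real (card S) / 2 ^ k)"
proof -
  let ?K = "Suc k"
  have \<kappa>k: "\<kappa> j < ?K" if "\<kappa> \<in> A" for \<kappa> j
    using member_le_sum[of j UNIV \<kappa>] A(2)[OF that] by simp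
  \<comment> \<open>The volume of a cell depends on the total of its scale only; this is why the
    number of elements of \<open>S\<close> determines the sum.\<close>
  have pw: "(\<rho> / 2 ^ ?K) ^ CARD('n) * 2 ^ (\<Sum>j\<in>UNIV. ?K - \<kappa> j) = \<rho> ^ CARD('n) / 2 ^ k" if "\<kappa> \<in> A" for \<kappa>
  proof -
    have "(\<Sum>j\<in>UNIV. ?K - \<kappa> j) + (\<Sum>j\<in>UNIV. \<kappa> j) = (\<Sum>j\<in>(UNIV::'n set). ?K)"
      unfolding sum.distrib[symmetric] using \<kappa>k[OF that] by (intro sum.cong refl) (simp add: less_imp_le)
    then have "(2::real) ^ (\<Sum>j\<in>UNIV. ?K - \<kappa> j) * 2 ^ k = (2 ^ ?K) ^ CARD('n)"
      unfolding A(2)[OF that] by (simp add: power_add[symmetric] power_mult[symmetric] mult.commute del: power_Suc)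
    then show ?thesis by (simp add: power_divide field_simps del: power_Suc)
  qed
  have "(\<rho> / 2 ^ ?K) ^ CARD('n) * (\<Sum>z\<in>dgrid ?K. \<Sum>\<kappa>\<in>A. (haar_layer ?K (sign_coeff S a) \<kappa> z)\<^sup>2) =
     (\<Sum>\<kappa>\<in>A. (\<Sum>\<nu>\<in>V \<kappa>. (sign_coeff S a \<kappa> \<nu>)\<^sup>2) * ((\<rho> / 2 ^ ?K) ^ CARD('n) * 2 ^ (\<Sum>j\<in>UNIV. ?K - \<kappa> j)))"
    by (subst sum.swap) (simp add: sum_haar_layer_sq \<kappa>k sum_distrib_left mult_ac del: power_Suc)
  also have "\<dots> = (\<Sum>\<kappa>\<in>A. (\<Sum>\<nu>\<in>V \<kappa>. (sign_coeff S a \<kappa> \<nu>)\<^sup>2)) * (\<rho> ^ CARD('n) / 2 ^ k)"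
    unfolding sum_distrib_right by (intro sum.cong refl) (simp only: pw)
  finally have eq: "(\<rho> / 2 ^ ?K) ^ CARD('n) * (\<Sum>z\<in>dgrid ?K. \<Sum>\<kappa>\<in>A. (haar_layer ?K (sign_coeff S a) \<kappa> z)\<^sup>2) =
    (\<Sum>\<kappa>\<in>A. (\<Sum>\<nu>\<in>V \<kappa>. (sign_coeff S a \<kappa> \<nu>)\<^sup>2)) * (\<rho> ^ CARD('n) / 2 ^ k)" .
  have "(\<Sum>\<kappa>\<in>A. (\<Sum>\<nu>\<in>V \<kappa>. (sign_coeff S a \<kappa> \<nu>)\<^sup>2)) \<le> (\<Sum>\<kappa>\<in>A. \<Sum>\<nu>\<in>V \<kappa>. if (\<kappa>, \<nu>) \<in> S then 1 else 0)"
    by (intro sum_mono) (auto simp: sign_coeff_def sgn_if)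
  also have "\<dots> = (\<Sum>\<sigma>\<in>Sigma A V. if \<sigma> \<in> S then 1 else 0)"
    using A(1) by (subst sum.Sigma) (auto intro!: sum.cong)
  also have "\<dots> = real (card S)"
    using A(1) S by (subst sum.inter_restrict[symmetric]) (auto simp: Int_absorb1)
  finally have "(\<Sum>\<kappa>\<in>A. (\<Sum>\<nu>\<in>V \<kappa>. (sign_coeff S a \<kappa> \<nu>)\<^sup>2)) * (\<rho> ^ CARD('n) / 2 ^ k) \<le>
      real (card S) * (\<rho> ^ CARD('n) / 2 ^ k)"
    by (rule mult_right_mono) (use \<rho>_pos in simp)
  then show ?thesis unfolding eq by (simp add: mult_ac)
qed

text \<open>The exponent of \<open>card A\<close> is 0 for \<open>2 \<le> q\<close> and
  \<open>s / 2 - 1\<close> for \<open>q < 2\<close>. In the first case \<open>s \<le> 2\<close> lies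
  between the first and second moments, where the number of scales costs nothing. In the second case
  the square function replaces the sum of up to \<open>card A\<close> signs by its square
  root.\<close>

lemma hsum_norm_bound:
  assumes q: "1 < q" and sq: "s = q / (q - 1)"
  shows "\<exists>C>0. \<forall>A S a k. finite A \<longrightarrow> A \<noteq> {} \<longrightarrow> (\<forall>\<kappa>\<in>A. (\<Sum>j\<in>UNIV. \<kappa> j) = k) \<longrightarrow> S \<subseteq> Sigma A V \<longrightarrow>
    (\<integral>\<^sup>+x. ennreal (\<bar>hsum S a x\<bar> powr s) \<partial>lborel) \<le>
      ennreal (C * real (card A) powr (s * (1 - 1 / max 2 q) - 1) * (real (card S) / 2 ^ k))"
proof -
  \<comment> \<open>The discrete inequality is for even exponents, so an integer \<open>r\<close>
    with \<open>s \<le> 2 * r\<close> is taken and \<open>s\<close> is reached by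
    interpolation.\<close>
  define r where "r = nat \<lceil>s\<rceil>"
  have s1: "1 < s" unfolding sq using q by (simp add: less_divide_eq)
  have r: "1 \<le> r" "s \<le> real r" using s1 by (auto simp: r_def le_nat_iff) 
  obtain C1 where C1: "C1 \<ge> 0" "\<And>K b (A :: ('n \<Rightarrow> nat) set). finite A \<Longrightarrow> (\<forall>\<kappa>\<in>A. \<forall>j. \<kappa> j < K) \<Longrightarrow>
    (\<Sum>z\<in>dgrid K. (\<Sum>\<kappa>\<in>A. haar_layer K b \<kappa> z) ^ (2 * 1)) \<le>
    C1 * (\<Sum>z\<in>dgrid K. (\<Sum>\<kappa>\<in>A. (haar_layer K b \<kappa> z)\<^sup>2) ^ 1)"
    using haar_square_function[OF order_refl, where ?'n = 'n] by blast
  obtain Cr where Cr: "Cr \<ge> 0" "\<And>K b (A :: ('n \<Rightarrow> nat) set). finite A \<Longrightarrow> (\<forall>\<kappa>\<in>A. \<forall>j. \<kappa> j < K) \<Longrightarrow>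
    (\<Sum>z\<in>dgrid K. (\<Sum>\<kappa>\<in>A. haar_layer K b \<kappa> z) ^ (2 * r)) \<le>
    Cr * (\<Sum>z\<in>dgrid K. (\<Sum>\<kappa>\<in>A. (haar_layer K b \<kappa> z)\<^sup>2) ^ r)"
    using haar_square_function[OF r(1), where ?'n = 'n] by blast
  define C where "C = (1 + C1 + Cr) * \<rho> ^ CARD('n)"
  have C: "C > 0" using C1(1) Cr(1) \<rho>_pos by (simp add: C_def)
  have "(\<integral>\<^sup>+x. ennreal (\<bar>hsum S a x\<bar> powr s) \<partial>lborel) \<le>
      ennreal (C * real (card A) powr (s * (1 - 1 / max 2 q) - 1) * (real (card S) / 2 ^ k))"
    if A: "finite A" "A \<noteq> {}" "\<forall>\<kappa>\<in>A. (\<Sum>j\<in>UNIV. \<kappa> j) = k" and S: "S \<subseteq> Sigma A V" for A S a k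
  proof -
    define K where "K = Suc k"
    define h where "h \<kappa> z = haar_layer K (sign_coeff S a) \<kappa> z" for \<kappa> z
    define M where "M z = (\<Sum>\<kappa>\<in>A. h \<kappa> z)" for z
    define Wd where "Wd = (\<Sum>z\<in>dgrid K. \<Sum>\<kappa>\<in>A. (h \<kappa> z)\<^sup>2)"
    define N where "N = real (card A)"
    define E where "E = s * (1 - 1 / max 2 q) - 1"
    have N: "1 \<le> N" using A by (simp add: N_def card_gt_0_iff Suc_le_eq)
    have \<kappa>K: "\<kappa> j < K" if "\<kappa> \<in> A" for \<kappa> j
      using member_le_sum[of j UNIV \<kappa>] A(3) that by (simp add: K_def)
    have \<kappa>K': "\<forall>\<kappa>\<in>A. \<forall>j. \<kappa> j < K" using \<kappa>K by blast
    \<comment> \<open>A layer takes only the values -1, 0 and 1. Hence its first and second moments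
      coincide, and a sum of squares at a point is at most the number of scales.\<close>
    have h1: "\<bar>h \<kappa> z\<bar> = (h \<kappa> z)\<^sup>2" "(h \<kappa> z)\<^sup>2 \<le> 1" for \<kappa> z
    proof -
      have "\<bar>\<Prod>j\<in>UNIV. rad (z j div 2 ^ (K - Suc (\<kappa> j)))\<bar> = 1" by (simp add: abs_prod)
      then have "\<bar>h \<kappa> z\<bar> = \<bar>sign_coeff S a \<kappa> (\<lambda>j. z j div 2 ^ (K - \<kappa> j))\<bar>"
        by (simp add: h_def haar_layer_def abs_mult)
      then have "\<bar>h \<kappa> z\<bar> = 0 \<or> \<bar>h \<kappa> z\<bar> = 1" by (simp add: sign_coeff_def sgn_if)
      then have "h \<kappa> z = 0 \<or> h \<kappa> z = 1 \<or> h \<kappa> z = -1" by linarith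
      then show "\<bar>h \<kappa> z\<bar> = (h \<kappa> z)\<^sup>2" "(h \<kappa> z)\<^sup>2 \<le> 1" by (elim disjE; simp)+
    qed
    have Wd0: "0 \<le> Wd" unfolding Wd_def by (intro sum_nonneg) auto
    have m1: "(\<Sum>z\<in>dgrid K. \<bar>M z\<bar>) \<le> Wd"
      unfolding Wd_def M_def h1(1)[symmetric] by (intro sum_mono sum_abs)
    have m2: "(\<Sum>z\<in>dgrid K. (M z)\<^sup>2) \<le> C1 * Wd"
      using C1(2)[OF A(1) \<kappa>K', of "sign_coeff S a"] by (simp add: M_def Wd_def h_def)
    have mr: "(\<Sum>z\<in>dgrid K. (M z) ^ (2 * r)) \<le> Cr * (N ^ (r - 1) * Wd)"
    proof -
      have "(\<Sum>\<kappa>\<in>A. (h \<kappa> z)\<^sup>2) ^ r \<le> N ^ (r - 1) * (\<Sum>\<kappa>\<in>A. (h \<kappa> z)\<^sup>2)" for z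
      proof -
        have 0: "0 \<le> (\<Sum>\<kappa>\<in>A. (h \<kappa> z)\<^sup>2)" by (intro sum_nonneg) auto
        have "(\<Sum>\<kappa>\<in>A. (h \<kappa> z)\<^sup>2) \<le> (\<Sum>\<kappa>\<in>A. 1)" by (intro sum_mono h1(2))
        then have "(\<Sum>\<kappa>\<in>A. (h \<kappa> z)\<^sup>2) ^ (r - 1) \<le> N ^ (r - 1)" using 0 by (intro power_mono) (auto simp: N_def)
        then have "(\<Sum>\<kappa>\<in>A. (h \<kappa> z)\<^sup>2) ^ (r - 1) * (\<Sum>\<kappa>\<in>A. (h \<kappa> z)\<^sup>2) \<le> N ^ (r - 1) * (\<Sum>\<kappa>\<in>A. (h \<kappa> z)\<^sup>2)"
          using 0 by (rule mult_right_mono)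
        then show ?thesis using r(1) by (cases r) (auto simp: mult.commute)
      qed
      then have "(\<Sum>z\<in>dgrid K. (\<Sum>\<kappa>\<in>A. (h \<kappa> z)\<^sup>2) ^ r) \<le> N ^ (r - 1) * Wd"
        unfolding Wd_def sum_distrib_left[of "N ^ (r - 1)" "\<lambda>z. \<Sum>\<kappa>\<in>A. (h \<kappa> z)\<^sup>2"] by (intro sum_mono)
      then have "Cr * (\<Sum>z\<in>dgrid K. (\<Sum>\<kappa>\<in>A. (h \<kappa> z)\<^sup>2) ^ r) \<le> Cr * (N ^ (r - 1) * Wd)"
        using Cr(1) by (rule mult_left_mono)
      then show ?thesis using Cr(2)[OF A(1) \<kappa>K', of "sign_coeff S a"] by (simp add: M_def h_def)
    qed
    have key: "(\<Sum>z\<in>dgrid K. \<bar>M z\<bar> powr s) \<le> (1 + C1 + Cr) * N powr E * Wd"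
    proof (cases "2 \<le> q")
      case True
      then have "s \<le> 2" unfolding sq using q by (simp add: divide_le_eq)
      have "E = 0" unfolding E_def sq using q True by (simp add: field_simps max_def)
      have "(\<Sum>z\<in>dgrid K. \<bar>M z\<bar> powr s) \<le> (\<Sum>z\<in>dgrid K. \<bar>M z\<bar> + (M z)\<^sup>2)"
      proof (rule sum_mono)
        fix z
        have "\<bar>M z\<bar> powr s \<le> \<bar>M z\<bar> powr 1 + \<bar>M z\<bar> powr 2"
          using s1 \<open>s \<le> 2\<close> by (intro powr_le_interpolation) auto
        then show "\<bar>M z\<bar> powr s \<le> \<bar>M z\<bar> + (M z)\<^sup>2" by simp
      qed
      also have "\<dots> \<le> Wd + C1 * Wd" using m1 m2 by (simp add: sum.distrib)
      also have "\<dots> \<le> (1 + C1 + Cr) * Wd" using Wd0 Cr(1) by (simp add: algebra_simps)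
      finally show ?thesis using \<open>E = 0\<close> N by simp
    next
      case False
      then have s2: "2 < s" unfolding sq using q by (simp add: less_divide_eq)
      have E: "E = s / 2 - 1" using False by (simp add: E_def max_def)
      \<comment> \<open>Dividing the square by \<open>N\<close> before interpolating between the
        exponents 2 and \<open>2 * r\<close> makes both resulting moments of the same order
        \<open>Wd / N\<close>.\<close>
      have pt: "\<bar>M z\<bar> powr s \<le> N powr (s / 2) * ((M z)\<^sup>2 / N + (M z) ^ (2 * r) / N ^ r)" for z
      proof -
        define y where "y = (M z)\<^sup>2 / N"
        have y: "0 \<le> y" using N by (simp add: y_def)
        have "\<bar>M z\<bar> powr s = (\<bar>M z\<bar> powr 2) powr (s / 2)" by (subst powr_powr) simp
        also have "\<bar>M z\<bar> powr 2 = N * y" using N by (simp add: y_def)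
        also have "(N * y) powr (s / 2) = N powr (s / 2) * y powr (s / 2)" using N y by (simp add: powr_mult)
        also have "\<dots> \<le> N powr (s / 2) * (y powr 1 + y powr real r)"
          using s2 r y s1 by (intro mult_left_mono powr_le_interpolation) auto
        also have "y powr 1 + y powr real r = (M z)\<^sup>2 / N + (M z) ^ (2 * r) / N ^ r"
        proof -
          have "y powr real r = y ^ r" using y r(1) by (cases "y = 0") (auto simp: powr_realpow power_0_left)
          then show ?thesis using y N by (simp add: y_def power_divide power_mult)
        qed
        finally show ?thesis .
      qed
      have "(\<Sum>z\<in>dgrid K. \<bar>M z\<bar> powr s) \<le> (\<Sum>z\<in>dgrid K. N powr (s / 2) * ((M z)\<^sup>2 / N + (M z) ^ (2 * r) / N ^ r))"
        by (intro sum_mono pt)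
      also have "\<dots> = N powr (s / 2) * ((\<Sum>z\<in>dgrid K. (M z)\<^sup>2) / N + (\<Sum>z\<in>dgrid K. (M z) ^ (2 * r)) / N ^ r)"
        by (simp only: sum_distrib_left[symmetric] sum.distrib sum_divide_distrib[symmetric])
      also have "\<dots> \<le> N powr (s / 2) * (C1 * Wd / N + Cr * (N ^ (r - 1) * Wd) / N ^ r)"
        using m2 mr N by (intro mult_left_mono add_mono divide_right_mono) auto
      also have "Cr * (N ^ (r - 1) * Wd) / N ^ r = Cr * Wd / N"
        using N r(1) by (cases r) (auto simp: field_simps)
      also have "N powr (s / 2) * (C1 * Wd / N + Cr * Wd / N) = N powr E * ((C1 + Cr) * Wd)"
      proof -
        have "N powr (s / 2) = N * N powr E"
          unfolding E using powr_mult_base[of N "s / 2 - 1"] N by simp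
        then show ?thesis using N by (simp add: field_simps)
      qed
      also have "\<dots> \<le> N powr E * ((1 + C1 + Cr) * Wd)"
        using Wd0 by (intro mult_left_mono mult_right_mono) auto
      finally show ?thesis by (simp add: mult_ac)
    qed
    have "(\<rho> / 2 ^ K) ^ CARD('n) * (\<Sum>z\<in>dgrid K. \<bar>M z\<bar> powr s) \<le>
        (\<rho> / 2 ^ K) ^ CARD('n) * ((1 + C1 + Cr) * N powr E * Wd)"
      using key \<rho>_pos by (intro mult_left_mono) auto
    also have "\<dots> = (1 + C1 + Cr) * N powr E * ((\<rho> / 2 ^ K) ^ CARD('n) * Wd)" by simp
    also have "\<dots> \<le> (1 + C1 + Cr) * N powr E * (\<rho> ^ CARD('n) * (real (card S) / 2 ^ k))"
      unfolding Wd_def K_def h_def using A C1(1) Cr(1)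
      by (intro mult_left_mono sum_layers_sq S) auto
    finally have "(\<rho> / 2 ^ K) ^ CARD('n) * (\<Sum>z\<in>dgrid K. \<bar>M z\<bar> powr s) \<le> C * N powr E * (real (card S) / 2 ^ k)"
      by (simp add: C_def mult_ac)
    then have "ennreal ((\<rho> / 2 ^ K) ^ CARD('n) * (\<Sum>z\<in>dgrid K. \<bar>M z\<bar> powr s)) \<le> ennreal (C * N powr E * (real (card S) / 2 ^ k))"
      by (rule ennreal_leI)
    with nn_integral_hsum_le[OF A(1) \<kappa>K' S, of s a] s1
    show ?thesis unfolding M_def h_def N_def E_def by (meson order_trans less_trans zero_less_one)
  qed
  with C show ?thesis by blast
qed

text \<open>With \<open>W = card S / 2 ^ k\<close>, the pairing is at least a multiple of
  \<open>2 powr (- \<mu> * k) * W\<close>, while the integral of the dual sum is at most a multiple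
  of \<open>N powr E * W\<close>. Solving the duality estimate for the \<open>L\<^sub>q\<close> norm
  leaves \<open>W powr (1 / q)\<close> and turns \<open>E\<close> into
  \<open>1 / max 2 q - 1 / q\<close>.\<close>

lemma synth_norm_lower:
  assumes q: "1 < q"
  shows "\<exists>c>0. \<forall>A S a k. finite A \<longrightarrow> A \<noteq> {} \<longrightarrow>
    (\<forall>\<kappa>\<in>A. (\<Sum>j\<in>UNIV. \<kappa> j) = k \<and> (\<forall>j. \<kappa> j \<noteq> 0 \<longrightarrow> \<alpha> j - real (lam j) = \<mu>)) \<longrightarrow>
    S \<subseteq> Sigma A V \<longrightarrow> S \<noteq> {} \<longrightarrow> (\<forall>(\<kappa>, \<nu>)\<in>S. 1 / 2 \<le> \<bar>a \<kappa> \<nu>\<bar>) \<longrightarrow>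
    ennreal ((c * 2 powr (- \<mu> * real k) * real (card A) powr (1 / max 2 q - 1 / q) *
      (real (card S) / 2 ^ k) powr (1 / q)) powr q) \<le>
    (\<integral>\<^sup>+x. ennreal (\<bar>synth lam A a x\<bar> powr q) \<partial>lborel)"
proof -
  define s where "s = q / (q - 1)"
  obtain C where C: "C > 0" and hb: "\<And>A S a k. finite A \<Longrightarrow> A \<noteq> {} \<Longrightarrow> (\<forall>\<kappa>\<in>A. (\<Sum>j\<in>UNIV. \<kappa> j) = k) \<Longrightarrow> S \<subseteq> Sigma A V \<Longrightarrow>
    (\<integral>\<^sup>+x. ennreal (\<bar>hsum S a x\<bar> powr s) \<partial>lborel) \<le>
      ennreal (C * real (card A) powr (s * (1 - 1 / max 2 q) - 1) * (real (card S) / 2 ^ k))"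
    using hsum_norm_bound[OF q s_def] by blast
  define c0 where "c0 = (\<Prod>j\<in>UNIV. 2 * G j (1/2) * \<rho> powr (\<alpha> j - real (lam j) + 1))"
  have c0: "c0 \<noteq> 0" using G_half \<rho>_pos by (simp add: c0_def)
  \<comment> \<open>Of the factor 1/4, one half is the lower bound on the coefficients in
    \<open>S\<close> and one half is lost in the duality estimate.\<close>
  define c where "c = \<bar>c0\<bar> / 4 * C powr ((1 - q) / q)"
  have c: "c > 0" using c0 C by (simp add: c_def)
  have "ennreal ((c * 2 powr (- \<mu> * real k) * real (card A) powr (1 / max 2 q - 1 / q) *
      (real (card S) / 2 ^ k) powr (1 / q)) powr q) \<le>
    (\<integral>\<^sup>+x. ennreal (\<bar>synth lam A a x\<bar> powr q) \<partial>lborel)"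
    if A: "finite A" "A \<noteq> {}" and \<kappa>: "\<forall>\<kappa>\<in>A. (\<Sum>j\<in>UNIV. \<kappa> j) = k \<and> (\<forall>j. \<kappa> j \<noteq> 0 \<longrightarrow> \<alpha> j - real (lam j) = \<mu>)"
      and S: "S \<subseteq> Sigma A V" "S \<noteq> {}" and a: "\<forall>(\<kappa>, \<nu>)\<in>S. 1 / 2 \<le> \<bar>a \<kappa> \<nu>\<bar>" for A S a k
  proof -
    define N where "N = real (card A)"
    define W where "W = real (card S) / 2 ^ k"
    define E where "E = s * (1 - 1 / max 2 q) - 1"
    have finS: "finite S" using A S by (auto intro: finite_subset[OF S(1)] finite_SigmaI)
    have N: "N > 0" using A by (simp add: N_def card_gt_0_iff)
    have W: "W > 0" using S finS by (simp add: W_def card_gt_0_iff)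
    have sumk: "(\<Sum>j\<in>UNIV. \<kappa> j) = k" if "\<kappa> \<in> A" for \<kappa> using \<kappa> that by blast
    \<comment> \<open>In coordinates that are not critical \<open>\<kappa> j = 0\<close>, so they
      contribute powers of \<rho> only and the exponent \<open>\<mu> + 1\<close> may be written for
      all coordinates. The summand 1 accounts for the volume of a cell.\<close>
    have amp: "(\<Prod>j\<in>UNIV. \<beta> (\<kappa> j) powr (- \<alpha> j) * \<beta> (\<kappa> j) ^ lam j * (2 * G j (1/2) / \<beta> (\<kappa> j))) =
        c0 * 2 powr (- (\<mu> + 1) * real k)" if "\<kappa> \<in> A" for \<kappa>
    proof -
      have "\<beta> (\<kappa> j) powr (- \<alpha> j) * \<beta> (\<kappa> j) ^ lam j * (2 * G j (1/2) / \<beta> (\<kappa> j)) =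
          2 * G j (1/2) * \<rho> powr (\<alpha> j - real (lam j) + 1) * 2 powr (- (\<mu> + 1) * real (\<kappa> j))" for j
      proof -
        have "\<beta> (\<kappa> j) powr (- \<alpha> j) * \<beta> (\<kappa> j) ^ lam j / \<beta> (\<kappa> j) = \<beta> (\<kappa> j) powr (- (\<alpha> j - real (lam j) + 1))"
          by (simp add: powr_add powr_diff powr_minus powr_realpow field_simps)
        also have "\<dots> = (2 powr real (\<kappa> j)) powr (- (\<alpha> j - real (lam j) + 1)) / \<rho> powr (- (\<alpha> j - real (lam j) + 1))"
          unfolding \<beta>_def using \<rho>_pos by (simp add: powr_divide powr_realpow)
        also have "\<dots> = 2 powr (- (\<alpha> j - real (lam j) + 1) * real (\<kappa> j)) * \<rho> powr (\<alpha> j - real (lam j) + 1)"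
        proof -
          have "(2 powr y) powr (- x) / \<rho> powr (- x) = 2 powr (- x * y) * \<rho> powr x" for x y :: real
            by (simp add: powr_powr powr_minus divide_inverse mult.commute)
          then show ?thesis .
        qed
        also have "2 powr (- (\<alpha> j - real (lam j) + 1) * real (\<kappa> j)) = 2 powr (- (\<mu> + 1) * real (\<kappa> j))"
          using \<kappa> that by (cases "\<kappa> j = 0") auto
        finally show ?thesis by (simp add: field_simps)
      qed
      then have "(\<Prod>j\<in>UNIV. \<beta> (\<kappa> j) powr (- \<alpha> j) * \<beta> (\<kappa> j) ^ lam j * (2 * G j (1/2) / \<beta> (\<kappa> j))) =
        c0 * (\<Prod>j\<in>UNIV. 2 powr (- (\<mu> + 1) * real (\<kappa> j)))"
        by (simp only: prod.distrib c0_def)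
      also have "(\<Prod>j\<in>UNIV. 2 powr (- (\<mu> + 1) * real (\<kappa> j))) = 2 powr (\<Sum>j\<in>UNIV. - (\<mu> + 1) * real (\<kappa> j))"
        by (rule powr_sum[symmetric]) auto
      also have "(\<Sum>j\<in>UNIV. - (\<mu> + 1) * real (\<kappa> j)) = - (\<mu> + 1) * real k"
        unfolding sum_distrib_left[symmetric] using sumk[OF that] by (simp flip: of_nat_sum)
      finally show ?thesis .
    qed
    define P where "P = \<bar>c0\<bar> / 2 * 2 powr (- \<mu> * real k) * W"
    have P: "P > 0" using c0 W by (simp add: P_def)
    have int: "(\<integral>x. synth lam A a x * hsum S a x \<partial>lborel) =
        (\<Sum>(\<kappa>, \<nu>)\<in>S. \<bar>a \<kappa> \<nu>\<bar>) * (c0 * 2 powr (- (\<mu> + 1) * real k))"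
    proof -
      have "(\<integral>x. synth lam A a x * hsum S a x \<partial>lborel) = (\<Sum>(\<kappa>, \<nu>)\<in>S. \<bar>a \<kappa> \<nu>\<bar> *
        (\<Prod>j\<in>UNIV. \<beta> (\<kappa> j) powr (- \<alpha> j) * \<beta> (\<kappa> j) ^ lam j * (2 * G j (1/2) / \<beta> (\<kappa> j))))"
        by (rule integral_synth_hsum(1)[OF A(1) sumk S(1)])
      also have "\<dots> = (\<Sum>(\<kappa>, \<nu>)\<in>S. \<bar>a \<kappa> \<nu>\<bar> * (c0 * 2 powr (- (\<mu> + 1) * real k)))"
      proof (intro sum.cong refl, clarify)
        fix \<kappa> \<nu> assume "(\<kappa>, \<nu>) \<in> S"
        then have "\<kappa> \<in> A" using S(1) by auto
        then show "\<bar>a \<kappa> \<nu>\<bar> * (\<Prod>j\<in>UNIV. \<beta> (\<kappa> j) powr (- \<alpha> j) * \<beta> (\<kappa> j) ^ lam j * (2 * G j (1/2) / \<beta> (\<kappa> j))) =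
          \<bar>a \<kappa> \<nu>\<bar> * (c0 * 2 powr (- (\<mu> + 1) * real k))" by (simp only: amp)
      qed
      finally show ?thesis by (simp only: split_def sum_distrib_right)
    qed
    have m1: "P \<le> \<bar>\<integral>x. synth lam A a x * hsum S a x \<partial>lborel\<bar>"
    proof -
      have "1 / 2 \<le> \<bar>a (fst \<sigma>) (snd \<sigma>)\<bar>" if "\<sigma> \<in> S" for \<sigma> using a that by (simp add: case_prod_beta)
      then have "(\<Sum>\<sigma>\<in>S. 1 / 2) \<le> (\<Sum>\<sigma>\<in>S. \<bar>a (fst \<sigma>) (snd \<sigma>)\<bar>)" by (intro sum_mono)
      then have "real (card S) / 2 \<le> (\<Sum>(\<kappa>, \<nu>)\<in>S. \<bar>a \<kappa> \<nu>\<bar>)" by (simp add: case_prod_beta)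
      then have "\<bar>c0\<bar> * 2 powr (- (\<mu> + 1) * real k) * (real (card S) / 2) \<le>
          \<bar>c0\<bar> * 2 powr (- (\<mu> + 1) * real k) * (\<Sum>(\<kappa>, \<nu>)\<in>S. \<bar>a \<kappa> \<nu>\<bar>)" by (intro mult_left_mono) auto
      also have "\<dots> = \<bar>\<integral>x. synth lam A a x * hsum S a x \<partial>lborel\<bar>"
        unfolding int by (simp add: abs_mult sum_nonneg case_prod_beta mult_ac)
      also have "2 powr (- (\<mu> + 1) * real k) = 2 powr (- \<mu> * real k) / 2 ^ k"
      proof -
        have "- (\<mu> + 1) * real k = - \<mu> * real k - real k" by (simp add: algebra_simps)
        then show ?thesis by (simp add: powr_diff powr_realpow)
      qed
      finally show ?thesis by (simp add: P_def W_def mult_ac)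
    qed
    have m2: "integrable lborel (\<lambda>x. synth lam A a x * hsum S a x)"
      by (rule integral_synth_hsum(2)[OF A(1) sumk S(1)])
    have "lam j \<le> l j" for j using lam_less_l[of j] by simp
    from borel_measurable_integrable[OF integrable_synth[OF this]]
    have m3: "synth lam A a \<in> borel_measurable borel" by simp
    have m4: "hsum S a \<in> borel_measurable borel"
      unfolding hsum_def[abs_def] loc_def case_prod_beta by measurable
    have m5: "0 < C * N powr E * W" using C N W by simp
    have m6: "(\<integral>\<^sup>+x. ennreal (\<bar>hsum S a x\<bar> powr s) \<partial>lborel) \<le> ennreal (C * N powr E * W)"
      unfolding N_def E_def W_def by (rule hb[OF A _ S(1)]) (use sumk in blast)
    have "ennreal ((P / 2) powr q * (C * N powr E * W) powr (1 - q)) \<le>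
        (\<integral>\<^sup>+x. ennreal (\<bar>synth lam A a x\<bar> powr q) \<partial>lborel)"
      by (rule nn_integral_powr_ge_pairing[OF m2 m3 m4 q s_def P m1 m5 m6])
    moreover have "(P / 2) powr q * (C * N powr E * W) powr (1 - q) =
       (c * 2 powr (- \<mu> * real k) * N powr (1 / max 2 q - 1 / q) * W powr (1 / q)) powr q"
    proof -
      have e1: "(C powr ((1 - q) / q)) powr q = C powr (1 - q)" using q by (simp add: powr_powr)
      have e2: "(N powr (1 / max 2 q - 1 / q)) powr q = (N powr E) powr (1 - q)"
      proof -
        have "(1 / max 2 q - 1 / q) * q = E * (1 - q)" 
        proof -
          have a: "s * (1 - q) = - q" unfolding s_def using q by (simp add: field_simps)
          have "E * (1 - q) = s * (1 - q) * (1 - 1 / max 2 q) - (1 - q)"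
            by (simp add: E_def algebra_simps)
          then have "E * (1 - q) = q / max 2 q - 1" unfolding a by (simp add: right_diff_distrib)
          moreover have "(1 / max 2 q - 1 / q) * q = q / max 2 q - 1" using q by (simp add: left_diff_distrib)
          ultimately show ?thesis by simp
        qed
        then show ?thesis by (simp add: powr_powr)
      qed
      have e3: "(W powr (1 / q)) powr q = W powr q * W powr (1 - q)" 
        unfolding powr_add[symmetric] powr_powr using q by simp
      have "(c * 2 powr (- \<mu> * real k) * N powr (1 / max 2 q - 1 / q) * W powr (1 / q)) powr q =
        (\<bar>c0\<bar> / 4) powr q * (C powr ((1 - q) / q)) powr q * (2 powr (- \<mu> * real k)) powr q *
        (N powr (1 / max 2 q - 1 / q)) powr q * (W powr (1 / q)) powr q"
        unfolding c_def using C N W by (simp only: powr_mult)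
      also have "\<dots> = ((\<bar>c0\<bar> / 4) powr q * (2 powr (- \<mu> * real k)) powr q * W powr q) *
        (C powr (1 - q) * (N powr E) powr (1 - q) * W powr (1 - q))"
        unfolding e1 e2 e3 by (simp only: mult_ac)
      also have "(\<bar>c0\<bar> / 4) powr q * (2 powr (- \<mu> * real k)) powr q * W powr q = (P / 2) powr q"
      proof -
        have "P / 2 = \<bar>c0\<bar> / 4 * 2 powr (- \<mu> * real k) * W" by (simp add: P_def)
        then show ?thesis using W by (simp only: powr_mult)
      qed
      also have "C powr (1 - q) * (N powr E) powr (1 - q) * W powr (1 - q) = (C * N powr E * W) powr (1 - q)"
        using C N W by (simp only: powr_mult)
      finally show ?thesis by simp
    qed
    ultimately show ?thesis by (simp only: N_def W_def)
  qed
  with c show ?thesis by blast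
qed

section \<open>Differences of a single scale\<close>

definition block :: "('n \<Rightarrow> nat) \<Rightarrow> (('n \<Rightarrow> nat) \<Rightarrow> real) \<Rightarrow> real^'n \<Rightarrow> real" where
  "block \<kappa> b x = (\<Sum>\<nu>\<in>V \<kappa>. b \<nu> * wav (\<lambda>_. 0) \<kappa> \<nu> x)"

text \<open>Order 0 is included for the coordinates outside \<open>J\<close>, in which no difference
  is taken. The same number of intervals for both orders gives all \<open>J\<close> a common index
  set.\<close>

lemma fdiff_cover_uniform:
  "\<exists>D>0. \<forall>m\<in>{0, l j}. \<forall>h. \<exists>\<tau>::nat \<Rightarrow> real. \<forall>t.
    \<bar>fdiff m h (F j 0) t\<bar> \<le> D * min 1 \<bar>h\<bar> ^ m * (\<Sum>i\<le>2*l j. indicator {0..<1} (t + \<tau> i))"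
proof -
  obtain D1 where D1: "D1 > 0" "\<And>h. \<exists>\<tau>::nat \<Rightarrow> real. \<forall>t.
    \<bar>fdiff (l j) h (F j 0) t\<bar> \<le> D1 * min 1 \<bar>h\<bar> ^ l j * (\<Sum>i\<le>2*l j. indicator {0..<1} (t + \<tau> i))"
    using fdiff_cover[of "l j" "F j"] F_der F_cont F_van by blast
  obtain M where M: "M > 0" "\<And>t. \<bar>F j 0 t\<bar> \<le> M"
    using continuous_vanishing_bounded[OF F_cont[of 0 j]] F_van[of _ j 0] by auto
  have F0: "\<bar>F j 0 t\<bar> \<le> M * indicator {0..<1} t" for t
    using M(2)[of t] F_van[of t j 0] by (auto simp: indicator_def)
  have le_sum: "indicator {0..<1} t \<le> (\<Sum>i\<le>2*l j. indicator {0..<1} (t + 0) :: real)" for t :: real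
    using member_le_sum[of 0 "{..2*l j}" "\<lambda>_. indicator {0..<1} t :: real"] by simp
  define D where "D = D1 + M"
  have "\<exists>\<tau>::nat \<Rightarrow> real. \<forall>t.
    \<bar>fdiff m h (F j 0) t\<bar> \<le> D * min 1 \<bar>h\<bar> ^ m * (\<Sum>i\<le>2*l j. indicator {0..<1} (t + \<tau> i))"
    if "m \<in> {0, l j}" for m h
  proof (cases "m = l j")
    case True
    obtain \<tau> :: "nat \<Rightarrow> real" where \<tau>: "\<And>t. \<bar>fdiff (l j) h (F j 0) t\<bar> \<le> D1 * min 1 \<bar>h\<bar> ^ l j * (\<Sum>i\<le>2*l j. indicator {0..<1} (t + \<tau> i))"
      using D1(2) by blast
    have "D1 * min 1 \<bar>h\<bar> ^ l j * (\<Sum>i\<le>2*l j. indicator {0..<1} (t + \<tau> i)) \<le> D * min 1 \<bar>h\<bar> ^ l j * (\<Sum>i\<le>2*l j. indicator {0..<1} (t + \<tau> i))" for t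
      using M by (intro mult_right_mono sum_nonneg) (auto simp: D_def)
    then show ?thesis using \<tau> True by (meson order_trans)
  next
    case False
    then have "m = 0" using that by simp
    have "\<bar>F j 0 t\<bar> \<le> D * (\<Sum>i\<le>2*l j. indicator {0..<1} (t + 0))" for t
    proof -
      have "\<bar>F j 0 t\<bar> \<le> M * (\<Sum>i\<le>2*l j. indicator {0..<1} (t + 0))"
        using F0[of t] le_sum[of t] M(1) by (meson mult_left_mono less_imp_le order_trans)
      also have "\<dots> \<le> D * (\<Sum>i\<le>2*l j. indicator {0..<1} (t + 0))"
        using D1 by (intro mult_right_mono sum_nonneg) (auto simp: D_def)
      finally show ?thesis .
    qed
    then show ?thesis using \<open>m = 0\<close> by (intro exI[of _ "\<lambda>_. 0"]) simp
  qed
  moreover have "D > 0" using D1 M by (simp add: D_def)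
  ultimately show ?thesis by blast
qed

lemma prod_\<beta>:
  fixes \<kappa> :: "'n \<Rightarrow> nat"
  shows "(\<Prod>j\<in>UNIV. 1 / \<beta> (\<kappa> j)) = \<rho> ^ CARD('n) / 2 ^ (\<Sum>j\<in>UNIV. \<kappa> j)"
  by (simp add: \<beta>_def prod_dividef power_sum)

text \<open>The one-dimensional covers multiply, and \<open>i\<close> selects an interval of the
  cover in each coordinate. The shifts \<open>\<sigma>\<close> depend on \<open>J\<close>, the scale
  and the step, but not on \<open>\<nu>\<close>: for fixed \<open>i\<close> the cells are all
  translated alike and remain disjoint.\<close>

lemma mdiff_block_le:
  "\<exists>C>0. \<forall>J \<kappa> \<xi>. \<exists>\<sigma> :: 'n \<Rightarrow> nat \<Rightarrow> real. \<forall>b x.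
     \<bar>mdiff (chiJ J l) (vecJ J \<xi>) (block \<kappa> b) x\<bar> \<le> C * (\<Prod>j\<in>J. min 1 (\<beta> (\<kappa> j) * \<bar>\<xi> j\<bar>) ^ l j) *
       (\<Sum>(i, \<nu>)\<in>PiE UNIV (\<lambda>j. {..2 * l j}) \<times> V \<kappa>.
          \<bar>b \<nu>\<bar> * (\<Prod>j\<in>UNIV. indicator {0..<1} (\<beta> (\<kappa> j) * (x $ j - e j) - (real (\<nu> j) - \<sigma> j (i j)))))"
proof -
  obtain D where D: "\<And>j. D j > 0" "\<And>j m h. m \<in> {0, l j} \<Longrightarrow> \<exists>\<tau>::nat \<Rightarrow> real. \<forall>t.
    \<bar>fdiff m h (F j 0) t\<bar> \<le> D j * min 1 \<bar>h\<bar> ^ m * (\<Sum>i\<le>2*l j. indicator {0..<1} (t + \<tau> i))"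
    using fdiff_cover_uniform by metis
  define C where "C = (\<Prod>j\<in>UNIV. D j)"
  have "\<exists>\<sigma> :: 'n \<Rightarrow> nat \<Rightarrow> real. \<forall>b x.
     \<bar>mdiff (chiJ J l) (vecJ J \<xi>) (block \<kappa> b) x\<bar> \<le> C * (\<Prod>j\<in>J. min 1 (\<beta> (\<kappa> j) * \<bar>\<xi> j\<bar>) ^ l j) *
       (\<Sum>(i, \<nu>)\<in>PiE UNIV (\<lambda>j. {..2 * l j}) \<times> V \<kappa>.
          \<bar>b \<nu>\<bar> * (\<Prod>j\<in>UNIV. indicator {0..<1} (\<beta> (\<kappa> j) * (x $ j - e j) - (real (\<nu> j) - \<sigma> j (i j)))))"
    for J \<kappa> \<xi>
  proof -
    define m where "m = chiJ J l"
    define h where "h j = \<beta> (\<kappa> j) * vecJ J \<xi> $ j" for j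
    have m: "m j \<in> {0, l j}" for j by (simp add: m_def chiJ_def)
    have "\<forall>j. \<exists>\<tau>::nat \<Rightarrow> real. \<forall>t. \<bar>fdiff (m j) (h j) (F j 0) t\<bar> \<le>
        D j * min 1 \<bar>h j\<bar> ^ m j * (\<Sum>i\<le>2*l j. indicator {0..<1} (t + \<tau> i))"
      by (rule allI, rule D(2)[OF m])
    from choice[OF this] obtain \<sigma> :: "'n \<Rightarrow> nat \<Rightarrow> real" where "\<forall>j t. \<bar>fdiff (m j) (h j) (F j 0) t\<bar> \<le>
        D j * min 1 \<bar>h j\<bar> ^ m j * (\<Sum>i\<le>2*l j. indicator {0..<1} (t + \<sigma> j i))" by (elim exE) (rule that)
    then have \<sigma>: "\<And>j t. \<bar>fdiff (m j) (h j) (F j 0) t\<bar> \<le>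
        D j * min 1 \<bar>h j\<bar> ^ m j * (\<Sum>i\<le>2*l j. indicator {0..<1} (t + \<sigma> j i))"
      by (elim allE)
    have mh: "(\<Prod>j\<in>UNIV. min 1 \<bar>h j\<bar> ^ m j) = (\<Prod>j\<in>J. min 1 (\<beta> (\<kappa> j) * \<bar>\<xi> j\<bar>) ^ l j)"
    proof -
      have "(\<Prod>j\<in>UNIV. min 1 \<bar>h j\<bar> ^ m j) = (\<Prod>j\<in>J. min 1 \<bar>h j\<bar> ^ m j)"
        by (intro prod.mono_neutral_right) (auto simp: m_def chiJ_def)
      also have "\<dots> = (\<Prod>j\<in>J. min 1 (\<beta> (\<kappa> j) * \<bar>\<xi> j\<bar>) ^ l j)"
        by (intro prod.cong refl) (simp add: m_def chiJ_def h_def vecJ_def abs_mult)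
      finally show ?thesis .
    qed
    have "\<bar>mdiff m (vecJ J \<xi>) (block \<kappa> b) x\<bar> \<le> C * (\<Prod>j\<in>J. min 1 (\<beta> (\<kappa> j) * \<bar>\<xi> j\<bar>) ^ l j) *
       (\<Sum>(i, \<nu>)\<in>PiE UNIV (\<lambda>j. {..2 * l j}) \<times> V \<kappa>.
          \<bar>b \<nu>\<bar> * (\<Prod>j\<in>UNIV. indicator {0..<1} (\<beta> (\<kappa> j) * (x $ j - e j) - (real (\<nu> j) - \<sigma> j (i j)))))" for b x
    proof -
      define I :: "('n \<Rightarrow> nat) set" where "I = PiE UNIV (\<lambda>j. {..2 * l j})"
      define ind where "ind i \<nu> = (\<Prod>j\<in>UNIV. indicator {0..<1} (\<beta> (\<kappa> j) * (x $ j - e j) - (real (\<nu> j) - \<sigma> j (i j))) :: real)" for i \<nu>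
      have wav: "mdiff m (vecJ J \<xi>) (wav (\<lambda>_. 0) \<kappa> \<nu>) x = (\<Prod>j\<in>UNIV. fdiff (m j) (h j) (F j 0) (loc \<kappa> \<nu> x j))" for \<nu>
      proof -
        have "wav (\<lambda>_. 0) \<kappa> \<nu> = (\<lambda>x. \<Prod>j\<in>UNIV. (\<lambda>t. F j 0 (\<beta> (\<kappa> j) * (t - e j) - real (\<nu> j))) (x $ j))"
          by (simp add: wav_def[abs_def] loc_def)
        then have "mdiff m (vecJ J \<xi>) (wav (\<lambda>_. 0) \<kappa> \<nu>) x =
            (\<Prod>j\<in>UNIV. fdiff (m j) (vecJ J \<xi> $ j) (\<lambda>t. F j 0 (\<beta> (\<kappa> j) * (t - e j) - real (\<nu> j))) (x $ j))"
          using mdiff_prod[of m "vecJ J \<xi>" "\<lambda>j t. F j 0 (\<beta> (\<kappa> j) * (t - e j) - real (\<nu> j))" x] by simp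
        then show ?thesis unfolding h_def loc_def by (simp only: fdiff_affine)
      qed
      have "\<bar>mdiff m (vecJ J \<xi>) (wav (\<lambda>_. 0) \<kappa> \<nu>) x\<bar> \<le> C * (\<Prod>j\<in>UNIV. min 1 \<bar>h j\<bar> ^ m j) * (\<Sum>i\<in>I. ind i \<nu>)" for \<nu>
      proof -
        have "\<bar>mdiff m (vecJ J \<xi>) (wav (\<lambda>_. 0) \<kappa> \<nu>) x\<bar> = (\<Prod>j\<in>UNIV. \<bar>fdiff (m j) (h j) (F j 0) (loc \<kappa> \<nu> x j)\<bar>)"
          unfolding wav by (rule abs_prod)
        also have "\<dots> \<le> (\<Prod>j\<in>UNIV. D j * min 1 \<bar>h j\<bar> ^ m j * (\<Sum>i\<le>2*l j. indicator {0..<1} (loc \<kappa> \<nu> x j + \<sigma> j i)))"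
          by (intro prod_mono conjI abs_ge_zero \<sigma>)
        also have "\<dots> = C * (\<Prod>j\<in>UNIV. min 1 \<bar>h j\<bar> ^ m j) * (\<Prod>j\<in>UNIV. \<Sum>i\<le>2*l j. indicator {0..<1} (loc \<kappa> \<nu> x j + \<sigma> j i))"
          by (simp only: prod.distrib C_def)
        also have "(\<Prod>j\<in>UNIV. \<Sum>i\<le>2*l j. indicator {0..<1} (loc \<kappa> \<nu> x j + \<sigma> j i) :: real) = (\<Sum>i\<in>I. ind i \<nu>)"
          unfolding I_def ind_def
          by (subst prod_sum_PiE) (auto simp: loc_def algebra_simps)
        finally show ?thesis .
      qed
      then have each: "\<bar>mdiff m (vecJ J \<xi>) (wav (\<lambda>_. 0) \<kappa> \<nu>) x\<bar> \<le> C * (\<Prod>j\<in>J. min 1 (\<beta> (\<kappa> j) * \<bar>\<xi> j\<bar>) ^ l j) * (\<Sum>i\<in>I. ind i \<nu>)" for \<nu>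
        unfolding mh .
      have "\<bar>mdiff m (vecJ J \<xi>) (block \<kappa> b) x\<bar> = \<bar>\<Sum>\<nu>\<in>V \<kappa>. b \<nu> * mdiff m (vecJ J \<xi>) (wav (\<lambda>_. 0) \<kappa> \<nu>) x\<bar>"
        unfolding block_def[abs_def] by (simp only: mdiff_sum)
      also have "\<dots> \<le> (\<Sum>\<nu>\<in>V \<kappa>. \<bar>b \<nu>\<bar> * \<bar>mdiff m (vecJ J \<xi>) (wav (\<lambda>_. 0) \<kappa> \<nu>) x\<bar>)"
        unfolding abs_mult[symmetric] by (rule sum_abs)
      also have "\<dots> \<le> (\<Sum>\<nu>\<in>V \<kappa>. \<bar>b \<nu>\<bar> * (C * (\<Prod>j\<in>J. min 1 (\<beta> (\<kappa> j) * \<bar>\<xi> j\<bar>) ^ l j) * (\<Sum>i\<in>I. ind i \<nu>)))"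
        by (intro sum_mono mult_left_mono each abs_ge_zero)
      also have "\<dots> = C * (\<Prod>j\<in>J. min 1 (\<beta> (\<kappa> j) * \<bar>\<xi> j\<bar>) ^ l j) * (\<Sum>\<nu>\<in>V \<kappa>. \<Sum>i\<in>I. \<bar>b \<nu>\<bar> * ind i \<nu>)"
      proof -
        have "(\<Sum>\<nu>\<in>V \<kappa>. \<bar>b \<nu>\<bar> * (c * (\<Sum>i\<in>I. ind i \<nu>))) = (\<Sum>\<nu>\<in>V \<kappa>. c * (\<bar>b \<nu>\<bar> * (\<Sum>i\<in>I. ind i \<nu>)))" for c
          by (intro sum.cong refl) (rule mult.left_commute)
        then show ?thesis by (simp only: sum_distrib_left[symmetric])
      qed
      also have "(\<Sum>\<nu>\<in>V \<kappa>. \<Sum>i\<in>I. \<bar>b \<nu>\<bar> * ind i \<nu>) = (\<Sum>(i, \<nu>)\<in>I \<times> V \<kappa>. \<bar>b \<nu>\<bar> * ind i \<nu>)"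
        by (subst sum.swap) (rule sum.cartesian_product)
      finally show ?thesis unfolding I_def ind_def .
    qed
    then show ?thesis unfolding m_def by blast
  qed
  moreover have "C > 0" unfolding C_def by (intro prod_pos D(1))
  ultimately show ?thesis by blast
qed

lemma continuous_block: "continuous_on UNIV (block \<kappa> b)"
  unfolding block_def[abs_def] by (intro continuous_intros continuous_wav) simp

lemma measurable_mdiff:
  assumes "continuous_on UNIV f"
  shows "mdiff m h f \<in> borel_measurable borel"
proof -
  have "continuous_on UNIV (\<lambda>x. f (shift_pt x k h))" for k
    by (rule continuous_on_compose2[OF assms]) (auto simp: shift_pt_def intro!: continuous_intros continuous_on_vec_lambda)
  then have "continuous_on UNIV (mdiff m h f)"
    unfolding mdiff_def[abs_def] by (intro continuous_intros)
  then show ?thesis by (rule borel_measurable_continuous_onI)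
qed

text \<open>\<open>B\<close> bounds the mean of order \<open>p\<close> of the coefficients over the
  cells. By disjointness for fixed \<open>i\<close>, at most \<open>card I\<close> terms are nonzero
  at a point, so the power of the sum is controlled by the sum of the powers.\<close>

lemma nn_integral_mdiff_block:
  assumes p: "1 \<le> p"
  shows "\<exists>C>0. \<forall>J \<kappa> \<xi> b B. 0 \<le> B \<longrightarrow> (\<Sum>\<nu>\<in>V \<kappa>. \<bar>b \<nu>\<bar> powr p) \<le> 2 ^ (\<Sum>j\<in>UNIV. \<kappa> j) * B powr p \<longrightarrow>
    (\<integral>\<^sup>+x. ennreal (\<bar>mdiff (chiJ J l) (vecJ J \<xi>) (block \<kappa> b) x\<bar> powr p) \<partial>lborel) \<le>
      ennreal ((C * (\<Prod>j\<in>J. min 1 (\<beta> (\<kappa> j) * \<bar>\<xi> j\<bar>) ^ l j) * B) powr p)"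
proof -
  obtain C0 where C0: "C0 > 0" and cov: "\<And>J \<kappa> \<xi>. \<exists>\<sigma> :: 'n \<Rightarrow> nat \<Rightarrow> real. \<forall>b x.
     \<bar>mdiff (chiJ J l) (vecJ J \<xi>) (block \<kappa> b) x\<bar> \<le> C0 * (\<Prod>j\<in>J. min 1 (\<beta> (\<kappa> j) * \<bar>\<xi> j\<bar>) ^ l j) *
       (\<Sum>(i, \<nu>)\<in>PiE UNIV (\<lambda>j. {..2 * l j}) \<times> V \<kappa>.
          \<bar>b \<nu>\<bar> * (\<Prod>j\<in>UNIV. indicator {0..<1} (\<beta> (\<kappa> j) * (x $ j - e j) - (real (\<nu> j) - \<sigma> j (i j)))))"
    using mdiff_block_le by blast
  define I :: "('n \<Rightarrow> nat) set" where "I = PiE UNIV (\<lambda>j. {..2 * l j})"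
  define R where "R = real (card I)"
  have I: "finite I" unfolding I_def by (intro finite_PiE) auto
  have "(\<lambda>_. 0) \<in> I" by (simp add: I_def PiE_iff extensional_def)
  then have R: "R > 0" using I by (auto simp: R_def card_gt_0_iff)
  \<comment> \<open>The first \<open>R\<close> bounds the overlap, the second counts the translates
    of every cell. Adding 1 makes the last factor at least 1, so it may be raised to the power
    \<open>p\<close>.\<close>
  define C where "C = C0 * R * (R * \<rho> ^ CARD('n) + 1)"
  have C: "C > 0" using C0 R \<rho>_pos by (simp add: C_def add_pos_pos)
  have "(\<integral>\<^sup>+x. ennreal (\<bar>mdiff (chiJ J l) (vecJ J \<xi>) (block \<kappa> b) x\<bar> powr p) \<partial>lborel) \<le>
      ennreal ((C * (\<Prod>j\<in>J. min 1 (\<beta> (\<kappa> j) * \<bar>\<xi> j\<bar>) ^ l j) * B) powr p)"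
    if B: "0 \<le> B" and sum_b: "(\<Sum>\<nu>\<in>V \<kappa>. \<bar>b \<nu>\<bar> powr p) \<le> 2 ^ (\<Sum>j\<in>UNIV. \<kappa> j) * B powr p" for J \<kappa> \<xi> b B
  proof -
    from cov[of J \<xi> \<kappa>, folded I_def] obtain \<sigma> :: "'n \<Rightarrow> nat \<Rightarrow> real" where "\<forall>b x. \<bar>mdiff (chiJ J l) (vecJ J \<xi>) (block \<kappa> b) x\<bar> \<le>
       C0 * (\<Prod>j\<in>J. min 1 (\<beta> (\<kappa> j) * \<bar>\<xi> j\<bar>) ^ l j) * (\<Sum>(i, \<nu>)\<in>I \<times> V \<kappa>.
          \<bar>b \<nu>\<bar> * (\<Prod>j\<in>UNIV. indicator {0..<1} (\<beta> (\<kappa> j) * (x $ j - e j) - (real (\<nu> j) - \<sigma> j (i j)))))"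
      by (elim exE) (rule that)
    then have \<sigma>: "\<And>x. \<bar>mdiff (chiJ J l) (vecJ J \<xi>) (block \<kappa> b) x\<bar> \<le>
       C0 * (\<Prod>j\<in>J. min 1 (\<beta> (\<kappa> j) * \<bar>\<xi> j\<bar>) ^ l j) * (\<Sum>(i, \<nu>)\<in>I \<times> V \<kappa>.
          \<bar>b \<nu>\<bar> * (\<Prod>j\<in>UNIV. indicator {0..<1} (\<beta> (\<kappa> j) * (x $ j - e j) - (real (\<nu> j) - \<sigma> j (i j)))))"
      by (elim allE)
    define ind where "ind t x = (\<Prod>j\<in>UNIV. indicator {0..<1} (\<beta> (\<kappa> j) * (x $ j - e j) - (real (snd t j) - \<sigma> j (fst t j))) :: real)"
      for t :: "('n \<Rightarrow> nat) \<times> ('n \<Rightarrow> nat)" and x :: "real^'n"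
    define T where "T = I \<times> V \<kappa>"
    define M where "M = (\<Prod>j\<in>J. min 1 (\<beta> (\<kappa> j) * \<bar>\<xi> j\<bar>) ^ l j)"
    have M: "0 \<le> M" unfolding M_def by (intro prod_nonneg) auto
    have T: "finite T" using I by (simp add: T_def)
    have ind01: "ind t x = 0 \<or> ind t x = 1" for t x
    proof (cases "\<forall>j. \<beta> (\<kappa> j) * (x $ j - e j) - (real (snd t j) - \<sigma> j (fst t j)) \<in> {0..<1}")
      case True
      then have "ind t x = 1" unfolding ind_def by (intro prod.neutral ballI) (simp only: indicator_simps)
      then show ?thesis ..
    next
      case False
      then have "ind t x = 0" unfolding ind_def by (auto intro!: prod_zero simp: indicator_def)
      then show ?thesis ..
    qed
    have ind_nn: "0 \<le> ind t x" for t x using ind01[of t x] by auto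
    have card_le: "card {t\<in>T. \<bar>b (snd t)\<bar> * ind t x \<noteq> 0} \<le> card I" for x
    proof (rule card_inj_on_le[of fst])
      show "inj_on fst {t\<in>T. \<bar>b (snd t)\<bar> * ind t x \<noteq> 0}"
      proof (rule inj_onI)
        fix t t' assume t: "t \<in> {t\<in>T. \<bar>b (snd t)\<bar> * ind t x \<noteq> 0}" "t' \<in> {t\<in>T. \<bar>b (snd t)\<bar> * ind t x \<noteq> 0}"
          and eq: "fst t = fst t'"
        have mem: "\<beta> (\<kappa> j) * (x $ j - e j) - (real (snd u j) - \<sigma> j (fst u j)) \<in> {0..<1}"
          if "ind u x \<noteq> 0" for u j
        proof (rule ccontr)
          assume "\<not> ?thesis"
          then have "indicator {0..<1} (\<beta> (\<kappa> j) * (x $ j - e j) - (real (snd u j) - \<sigma> j (fst u j))) = (0::real)"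
            by (rule indicator_simps(2))
          then have "ind u x = 0" unfolding ind_def by (intro prod_zero bexI[of _ j]) simp_all
          with that show False by simp
        qed
        have "snd t j = snd t' j" for j
        proof -
          have "ind t x \<noteq> 0" "ind t' x \<noteq> 0" using t by auto
          from mem[OF this(1), of j] mem[OF this(2), of j] show ?thesis unfolding eq by auto
        qed
        then show "t = t'" using eq by (auto simp: prod_eq_iff)
      qed
    qed (use I in \<open>auto simp: T_def\<close>)
    have pt: "\<bar>mdiff (chiJ J l) (vecJ J \<xi>) (block \<kappa> b) x\<bar> powr p \<le>
       (C0 * M * R) powr p * (\<Sum>t\<in>T. \<bar>b (snd t)\<bar> powr p * ind t x)" for x
    proof -
      have "\<bar>mdiff (chiJ J l) (vecJ J \<xi>) (block \<kappa> b) x\<bar> \<le> C0 * M * (\<Sum>t\<in>T. \<bar>b (snd t)\<bar> * ind t x)"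
        using \<sigma>[of x] by (simp add: T_def M_def ind_def split_def)
      then have "\<bar>mdiff (chiJ J l) (vecJ J \<xi>) (block \<kappa> b) x\<bar> powr p \<le> (C0 * M * (\<Sum>t\<in>T. \<bar>b (snd t)\<bar> * ind t x)) powr p"
        using p by (intro powr_mono2) auto
      also have "\<dots> = (C0 * M) powr p * (\<Sum>t\<in>T. \<bar>b (snd t)\<bar> * ind t x) powr p" by (rule powr_mult)
      also have "\<dots> \<le> (C0 * M) powr p * (R powr p * (\<Sum>t\<in>T. (\<bar>b (snd t)\<bar> * ind t x) powr p))"
        unfolding R_def using T card_le[of x] p ind_nn
        by (intro mult_left_mono powr_sum_le) auto
      also have "\<dots> = (C0 * M * R) powr p * (\<Sum>t\<in>T. \<bar>b (snd t)\<bar> powr p * ind t x)"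
      proof -
        have "(\<bar>b (snd t)\<bar> * ind t x) powr p = \<bar>b (snd t)\<bar> powr p * ind t x" for t
          using ind01[of t x] by auto
        then have eq: "(\<Sum>t\<in>T. (\<bar>b (snd t)\<bar> * ind t x) powr p) = (\<Sum>t\<in>T. \<bar>b (snd t)\<bar> powr p * ind t x)"
          by (intro sum.cong refl)
        show ?thesis unfolding eq powr_mult[of "C0 * M" R] by (rule mult.assoc[symmetric])
      qed
      finally show ?thesis .
    qed
    have ind_int: "(\<integral>\<^sup>+x. ennreal (ind t x) \<partial>lborel) = ennreal (\<rho> ^ CARD('n) / 2 ^ (\<Sum>j\<in>UNIV. \<kappa> j))" for t
      unfolding ind_def by (subst nn_integral_cell) (simp_all only: prod_\<beta> \<beta>_pos)
    have ind_meas: "(\<lambda>x. ennreal (ind t x)) \<in> borel_measurable lborel" for t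
      unfolding ind_def by measurable
    have "(\<integral>\<^sup>+x. ennreal (\<bar>mdiff (chiJ J l) (vecJ J \<xi>) (block \<kappa> b) x\<bar> powr p) \<partial>lborel) \<le>
        (\<integral>\<^sup>+x. (\<Sum>t\<in>T. ennreal ((C0 * M * R) powr p * \<bar>b (snd t)\<bar> powr p) * ennreal (ind t x)) \<partial>lborel)"
    proof (rule nn_integral_mono)
      fix x
      have "ennreal (\<bar>mdiff (chiJ J l) (vecJ J \<xi>) (block \<kappa> b) x\<bar> powr p) \<le>
        ennreal (\<Sum>t\<in>T. (C0 * M * R) powr p * \<bar>b (snd t)\<bar> powr p * ind t x)"
        using pt[of x] by (intro ennreal_leI) (simp only: sum_distrib_left mult.assoc)
      also have "\<dots> = (\<Sum>t\<in>T. ennreal ((C0 * M * R) powr p * \<bar>b (snd t)\<bar> powr p * ind t x))"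
        by (intro sum_ennreal[symmetric] mult_nonneg_nonneg powr_ge_zero ind_nn)
      also have "\<dots> = (\<Sum>t\<in>T. ennreal ((C0 * M * R) powr p * \<bar>b (snd t)\<bar> powr p) * ennreal (ind t x))"
        by (intro sum.cong refl ennreal_mult mult_nonneg_nonneg powr_ge_zero ind_nn)
      finally show "ennreal (\<bar>mdiff (chiJ J l) (vecJ J \<xi>) (block \<kappa> b) x\<bar> powr p) \<le>
        (\<Sum>t\<in>T. ennreal ((C0 * M * R) powr p * \<bar>b (snd t)\<bar> powr p) * ennreal (ind t x))" .
    qed
    also have "\<dots> = (\<Sum>t\<in>T. \<integral>\<^sup>+x. ennreal ((C0 * M * R) powr p * \<bar>b (snd t)\<bar> powr p) * ennreal (ind t x) \<partial>lborel)"
      by (intro nn_integral_sum borel_measurable_times_ennreal ind_meas borel_measurable_const)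
    also have "\<dots> = (\<Sum>t\<in>T. ennreal ((C0 * M * R) powr p * \<bar>b (snd t)\<bar> powr p) * ennreal (\<rho> ^ CARD('n) / 2 ^ (\<Sum>j\<in>UNIV. \<kappa> j)))"
      by (simp only: nn_integral_cmult[OF ind_meas] ind_int)
    also have "\<dots> = (\<Sum>t\<in>T. ennreal ((C0 * M * R) powr p * \<bar>b (snd t)\<bar> powr p * (\<rho> ^ CARD('n) / 2 ^ (\<Sum>j\<in>UNIV. \<kappa> j))))"
      using \<rho>_pos by (intro sum.cong refl ennreal_mult[symmetric]) auto
    also have "\<dots> = ennreal (\<Sum>t\<in>T. (C0 * M * R) powr p * \<bar>b (snd t)\<bar> powr p * (\<rho> ^ CARD('n) / 2 ^ (\<Sum>j\<in>UNIV. \<kappa> j)))"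
      using \<rho>_pos by (intro sum_ennreal) auto
    also have "\<dots> \<le> ennreal ((C * M * B) powr p)"
    proof (rule ennreal_leI)
      have "(\<Sum>t\<in>T. \<bar>b (snd t)\<bar> powr p) = R * (\<Sum>\<nu>\<in>V \<kappa>. \<bar>b \<nu>\<bar> powr p)"
        unfolding T_def by (simp add: sum.cartesian_product[symmetric, of "\<lambda>_ \<nu>. \<bar>b \<nu>\<bar> powr p", unfolded split_def] R_def)
      then have "(\<Sum>t\<in>T. (C0 * M * R) powr p * \<bar>b (snd t)\<bar> powr p * (\<rho> ^ CARD('n) / 2 ^ (\<Sum>j\<in>UNIV. \<kappa> j))) =
        (C0 * M * R) powr p * (R * (\<Sum>\<nu>\<in>V \<kappa>. \<bar>b \<nu>\<bar> powr p)) * (\<rho> ^ CARD('n) / 2 ^ (\<Sum>j\<in>UNIV. \<kappa> j))"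
        by (simp only: sum_distrib_left[symmetric] sum_distrib_right[symmetric])
      also have "\<dots> \<le> (C0 * M * R) powr p * (R * (2 ^ (\<Sum>j\<in>UNIV. \<kappa> j) * B powr p)) * (\<rho> ^ CARD('n) / 2 ^ (\<Sum>j\<in>UNIV. \<kappa> j))"
        using sum_b R \<rho>_pos by (intro mult_right_mono mult_left_mono) auto
      also have "\<dots> = (C0 * M * R) powr p * (R * \<rho> ^ CARD('n)) * B powr p" by simp
      also have "\<dots> \<le> (C0 * M * R) powr p * (R * \<rho> ^ CARD('n) + 1) powr p * B powr p"
      proof (intro mult_right_mono mult_left_mono)
        have "R * \<rho> ^ CARD('n) \<le> (R * \<rho> ^ CARD('n) + 1) powr 1" using R \<rho>_pos by (simp add: add_nonneg_nonneg)
        also have "\<dots> \<le> (R * \<rho> ^ CARD('n) + 1) powr p" using R \<rho>_pos p by (intro powr_mono) auto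
        finally show "R * \<rho> ^ CARD('n) \<le> (R * \<rho> ^ CARD('n) + 1) powr p" .
      qed auto
      also have "\<dots> = (C0 * M * R * (R * \<rho> ^ CARD('n) + 1) * B) powr p" by (simp only: powr_mult)
      also have "C0 * M * R * (R * \<rho> ^ CARD('n) + 1) * B = C * M * B" by (simp add: C_def)
      finally show "(\<Sum>t\<in>T. (C0 * M * R) powr p * \<bar>b (snd t)\<bar> powr p * (\<rho> ^ CARD('n) / 2 ^ (\<Sum>j\<in>UNIV. \<kappa> j))) \<le> (C * M * B) powr p" .
    qed
    finally show ?thesis unfolding M_def .
  qed
  with C show ?thesis by blast
qed

section \<open>Upper bound for the Besov norm\<close>

definition ampl :: "('n \<Rightarrow> nat) \<Rightarrow> real" where
  "ampl \<kappa> = (\<Prod>j\<in>UNIV. \<beta> (\<kappa> j) powr (- \<alpha> j))"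

text \<open>The share of scale \<open>\<kappa>\<close> in the weighted modulus of smoothness.
  Coordinates of \<open>J\<close> give a Schur kernel; in the others no step occurs and the
  normalising factor itself provides the geometric decay.\<close>

definition schur_weight :: "'n set \<Rightarrow> ('n \<Rightarrow> real) \<Rightarrow> ('n \<Rightarrow> nat) \<Rightarrow> real" where
  "schur_weight J t \<kappa> = (\<Prod>j\<in>UNIV. if j \<in> J then schur_kernel (\<alpha> j) (l j) (\<beta> (\<kappa> j) * t j) else \<beta> (\<kappa> j) powr (- \<alpha> j))"

definition step_bound :: "'n set \<Rightarrow> ('n \<Rightarrow> real) \<Rightarrow> ('n \<Rightarrow> nat) \<Rightarrow> real" where
  "step_bound J t \<kappa> = ampl \<kappa> * (\<Prod>j\<in>J. min 1 (\<beta> (\<kappa> j) * t j) ^ l j)"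

lemma ampl_nonneg: "0 \<le> ampl \<kappa>"
  unfolding ampl_def by (intro prod_nonneg) auto

lemma step_bound_nonneg: "(\<And>j. j \<in> J \<Longrightarrow> 0 \<le> t j) \<Longrightarrow> 0 \<le> step_bound J t \<kappa>"
  unfolding step_bound_def by (intro mult_nonneg_nonneg ampl_nonneg prod_nonneg) auto

lemma schur_weight_nonneg: "(\<And>j. j \<in> J \<Longrightarrow> 0 < t j) \<Longrightarrow> 0 \<le> schur_weight J t \<kappa>"
  unfolding schur_weight_def by (intro prod_nonneg) (auto intro!: schur_kernel_nonneg mult_nonneg_nonneg simp: less_imp_le)

lemma prod_split_subset:
  fixes f :: "'n \<Rightarrow> real"
  shows "(\<Prod>j\<in>UNIV. f j) = (\<Prod>j\<in>J. f j) * (\<Prod>j\<in>-J. f j)"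
proof -
  have "(\<Prod>j\<in>J \<union> -J. f j) = (\<Prod>j\<in>J. f j) * (\<Prod>j\<in>-J. f j)"
    by (intro prod.union_disjoint) auto
  then show ?thesis by simp
qed

lemma schur_weight_split:
  "schur_weight J t \<kappa> = (\<Prod>j\<in>J. schur_kernel (\<alpha> j) (l j) (\<beta> (\<kappa> j) * t j)) * (\<Prod>j\<in>-J. \<beta> (\<kappa> j) powr (- \<alpha> j))"
  unfolding schur_weight_def prod_split_subset[of _ J] by (intro arg_cong2[of _ _ _ _ "(*)"] prod.cong refl) auto

lemma schur_weight_eq:
  assumes "\<And>j. j \<in> J \<Longrightarrow> 0 < t j"
  shows "(\<Prod>j\<in>J. t j powr (- \<alpha> j)) * step_bound J t \<kappa> = schur_weight J t \<kappa>"
proof -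
  have "(\<Prod>j\<in>J. t j powr (- \<alpha> j)) * step_bound J t \<kappa> =
    (\<Prod>j\<in>J. t j powr (- \<alpha> j) * \<beta> (\<kappa> j) powr (- \<alpha> j) * min 1 (\<beta> (\<kappa> j) * t j) ^ l j) * (\<Prod>j\<in>-J. \<beta> (\<kappa> j) powr (- \<alpha> j))"
    unfolding step_bound_def ampl_def by (subst prod_split_subset[of _ J]) (simp add: prod.distrib)
  also have "(\<Prod>j\<in>J. t j powr (- \<alpha> j) * \<beta> (\<kappa> j) powr (- \<alpha> j) * min 1 (\<beta> (\<kappa> j) * t j) ^ l j) =
      (\<Prod>j\<in>J. schur_kernel (\<alpha> j) (l j) (\<beta> (\<kappa> j) * t j))"
    by (intro prod.cong refl) (simp add: schur_kernel_def powr_mult mult.commute)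
  also have "\<dots> * (\<Prod>j\<in>-J. \<beta> (\<kappa> j) powr (- \<alpha> j)) = schur_weight J t \<kappa>"
    by (simp only: schur_weight_split)
  finally show ?thesis .
qed

lemma synth_eq_blocks: "synth (\<lambda>_. 0) A a = (\<lambda>x. \<Sum>\<kappa>\<in>A. ampl \<kappa> * block \<kappa> (a \<kappa>) x)"
  by (simp add: fun_eq_iff synth_def ampl_def block_def sum_distrib_left mult.assoc)

lemma nn_integral_mdiff_synth:
  assumes p: "1 \<le> p"
  shows "\<exists>C>0. \<forall>A a B J t \<xi>. finite A \<longrightarrow>
    (\<forall>\<kappa>\<in>A. 0 \<le> B \<kappa> \<and> (\<Sum>\<nu>\<in>V \<kappa>. \<bar>a \<kappa> \<nu>\<bar> powr p) \<le> 2 ^ (\<Sum>j\<in>UNIV. \<kappa> j) * B \<kappa> powr p) \<longrightarrow>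
    (\<forall>j\<in>J. \<bar>\<xi> j\<bar> \<le> t j) \<longrightarrow>
    (\<integral>\<^sup>+x. ennreal (\<bar>mdiff (chiJ J l) (vecJ J \<xi>) (synth (\<lambda>_. 0) A a) x\<bar> powr p) \<partial>lborel) \<le>
      ennreal ((C * (\<Sum>\<kappa>\<in>A. step_bound J t \<kappa> * B \<kappa>)) powr p)"
proof -
  obtain C where C: "C > 0" and blk: "\<And>J \<kappa> \<xi> b B. 0 \<le> B \<Longrightarrow> (\<Sum>\<nu>\<in>V \<kappa>. \<bar>b \<nu>\<bar> powr p) \<le> 2 ^ (\<Sum>j\<in>UNIV. \<kappa> j) * B powr p \<Longrightarrow>
    (\<integral>\<^sup>+x. ennreal (\<bar>mdiff (chiJ J l) (vecJ J \<xi>) (block \<kappa> b) x\<bar> powr p) \<partial>lborel) \<le>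
      ennreal ((C * (\<Prod>j\<in>J. min 1 (\<beta> (\<kappa> j) * \<bar>\<xi> j\<bar>) ^ l j) * B) powr p)"
    using nn_integral_mdiff_block[OF p] by blast
  have "(\<integral>\<^sup>+x. ennreal (\<bar>mdiff (chiJ J l) (vecJ J \<xi>) (synth (\<lambda>_. 0) A a) x\<bar> powr p) \<partial>lborel) \<le>
      ennreal ((C * (\<Sum>\<kappa>\<in>A. step_bound J t \<kappa> * B \<kappa>)) powr p)"
    if A: "finite A" and B: "\<forall>\<kappa>\<in>A. 0 \<le> B \<kappa> \<and> (\<Sum>\<nu>\<in>V \<kappa>. \<bar>a \<kappa> \<nu>\<bar> powr p) \<le> 2 ^ (\<Sum>j\<in>UNIV. \<kappa> j) * B \<kappa> powr p"
      and \<xi>: "\<forall>j\<in>J. \<bar>\<xi> j\<bar> \<le> t j" for A a B J t \<xi>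
  proof -
    define f where "f \<kappa> x = ampl \<kappa> * mdiff (chiJ J l) (vecJ J \<xi>) (block \<kappa> (a \<kappa>)) x" for \<kappa> x
    have t: "0 \<le> t j" if "j \<in> J" for j using \<xi> that by (meson abs_ge_zero order_trans)
    have "mdiff (chiJ J l) (vecJ J \<xi>) (synth (\<lambda>_. 0) A a) x = (\<Sum>\<kappa>\<in>A. f \<kappa> x)" for x
      unfolding synth_eq_blocks f_def by (rule mdiff_sum)
    then have "(\<integral>\<^sup>+x. ennreal (\<bar>mdiff (chiJ J l) (vecJ J \<xi>) (synth (\<lambda>_. 0) A a) x\<bar> powr p) \<partial>lborel) =
      (\<integral>\<^sup>+x. ennreal (\<bar>\<Sum>\<kappa>\<in>A. f \<kappa> x\<bar> powr p) \<partial>lborel)" by simp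
    also have "\<dots> \<le> ennreal ((\<Sum>\<kappa>\<in>A. C * (step_bound J t \<kappa> * B \<kappa>)) powr p)"
    proof (rule nn_integral_sum_powr_le[OF A _ _ _ p])
      fix \<kappa> assume \<kappa>: "\<kappa> \<in> A"
      have meas: "mdiff (chiJ J l) (vecJ J \<xi>) (block \<kappa> (a \<kappa>)) \<in> borel_measurable borel"
        by (rule measurable_mdiff[OF continuous_block])
      then show "f \<kappa> \<in> borel_measurable borel" unfolding f_def by measurable
      show "0 \<le> C * (step_bound J t \<kappa> * B \<kappa>)"
        using C B \<kappa> step_bound_nonneg[OF t] by (intro mult_nonneg_nonneg) auto
      have "(\<integral>\<^sup>+x. ennreal (\<bar>f \<kappa> x\<bar> powr p) \<partial>lborel) =
         (\<integral>\<^sup>+x. ennreal (ampl \<kappa> powr p) * ennreal (\<bar>mdiff (chiJ J l) (vecJ J \<xi>) (block \<kappa> (a \<kappa>)) x\<bar> powr p) \<partial>lborel)"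
        using ampl_nonneg[of \<kappa>] by (intro nn_integral_cong) (simp add: f_def abs_mult powr_mult ennreal_mult)
      also have "\<dots> = ennreal (ampl \<kappa> powr p) * (\<integral>\<^sup>+x. ennreal (\<bar>mdiff (chiJ J l) (vecJ J \<xi>) (block \<kappa> (a \<kappa>)) x\<bar> powr p) \<partial>lborel)"
        using meas by (intro nn_integral_cmult) simp
      also have "\<dots> \<le> ennreal (ampl \<kappa> powr p) * ennreal ((C * (\<Prod>j\<in>J. min 1 (\<beta> (\<kappa> j) * \<bar>\<xi> j\<bar>) ^ l j) * B \<kappa>) powr p)"
        using B \<kappa> by (intro mult_left_mono blk) auto
      also have "\<dots> = ennreal ((C * (ampl \<kappa> * (\<Prod>j\<in>J. min 1 (\<beta> (\<kappa> j) * \<bar>\<xi> j\<bar>) ^ l j) * B \<kappa>)) powr p)"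
        by (subst ennreal_mult[symmetric]) (simp_all add: powr_mult mult_ac)
      also have "\<dots> \<le> ennreal ((C * (step_bound J t \<kappa> * B \<kappa>)) powr p)"
      proof (intro ennreal_leI powr_mono2)
        have "(\<Prod>j\<in>J. min 1 (\<beta> (\<kappa> j) * \<bar>\<xi> j\<bar>) ^ l j) \<le> (\<Prod>j\<in>J. min 1 (\<beta> (\<kappa> j) * t j) ^ l j)"
        proof (intro prod_mono conjI power_mono)
          fix j assume "j \<in> J"
          then have "\<beta> (\<kappa> j) * \<bar>\<xi> j\<bar> \<le> \<beta> (\<kappa> j) * t j" using \<xi> by (intro mult_left_mono) auto
          then show "min 1 (\<beta> (\<kappa> j) * \<bar>\<xi> j\<bar>) \<le> min 1 (\<beta> (\<kappa> j) * t j)" by (rule min.mono[OF order_refl])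
        qed auto
        then show "C * (ampl \<kappa> * (\<Prod>j\<in>J. min 1 (\<beta> (\<kappa> j) * \<bar>\<xi> j\<bar>) ^ l j) * B \<kappa>) \<le> C * (step_bound J t \<kappa> * B \<kappa>)"
          unfolding step_bound_def using C B \<kappa> ampl_nonneg by (intro mult_left_mono mult_right_mono) auto
        show "0 \<le> C * (ampl \<kappa> * (\<Prod>j\<in>J. min 1 (\<beta> (\<kappa> j) * \<bar>\<xi> j\<bar>) ^ l j) * B \<kappa>)"
          using C B \<kappa> by (intro mult_nonneg_nonneg ampl_nonneg prod_nonneg) auto
      qed (use p in auto)
      finally show "(\<integral>\<^sup>+x. ennreal (\<bar>f \<kappa> x\<bar> powr p) \<partial>lborel) \<le> ennreal ((C * (step_bound J t \<kappa> * B \<kappa>)) powr p)" .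
    qed
    finally show ?thesis by (simp only: sum_distrib_left)
  qed
  with C show ?thesis by blast
qed

lemma \<beta>_powr: "\<beta> i powr (- \<alpha> j) = \<rho> powr \<alpha> j * (2 powr (- \<alpha> j)) ^ i"
proof -
  have "\<beta> i powr (- \<alpha> j) = (2 powr real i) powr (- \<alpha> j) / \<rho> powr (- \<alpha> j)"
    unfolding \<beta>_def by (simp add: powr_divide powr_realpow)
  also have "\<dots> = \<rho> powr \<alpha> j * (2 powr (- \<alpha> j)) ^ i"
  proof -
    have "(2 powr real i) powr (- \<alpha> j) = (2 powr (- \<alpha> j)) ^ i"
      by (subst powr_realpow[symmetric], simp, simp only: powr_powr mult.commute)
    then show ?thesis by (simp add: powr_minus divide_inverse)
  qed
  finally show ?thesis .
qed

lemma two_powr_minus_\<alpha>: "2 powr (- \<alpha> j) < 1"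
  using powr_less_mono[of "- \<alpha> j" 0 2] \<alpha>_pos[of j] by simp

lemma sum_schur_weight:
  "\<exists>C>0. \<forall>J t A. finite A \<longrightarrow> (\<forall>j\<in>J. 0 < t j) \<longrightarrow> (\<Sum>\<kappa>\<in>A. schur_weight J t \<kappa>) \<le> C"
proof -
  have "\<forall>j. \<exists>C>0. \<forall>v>0. \<forall>I. finite I \<longrightarrow> (\<Sum>i\<in>I. schur_kernel (\<alpha> j) (l j) (2 ^ i * v)) \<le> C"
    by (intro allI sum_schur_kernel \<alpha>_pos \<alpha>_less)
  from choice[OF this] obtain D where D: "\<And>j. D j > 0"
    "\<And>j v I. v > 0 \<Longrightarrow> finite I \<Longrightarrow> (\<Sum>i\<in>I. schur_kernel (\<alpha> j) (l j) (2 ^ i * v)) \<le> D j" by blast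
  define E where "E j = \<rho> powr \<alpha> j * (1 / (1 - 2 powr (- \<alpha> j)))" for j
  have E: "E j > 0" for j using two_powr_minus_\<alpha>[of j] \<rho>_pos by (simp add: E_def)
  have "(\<Sum>\<kappa>\<in>A. schur_weight J t \<kappa>) \<le> (\<Prod>j\<in>UNIV. D j + E j)"
    if A: "finite A" and t: "\<forall>j\<in>J. 0 < t j" for J t A
  proof -
    define c where "c j i = (if j \<in> J then schur_kernel (\<alpha> j) (l j) (\<beta> i * t j) else \<beta> i powr (- \<alpha> j))" for j i
    have c0: "0 \<le> c j i" for j i using t by (auto simp: c_def less_imp_le intro!: schur_kernel_nonneg mult_nonneg_nonneg)
    define m where "m = (\<Sum>\<kappa>\<in>A. \<Sum>j\<in>UNIV. \<kappa> j)"
    \<comment> \<open>Enlarging \<open>A\<close> to a full box turns the sum of products into a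
      product of sums over the coordinates.\<close>
    have sub: "A \<subseteq> PiE UNIV (\<lambda>_. {..m})"
    proof
      fix \<kappa> assume "\<kappa> \<in> A"
      have "\<kappa> j \<le> m" for j
      proof -
        have "\<kappa> j \<le> (\<Sum>j\<in>UNIV. \<kappa> j)" by (intro member_le_sum) auto
        also have "\<dots> \<le> m" unfolding m_def using A \<open>\<kappa> \<in> A\<close> by (intro member_le_sum) auto
        finally show ?thesis .
      qed
      then show "\<kappa> \<in> PiE UNIV (\<lambda>_. {..m})" by (simp add: PiE_iff extensional_def)
    qed
    have "(\<Sum>\<kappa>\<in>A. schur_weight J t \<kappa>) = (\<Sum>\<kappa>\<in>A. \<Prod>j\<in>UNIV. c j (\<kappa> j))"
      by (simp add: schur_weight_def c_def)
    also have "\<dots> \<le> (\<Sum>\<kappa>\<in>PiE UNIV (\<lambda>_. {..m}). \<Prod>j\<in>UNIV. c j (\<kappa> j))"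
      using sub c0 by (intro sum_mono2 finite_PiE prod_nonneg) auto
    also have "\<dots> = (\<Prod>j\<in>UNIV. \<Sum>i\<le>m. c j i)" by (rule prod_sum_PiE[symmetric]) auto
    also have "\<dots> \<le> (\<Prod>j\<in>UNIV. D j + E j)"
    proof (intro prod_mono conjI sum_nonneg c0)
      fix j
      show "(\<Sum>i\<le>m. c j i) \<le> D j + E j"
      proof (cases "j \<in> J")
        case True
        have "(\<Sum>i\<le>m. c j i) = (\<Sum>i\<le>m. schur_kernel (\<alpha> j) (l j) (2 ^ i * (t j / \<rho>)))"
          using True by (simp add: c_def \<beta>_def)
        also have "\<dots> \<le> D j" using t True \<rho>_pos by (intro D(2)) auto
        finally show ?thesis using E[of j] by simp
      next
        case False
        have "(\<Sum>i\<le>m. c j i) = \<rho> powr \<alpha> j * (\<Sum>i\<le>m. (2 powr (- \<alpha> j)) ^ i)"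
          using False by (simp add: c_def \<beta>_powr sum_distrib_left)
        also have "\<dots> \<le> E j" unfolding E_def
          using two_powr_minus_\<alpha>[of j] by (intro mult_left_mono sum_powr_geometric) auto
        finally show ?thesis using D(1)[of j] by simp
      qed
    qed
    finally show ?thesis .
  qed
  moreover have "(\<Prod>j\<in>UNIV. D j + E j) > 0" by (intro prod_pos add_pos_pos D(1) E)
  ultimately show ?thesis by blast
qed

lemma nn_integral_schur_weight:
  "\<exists>C>0. \<forall>J \<kappa>. (\<integral>\<^sup>+t. indicator (PiE J (\<lambda>_. {0<..})) t * ennreal ((\<Prod>j\<in>J. t j powr (-1)) * schur_weight J t \<kappa>)
      \<partial>(PiM J (\<lambda>_. lborel))) \<le> ennreal C"
proof -
  interpret product_sigma_finite "\<lambda>_::'n. lborel :: real measure" ..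
  have "\<forall>j. \<exists>C>0. \<forall>b>0. (\<integral>\<^sup>+t. indicator {0<..} t * ennreal (t powr (-1) * schur_kernel (\<alpha> j) (l j) (b * t)) \<partial>lborel) \<le> ennreal C"
    by (intro allI nn_integral_schur_kernel \<alpha>_pos \<alpha>_less)
  from choice[OF this] obtain D where D: "\<And>j. D j > 0"
    "\<And>j b. b > 0 \<Longrightarrow> (\<integral>\<^sup>+t. indicator {0<..} t * ennreal (t powr (-1) * schur_kernel (\<alpha> j) (l j) (b * t)) \<partial>lborel) \<le> ennreal (D j)"
    by blast
  \<comment> \<open>Factors of the form 1 plus a nonnegative number make the products over
    \<open>J\<close> and over its complement extend to all coordinates, so the constant does not
    depend on \<open>J\<close>.\<close>
  define C where "C = (\<Prod>j\<in>UNIV. 1 + D j) * (\<Prod>j\<in>UNIV. 1 + \<rho> powr \<alpha> j)"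
  have C: "C > 0" unfolding C_def using D(1) by (intro mult_pos_pos prod_pos) (auto simp: add_pos_pos add_pos_nonneg)
  have "(\<integral>\<^sup>+t. indicator (PiE J (\<lambda>_. {0<..})) t * ennreal ((\<Prod>j\<in>J. t j powr (-1)) * schur_weight J t \<kappa>)
      \<partial>(PiM J (\<lambda>_. lborel))) \<le> ennreal C" for J \<kappa>
  proof -
    define E where "E = (\<Prod>j\<in>-J. \<beta> (\<kappa> j) powr (- \<alpha> j))"
    define g where "g j s = indicator {0<..} s * ennreal (s powr (-1) * schur_kernel (\<alpha> j) (l j) (\<beta> (\<kappa> j) * s))" for j s
    have E0: "0 \<le> E" unfolding E_def by (intro prod_nonneg) auto
    have E1: "E \<le> (\<Prod>j\<in>UNIV. 1 + \<rho> powr \<alpha> j)"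
    proof -
      have "E \<le> (\<Prod>j\<in>-J. 1 + \<rho> powr \<alpha> j)"
        unfolding E_def
      proof (intro prod_mono conjI)
        fix j
        have "(2 powr (- \<alpha> j)) ^ \<kappa> j \<le> 1" using two_powr_minus_\<alpha>[of j] by (intro power_le_one) auto
        then have "\<rho> powr \<alpha> j * (2 powr (- \<alpha> j)) ^ \<kappa> j \<le> \<rho> powr \<alpha> j * 1" by (intro mult_left_mono) auto
        then show "\<beta> (\<kappa> j) powr (- \<alpha> j) \<le> 1 + \<rho> powr \<alpha> j" unfolding \<beta>_powr by simp
      qed auto
      also have "\<dots> \<le> (\<Prod>j\<in>UNIV. 1 + \<rho> powr \<alpha> j)" by (intro prod_mono2) auto
      finally show ?thesis .
    qed
    have "(\<integral>\<^sup>+t. indicator (PiE J (\<lambda>_. {0<..})) t * ennreal ((\<Prod>j\<in>J. t j powr (-1)) * schur_weight J t \<kappa>)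
      \<partial>(PiM J (\<lambda>_. lborel))) \<le> (\<integral>\<^sup>+t. ennreal E * (\<Prod>j\<in>J. g j (t j)) \<partial>(PiM J (\<lambda>_. lborel)))"
    proof (rule nn_integral_mono)
      fix t :: "'n \<Rightarrow> real"
      show "indicator (PiE J (\<lambda>_. {0<..})) t * ennreal ((\<Prod>j\<in>J. t j powr (-1)) * schur_weight J t \<kappa>) \<le>
        ennreal E * (\<Prod>j\<in>J. g j (t j))"
      proof (cases "t \<in> PiE J (\<lambda>_. {0<..})")
        case False
        then show ?thesis by simp
      next
        case True
        then have t: "0 < t j" if "j \<in> J" for j using that by (auto simp: PiE_def Pi_def)
        have "schur_weight J t \<kappa> = (\<Prod>j\<in>J. schur_kernel (\<alpha> j) (l j) (\<beta> (\<kappa> j) * t j)) * E"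
          unfolding E_def by (rule schur_weight_split)
        then have eq: "(\<Prod>j\<in>J. t j powr (-1)) * schur_weight J t \<kappa> =
            E * (\<Prod>j\<in>J. t j powr (-1) * schur_kernel (\<alpha> j) (l j) (\<beta> (\<kappa> j) * t j))"
          by (simp only: prod.distrib mult_ac)
        have nn: "0 \<le> t j powr (-1) * schur_kernel (\<alpha> j) (l j) (\<beta> (\<kappa> j) * t j)" if "j \<in> J" for j
          using t[OF that] by (intro mult_nonneg_nonneg schur_kernel_nonneg) auto
        have "ennreal (E * (\<Prod>j\<in>J. t j powr (-1) * schur_kernel (\<alpha> j) (l j) (\<beta> (\<kappa> j) * t j))) =
           ennreal E * (\<Prod>j\<in>J. ennreal (t j powr (-1) * schur_kernel (\<alpha> j) (l j) (\<beta> (\<kappa> j) * t j)))"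
          using nn E0 by (simp only: ennreal_mult prod_nonneg prod_ennreal)
        also have "(\<Prod>j\<in>J. ennreal (t j powr (-1) * schur_kernel (\<alpha> j) (l j) (\<beta> (\<kappa> j) * t j))) = (\<Prod>j\<in>J. g j (t j))"
          using t by (intro prod.cong refl) (simp add: g_def)
        finally show ?thesis unfolding eq using True by simp
      qed
    qed
    also have "\<dots> = ennreal E * (\<Prod>j\<in>J. \<integral>\<^sup>+s. g j s \<partial>lborel)"
    proof -
      have [measurable]: "g j \<in> borel_measurable borel" for j unfolding g_def by measurable
      have "(\<integral>\<^sup>+t. ennreal E * (\<Prod>j\<in>J. g j (t j)) \<partial>(PiM J (\<lambda>_. lborel))) =
          ennreal E * (\<integral>\<^sup>+t. (\<Prod>j\<in>J. g j (t j)) \<partial>(PiM J (\<lambda>_. lborel)))"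
        by (rule nn_integral_cmult) measurable
      also have "(\<integral>\<^sup>+t. (\<Prod>j\<in>J. g j (t j)) \<partial>(PiM J (\<lambda>_. lborel))) = (\<Prod>j\<in>J. \<integral>\<^sup>+s. g j s \<partial>lborel)"
        by (rule product_nn_integral_prod) auto
      finally show ?thesis .
    qed
    also have "\<dots> \<le> ennreal E * (\<Prod>j\<in>J. ennreal (1 + D j))"
    proof (intro mult_left_mono prod_mono_ennreal)
      fix j
      have "(\<integral>\<^sup>+s. g j s \<partial>lborel) \<le> ennreal (D j)" unfolding g_def by (rule D(2)) simp
      also have "\<dots> \<le> ennreal (1 + D j)" by (intro ennreal_leI) simp
      finally show "(\<integral>\<^sup>+s. g j s \<partial>lborel) \<le> ennreal (1 + D j)" .
    qed auto
    also have "\<dots> = ennreal (E * (\<Prod>j\<in>J. 1 + D j))"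
    proof -
      have "0 \<le> 1 + D j" for j using D(1)[of j] by linarith
      then show ?thesis using E0 by (simp only: prod_ennreal ennreal_mult prod_nonneg)
    qed
    also have "\<dots> \<le> ennreal C"
    proof (rule ennreal_leI)
      have D1: "1 \<le> 1 + D j" for j using D(1)[of j] by linarith
      have "(\<Prod>j\<in>J. 1 + D j) \<le> (\<Prod>j\<in>UNIV. 1 + D j)"
        using D1 by (intro prod_mono2) (auto intro: order_trans[OF zero_le_one])
      moreover have "0 \<le> (\<Prod>j\<in>J. 1 + D j)" using D1 by (intro prod_nonneg) (auto intro: order_trans[OF zero_le_one])
      ultimately have "E * (\<Prod>j\<in>J. 1 + D j) \<le> (\<Prod>j\<in>UNIV. 1 + \<rho> powr \<alpha> j) * (\<Prod>j\<in>UNIV. 1 + D j)"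
        using E0 E1 by (intro mult_mono) auto
      then show "E * (\<Prod>j\<in>J. 1 + D j) \<le> C" by (simp add: C_def mult.commute)
    qed
    finally show ?thesis .
  qed
  with C show ?thesis by blast
qed

text \<open>\<open>B \<kappa>\<close> stands for the mean of order \<open>p\<close> of the
  coefficients of scale \<open>\<kappa>\<close>, and \<open>R\<close> for a bound on the norm of
  order \<open>\<theta>\<close> of the sequence \<open>B\<close>. The Schur test maps such sequences
  to functions of the step \<open>t\<close>, so the Besov norm is at most
  \<open>C * R\<close>.\<close>

lemma synth_unit_ball:
  assumes p: "1 \<le> p" and \<theta>: "1 \<le> \<theta>"
  shows "\<exists>C>0. \<forall>A a B R D. finite A \<longrightarrow> 0 < R \<longrightarrow> D \<in> sets borel \<longrightarrow>
    (\<forall>\<kappa>\<in>A. 0 \<le> B \<kappa> \<and> B \<kappa> \<le> R \<and> (\<Sum>\<nu>\<in>V \<kappa>. \<bar>a \<kappa> \<nu>\<bar> powr p) \<le> 2 ^ (\<Sum>j\<in>UNIV. \<kappa> j) * B \<kappa> powr p) \<longrightarrow>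
    (\<theta> \<noteq> \<infinity> \<longrightarrow> (\<Sum>\<kappa>\<in>A. B \<kappa> powr real_of_ereal \<theta>) \<le> R powr real_of_ereal \<theta>) \<longrightarrow>
    l = l_of \<alpha> \<longrightarrow> synth (\<lambda>_. 0) A (\<lambda>\<kappa> \<nu>. a \<kappa> \<nu> / (C * R)) \<in> unit_ball_SB \<alpha> p \<theta> D"
proof -
  obtain C1 where C1: "C1 > 0" and md: "\<And>A a B J t \<xi>. finite A \<Longrightarrow>
    (\<forall>\<kappa>\<in>A. 0 \<le> B \<kappa> \<and> (\<Sum>\<nu>\<in>V \<kappa>. \<bar>a \<kappa> \<nu>\<bar> powr p) \<le> 2 ^ (\<Sum>j\<in>UNIV. \<kappa> j) * B \<kappa> powr p) \<Longrightarrow>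
    (\<forall>j\<in>J. \<bar>\<xi> j\<bar> \<le> t j) \<Longrightarrow>
    (\<integral>\<^sup>+x. ennreal (\<bar>mdiff (chiJ J l) (vecJ J \<xi>) (synth (\<lambda>_. 0) A a) x\<bar> powr p) \<partial>lborel) \<le>
      ennreal ((C1 * (\<Sum>\<kappa>\<in>A. step_bound J t \<kappa> * B \<kappa>)) powr p)"
    using nn_integral_mdiff_synth[OF p] by blast
  obtain C2 where C2: "C2 > 0" and sw: "\<And>J t A. finite A \<Longrightarrow> (\<forall>j\<in>J. 0 < t j) \<Longrightarrow> (\<Sum>\<kappa>\<in>A. schur_weight J t \<kappa>) \<le> C2"
    using sum_schur_weight by blast
  obtain C3 where C3: "C3 > 0" and iw: "\<And>J \<kappa>. (\<integral>\<^sup>+t. indicator (PiE J (\<lambda>_. {0<..})) t * ennreal ((\<Prod>j\<in>J. t j powr (-1)) * schur_weight J t \<kappa>)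
      \<partial>(PiM J (\<lambda>_. lborel))) \<le> ennreal C3"
    using nn_integral_schur_weight by blast
  define th where "th = real_of_ereal \<theta>"
  have th: "1 \<le> th" if "\<theta> \<noteq> \<infinity>" using \<theta> that by (cases \<theta>) (auto simp: th_def one_ereal_def)
  \<comment> \<open>The power of \<open>C2\<close> comes from Jensen's inequality with total weight
    \<open>C2\<close>; integrating over the step then gives \<open>C3\<close>, and a root of order
    \<open>th\<close> yields the second summand of \<open>C\<close>. The first summand serves the
    \<open>L\<^sub>p\<close> norm and the case \<open>\<theta> = \<infinity>\<close>.\<close>
  define q1 where "q1 = C1 powr th * C2 powr (th - 1)"
  define C where "C = C1 * C2 + (q1 * C3) powr (1 / th)"
  have C: "C > 0" using C1 C2 by (auto simp: C_def intro!: add_pos_nonneg)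
  have norms: "Lp_norm p D (synth (\<lambda>_. 0) A a) \<le> ennreal (C * R) \<and> semiJ \<alpha> p \<theta> D J (synth (\<lambda>_. 0) A a) \<le> ennreal (C * R)"
    if A: "finite A" and R: "0 < R"
      and B: "\<forall>\<kappa>\<in>A. 0 \<le> B \<kappa> \<and> B \<kappa> \<le> R \<and> (\<Sum>\<nu>\<in>V \<kappa>. \<bar>a \<kappa> \<nu>\<bar> powr p) \<le> 2 ^ (\<Sum>j\<in>UNIV. \<kappa> j) * B \<kappa> powr p"
      and Bth: "\<theta> \<noteq> \<infinity> \<longrightarrow> (\<Sum>\<kappa>\<in>A. B \<kappa> powr th) \<le> R powr th"
      and l: "l = l_of \<alpha>" for A a B R D J
  proof -
    define f where "f = synth (\<lambda>_. 0) A a"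
    define X where "X J t = (\<Sum>\<kappa>\<in>A. step_bound J t \<kappa> * B \<kappa>)" for J t
    have B': "\<forall>\<kappa>\<in>A. 0 \<le> B \<kappa> \<and> (\<Sum>\<nu>\<in>V \<kappa>. \<bar>a \<kappa> \<nu>\<bar> powr p) \<le> 2 ^ (\<Sum>j\<in>UNIV. \<kappa> j) * B \<kappa> powr p" using B by blast
    have X0: "0 \<le> X J t" if "\<And>j. j \<in> J \<Longrightarrow> 0 < t j" for J t
      unfolding X_def using B that by (intro sum_nonneg mult_nonneg_nonneg step_bound_nonneg) (auto simp: less_imp_le)
    have Xw: "(\<Prod>j\<in>J. t j powr (- \<alpha> j)) * X J t = (\<Sum>\<kappa>\<in>A. schur_weight J t \<kappa> * B \<kappa>)"
      if "\<And>j. j \<in> J \<Longrightarrow> 0 < t j" for J t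
      unfolding X_def sum_distrib_left using schur_weight_eq[OF that] by (intro sum.cong refl) (simp flip: mult.assoc)
    have Xle: "(\<Sum>\<kappa>\<in>A. schur_weight J t \<kappa> * B \<kappa>) \<le> C2 * R" if t: "\<And>j. j \<in> J \<Longrightarrow> 0 < t j" for J t
    proof -
      have "(\<Sum>\<kappa>\<in>A. schur_weight J t \<kappa> * B \<kappa>) \<le> (\<Sum>\<kappa>\<in>A. schur_weight J t \<kappa> * R)"
        using B schur_weight_nonneg[OF t] by (intro sum_mono mult_left_mono) auto
      also have "\<dots> = (\<Sum>\<kappa>\<in>A. schur_weight J t \<kappa>) * R" by (rule sum_distrib_right[symmetric])
      also have "\<dots> \<le> C2 * R" using sw[OF A] t R by (intro mult_right_mono) auto
      finally show ?thesis .
    qed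
    have CR: "C1 * C2 * R \<le> C * R" using R by (intro mult_right_mono) (auto simp: C_def)
    have om: "Omega' p (l_of \<alpha>) J f D t \<le> ennreal (C1 * X J t)" if t: "\<And>j. j \<in> J \<Longrightarrow> 0 < t j" for J t D
      unfolding l[symmetric]
    proof (rule Omega'_le[OF p _ t])
      show "0 \<le> C1 * X J t" using C1 X0[OF t] by simp
      show "(\<integral>\<^sup>+x. ennreal (\<bar>mdiff (chiJ J l) (vecJ J \<xi>) f x\<bar> powr p) \<partial>lborel) \<le> ennreal ((C1 * X J t) powr p)"
        if "\<And>j. j \<in> J \<Longrightarrow> \<bar>\<xi> j\<bar> \<le> t j" for \<xi>
        unfolding f_def X_def by (rule md[OF A B']) (use that in blast)
    qed
    have "Lp_norm p D f \<le> ennreal (C * R)"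
      unfolding Lp_norm_def
    proof (rule epow_le_ennreal)
      \<comment> \<open>For empty \<open>J\<close> the mixed difference is the function itself, so
        the \<open>L\<^sub>p\<close> norm is a special case of the difference estimate.\<close>
      have mf: "mdiff (chiJ {} l) (vecJ {} (\<lambda>_. 0)) f x = f x" for x
      proof -
        have "{k::'n \<Rightarrow> nat. \<forall>j. k j \<le> chiJ {} l j} = {\<lambda>_. 0}" by (auto simp: chiJ_def)
        then show ?thesis by (simp add: mdiff_def chiJ_def shift_pt_def)
      qed
      have "(\<integral>\<^sup>+ x. ennreal (\<bar>f x\<bar> powr p) * indicator D x \<partial>lborel) \<le> (\<integral>\<^sup>+ x. ennreal (\<bar>f x\<bar> powr p) \<partial>lborel)"
        by (intro nn_integral_mono) (auto simp: indicator_def)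
      also have "\<dots> \<le> ennreal ((C1 * X {} (\<lambda>_. 0)) powr p)"
        using md[OF A B', of "{}" "\<lambda>_. 0" "\<lambda>_. 0"] by (simp add: mf flip: f_def X_def)
      also have "\<dots> \<le> ennreal ((C * R) powr p)"
      proof (intro ennreal_leI powr_mono2)
        have "X {} (\<lambda>_. 0) \<le> C2 * R" using Xw[of "{}" "\<lambda>_. 0"] Xle[of "{}" "\<lambda>_. 0"] by simp
        then have "C1 * X {} (\<lambda>_. 0) \<le> C1 * (C2 * R)" using C1 by (intro mult_left_mono) auto
        then show "C1 * X {} (\<lambda>_. 0) \<le> C * R" using CR by simp
        show "0 \<le> C1 * X {} (\<lambda>_. 0)" using C1 X0[of "{}" "\<lambda>_. 0"] by simp
      qed (use p in auto)
      finally show "(\<integral>\<^sup>+ x. ennreal (\<bar>f x\<bar> powr p) * indicator D x \<partial>lborel) \<le> ennreal ((C * R) powr p)" .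
    qed (use p C R in auto)
    moreover have "semiJ \<alpha> p \<theta> D J f \<le> ennreal (C * R)"
    proof (cases "\<theta> = \<infinity>")
      case True
      have "ennreal (\<Prod>j\<in>J. t j powr (- \<alpha> j)) * Omega' p (l_of \<alpha>) J f D t \<le> ennreal (C * R)"
        if "t \<in> PiE J (\<lambda>_. {0<..})" for t
      proof -
        have t: "0 < t j" if "j \<in> J" for j using \<open>t \<in> _\<close> that by (auto simp: PiE_def Pi_def)
        have "ennreal (\<Prod>j\<in>J. t j powr (- \<alpha> j)) * Omega' p (l_of \<alpha>) J f D t \<le>
            ennreal (\<Prod>j\<in>J. t j powr (- \<alpha> j)) * ennreal (C1 * X J t)"
          by (intro mult_left_mono om t) auto
        also have "\<dots> = ennreal (C1 * ((\<Prod>j\<in>J. t j powr (- \<alpha> j)) * X J t))"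
          using C1 X0[OF t] by (subst ennreal_mult[symmetric]) (auto intro!: prod_nonneg simp: mult.left_commute)
        also have "\<dots> \<le> ennreal (C1 * (C2 * R))"
        proof (intro ennreal_leI mult_left_mono)
          have "(\<Prod>j\<in>J. t j powr (- \<alpha> j)) * X J t = (\<Sum>\<kappa>\<in>A. schur_weight J t \<kappa> * B \<kappa>)"
            using t by (rule Xw)
          also have "\<dots> \<le> C2 * R" using t by (rule Xle)
          finally show "(\<Prod>j\<in>J. t j powr (- \<alpha> j)) * X J t \<le> C2 * R" .
        qed (use C1 in simp)
        also have "\<dots> \<le> ennreal (C * R)" using CR by (intro ennreal_leI) simp
        finally show ?thesis .
      qed
      then show ?thesis unfolding semiJ_def using True by (simp add: SUP_least)
    next
      case False
      note th = th[OF False]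
      have "(\<integral>\<^sup>+ t. indicator (PiE J (\<lambda>_. {0<..})) t *
                 ennreal (\<Prod>j\<in>J. t j powr (-1 - th * \<alpha> j)) * epow (Omega' p (l_of \<alpha>) J f D t) th
               \<partial>(PiM J (\<lambda>_. lborel))) \<le>
         (\<integral>\<^sup>+ t. (\<Sum>\<kappa>\<in>A. ennreal (q1 * B \<kappa> powr th) * (indicator (PiE J (\<lambda>_. {0<..})) t *
            ennreal ((\<Prod>j\<in>J. t j powr (-1)) * schur_weight J t \<kappa>))) \<partial>(PiM J (\<lambda>_. lborel)))"
      proof (rule nn_integral_mono)
        fix t :: "'n \<Rightarrow> real"
        show "indicator (PiE J (\<lambda>_. {0<..})) t *
                 ennreal (\<Prod>j\<in>J. t j powr (-1 - th * \<alpha> j)) * epow (Omega' p (l_of \<alpha>) J f D t) th \<le>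
          (\<Sum>\<kappa>\<in>A. ennreal (q1 * B \<kappa> powr th) * (indicator (PiE J (\<lambda>_. {0<..})) t *
            ennreal ((\<Prod>j\<in>J. t j powr (-1)) * schur_weight J t \<kappa>)))"
        proof (cases "t \<in> PiE J (\<lambda>_. {0<..})")
          case out: False
          then show ?thesis by simp
        next
          case True
          then have t: "0 < t j" if "j \<in> J" for j using that by (auto simp: PiE_def Pi_def)
          define P1 where "P1 = (\<Prod>j\<in>J. t j powr (-1))"
          have P1: "0 \<le> P1" unfolding P1_def by (intro prod_nonneg) auto
          have "epow (Omega' p (l_of \<alpha>) J f D t) th \<le> epow (ennreal (C1 * X J t)) th"
            using th by (intro epow_mono om t) auto
          also have "\<dots> = ennreal ((C1 * X J t) powr th)" using C1 X0[OF t] by (intro epow_ennreal) simp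
          finally have "ennreal (\<Prod>j\<in>J. t j powr (-1 - th * \<alpha> j)) * epow (Omega' p (l_of \<alpha>) J f D t) th \<le>
              ennreal (\<Prod>j\<in>J. t j powr (-1 - th * \<alpha> j)) * ennreal ((C1 * X J t) powr th)"
            by (rule mult_left_mono) simp
          also have "\<dots> = ennreal (P1 * (C1 powr th * (\<Sum>\<kappa>\<in>A. schur_weight J t \<kappa> * B \<kappa>) powr th))"
          proof -
            \<comment> \<open>One factor \<open>t powr (-1)\<close> is kept for the scaling
              invariant measure; the rest moves inside the power \<open>th\<close> and completes the
              Schur weight.\<close>
            have "t j powr (-1 - th * \<alpha> j) = t j powr (-1) * (t j powr (- \<alpha> j)) powr th" for j
            proof -
              have e: "-1 - th * \<alpha> j = -1 + - \<alpha> j * th" by simp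
              show ?thesis unfolding e powr_add powr_powr by (rule refl)
            qed
            then have "(\<Prod>j\<in>J. t j powr (-1 - th * \<alpha> j)) = P1 * (\<Prod>j\<in>J. t j powr (- \<alpha> j)) powr th"
              by (simp only: prod.distrib P1_def prod_powr_distrib)
            then have "(\<Prod>j\<in>J. t j powr (-1 - th * \<alpha> j)) * (C1 * X J t) powr th =
                P1 * (C1 powr th * ((\<Prod>j\<in>J. t j powr (- \<alpha> j)) * X J t) powr th)"
              by (simp only: powr_mult mult_ac)
            moreover have "(\<Prod>j\<in>J. t j powr (- \<alpha> j)) * X J t = (\<Sum>\<kappa>\<in>A. schur_weight J t \<kappa> * B \<kappa>)"
              using t by (rule Xw)
            ultimately show ?thesis by (subst ennreal_mult[symmetric]) (auto intro!: prod_nonneg)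
          qed
          also have "\<dots> \<le> ennreal (P1 * (C1 powr th * (C2 powr (th - 1) * (\<Sum>\<kappa>\<in>A. schur_weight J t \<kappa> * B \<kappa> powr th))))"
            using P1 B th by (intro ennreal_leI mult_left_mono schur_powr A schur_weight_nonneg t sw) (auto simp: t)
          also have "\<dots> = ennreal (\<Sum>\<kappa>\<in>A. q1 * B \<kappa> powr th * (P1 * schur_weight J t \<kappa>))"
            by (simp add: sum_distrib_left q1_def mult_ac)
          also have "\<dots> = (\<Sum>\<kappa>\<in>A. ennreal (q1 * B \<kappa> powr th * (P1 * schur_weight J t \<kappa>)))"
            using P1 by (intro sum_ennreal[symmetric] mult_nonneg_nonneg schur_weight_nonneg t) (auto simp: q1_def)
          also have "\<dots> = (\<Sum>\<kappa>\<in>A. ennreal (q1 * B \<kappa> powr th) * ennreal (P1 * schur_weight J t \<kappa>))"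
            using P1 by (intro sum.cong refl ennreal_mult mult_nonneg_nonneg schur_weight_nonneg t) (auto simp: q1_def)
          finally show ?thesis using True by (simp add: P1_def)
        qed
      qed
      also have "\<dots> = (\<Sum>\<kappa>\<in>A. ennreal (q1 * B \<kappa> powr th) * (\<integral>\<^sup>+ t. indicator (PiE J (\<lambda>_. {0<..})) t *
            ennreal ((\<Prod>j\<in>J. t j powr (-1)) * schur_weight J t \<kappa>) \<partial>(PiM J (\<lambda>_. lborel))))"
      proof -
        have sets: "PiE J (\<lambda>_. {0::real<..}) \<in> sets (PiM J (\<lambda>_. lborel))" by (intro sets_PiM_I_finite) auto
        have comp: "(\<lambda>t. t j) \<in> borel_measurable (PiM J (\<lambda>_. lborel :: real measure))" if "j \<in> J" for j :: 'n
          using measurable_component_singleton[OF that, of "\<lambda>_. lborel :: real measure"] by simp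
        have "(\<lambda>t. if j \<in> J then schur_kernel (\<alpha> j) (l j) (\<beta> (\<kappa> j) * t j) else \<beta> (\<kappa> j) powr (- \<alpha> j)) \<in>
            borel_measurable (PiM J (\<lambda>_. lborel))" for \<kappa> :: "'n \<Rightarrow> nat" and j
        proof (cases "j \<in> J")
          case True
          note comp[OF True, measurable]
          show ?thesis using True by simp
        qed simp
        then have [measurable]: "(\<lambda>t. schur_weight J t \<kappa>) \<in> borel_measurable (PiM J (\<lambda>_. lborel))" for \<kappa>
          unfolding schur_weight_def by (intro borel_measurable_prod)
        have [measurable]: "(\<lambda>t. \<Prod>j\<in>J. t j powr (-1)) \<in> borel_measurable (PiM J (\<lambda>_. lborel :: real measure))"
          by (intro borel_measurable_prod) (use comp in measurable)
        have m: "(\<lambda>t. indicator (PiE J (\<lambda>_. {0<..})) t * ennreal ((\<Prod>j\<in>J. t j powr (-1)) * schur_weight J t \<kappa>))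
            \<in> borel_measurable (PiM J (\<lambda>_. lborel))" for \<kappa>
          using sets by measurable
        show ?thesis by (subst nn_integral_sum) (auto intro!: sum.cong nn_integral_cmult m borel_measurable_times_ennreal)
      qed
      also have "\<dots> \<le> (\<Sum>\<kappa>\<in>A. ennreal (q1 * B \<kappa> powr th) * ennreal C3)"
        by (intro sum_mono mult_left_mono iw) auto
      also have "\<dots> = ennreal (q1 * C3 * (\<Sum>\<kappa>\<in>A. B \<kappa> powr th))"
        using C3 by (simp add: ennreal_mult[symmetric] sum_ennreal q1_def sum_distrib_left mult_ac)
      also have "\<dots> \<le> ennreal (((q1 * C3) powr (1 / th) * R) powr th)"
      proof (rule ennreal_leI)
        have "((q1 * C3) powr (1 / th) * R) powr th = ((q1 * C3) powr (1 / th)) powr th * R powr th" by (rule powr_mult)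
        also have "((q1 * C3) powr (1 / th)) powr th = q1 * C3"
          using th C3 by (simp add: powr_powr q1_def)
        finally show "q1 * C3 * (\<Sum>\<kappa>\<in>A. B \<kappa> powr th) \<le> ((q1 * C3) powr (1 / th) * R) powr th"
          using Bth False C3 by (auto intro!: mult_left_mono simp: q1_def)
      qed
      finally have "epow (\<integral>\<^sup>+ t. indicator (PiE J (\<lambda>_. {0<..})) t *
                 ennreal (\<Prod>j\<in>J. t j powr (-1 - th * \<alpha> j)) * epow (Omega' p (l_of \<alpha>) J f D t) th
               \<partial>(PiM J (\<lambda>_. lborel))) (1 / th) \<le> ennreal ((q1 * C3) powr (1 / th) * R)"
        using th R by (intro epow_le_ennreal) auto
      also have "\<dots> \<le> ennreal (C * R)"
        using R C1 C2 by (intro ennreal_leI mult_right_mono) (auto simp: C_def)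
      finally show ?thesis unfolding semiJ_def using False by (simp add: th_def)
    qed
    ultimately show ?thesis unfolding f_def by simp
  qed
  have "synth (\<lambda>_. 0) A (\<lambda>\<kappa> \<nu>. a \<kappa> \<nu> / (C * R)) \<in> unit_ball_SB \<alpha> p \<theta> D"
    if A: "finite A" and R: "0 < R"
      and B: "\<forall>\<kappa>\<in>A. 0 \<le> B \<kappa> \<and> B \<kappa> \<le> R \<and> (\<Sum>\<nu>\<in>V \<kappa>. \<bar>a \<kappa> \<nu>\<bar> powr p) \<le> 2 ^ (\<Sum>j\<in>UNIV. \<kappa> j) * B \<kappa> powr p"
      and Bth: "\<theta> \<noteq> \<infinity> \<longrightarrow> (\<Sum>\<kappa>\<in>A. B \<kappa> powr th) \<le> R powr th"
      and l: "l = l_of \<alpha>" and D: "D \<in> sets borel" for A a B R D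
  proof -
    define a' where "a' = (\<lambda>\<kappa> \<nu>. a \<kappa> \<nu> / (C * R))"
    define f where "f = synth (\<lambda>_. 0) A a'"
    have CR: "C * R > 0" using C R by simp
    \<comment> \<open>The estimate \<open>norms\<close> is applied with \<open>1 / C\<close> in
      place of \<open>R\<close>, so that its bound becomes 1.\<close>
    have B1: "\<forall>\<kappa>\<in>A. 0 \<le> B \<kappa> / (C * R) \<and> B \<kappa> / (C * R) \<le> 1 / C \<and>
      (\<Sum>\<nu>\<in>V \<kappa>. \<bar>a' \<kappa> \<nu>\<bar> powr p) \<le> 2 ^ (\<Sum>j\<in>UNIV. \<kappa> j) * (B \<kappa> / (C * R)) powr p"
    proof (intro ballI conjI)
      fix \<kappa> assume \<kappa>: "\<kappa> \<in> A"
      show "0 \<le> B \<kappa> / (C * R)" using B \<kappa> CR by (intro divide_nonneg_pos) auto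
      show "B \<kappa> / (C * R) \<le> 1 / C" using B \<kappa> C R by (simp add: field_simps)
      have "(\<Sum>\<nu>\<in>V \<kappa>. \<bar>a' \<kappa> \<nu>\<bar> powr p) = (\<Sum>\<nu>\<in>V \<kappa>. \<bar>a \<kappa> \<nu>\<bar> powr p) / (C * R) powr p"
        using CR by (simp add: a'_def abs_divide powr_divide sum_divide_distrib)
      also have "\<dots> \<le> 2 ^ (\<Sum>j\<in>UNIV. \<kappa> j) * B \<kappa> powr p / (C * R) powr p"
        using B \<kappa> by (intro divide_right_mono) auto
      finally show "(\<Sum>\<nu>\<in>V \<kappa>. \<bar>a' \<kappa> \<nu>\<bar> powr p) \<le> 2 ^ (\<Sum>j\<in>UNIV. \<kappa> j) * (B \<kappa> / (C * R)) powr p"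
        by (simp add: powr_divide)
    qed
    have B2: "\<theta> \<noteq> \<infinity> \<longrightarrow> (\<Sum>\<kappa>\<in>A. (B \<kappa> / (C * R)) powr th) \<le> (1 / C) powr th"
    proof
      assume "\<theta> \<noteq> \<infinity>"
      have "(\<Sum>\<kappa>\<in>A. (B \<kappa> / (C * R)) powr th) = (\<Sum>\<kappa>\<in>A. B \<kappa> powr th) / (C * R) powr th"
        by (simp add: powr_divide sum_divide_distrib)
      also have "\<dots> \<le> R powr th / (C * R) powr th"
        using Bth \<open>\<theta> \<noteq> \<infinity>\<close> by (intro divide_right_mono) auto
      also have "\<dots> = (1 / C) powr th" using C R by (simp flip: powr_divide)
      finally show "(\<Sum>\<kappa>\<in>A. (B \<kappa> / (C * R)) powr th) \<le> (1 / C) powr th" .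
    qed
    have n: "Lp_norm p D f \<le> 1" "semiJ \<alpha> p \<theta> D J f \<le> 1" for J
      using norms[OF A _ B1 B2 l, of D J] C by (auto simp: f_def)
    have cont: "continuous_on UNIV f" unfolding f_def by (intro continuous_synth) simp
    have vanp: "\<bar>f x\<bar> powr p = 0" if "x \<notin> cbox corner (corner + (\<chi> j. \<rho>))" for x
      using synth_outside[of x] that p by (simp add: f_def cube_def)
    have "continuous_on UNIV (\<lambda>x. \<bar>f x\<bar> powr p)"
      using p by (intro continuous_on_powr' cont continuous_intros) auto
    then have "integrable lborel (\<lambda>x. \<bar>f x\<bar> powr p)"
      by (rule integrable_continuous_vanishing) (rule vanp)
    then have "set_integrable lborel D (\<lambda>x. \<bar>f x\<bar> powr p)"
      unfolding set_integrable_def using D by (intro integrable_mult_indicator) auto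
    moreover have "set_borel_measurable lborel D f"
      unfolding set_borel_measurable_def using D borel_measurable_continuous_onI[OF cont] by simp
    ultimately have "in_Lp p D f" by (simp add: in_Lp_def)
    then show ?thesis unfolding unit_ball_SB_def using n cont
      by (auto simp: f_def a'_def intro: continuous_on_subset)
  qed
  with C show ?thesis unfolding th_def by blast
qed

section \<open>Fooling functions\<close>

lemma synth_scale: "synth \<iota> A (\<lambda>\<kappa> \<nu>. a \<kappa> \<nu> / r) x = synth \<iota> A a x / r"
  by (simp add: synth_def sum_divide_distrib)

lemma synth_uminus: "synth \<iota> A (\<lambda>\<kappa> \<nu>. - a \<kappa> \<nu>) x = - synth \<iota> A a x"
  by (simp add: synth_def sum_negf)

definition layer :: "real \<Rightarrow> nat \<Rightarrow> ('n \<Rightarrow> nat) set \<Rightarrow> bool" where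
  "layer \<mu> k A \<longleftrightarrow> finite A \<and> A \<noteq> {} \<and>
    (\<forall>\<kappa>\<in>A. (\<Sum>j\<in>UNIV. \<kappa> j) = k \<and> (\<forall>j. \<kappa> j \<noteq> 0 \<longrightarrow> \<alpha> j - real (lam j) = \<mu>))"

text \<open>Whatever the \<open>n\<close> points, some function of the layer \<open>A\<close> vanishes at them, has Besov norm of
  order at most \<open>R\<close> and at least \<open>s\<close> large coefficients.\<close>

definition fooling :: "real \<Rightarrow> ereal \<Rightarrow> ('n \<Rightarrow> nat) set \<Rightarrow> nat \<Rightarrow> real \<Rightarrow> real \<Rightarrow> nat \<Rightarrow> bool" where
  "fooling p \<theta> A k R s n \<longleftrightarrow> (\<forall>ys. length ys = n \<longrightarrow> (\<exists>a B S.
      (\<forall>\<kappa>\<in>A. 0 \<le> B \<kappa> \<and> B \<kappa> \<le> R \<and> (\<Sum>\<nu>\<in>V \<kappa>. \<bar>a \<kappa> \<nu>\<bar> powr p) \<le> 2 ^ k * B \<kappa> powr p) \<and>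
      (\<theta> \<noteq> \<infinity> \<longrightarrow> (\<Sum>\<kappa>\<in>A. B \<kappa> powr real_of_ereal \<theta>) \<le> R powr real_of_ereal \<theta>) \<and>
      S \<subseteq> Sigma A V \<and> s \<le> real (card S) \<and> (\<forall>(\<kappa>, \<nu>)\<in>S. 1 / 2 \<le> \<bar>a \<kappa> \<nu>\<bar>) \<and>
      (\<forall>y\<in>set ys. synth (\<lambda>_. 0) A a y = 0)))"

lemma width_lower:
  assumes p: "1 \<le> p" and \<theta>: "1 \<le> \<theta>" and q: "1 < q" and l: "l = l_of \<alpha>" and cube: "cube \<subseteq> D"
    and D: "open D"
  shows "\<exists>c>0. \<forall>n A k R s. layer \<mu> k A \<longrightarrow> 0 < R \<longrightarrow> 0 < s \<longrightarrow>
    fooling p \<theta> A k R s n \<longrightarrow>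
    ennreal (c * (2 powr (- \<mu> * real k) * real (card A) powr (1 / max 2 q - 1 / q) * (s / 2 ^ k) powr (1 / q)) / R) \<le>
      recovery_width n lam (unit_ball_SB \<alpha> p \<theta> D) q D"
proof -
  obtain c where c: "c > 0" and low: "\<And>A S a k. finite A \<Longrightarrow> A \<noteq> {} \<Longrightarrow>
    (\<forall>\<kappa>\<in>A. (\<Sum>j\<in>UNIV. \<kappa> j) = k \<and> (\<forall>j. \<kappa> j \<noteq> 0 \<longrightarrow> \<alpha> j - real (lam j) = \<mu>)) \<Longrightarrow>
    S \<subseteq> Sigma A V \<Longrightarrow> S \<noteq> {} \<Longrightarrow> (\<forall>(\<kappa>, \<nu>)\<in>S. 1 / 2 \<le> \<bar>a \<kappa> \<nu>\<bar>) \<Longrightarrow>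
    ennreal ((c * 2 powr (- \<mu> * real k) * real (card A) powr (1 / max 2 q - 1 / q) *
      (real (card S) / 2 ^ k) powr (1 / q)) powr q) \<le>
    (\<integral>\<^sup>+x. ennreal (\<bar>synth lam A a x\<bar> powr q) \<partial>lborel)"
    using synth_norm_lower[OF q] by blast
  obtain C where C: "C > 0" and ball: "\<And>A a B R D. finite A \<Longrightarrow> 0 < R \<Longrightarrow> D \<in> sets borel \<Longrightarrow>
    (\<forall>\<kappa>\<in>A. 0 \<le> B \<kappa> \<and> B \<kappa> \<le> R \<and> (\<Sum>\<nu>\<in>V \<kappa>. \<bar>a \<kappa> \<nu>\<bar> powr p) \<le> 2 ^ (\<Sum>j\<in>UNIV. \<kappa> j) * B \<kappa> powr p) \<Longrightarrow>
    (\<theta> \<noteq> \<infinity> \<longrightarrow> (\<Sum>\<kappa>\<in>A. B \<kappa> powr real_of_ereal \<theta>) \<le> R powr real_of_ereal \<theta>) \<Longrightarrow>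
    l = l_of \<alpha> \<Longrightarrow> synth (\<lambda>_. 0) A (\<lambda>\<kappa> \<nu>. a \<kappa> \<nu> / (C * R)) \<in> unit_ball_SB \<alpha> p \<theta> D"
    using synth_unit_ball[OF p \<theta>] by blast
  have Db: "D \<in> sets borel" using D by simp
  have lam_l: "lam j \<le> l j" for j using lam_less_l[of j] by simp
  have "ennreal (c / C * (2 powr (- \<mu> * real k) * real (card A) powr (1 / max 2 q - 1 / q) * (s / 2 ^ k) powr (1 / q)) / R) \<le>
      recovery_width n lam (unit_ball_SB \<alpha> p \<theta> D) q D"
    if lay: "layer \<mu> k A" and R: "0 < R" and s: "0 < s" and ex: "fooling p \<theta> A k R s n" for n A k R s
  proof (rule recovery_width_ge[OF _ _ Db])
    have A: "finite A" "A \<noteq> {}" and \<kappa>: "\<forall>\<kappa>\<in>A. (\<Sum>j\<in>UNIV. \<kappa> j) = k \<and> (\<forall>j. \<kappa> j \<noteq> 0 \<longrightarrow> \<alpha> j - real (lam j) = \<mu>)"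
      using lay unfolding layer_def by blast+
    define Y where "Y = 2 powr (- \<mu> * real k) * real (card A) powr (1 / max 2 q - 1 / q) * (s / 2 ^ k) powr (1 / q)"
    show "0 \<le> c / C * (2 powr (- \<mu> * real k) * real (card A) powr (1 / max 2 q - 1 / q) * (s / 2 ^ k) powr (1 / q)) / R"
      using c C R by (intro divide_nonneg_pos mult_nonneg_nonneg) auto
    fix ys :: "(real^'n) list" assume "length ys = n"
    then obtain a B S where B: "\<forall>\<kappa>\<in>A. 0 \<le> B \<kappa> \<and> B \<kappa> \<le> R \<and> (\<Sum>\<nu>\<in>V \<kappa>. \<bar>a \<kappa> \<nu>\<bar> powr p) \<le> 2 ^ k * B \<kappa> powr p"
      and Bth: "\<theta> \<noteq> \<infinity> \<longrightarrow> (\<Sum>\<kappa>\<in>A. B \<kappa> powr real_of_ereal \<theta>) \<le> R powr real_of_ereal \<theta>"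
      and S: "S \<subseteq> Sigma A V" "s \<le> real (card S)" and a: "\<forall>(\<kappa>, \<nu>)\<in>S. 1 / 2 \<le> \<bar>a \<kappa> \<nu>\<bar>"
      and van: "\<forall>y\<in>set ys. synth (\<lambda>_. 0) A a y = 0"
      using ex unfolding fooling_def by blast
    define a1 where "a1 = (\<lambda>\<kappa> \<nu>. a \<kappa> \<nu> / (C * R))"
    define a2 where "a2 = (\<lambda>\<kappa> \<nu>. - a \<kappa> \<nu> / (C * R))"
    have a2: "synth \<iota> A a2 x = - synth \<iota> A a1 x" for \<iota> x
      unfolding a1_def a2_def synth_scale synth_uminus by simp
    have B1: "\<forall>\<kappa>\<in>A. 0 \<le> B \<kappa> \<and> B \<kappa> \<le> R \<and> (\<Sum>\<nu>\<in>V \<kappa>. \<bar>a \<kappa> \<nu>\<bar> powr p) \<le> 2 ^ (\<Sum>j\<in>UNIV. \<kappa> j) * B \<kappa> powr p"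
      using B \<kappa> by simp
    then have B2: "\<forall>\<kappa>\<in>A. 0 \<le> B \<kappa> \<and> B \<kappa> \<le> R \<and> (\<Sum>\<nu>\<in>V \<kappa>. \<bar>- a \<kappa> \<nu>\<bar> powr p) \<le> 2 ^ (\<Sum>j\<in>UNIV. \<kappa> j) * B \<kappa> powr p"
      by simp
    have f1: "synth (\<lambda>_. 0) A a1 \<in> unit_ball_SB \<alpha> p \<theta> D"
      unfolding a1_def by (rule ball[OF A(1) R Db B1 Bth l])
    have f2: "synth (\<lambda>_. 0) A a2 \<in> unit_ball_SB \<alpha> p \<theta> D"
      unfolding a2_def by (rule ball[OF A(1) R Db B2 Bth l])
    have same: "map (synth (\<lambda>_. 0) A a1) ys = map (synth (\<lambda>_. 0) A a2) ys"
      using van by (simp add: a2) (simp add: a1_def synth_scale)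
    have w1: "weak_deriv D lam (synth (\<lambda>_. 0) A a1) (synth lam A a1)" by (rule weak_deriv_synth[OF cube])
    have w2: "weak_deriv D lam (synth (\<lambda>_. 0) A a2) (\<lambda>x. - synth lam A a1 x)"
    proof -
      have "synth lam A a2 = (\<lambda>x. - synth lam A a1 x)" by (rule ext) (rule a2)
      then show ?thesis using weak_deriv_synth[OF cube, of A a2] by (simp only:)
    qed
    have m: "synth lam A a1 \<in> borel_measurable borel"
      using borel_measurable_integrable[OF integrable_synth[OF lam_l]] by simp
    have ma: "synth lam A a \<in> borel_measurable borel"
      using borel_measurable_integrable[OF integrable_synth[OF lam_l]] by simp
    have "ennreal ((c / C * Y / R) powr q) \<le> (\<integral>\<^sup>+x. ennreal (\<bar>synth lam A a1 x\<bar> powr q) * indicator D x \<partial>lborel)"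
    proof -
      have "S \<noteq> {}" using S(2) s by auto
      have Y0: "0 \<le> Y" unfolding Y_def by (intro mult_nonneg_nonneg) auto
      have "Y \<le> 2 powr (- \<mu> * real k) * real (card A) powr (1 / max 2 q - 1 / q) * (real (card S) / 2 ^ k) powr (1 / q)"
        unfolding Y_def using S(2) s q by (intro mult_left_mono powr_mono2 divide_right_mono) auto
      then have "c * Y \<le> c * 2 powr (- \<mu> * real k) * real (card A) powr (1 / max 2 q - 1 / q) * (real (card S) / 2 ^ k) powr (1 / q)"
        using c by (simp add: mult.assoc)
      then have "ennreal ((c * Y) powr q) \<le> ennreal ((c * 2 powr (- \<mu> * real k) * real (card A) powr (1 / max 2 q - 1 / q) *
          (real (card S) / 2 ^ k) powr (1 / q)) powr q)"
        using c Y0 q by (intro ennreal_leI powr_mono2) auto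
      also have "\<dots> \<le> (\<integral>\<^sup>+x. ennreal (\<bar>synth lam A a x\<bar> powr q) \<partial>lborel)"
        by (rule low[OF A \<kappa> S(1) \<open>S \<noteq> {}\<close> a])
      finally have "ennreal ((1 / (C * R)) powr q) * ennreal ((c * Y) powr q) \<le>
          ennreal ((1 / (C * R)) powr q) * (\<integral>\<^sup>+x. ennreal (\<bar>synth lam A a x\<bar> powr q) \<partial>lborel)"
        by (rule mult_left_mono) simp
      also have "\<dots> = (\<integral>\<^sup>+x. ennreal ((1 / (C * R)) powr q) * ennreal (\<bar>synth lam A a x\<bar> powr q) \<partial>lborel)"
        using ma by (intro nn_integral_cmult[symmetric]) simp
      also have "\<dots> = (\<integral>\<^sup>+x. ennreal (\<bar>synth lam A a1 x\<bar> powr q) * indicator D x \<partial>lborel)"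
      proof (rule nn_integral_cong)
        fix x
        have "\<bar>synth lam A a1 x\<bar> = 1 / (C * R) * \<bar>synth lam A a x\<bar>"
          using C R by (simp add: a1_def synth_scale abs_divide)
        then have "ennreal (\<bar>synth lam A a1 x\<bar> powr q) = ennreal ((1 / (C * R)) powr q) * ennreal (\<bar>synth lam A a x\<bar> powr q)"
          by (simp only: powr_mult) (rule ennreal_mult; simp)
        moreover have "synth lam A a x = 0" if "x \<notin> D" using that cube by (intro synth_outside) auto
        ultimately show "ennreal ((1 / (C * R)) powr q) * ennreal (\<bar>synth lam A a x\<bar> powr q) =
            ennreal (\<bar>synth lam A a1 x\<bar> powr q) * indicator D x"
          using q by (cases "x \<in> D") auto
      qed
      also have "ennreal ((1 / (C * R)) powr q) * ennreal ((c * Y) powr q) = ennreal ((c / C * Y / R) powr q)"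
      proof -
        have "c / C * Y / R = 1 / (C * R) * (c * Y)" by simp
        then show ?thesis by (simp only: powr_mult) (rule ennreal_mult[symmetric]; simp)
      qed
      finally show ?thesis .
    qed
    with f1 f2 same w1 w2 m show "\<exists>f1\<in>unit_ball_SB \<alpha> p \<theta> D. \<exists>f2\<in>unit_ball_SB \<alpha> p \<theta> D. \<exists>g. map f1 ys = map f2 ys \<and>
      weak_deriv D lam f1 g \<and> weak_deriv D lam f2 (\<lambda>x. - g x) \<and> g \<in> borel_measurable borel \<and>
      ennreal ((c / C * (2 powr (- \<mu> * real k) * real (card A) powr (1 / max 2 q - 1 / q) * (s / 2 ^ k) powr (1 / q)) / R) powr q) \<le>
        (\<integral>\<^sup>+x. ennreal (\<bar>g x\<bar> powr q) * indicator D x \<partial>lborel)"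
      unfolding Y_def by blast
  qed (use q in simp)
  then show ?thesis using c C by (intro exI[of _ "c / C"] conjI) (simp, blast)
qed

lemma card_coeffs:
  assumes "finite A" "\<forall>\<kappa>\<in>A. (\<Sum>j\<in>UNIV. \<kappa> j) = k"
  shows "card (Sigma A V) = card A * 2 ^ k"
  using assms by (simp add: card_SigmaI card_V)

lemma synth_eq_sum_coeffs:
  assumes "finite A"
  shows "synth (\<lambda>_. 0) A a y = (\<Sum>t\<in>Sigma A V. ampl (fst t) * wav (\<lambda>_. 0) (fst t) (snd t) y * a (fst t) (snd t))"
proof -
  have "synth (\<lambda>_. 0) A a y = (\<Sum>\<kappa>\<in>A. \<Sum>\<nu>\<in>V \<kappa>. ampl \<kappa> * wav (\<lambda>_. 0) \<kappa> \<nu> y * a \<kappa> \<nu>)"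
    by (simp add: synth_def ampl_def mult_ac)
  also have "\<dots> = (\<Sum>t\<in>Sigma A V. ampl (fst t) * wav (\<lambda>_. 0) (fst t) (snd t) y * a (fst t) (snd t))"
    using assms by (subst sum.Sigma) (auto simp: split_def)
  finally show ?thesis .
qed

text \<open>The coefficients are a vertex of the cube section, so half of them have modulus one.\<close>

lemma width_lower_vertex:
  assumes p: "1 \<le> p" and \<theta>: "1 \<le> \<theta>" and q: "1 < q" and l: "l = l_of \<alpha>" and cube: "cube \<subseteq> D"
    and D: "open D"
  shows "\<exists>c>0. \<forall>n A k. layer \<mu> k A \<longrightarrow> 2 * n \<le> card A * 2 ^ k \<longrightarrow>
    ennreal (c * (2 powr (- \<mu> * real k) * real (card A) powr (1 / max 2 q - inv_exp \<theta>))) \<le>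
      recovery_width n lam (unit_ball_SB \<alpha> p \<theta> D) q D"
proof -
  obtain c where c: "c > 0" and low: "\<And>n A k R s. layer \<mu> k A \<Longrightarrow> 0 < R \<Longrightarrow> 0 < s \<Longrightarrow>
    fooling p \<theta> A k R s n \<Longrightarrow>
    ennreal (c * (2 powr (- \<mu> * real k) * real (card A) powr (1 / max 2 q - 1 / q) * (s / 2 ^ k) powr (1 / q)) / R) \<le>
      recovery_width n lam (unit_ball_SB \<alpha> p \<theta> D) q D"
    using width_lower[OF p \<theta> q l cube D] by blast
  define c' where "c' = c * (1 / 2) powr (1 / q)"
  have "ennreal (c' * (2 powr (- \<mu> * real k) * real (card A) powr (1 / max 2 q - inv_exp \<theta>))) \<le>
      recovery_width n lam (unit_ball_SB \<alpha> p \<theta> D) q D"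
    if lay: "layer \<mu> k A" and n: "2 * n \<le> card A * 2 ^ k"
    for n A k
  proof -
    have A: "finite A" "A \<noteq> {}" and k: "\<forall>\<kappa>\<in>A. (\<Sum>j\<in>UNIV. \<kappa> j) = k"
      using lay unfolding layer_def by blast+
    define N where "N = real (card A)"
    \<comment> \<open>Coefficients of modulus at most 1 have mean at most 1 on every scale, and
      \<open>N\<close> bounds equal to 1 form a sequence whose norm of order \<open>\<theta>\<close>
      is \<open>N powr inv_exp \<theta>\<close>.\<close>
    define R where "R = N powr inv_exp \<theta>"
    define s where "s = N * 2 ^ k / 2"
    have N: "1 \<le> N" using A by (simp add: N_def card_gt_0_iff Suc_le_eq)
    have R: "0 < R" "1 \<le> R"
      using N \<theta> by (cases \<theta>; auto simp: R_def inv_exp_def one_ereal_def intro!: ge_one_powr_ge_zero)+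
    have s: "0 < s" using N by (simp add: s_def)
    have "ennreal (c * (2 powr (- \<mu> * real k) * real (card A) powr (1 / max 2 q - 1 / q) * (s / 2 ^ k) powr (1 / q)) / R) \<le>
      recovery_width n lam (unit_ball_SB \<alpha> p \<theta> D) q D"
    proof (rule low[OF lay R(1) s], unfold fooling_def, intro allI impI)
      fix ys :: "(real^'n) list" assume ys: "length ys = n"
      define T where "T = Sigma A V"
      have T: "finite T" using A by (auto simp: T_def)
      define w where "w i t = ampl (fst t) * wav (\<lambda>_. 0) (fst t) (snd t) (ys ! i)" for i and t :: "('n \<Rightarrow> nat) \<times> ('n \<Rightarrow> nat)"
      obtain b where b: "\<forall>t\<in>T. \<bar>b t\<bar> \<le> 1" "\<forall>i<n. (\<Sum>t\<in>T. w i t * b t) = 0" "card T \<le> n + card {t\<in>T. \<bar>b t\<bar> = 1}"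
        using kernel_cube_vertex[OF T, of n w] by blast
      define a where "a \<kappa> \<nu> = b (\<kappa>, \<nu>)" for \<kappa> \<nu>
      define S where "S = {t\<in>T. \<bar>b t\<bar> = 1}"
      have "(\<Sum>\<nu>\<in>V \<kappa>. \<bar>a \<kappa> \<nu>\<bar> powr p) \<le> 2 ^ k * 1 powr p" if "\<kappa> \<in> A" for \<kappa>
      proof -
        have "(\<Sum>\<nu>\<in>V \<kappa>. \<bar>a \<kappa> \<nu>\<bar> powr p) \<le> (\<Sum>\<nu>\<in>V \<kappa>. 1)"
          using b(1) that p by (intro sum_mono powr_le1) (auto simp: a_def T_def)
        then show ?thesis using card_V[of \<kappa>] k that by simp
      qed
      moreover have "(\<Sum>\<kappa>\<in>A. 1 powr real_of_ereal \<theta>) \<le> R powr real_of_ereal \<theta>" if "\<theta> \<noteq> \<infinity>"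
      proof -
        have "1 \<le> real_of_ereal \<theta>" using \<theta> that by (cases \<theta>) (auto simp: one_ereal_def)
        then show ?thesis using that N by (simp add: R_def inv_exp_def powr_powr N_def)
      qed
      moreover have "s \<le> real (card S)"
      proof -
        have "real (card T) = N * 2 ^ k" unfolding T_def card_coeffs[OF A(1) k] by (simp add: N_def)
        moreover have "real (2 * n) \<le> real (card A * 2 ^ k)" using n by (simp only: of_nat_le_iff)
        moreover have "real (card T) \<le> real (n + card S)"
          using b(3) unfolding S_def by (simp only: of_nat_le_iff)
        ultimately show ?thesis by (simp add: s_def N_def)
      qed
      moreover have "synth (\<lambda>_. 0) A a y = 0" if "y \<in> set ys" for y
      proof -
        have "\<exists>i<length ys. ys ! i = y" using that by (simp only: in_set_conv_nth)
        then obtain i where i: "i < n" "ys ! i = y" unfolding ys by (elim exE conjE) (rule that)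
        from b(2) i(1) have "(\<Sum>t\<in>T. w i t * b t) = 0" by (elim allE impE)
        then show ?thesis unfolding synth_eq_sum_coeffs[OF A(1)] w_def i(2) T_def a_def by (simp only: prod.collapse)
      qed
      moreover have "\<forall>(\<kappa>, \<nu>)\<in>S. 1 / 2 \<le> \<bar>a \<kappa> \<nu>\<bar>" by (auto simp: S_def a_def)
      moreover have "S \<subseteq> Sigma A V" by (auto simp: S_def T_def)
      ultimately show "\<exists>a B S.
        (\<forall>\<kappa>\<in>A. 0 \<le> B \<kappa> \<and> B \<kappa> \<le> R \<and> (\<Sum>\<nu>\<in>V \<kappa>. \<bar>a \<kappa> \<nu>\<bar> powr p) \<le> 2 ^ k * B \<kappa> powr p) \<and>
        (\<theta> \<noteq> \<infinity> \<longrightarrow> (\<Sum>\<kappa>\<in>A. B \<kappa> powr real_of_ereal \<theta>) \<le> R powr real_of_ereal \<theta>) \<and>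
        S \<subseteq> Sigma A V \<and> s \<le> real (card S) \<and> (\<forall>(\<kappa>, \<nu>)\<in>S. 1 / 2 \<le> \<bar>a \<kappa> \<nu>\<bar>) \<and>
        (\<forall>y\<in>set ys. synth (\<lambda>_. 0) A a y = 0)"
        using R(2) by (intro exI[of _ a] exI[of _ "\<lambda>_. 1"] exI[of _ S]) auto
    qed
    also have "c * (2 powr (- \<mu> * real k) * real (card A) powr (1 / max 2 q - 1 / q) * (s / 2 ^ k) powr (1 / q)) / R =
        c' * (2 powr (- \<mu> * real k) * real (card A) powr (1 / max 2 q - inv_exp \<theta>))"
    proof -
      have "s / 2 ^ k = N * (1 / 2)" by (simp add: s_def)
      then have "(s / 2 ^ k) powr (1 / q) = N powr (1 / q) * (1 / 2) powr (1 / q)" by (simp only: powr_mult)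
      moreover have "N powr (1 / max 2 q - 1 / q) * N powr (1 / q) / R = N powr (1 / max 2 q - inv_exp \<theta>)"
        unfolding R_def powr_add[symmetric] powr_diff[symmetric] by simp
      moreover have "c * (x1 * x2 * (x3 * x4)) / R = c * x4 * (x1 * (x2 * x3 / R))" for x1 x2 x3 x4
        by simp
      ultimately show ?thesis unfolding N_def[symmetric] c'_def by (simp only:)
    qed
    finally show ?thesis .
  qed
  moreover have "c' > 0" using c by (simp add: c'_def)
  ultimately show ?thesis by blast
qed

text \<open>A single coefficient carries half of the Euclidean norm.\<close>

lemma width_lower_peak:
  assumes p: "2 \<le> p" and \<theta>: "1 \<le> \<theta>" and q: "p < q" and l: "l = l_of \<alpha>" and cube: "cube \<subseteq> D"
    and D: "open D"
  shows "\<exists>c>0. \<forall>n A k. layer \<mu> k A \<longrightarrow> 2 * n \<le> card A * 2 ^ k \<longrightarrow>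
    ennreal (c * (2 powr (- (\<mu> - (1 / p - 1 / q)) * real k) * real (card A) powr (- pos_part (inv_exp \<theta> - 1 / p)))) \<le>
      recovery_width n lam (unit_ball_SB \<alpha> p \<theta> D) q D"
proof -
  have pq: "1 \<le> p" "1 < q" "max 2 q = q" using p q by auto
  obtain c where c: "c > 0" and low: "\<And>n A k R s. layer \<mu> k A \<Longrightarrow> 0 < R \<Longrightarrow> 0 < s \<Longrightarrow>
    fooling p \<theta> A k R s n \<Longrightarrow>
    ennreal (c * (2 powr (- \<mu> * real k) * real (card A) powr (1 / max 2 q - 1 / q) * (s / 2 ^ k) powr (1 / q)) / R) \<le>
      recovery_width n lam (unit_ball_SB \<alpha> p \<theta> D) q D"
    using width_lower[OF pq(1) \<theta> pq(2) l cube D] by blast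
  have "ennreal (c * (2 powr (- (\<mu> - (1 / p - 1 / q)) * real k) * real (card A) powr (- pos_part (inv_exp \<theta> - 1 / p)))) \<le>
      recovery_width n lam (unit_ball_SB \<alpha> p \<theta> D) q D"
    if lay: "layer \<mu> k A" and n: "2 * n \<le> card A * 2 ^ k" for n A k
  proof -
    have A: "finite A" "A \<noteq> {}" and k: "\<forall>\<kappa>\<in>A. (\<Sum>j\<in>UNIV. \<kappa> j) = k"
      using lay unfolding layer_def by blast+
    define N where "N = real (card A)"
    \<comment> \<open>A unit vector of order \<open>p\<close> on \<open>2 ^ k\<close> cells has mean
      \<open>r\<close>. Passing from order \<open>p\<close> to order \<open>\<theta>\<close> on the
      \<open>N\<close> scales then costs the factor \<open>N powr \<delta>\<close>.\<close>
    define r where "r = 2 powr (- real k / p)"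
    define \<delta> where "\<delta> = pos_part (inv_exp \<theta> - 1 / p)"
    define R where "R = r * N powr \<delta>"
    have N: "1 \<le> N" using A by (simp add: N_def card_gt_0_iff Suc_le_eq)
    have r: "0 < r" "r powr p = 1 / 2 ^ k"
      using p two_powr_root[of p k] by (simp_all add: r_def)
    have \<delta>: "0 \<le> \<delta>" by (simp add: \<delta>_def pos_part_def)
    have R: "0 < R" "r \<le> R"
      using r N \<delta> by (auto simp: R_def ge_one_powr_ge_zero)
    have "ennreal (c * (2 powr (- \<mu> * real k) * real (card A) powr (1 / max 2 q - 1 / q) * (1 / 2 ^ k) powr (1 / q)) / R) \<le>
      recovery_width n lam (unit_ball_SB \<alpha> p \<theta> D) q D"
    proof (rule low[OF lay R(1) zero_less_one], unfold fooling_def, intro allI impI)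
      fix ys :: "(real^'n) list" assume ys: "length ys = n"
      define T where "T = Sigma A V"
      have T: "finite T" using A by (auto simp: T_def)
      have cT: "card T = card A * 2 ^ k" unfolding T_def by (rule card_coeffs[OF A(1) k])
      then have "0 < card T" using A by (simp add: card_gt_0_iff)
      then have T0: "T \<noteq> {}" by auto
      define w where "w i t = ampl (fst t) * wav (\<lambda>_. 0) (fst t) (snd t) (ys ! i)" for i and t :: "('n \<Rightarrow> nat) \<times> ('n \<Rightarrow> nat)"
      have "2 * n \<le> card T" using n by (simp only: cT)
      from kernel_peaked_vector[OF T T0 this, of w]
      obtain b s where s: "s \<in> T" and b: "\<forall>i<n. (\<Sum>t\<in>T. w i t * b t) = 0" "(\<Sum>t\<in>T. (b t)\<^sup>2) \<le> 1" "1 / 2 \<le> b s"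
        by blast
      define a where "a \<kappa> \<nu> = b (\<kappa>, \<nu>)" for \<kappa> \<nu>
      define m where "m \<kappa> = (\<Sum>\<nu>\<in>V \<kappa>. \<bar>a \<kappa> \<nu>\<bar> powr p)" for \<kappa>
      have m0: "0 \<le> m \<kappa>" for \<kappa> unfolding m_def by (intro sum_nonneg) auto
      \<comment> \<open>Here \<open>2 \<le> p\<close> matters: entries of modulus at most 1 have
        powers of order \<open>p\<close> below their squares.\<close>
      have bp: "\<bar>b t\<bar> powr p \<le> (b t)\<^sup>2" if "t \<in> T" for t
      proof -
        have "(b t)\<^sup>2 \<le> (\<Sum>t\<in>T. (b t)\<^sup>2)" using T that by (intro member_le_sum) auto
        then have "\<bar>b t\<bar> \<le> 1" using b(2) by (simp add: abs_square_le_1[symmetric])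
        with p have "\<bar>b t\<bar> powr p \<le> \<bar>b t\<bar> powr 2" by (intro powr_mono') auto
        then show ?thesis by simp
      qed
      have msum: "(\<Sum>\<kappa>\<in>A. m \<kappa>) \<le> 1"
      proof -
        have "(\<Sum>\<kappa>\<in>A. m \<kappa>) = (\<Sum>t\<in>T. \<bar>b t\<bar> powr p)"
          unfolding m_def a_def T_def using A by (subst sum.Sigma) (auto simp: split_def)
        also have "\<dots> \<le> (\<Sum>t\<in>T. (b t)\<^sup>2)" by (intro sum_mono bp)
        finally show ?thesis using b(2) by linarith
      qed
      define B where "B \<kappa> = r * m \<kappa> powr (1 / p)" for \<kappa>
      have m1: "m \<kappa> \<le> 1" if "\<kappa> \<in> A" for \<kappa>
        using member_le_sum[of \<kappa> A m] that A m0 msum by auto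
      have B1: "0 \<le> B \<kappa>" "B \<kappa> \<le> R" "m \<kappa> \<le> 2 ^ k * B \<kappa> powr p" if "\<kappa> \<in> A" for \<kappa>
      proof -
        show "0 \<le> B \<kappa>" using r by (simp add: B_def)
        have "m \<kappa> powr (1 / p) \<le> 1" using m0 m1[OF that] p by (intro powr_le1) auto
        then have "B \<kappa> \<le> r" unfolding B_def using r by (simp add: mult_left_le)
        then show "B \<kappa> \<le> R" using R by linarith
        show "m \<kappa> \<le> 2 ^ k * B \<kappa> powr p"
          using r m0[of \<kappa>] p by (simp add: B_def powr_mult powr_powr)
      qed
      have Bth: "(\<Sum>\<kappa>\<in>A. B \<kappa> powr real_of_ereal \<theta>) \<le> R powr real_of_ereal \<theta>" if "\<theta> \<noteq> \<infinity>"
      proof -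
        define th where "th = real_of_ereal \<theta>"
        have th: "1 \<le> th" using \<theta> that by (cases \<theta>) (auto simp: th_def one_ereal_def)
        have inv: "inv_exp \<theta> = 1 / th" using that by (simp add: inv_exp_def th_def)
        \<comment> \<open>Embedding of sequence spaces: for \<open>p \<le> th\<close> the sum does
          not grow because each \<open>m \<kappa> \<le> 1\<close>; for \<open>th < p\<close>
          Jensen's inequality over the \<open>N\<close> scales gives the power of
          \<open>N\<close>.\<close>
        have "(\<Sum>\<kappa>\<in>A. m \<kappa> powr (th / p)) \<le> N powr (\<delta> * th)"
        proof (cases "p \<le> th")
          case True
          have "(\<Sum>\<kappa>\<in>A. m \<kappa> powr (th / p)) \<le> (\<Sum>\<kappa>\<in>A. m \<kappa>)"
          proof (rule sum_mono)
            fix \<kappa> assume "\<kappa> \<in> A"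
            then have "m \<kappa> powr (th / p) \<le> m \<kappa> powr 1"
              using m0[of \<kappa>] m1[of \<kappa>] True p by (intro powr_mono') auto
            then show "m \<kappa> powr (th / p) \<le> m \<kappa>" using m0[of \<kappa>] by simp
          qed
          also have "\<dots> \<le> 1" by (rule msum)
          also have "\<dots> \<le> N powr (\<delta> * th)" using N \<delta> th by (intro ge_one_powr_ge_zero) auto
          finally show ?thesis .
        next
          case False
          have "1 / p \<le> 1 / th" using False th by (simp add: frac_le)
          then have \<delta>th: "\<delta> * th = 1 - th / p" using th by (simp add: \<delta>_def pos_part_def inv left_diff_distrib)
          define Z where "Z = (\<Sum>\<kappa>\<in>A. m \<kappa> powr (th / p))"
          have Z0: "0 \<le> Z" unfolding Z_def by (intro sum_nonneg) auto
          have "Z powr (p / th) \<le> N powr (p / th - 1) * (\<Sum>\<kappa>\<in>A. (m \<kappa> powr (th / p)) powr (p / th))"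
            using schur_powr[OF A(1), of "\<lambda>_. 1" "\<lambda>\<kappa>. m \<kappa> powr (th / p)" N "p / th"] False th
            by (simp add: Z_def N_def)
          also have "(\<Sum>\<kappa>\<in>A. (m \<kappa> powr (th / p)) powr (p / th)) = (\<Sum>\<kappa>\<in>A. m \<kappa>)"
            using th p m0 by (intro sum.cong refl) (simp add: powr_powr)
          also have "N powr (p / th - 1) * (\<Sum>\<kappa>\<in>A. m \<kappa>) \<le> N powr (p / th - 1)"
            using msum by (intro mult_left_le) auto
          finally have "(Z powr (p / th)) powr (th / p) \<le> (N powr (p / th - 1)) powr (th / p)"
            using th p by (intro powr_mono2) auto
          moreover have "(Z powr (p / th)) powr (th / p) = Z" using th p Z0 by (simp add: powr_powr)
          moreover have "(N powr (p / th - 1)) powr (th / p) = N powr (\<delta> * th)"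
          proof -
            have "(p / th - 1) * (th / p) = 1 - th / p" using th p by (simp add: field_simps)
            then show ?thesis by (simp only: powr_powr \<delta>th)
          qed
          ultimately show ?thesis by (simp add: Z_def)
        qed
        then have "r powr th * (\<Sum>\<kappa>\<in>A. m \<kappa> powr (th / p)) \<le> r powr th * N powr (\<delta> * th)"
          by (intro mult_left_mono) auto
        then show ?thesis unfolding th_def[symmetric]
          by (simp add: B_def R_def powr_mult powr_powr sum_distrib_left)
      qed
      have van: "synth (\<lambda>_. 0) A a y = 0" if "y \<in> set ys" for y
      proof -
        have "\<exists>i<length ys. ys ! i = y" using that by (simp only: in_set_conv_nth)
        then obtain i where i: "i < n" "ys ! i = y" unfolding ys by (elim exE conjE) (rule that)
        from b(1) i(1) have "(\<Sum>t\<in>T. w i t * b t) = 0" by (elim allE impE)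
        then show ?thesis unfolding synth_eq_sum_coeffs[OF A(1)] w_def i(2) T_def a_def by (simp only: prod.collapse)
      qed
      show "\<exists>a B S.
        (\<forall>\<kappa>\<in>A. 0 \<le> B \<kappa> \<and> B \<kappa> \<le> R \<and> (\<Sum>\<nu>\<in>V \<kappa>. \<bar>a \<kappa> \<nu>\<bar> powr p) \<le> 2 ^ k * B \<kappa> powr p) \<and>
        (\<theta> \<noteq> \<infinity> \<longrightarrow> (\<Sum>\<kappa>\<in>A. B \<kappa> powr real_of_ereal \<theta>) \<le> R powr real_of_ereal \<theta>) \<and>
        S \<subseteq> Sigma A V \<and> 1 \<le> real (card S) \<and> (\<forall>(\<kappa>, \<nu>)\<in>S. 1 / 2 \<le> \<bar>a \<kappa> \<nu>\<bar>) \<and>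
        (\<forall>y\<in>set ys. synth (\<lambda>_. 0) A a y = 0)"
        using B1 Bth van s b(3) unfolding m_def
        by (intro exI[of _ a] exI[of _ B] exI[of _ "{s}"]) (auto simp: T_def a_def)
    qed
    also have "c * (2 powr (- \<mu> * real k) * real (card A) powr (1 / max 2 q - 1 / q) * (1 / 2 ^ k) powr (1 / q)) / R =
        c * (2 powr (- (\<mu> - (1 / p - 1 / q)) * real k) * real (card A) powr (- \<delta>))"
    proof -
      have "(1 / 2 ^ k) powr (1 / q) = 2 powr (- real k / q)"
      proof -
        show ?thesis unfolding two_powr_minus_nat[symmetric] powr_powr by simp
      qed
      moreover have "2 powr (- \<mu> * real k) * 2 powr (- real k / q) / r = 2 powr (- (\<mu> - (1 / p - 1 / q)) * real k)"
      proof -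
        have "- \<mu> * real k + - real k / q - - real k / p = - (\<mu> - (1 / p - 1 / q)) * real k"
          by (simp add: algebra_simps)
        then show ?thesis unfolding r_def powr_add[symmetric] powr_diff[symmetric] by (simp only:)
      qed
      moreover have "c * (x1 * 1 * x2) / (r * x3) = c * (x1 * x2 / r * (1 / x3))" for x1 x2 x3 by simp
      moreover have "1 / N powr \<delta> = N powr (- \<delta>)" by (simp add: powr_minus divide_inverse)
      moreover have "N powr (1 / max 2 q - 1 / q) = 1" using pq(3) N by simp
      ultimately show ?thesis unfolding N_def[symmetric] R_def by (simp only:)
    qed
    finally show ?thesis unfolding \<delta>_def .
  qed
  with c show ?thesis by blast
qed

text \<open>Pigeonhole: a bump is nonzero only in its open cell and the cells of one scale are
  disjoint, so each point spoils at most one of them.\<close>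

lemma free_cell_exists:
  assumes "length ys < 2 ^ (\<Sum>j\<in>UNIV. \<kappa> j)"
  shows "\<exists>\<nu>\<in>V \<kappa>. \<forall>y\<in>set ys. wav (\<lambda>_. 0) \<kappa> \<nu> y = 0"
proof (rule ccontr)
  assume "\<not> ?thesis"
  then have "\<forall>\<nu>\<in>V \<kappa>. \<exists>y. y \<in> set ys \<and> wav (\<lambda>_. 0) \<kappa> \<nu> y \<noteq> 0" by blast
  from bchoice[OF this] obtain Y where Y: "\<And>\<nu>. \<nu> \<in> V \<kappa> \<Longrightarrow> Y \<nu> \<in> set ys"
    "\<And>\<nu>. \<nu> \<in> V \<kappa> \<Longrightarrow> wav (\<lambda>_. 0) \<kappa> \<nu> (Y \<nu>) \<noteq> 0" by blast
  have "inj_on Y (V \<kappa>)"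
  proof (rule inj_onI)
    fix \<nu> \<nu>' assume \<nu>: "\<nu> \<in> V \<kappa>" "\<nu>' \<in> V \<kappa>" and eq: "Y \<nu> = Y \<nu>'"
    have cell: "0 < loc \<kappa> u y j \<and> loc \<kappa> u y j < 1" if "wav (\<lambda>_. 0) \<kappa> u y \<noteq> 0" for u y j
    proof (rule ccontr)
      assume "\<not> ?thesis"
      then have "F j 0 (loc \<kappa> u y j) = 0" by (intro F_van) auto
      then have "wav (\<lambda>_. 0) \<kappa> u y = 0" unfolding wav_def by (intro prod_zero bexI[of _ j]) simp_all
      with that show False by simp
    qed
    have "\<nu> j = \<nu>' j" for j
      using cell[OF Y(2)[OF \<nu>(1)], of j] cell[OF Y(2)[OF \<nu>(2)], of j] unfolding eq loc_def by linarith
    then show "\<nu> = \<nu>'" by (rule ext)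
  qed
  moreover have "Y ` V \<kappa> \<subseteq> set ys" using Y(1) by blast
  ultimately have "card (V \<kappa>) \<le> card (set ys)" by (intro card_inj_on_le) auto
  also have "\<dots> \<le> length ys" by (rule card_length)
  finally show False using assms by (simp add: card_V)
qed

text \<open>Every summand vanishes at the points by itself, so no kernel vector is involved. The
  unit coefficients, one per scale, make the norms explicit for all \<open>p\<close>.\<close>

lemma width_lower_free_cells:
  assumes p: "1 \<le> p" and \<theta>: "1 \<le> \<theta>" and q: "1 < q" and l: "l = l_of \<alpha>" and cube: "cube \<subseteq> D"
    and D: "open D"
  shows "\<exists>c>0. \<forall>n A k. layer \<mu> k A \<longrightarrow> n < 2 ^ k \<longrightarrow>
    ennreal (c * (2 powr (- (\<mu> - (1 / p - 1 / q)) * real k) * real (card A) powr (1 / max 2 q - inv_exp \<theta>))) \<le>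
      recovery_width n lam (unit_ball_SB \<alpha> p \<theta> D) q D"
proof -
  obtain c where c: "c > 0" and low: "\<And>n A k R s. layer \<mu> k A \<Longrightarrow> 0 < R \<Longrightarrow> 0 < s \<Longrightarrow>
    fooling p \<theta> A k R s n \<Longrightarrow>
    ennreal (c * (2 powr (- \<mu> * real k) * real (card A) powr (1 / max 2 q - 1 / q) * (s / 2 ^ k) powr (1 / q)) / R) \<le>
      recovery_width n lam (unit_ball_SB \<alpha> p \<theta> D) q D"
    using width_lower[OF p \<theta> q l cube D] by blast
  have "ennreal (c * (2 powr (- (\<mu> - (1 / p - 1 / q)) * real k) * real (card A) powr (1 / max 2 q - inv_exp \<theta>))) \<le>
      recovery_width n lam (unit_ball_SB \<alpha> p \<theta> D) q D"
    if lay: "layer \<mu> k A" and n: "n < 2 ^ k" for n A k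
  proof -
    have A: "finite A" "A \<noteq> {}" and k: "\<forall>\<kappa>\<in>A. (\<Sum>j\<in>UNIV. \<kappa> j) = k"
      using lay unfolding layer_def by blast+
    define N where "N = real (card A)"
    define r where "r = 2 powr (- real k / p)"
    \<comment> \<open>A single unit coefficient among \<open>2 ^ k\<close> has mean
      \<open>r\<close>, and the sequence of \<open>N\<close> such means has norm
      \<open>r * N powr inv_exp \<theta>\<close>.\<close>
    define R where "R = r * N powr inv_exp \<theta>"
    have N: "1 \<le> N" using A by (simp add: N_def card_gt_0_iff Suc_le_eq)
    have r: "0 < r" "r powr p = 1 / 2 ^ k"
      using p two_powr_root[of p k] by (simp_all add: r_def)
    have "0 \<le> inv_exp \<theta>" using \<theta> by (cases \<theta>) (auto simp: inv_exp_def one_ereal_def)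
    then have R: "0 < R" "r \<le> R" using r N by (auto simp: R_def ge_one_powr_ge_zero)
    have s: "0 < N" using N by simp
    have "ennreal (c * (2 powr (- \<mu> * real k) * real (card A) powr (1 / max 2 q - 1 / q) * (N / 2 ^ k) powr (1 / q)) / R) \<le>
      recovery_width n lam (unit_ball_SB \<alpha> p \<theta> D) q D"
    proof (rule low[OF lay R(1) s], unfold fooling_def, intro allI impI)
      fix ys :: "(real^'n) list" assume ys: "length ys = n"
      have "\<forall>\<kappa>\<in>A. \<exists>\<nu>. \<nu> \<in> V \<kappa> \<and> (\<forall>y\<in>set ys. wav (\<lambda>_. 0) \<kappa> \<nu> y = 0)"
      proof
        fix \<kappa> assume "\<kappa> \<in> A"
        then have "length ys < 2 ^ (\<Sum>j\<in>UNIV. \<kappa> j)" using n k ys by simp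
        from free_cell_exists[OF this] show "\<exists>\<nu>. \<nu> \<in> V \<kappa> \<and> (\<forall>y\<in>set ys. wav (\<lambda>_. 0) \<kappa> \<nu> y = 0)" by blast
      qed
      from bchoice[OF this] obtain v where v: "\<And>\<kappa>. \<kappa> \<in> A \<Longrightarrow> v \<kappa> \<in> V \<kappa>"
        "\<And>\<kappa> y. \<kappa> \<in> A \<Longrightarrow> y \<in> set ys \<Longrightarrow> wav (\<lambda>_. 0) \<kappa> (v \<kappa>) y = 0" by blast
      define a where "a \<kappa> \<nu> = (if \<nu> = v \<kappa> then 1 else 0 :: real)" for \<kappa> \<nu>
      define S where "S = (\<lambda>\<kappa>. (\<kappa>, v \<kappa>)) ` A"
      have "(\<Sum>\<nu>\<in>V \<kappa>. \<bar>a \<kappa> \<nu>\<bar> powr p) \<le> 2 ^ k * r powr p" if "\<kappa> \<in> A" for \<kappa>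
      proof -
        have "(\<Sum>\<nu>\<in>V \<kappa>. \<bar>a \<kappa> \<nu>\<bar> powr p) = (\<Sum>\<nu>\<in>V \<kappa>. if \<nu> = v \<kappa> then 1 else 0)"
          by (intro sum.cong refl) (simp add: a_def)
        also have "\<dots> = 1" using v(1)[OF that] by (simp add: sum.delta)
        finally show ?thesis by (simp add: r)
      qed
      moreover have "(\<Sum>\<kappa>\<in>A. r powr real_of_ereal \<theta>) \<le> R powr real_of_ereal \<theta>" if "\<theta> \<noteq> \<infinity>"
      proof -
        have "1 \<le> real_of_ereal \<theta>" using \<theta> that by (cases \<theta>) (auto simp: one_ereal_def)
        then show ?thesis using that N by (simp add: R_def inv_exp_def powr_powr N_def powr_mult)
      qed
      moreover have "N \<le> real (card S)"
        unfolding S_def N_def by (subst card_image) (auto simp: inj_on_def)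
      moreover have "synth (\<lambda>_. 0) A a y = 0" if "y \<in> set ys" for y
        unfolding synth_def using v(2) that by (intro sum.neutral ballI) (auto simp: a_def)
      moreover have "\<forall>(\<kappa>, \<nu>)\<in>S. 1 / 2 \<le> \<bar>a \<kappa> \<nu>\<bar>" by (auto simp: S_def a_def)
      moreover have "S \<subseteq> Sigma A V" using v(1) by (auto simp: S_def)
      ultimately show "\<exists>a B S.
        (\<forall>\<kappa>\<in>A. 0 \<le> B \<kappa> \<and> B \<kappa> \<le> R \<and> (\<Sum>\<nu>\<in>V \<kappa>. \<bar>a \<kappa> \<nu>\<bar> powr p) \<le> 2 ^ k * B \<kappa> powr p) \<and>
        (\<theta> \<noteq> \<infinity> \<longrightarrow> (\<Sum>\<kappa>\<in>A. B \<kappa> powr real_of_ereal \<theta>) \<le> R powr real_of_ereal \<theta>) \<and>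
        S \<subseteq> Sigma A V \<and> N \<le> real (card S) \<and> (\<forall>(\<kappa>, \<nu>)\<in>S. 1 / 2 \<le> \<bar>a \<kappa> \<nu>\<bar>) \<and>
        (\<forall>y\<in>set ys. synth (\<lambda>_. 0) A a y = 0)"
        using R(2) r(1) by (intro exI[of _ a] exI[of _ "\<lambda>_. r"] exI[of _ S]) auto
    qed
    also have "c * (2 powr (- \<mu> * real k) * real (card A) powr (1 / max 2 q - 1 / q) * (N / 2 ^ k) powr (1 / q)) / R =
        c * (2 powr (- (\<mu> - (1 / p - 1 / q)) * real k) * real (card A) powr (1 / max 2 q - inv_exp \<theta>))"
    proof -
      have "(N / 2 ^ k) powr (1 / q) = N powr (1 / q) * 2 powr (- real k / q)"
      proof -
        have "N / 2 ^ k = N * 2 powr (- real k)" by (simp add: two_powr_minus_nat)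
        then have "(N / 2 ^ k) powr (1 / q) = N powr (1 / q) * (2 powr (- real k)) powr (1 / q)"
          by (simp only: powr_mult)
        then show ?thesis unfolding powr_powr by simp
      qed
      moreover have "2 powr (- \<mu> * real k) * 2 powr (- real k / q) / r = 2 powr (- (\<mu> - (1 / p - 1 / q)) * real k)"
      proof -
        have "- \<mu> * real k + - real k / q - - real k / p = - (\<mu> - (1 / p - 1 / q)) * real k"
          by (simp add: algebra_simps)
        then show ?thesis unfolding r_def powr_add[symmetric] powr_diff[symmetric] by (simp only:)
      qed
      moreover have "N powr (1 / max 2 q - 1 / q) * N powr (1 / q) / N powr inv_exp \<theta> = N powr (1 / max 2 q - inv_exp \<theta>)"
        unfolding powr_add[symmetric] powr_diff[symmetric] by simp
      moreover have "c * (x1 * x2 * (x3 * x4)) / (r * x5) = c * (x1 * x4 / r * (x2 * x3 / x5))" for x1 x2 x3 x4 x5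
        by simp
      ultimately show ?thesis unfolding N_def[symmetric] R_def by (simp only:)
    qed
    finally show ?thesis .
  qed
  with c show ?thesis by blast
qed

text \<open>On all critical coordinates but one the scale is chosen freely between 0 and
  \<open>k\<close>; the remaining coordinate \<open>i\<close> takes the rest of the total. The total
  \<open>g * k\<close> is large enough to leave a nonnegative rest for each of these
  choices.\<close>

lemma full_layer_exists:
  assumes "{j. \<alpha> j - real (lam j) = \<mu>} \<noteq> {}"
  defines "g \<equiv> card {j. \<alpha> j - real (lam j) = \<mu>}"
  shows "\<exists>A. layer \<mu> (g * k) A \<and> card A = (k + 1) ^ (g - 1)"
proof -
  define J where "J = {j. \<alpha> j - real (lam j) = \<mu>}"
  obtain i where i: "i \<in> J" using assms(1) by (auto simp: J_def)
  define J' where "J' = J - {i}"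
  have g: "g = Suc (card J')" unfolding g_def J'_def J_def[symmetric] using i by (intro card.remove) auto
  define ext where "ext c = (\<lambda>j. if j \<in> J' then c j else if j = i then g * k - (\<Sum>j\<in>J'. c j) else 0)"
    for c :: "'n \<Rightarrow> nat"
  define P where "P = PiE J' (\<lambda>_. {..k})"
  have "inj_on ext P"
  proof (rule inj_onI)
    fix c c' assume c: "c \<in> P" "c' \<in> P" and eq: "ext c = ext c'"
    have "c j = c' j" if "j \<in> J'" for j using fun_cong[OF eq, of j] that by (simp add: ext_def)
    then show "c = c'" using c unfolding P_def by (intro PiE_ext)
  qed
  then have "card (ext ` P) = card P" by (rule card_image)
  also have "\<dots> = (k + 1) ^ (g - 1)" unfolding P_def by (subst card_PiE) (auto simp: g)
  finally have card: "card (ext ` P) = (k + 1) ^ (g - 1)" .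
  have sum: "(\<Sum>j\<in>UNIV. ext c j) = g * k" if "c \<in> P" for c
  proof -
    have "(\<Sum>j\<in>J'. c j) \<le> (\<Sum>j\<in>J'. k)" using that by (intro sum_mono) (auto simp: P_def)
    also have "\<dots> \<le> g * k" by (simp add: g)
    finally have le: "(\<Sum>j\<in>J'. c j) \<le> g * k" .
    have "(\<Sum>j\<in>UNIV. ext c j) = (\<Sum>j\<in>insert i J'. ext c j)"
      by (rule sum.mono_neutral_right) (auto simp: ext_def)
    also have "\<dots> = ext c i + (\<Sum>j\<in>J'. ext c j)" by (rule sum.insert) (auto simp: J'_def)
    also have "(\<Sum>j\<in>J'. ext c j) = (\<Sum>j\<in>J'. c j)" by (rule sum.cong) (auto simp: ext_def)
    also have "ext c i = g * k - (\<Sum>j\<in>J'. c j)" by (simp add: ext_def J'_def)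
    finally show ?thesis using le by simp
  qed
  have supp: "\<alpha> j - real (lam j) = \<mu>" if "ext c j \<noteq> 0" for c j
  proof (rule ccontr)
    assume "\<alpha> j - real (lam j) \<noteq> \<mu>"
    then have "j \<notin> J" by (simp add: J_def)
    with i have "j \<notin> J'" "j \<noteq> i" by (auto simp: J'_def)
    with that show False by (simp add: ext_def)
  qed
  have "finite (ext ` P)" unfolding P_def by (intro finite_imageI finite_PiE) auto
  moreover have "ext ` P \<noteq> {}" unfolding P_def by (simp add: PiE_eq_empty_iff)
  ultimately have "layer \<mu> (g * k) (ext ` P)"
    unfolding layer_def using sum supp by auto
  with card show ?thesis by blast
qed

lemma recovery_width_rate:
  assumes p: "1 \<le> p" and \<theta>: "1 \<le> \<theta>" and q: "1 < q" and l: "l = l_of \<alpha>" and cube: "cube \<subseteq> D"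
    and D: "open D" and \<mu>: "{j. \<alpha> j - real (lam j) = \<mu>} \<noteq> {}" and pos: "pos_part (1 / p - 1 / q) \<le> \<mu>"
  defines "g \<equiv> card {j. \<alpha> j - real (lam j) = \<mu>}" and "K \<equiv> unit_ball_SB \<alpha> p \<theta> D"
  shows "q \<le> p \<or> (2 \<le> p \<and> p < q) \<Longrightarrow> \<exists>c>0. \<forall>n\<ge>2.
      ennreal (c * real n powr (- (\<mu> - pos_part (1 / p - 1 / q))) *
        ln (real n) powr ((real g - 1) * (\<mu> - (1 / p - 1 / q) - pos_part (inv_exp \<theta> - 1 / p) - pos_part (1 / q - 1 / max 2 q))))
      \<le> recovery_width n lam K q D" (is "?A \<Longrightarrow> ?goal1")
    and "p < min 2 q \<Longrightarrow> \<exists>c>0. \<forall>n\<ge>2.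
      ennreal (c * real n powr (- (\<mu> - pos_part (1 / p - 1 / q))) *
        ln (real n) powr ((real g - 1) * pos_part (1 / max 2 q - inv_exp \<theta>)))
      \<le> recovery_width n lam K q D" (is "_ \<Longrightarrow> ?goal2")
proof -
  have g: "1 \<le> g" using \<mu> by (simp add: g_def Suc_le_eq card_gt_0_iff)
  have layer: "\<exists>A. layer \<mu> (g * k) A \<and> card A = (k + 1) ^ (g - 1)" for k
    unfolding g_def by (rule full_layer_exists[OF \<mu>])
  define \<nu> where "\<nu> = \<mu> - pos_part (1 / p - 1 / q)"
  have \<nu>: "0 \<le> \<nu>" using pos by (simp add: \<nu>_def)
  define E where "E = \<mu> - (1 / p - 1 / q) - pos_part (inv_exp \<theta> - 1 / p) - pos_part (1 / q - 1 / max 2 q)"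
  have pp: "t \<le> pos_part t" "0 \<le> pos_part t" for t by (simp_all add: pos_part_def)
  show ?goal1 if A: ?A
  proof -
    \<comment> \<open>\<open>\<nu>\<close> fixes the power of \<open>n\<close> and
      \<open>E - \<nu>\<close> the required power of the number of scales. Both kinds of kernel
      vectors reach an exponent \<open>x\<close> at least that large, which suffices because the
      number of scales is at least 1.\<close>
    obtain x c where c: "c > 0" and x: "E - \<nu> \<le> x" and low: "\<And>n A k. layer \<mu> k A \<Longrightarrow> 2 * n \<le> card A * 2 ^ k \<Longrightarrow>
      ennreal (c * (2 powr (- \<nu> * real k) * real (card A) powr x)) \<le> recovery_width n lam K q D"
    proof (cases "q \<le> p")
      case True
      then have "1 / p \<le> 1 / q" using q by (simp add: frac_le)
      then have \<nu>\<mu>: "\<nu> = \<mu>" by (simp add: \<nu>_def pos_part_def)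
      have "E - \<nu> \<le> 1 / max 2 q - inv_exp \<theta>"
        using pp(1)[of "inv_exp \<theta> - 1 / p"] pp(1)[of "1 / q - 1 / max 2 q"] unfolding E_def \<nu>\<mu> by linarith
      moreover obtain c where "c > 0" and low: "\<forall>n A k. layer \<mu> k A \<longrightarrow> 2 * n \<le> card A * 2 ^ k \<longrightarrow>
        ennreal (c * (2 powr (- \<mu> * real k) * real (card A) powr (1 / max 2 q - inv_exp \<theta>))) \<le> recovery_width n lam K q D"
        using width_lower_vertex[OF p \<theta> q l cube D, of \<mu>, folded K_def] by (elim exE conjE) (rule that)
      moreover have "ennreal (c * (2 powr (- \<nu> * real k) * real (card A) powr (1 / max 2 q - inv_exp \<theta>))) \<le> recovery_width n lam K q D"
        if "layer \<mu> k A" "2 * n \<le> card A * 2 ^ k" for n A k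
        unfolding \<nu>\<mu> by (intro low[rule_format] that)
      ultimately show thesis by (intro that)
    next
      case False
      then have pq: "2 \<le> p" "p < q" using A by auto
      then have "1 / q \<le> 1 / p" by (simp add: frac_le)
      then have \<nu>\<mu>: "\<nu> = \<mu> - (1 / p - 1 / q)" by (simp add: \<nu>_def pos_part_def)
      have "E - \<nu> \<le> - pos_part (inv_exp \<theta> - 1 / p)"
        using pp(2)[of "1 / q - 1 / max 2 q"] unfolding E_def \<nu>\<mu> by linarith
      moreover obtain c where "c > 0" and low: "\<forall>n A k. layer \<mu> k A \<longrightarrow> 2 * n \<le> card A * 2 ^ k \<longrightarrow>
        ennreal (c * (2 powr (- (\<mu> - (1 / p - 1 / q)) * real k) * real (card A) powr (- pos_part (inv_exp \<theta> - 1 / p)))) \<le> recovery_width n lam K q D"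
        using width_lower_peak[OF pq(1) \<theta> pq(2) l cube D, of \<mu>, folded K_def] by (elim exE conjE) (rule that)
      moreover have "ennreal (c * (2 powr (- \<nu> * real k) * real (card A) powr (- pos_part (inv_exp \<theta> - 1 / p)))) \<le> recovery_width n lam K q D"
        if "layer \<mu> k A" "2 * n \<le> card A * 2 ^ k" for n A k
        unfolding \<nu>\<mu> by (intro low[rule_format] that)
      ultimately show thesis by (intro that)
    qed
    obtain c' where c': "c' > 0" and rate: "\<And>n. 2 \<le> n \<Longrightarrow> \<exists>k. 2 * n \<le> (k + 1) ^ (g - 1) * 2 ^ (g * k) \<and>
      c' * real n powr (- \<nu>) * ln (real n) powr ((real g - 1) * E) \<le>
      2 powr (- \<nu> * real (g * k)) * real ((k + 1) ^ (g - 1)) powr (E - \<nu>)"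
      using layer_rate[OF g \<nu>] by blast
    have "ennreal (c * c' * real n powr (- \<nu>) * ln (real n) powr ((real g - 1) * E)) \<le> recovery_width n lam K q D"
      if n: "2 \<le> n" for n
    proof -
      obtain k where k: "2 * n \<le> (k + 1) ^ (g - 1) * 2 ^ (g * k)"
        "c' * real n powr (- \<nu>) * ln (real n) powr ((real g - 1) * E) \<le>
        2 powr (- \<nu> * real (g * k)) * real ((k + 1) ^ (g - 1)) powr (E - \<nu>)"
        using rate[OF n] by (elim exE conjE) (rule that)
      obtain A where A: "layer \<mu> (g * k) A" "card A = (k + 1) ^ (g - 1)" using layer by blast
      note k(2)
      also have "2 powr (- \<nu> * real (g * k)) * real ((k + 1) ^ (g - 1)) powr (E - \<nu>) \<le>
          2 powr (- \<nu> * real (g * k)) * real (card A) powr x"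
        unfolding A(2) using x by (intro mult_left_mono powr_mono) auto
      finally have "c * (c' * real n powr (- \<nu>) * ln (real n) powr ((real g - 1) * E)) \<le>
          c * (2 powr (- \<nu> * real (g * k)) * real (card A) powr x)"
        using c by (intro mult_left_mono) auto
      then have "ennreal (c * c' * real n powr (- \<nu>) * ln (real n) powr ((real g - 1) * E)) \<le>
          ennreal (c * (2 powr (- \<nu> * real (g * k)) * real (card A) powr x))"
        by (intro ennreal_leI) (simp only: ac_simps)
      also have "\<dots> \<le> recovery_width n lam K q D" using k(1) by (intro low A(1)) (simp only: A(2))
      finally show ?thesis .
    qed
    moreover have "0 < c * c'" using c c' by simp
    ultimately show ?thesis unfolding \<nu>_def E_def by blast
  qed
  show ?goal2 if A: "p < min 2 q"
  proof -
    define y where "y = 1 / max 2 q - inv_exp \<theta>"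
    have "1 / q \<le> 1 / p" using p A by (simp add: frac_le)
    then have \<nu>\<mu>: "\<nu> = \<mu> - (1 / p - 1 / q)" by (simp add: \<nu>_def pos_part_def)
    obtain c where c: "c > 0" and low: "\<forall>n A k. layer \<mu> k A \<longrightarrow> n < 2 ^ k \<longrightarrow>
      ennreal (c * (2 powr (- \<nu> * real k) * real (card A) powr y)) \<le> recovery_width n lam K q D"
      using width_lower_free_cells[OF p \<theta> q l cube D, of \<mu>, folded K_def y_def \<nu>\<mu>]
      by (elim exE conjE) (rule that)
    obtain c' where c': "c' > 0" and rate: "\<And>n. 2 \<le> n \<Longrightarrow> \<exists>k. n < 2 ^ (g * k) \<and>
      c' * real n powr (- \<nu>) * ln (real n) powr ((real g - 1) * pos_part y) \<le>
      2 powr (- \<nu> * real (g * k)) * real ((k + 1) ^ (g - 1)) powr pos_part y"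
      using free_layer_rate[OF g \<nu> pp(2)] by blast
    have "ennreal (c * c' * real n powr (- \<nu>) * ln (real n) powr ((real g - 1) * pos_part y)) \<le> recovery_width n lam K q D"
      if n: "2 \<le> n" for n
    proof -
      obtain k where k: "n < 2 ^ (g * k)"
        "c' * real n powr (- \<nu>) * ln (real n) powr ((real g - 1) * pos_part y) \<le>
        2 powr (- \<nu> * real (g * k)) * real ((k + 1) ^ (g - 1)) powr pos_part y"
        using rate[OF n] by (elim exE conjE) (rule that)
      obtain A where A: "layer \<mu> (g * k) A" "card A = (k + 1) ^ (g - 1)" using layer by blast
      \<comment> \<open>With a negative exponent additional scales only hurt. A layer of a single
        scale contributes the factor 1, which corresponds to the positive part.\<close>
      obtain A' where A': "layer \<mu> (g * k) A'" "real (card A') powr y = real ((k + 1) ^ (g - 1)) powr pos_part y"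
      proof (cases "0 \<le> y")
        case True
        then have "pos_part y = y" by (simp add: pos_part_def)
        with A show thesis by (intro that[of A]) simp_all
      next
        case False
        then have "pos_part y = 0" by (simp add: pos_part_def)
        obtain \<kappa> where "\<kappa> \<in> A" using A(1) by (auto simp: layer_def)
        with A(1) have "layer \<mu> (g * k) {\<kappa>}" by (simp add: layer_def)
        with \<open>pos_part y = 0\<close> show thesis by (intro that[of "{\<kappa>}"]) simp_all
      qed
      have "c * (c' * real n powr (- \<nu>) * ln (real n) powr ((real g - 1) * pos_part y)) \<le>
          c * (2 powr (- \<nu> * real (g * k)) * real (card A') powr y)"
        using c k(2) unfolding A'(2) by (intro mult_left_mono) auto
      then have "ennreal (c * c' * real n powr (- \<nu>) * ln (real n) powr ((real g - 1) * pos_part y)) \<le>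
          ennreal (c * (2 powr (- \<nu> * real (g * k)) * real (card A') powr y))"
        by (intro ennreal_leI) (simp only: ac_simps)
      also have "\<dots> \<le> recovery_width n lam K q D" using k(1) by (intro low[rule_format] A'(1))
      finally show ?thesis .
    qed
    moreover have "0 < c * c'" using c c' by simp
    ultimately show ?thesis unfolding \<nu>_def y_def by blast
  qed
qed

end

theorem theorem3p4p3:
  fixes m :: "'n::finite \<Rightarrow> nat" and D :: "(real^'n) set"
    and \<alpha> :: "'n \<Rightarrow> real" and p q :: real and \<theta> :: ereal and lam :: "'n \<Rightarrow> nat"
  assumes m_pos: "\<forall>j. 1 \<le> m j"
    and D_dom: "open D" "connected D" "D \<noteq> {}" "bounded D"
    and D_mtype: "m_type m D"
    and \<alpha>_pos: "\<forall>j. 0 < \<alpha> j"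
    and p: "1 \<le> p" and \<theta>: "1 \<le> \<theta>" and q: "1 < q"
    and lam_le: "\<forall>j. lam j \<le> m j"
    and cond1: "\<forall>j. \<alpha> j - 1 / p > 0"
    and cond2: "\<forall>j. \<alpha> j - real (lam j) - pos_part (1/p - 1/q) > 0"
  defines "K \<equiv> unit_ball_SB \<alpha> p \<theta> D"
    and "\<mu> \<equiv> Min (range (\<lambda>j. \<alpha> j - real (lam j)))"
    and "\<gamma> \<equiv> card {j. \<alpha> j - real (lam j) = Min (range (\<lambda>i. \<alpha> i - real (lam i)))}"
    and "Q \<equiv> max 2 q"
    and "inv\<theta> \<equiv> (if \<theta> = \<infinity> then 0 else 1 / real_of_ereal \<theta>)"
  shows "\<exists>c>0. \<forall>n::nat. 2 \<le> n \<longrightarrow>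
     ((q \<le> p \<or> (2 \<le> p \<and> p < q)) \<longrightarrow>
        ennreal (c * real n powr (- (\<mu> - pos_part (1/p - 1/q))) *
                 ln (real n) powr ((real \<gamma> - 1) * (\<mu> - (1/p - 1/q) - pos_part (inv\<theta> - 1/p)
                                                   - pos_part (1/q - 1/Q))))
        \<le> recovery_width n lam K q D) \<and>
     (p < min 2 q \<longrightarrow>
        ennreal (c * real n powr (- (\<mu> - pos_part (1/p - 1/q))) *
                 ln (real n) powr ((real \<gamma> - 1) * pos_part (1/Q - inv\<theta>)))
        \<le> recovery_width n lam K q D)"
proof -
  have "finite (range (\<lambda>j. \<alpha> j - real (lam j)))" "range (\<lambda>j. \<alpha> j - real (lam j)) \<noteq> {}" by auto
  then have "\<mu> \<in> range (\<lambda>j. \<alpha> j - real (lam j))" unfolding \<mu>_def by (rule Min_in)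
  then obtain j0 where j0: "\<mu> = \<alpha> j0 - real (lam j0)" by blast
  then have \<mu>: "{j. \<alpha> j - real (lam j) = \<mu>} \<noteq> {}" by auto
  have pos: "pos_part (1 / p - 1 / q) \<le> \<mu>" using cond2[rule_format, of j0] by (simp add: j0)
  define l where "l = l_of \<alpha>"
  have l: "\<alpha> j < real (l j)" for j
  proof -
    have "1 \<le> nat \<lceil>\<alpha> j\<rceil> + 1 \<and> \<alpha> j < real (nat \<lceil>\<alpha> j\<rceil> + 1)" by linarith
    then have "1 \<le> (LEAST k::nat. 1 \<le> k \<and> \<alpha> j < real k) \<and> \<alpha> j < real (LEAST k::nat. 1 \<le> k \<and> \<alpha> j < real k)"
      by (rule LeastI)
    then show ?thesis by (simp add: l_def l_of_def)
  qed
  have lam: "real (lam j) < \<alpha> j" for j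
    using cond2[rule_format, of j] by (simp add: pos_part_def max_def split: if_splits)
  \<comment> \<open>The derivatives and the primitive are paired so that a single choice over
    \<open>j\<close> delivers matching families.\<close>
  have "\<exists>FG :: (nat \<Rightarrow> real \<Rightarrow> real) \<times> (real \<Rightarrow> real).
      (\<forall>i<l j. \<forall>t. (fst FG i has_real_derivative fst FG (Suc i) t) (at t)) \<and>
      (\<forall>i\<le>l j. continuous_on UNIV (fst FG i)) \<and> (\<forall>i t. t \<le> 0 \<or> 1 \<le> t \<longrightarrow> fst FG i t = 0) \<and>
      (\<forall>t. (snd FG has_real_derivative fst FG (lam j) t) (at t)) \<and>
      (\<forall>t. t \<le> 0 \<or> 1 \<le> t \<longrightarrow> snd FG t = 0) \<and> snd FG (1 / 2) \<noteq> 0" for j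
  proof -
    have "lam j \<le> l j" using l[of j] lam[of j] by linarith
    from bump_chain_exists[OF this] show ?thesis by simp
  qed
  then obtain FG :: "'n \<Rightarrow> (nat \<Rightarrow> real \<Rightarrow> real) \<times> (real \<Rightarrow> real)" where FG: "\<And>j.
      (\<forall>i<l j. \<forall>t. (fst (FG j) i has_real_derivative fst (FG j) (Suc i) t) (at t)) \<and>
      (\<forall>i\<le>l j. continuous_on UNIV (fst (FG j) i)) \<and> (\<forall>i t. t \<le> 0 \<or> 1 \<le> t \<longrightarrow> fst (FG j) i t = 0) \<and>
      (\<forall>t. (snd (FG j) has_real_derivative fst (FG j) (lam j) t) (at t)) \<and>
      (\<forall>t. t \<le> 0 \<or> 1 \<le> t \<longrightarrow> snd (FG j) t = 0) \<and> snd (FG j) (1 / 2) \<noteq> 0"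
    by metis
  note F = FG[THEN conjunct1, rule_format] FG[THEN conjunct2, THEN conjunct1, rule_format]
    FG[THEN conjunct2, THEN conjunct2, THEN conjunct1, rule_format]
    FG[THEN conjunct2, THEN conjunct2, THEN conjunct2, THEN conjunct1, rule_format]
    FG[THEN conjunct2, THEN conjunct2, THEN conjunct2, THEN conjunct2, THEN conjunct1, rule_format]
    FG[THEN conjunct2, THEN conjunct2, THEN conjunct2, THEN conjunct2, THEN conjunct2]
  obtain x0 where "x0 \<in> D" using D_dom(3) by blast
  then obtain r where r: "0 < r" "ball x0 r \<subseteq> D" using D_dom(1) openE by blast
  \<comment> \<open>A point of the cube differs from \<open>x0\<close> by at most \<rho> in each
    coordinate, so its distance is at most \<open>CARD('n) * \<rho>\<close>, that is, half of
    \<open>r\<close>.\<close>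
  define \<rho> where "\<rho> = r / (2 * real CARD('n))"
  have \<rho>: "0 < \<rho>" using r(1) by (simp add: \<rho>_def)
  interpret bump_system "\<lambda>j. fst (FG j)" "\<lambda>j. snd (FG j)" l lam \<alpha> "\<lambda>j. x0 $ j" \<rho>
    by unfold_locales (fact F l lam \<alpha>_pos[rule_format] \<rho>)+
  have cube: "cube \<subseteq> D"
  proof
    fix x assume "x \<in> cube"
    then have x: "\<bar>(x - x0) $ j\<bar> \<le> \<rho>" for j
      unfolding cube_def corner_def mem_box_cart by (simp add: abs_le_iff) (smt (verit))
    have "norm (x - x0) \<le> (\<Sum>j\<in>UNIV. \<bar>(x - x0) $ j\<bar>)" by (rule norm_le_l1_cart)
    also have "\<dots> \<le> (\<Sum>j\<in>(UNIV::'n set). \<rho>)" by (intro sum_mono x)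
    also have "\<dots> < r" using r(1) by (simp add: \<rho>_def)
    finally show "x \<in> D" using r(2) by (auto simp: dist_norm norm_minus_commute)
  qed
  have inv: "inv\<theta> = inv_exp \<theta>" by (simp add: inv\<theta>_def inv_exp_def)
  note rate = recovery_width_rate[OF p \<theta> q l_def cube D_dom(1) \<mu> pos,
      folded K_def Q_def inv, unfolded \<mu>_def, folded \<gamma>_def, folded \<mu>_def]
  show ?thesis
  proof (cases "q \<le> p \<or> (2 \<le> p \<and> p < q)")
    case True
    then have "\<not> p < min 2 q" by auto
    with rate(1)[OF True] show ?thesis by auto
  next
    case False
    then have "p < min 2 q" by auto
    from rate(2)[OF this] False show ?thesis by auto
  qed
qed

end
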